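(* For $\mathbb k \in \{\mathbb R, \mathbb C\}$ there exists an (infinite) measured Quillen family $(\mathrm{Sp}_{2r}(\mathbb k), X_{r, \bullet})_{r\in\mathbb N}$ with parameters $(\gamma,\tau)$, where $$\gamma(r) = \sup \{q \in \mathbb N \mid 2^q + \lceil (q+1)/2\rceil \leq r\}$$ and $\tau(r) = r-1$.
   Context: Conventions: $\mathbb N=\{0,1,2,\dots\}$, $[R]=\{0,\dots,R\}$ for $R\in\mathbb N$, $[\infty]=\mathbb N$; $\sup\emptyset=-\infty$; lcsc means locally compact second-countable. $\mathrm{Sp}_{2r}(\mathbb k)$ is the group of automorphisms of $(\mathbb k^{2r},\omega)$, where the standard basis $(e_{r-1},\dots,e_0,f_0,\dots,f_{r-1})$ satisfies $\omega(e_i,f_j)=\delta_{ij}$, $\omega(e_i,e_j)=\omega(f_i,f_j)=0$; $\mathrm{Sp}_0(\mathbb k)$ is trivial, and $\mathrm{Sp}_{2r}(\mathbb k)\hookrightarrow\mathrm{Sp}_{2(r+1)}(\mathbb k)$ is the block embedding $A\mapsto\mathrm{diag}(1,A,1)$. For $r=0$ the object is taken empty, with $\tau(0)=-1$, $[-1]=\emptyset$, so that all conditions are vacuous. Let $G$ be an lcsc group. A regular $G$-space is a standard Borel space $X$ with a Borel $G$-action and a Borel probability measure $\mu$ that is $G$-quasi-invariant ($g_*\mu\sim\mu$ for all $g\in G$). A measured $G$-object $X_\bullet$ of dimension $n$ is a sequence of regular $G$-spaces $(X_k,\mu_k)_{k\in[n]}$ (with $X_k$ empty for $k>n$) together with Borel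 $G$-maps (face maps) $\delta_i=\delta_{i,k}:X_{k+1}\to X_k$, $0\le i\le k+1$, satisfying $\delta_{i,k-1}\circ\delta_{j,k}=\delta_{j-1,k-1}\circ\delta_{i,k}$ for $i<j$. The face maps induce operators $\delta^i:L^\infty(X_k)\to L^\infty(X_{k+1})$, $\delta^if=f\circ\delta_i$ (preimages of null sets under $\delta_i$ are null), and $\mathrm d^k=\sum_{i=0}^{k+1}(-1)^i\delta^i$. With $\mathrm d^{-1}:\mathbb R\to L^\infty(X_0)$ the inclusion of constants, the augmented $L^\infty$-complex is $$0\to\mathbb R\xrightarrow{\mathrm d^{-1}}L^\infty(X_0)\xrightarrow{\mathrm d^0}L^\infty(X_1)\xrightarrow{\mathrm d^1}\cdots,$$ with $L^\infty(X_k)$ in degree $k$ and $\mathbb R$ in degree $-1$ (terms with $k>n$ are $0$). $X_\bullet$ is admissible if each $\mathrm d^k$ is the dual of a $G$-equivariant bounded linear map $L^1(X_{k+1},\mu_{k+1})\to L^1(X_k,\mu_k)$ (and $\mathrm d^{-1}$ of a map $L^1(X_0,\mu_0)\to\mathbb R$), where $G$ acts on $L^1(X_k)$ by isometries via $(g.f)(x)=\frac{d(g_*\mu_k)}{d\mu_k}(x)f(g^{-1}x)$. For $q\in[n]$, $X_\bullet$ is measurably $q$-connected if the cohomology of its augmented $L^\infty$-complex vanishes in all degrees $\le q$; it is called measurably $(-\infty)$-connected if it is not measurably $q$-connected for any $q\in[n]$. It is $q$-transitive if $G$ acts transitively on $X_k$ for all $k\in[q]$. An infinite ascending series of lcsc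 groups is a sequence $(G_r)_{r\in\mathbb N}$ of lcsc groups with inclusions $G_r\hookrightarrow G_{r+1}$; $G_r$ is trivial for $r<0$. Given $\tau$ and $\tau(r)$-transitive measured $G_r$-objects $X_{r,\bullet}$, the sequences $(G_r)$ and $(X_{r,\bullet})$ are measurably $\tau$-compatible if for every $r$ and $q\in[\tau(r)]$ there exist point stabilizers $H_{r,q}$ for the action of $G_r$ on $X_{r,q}$ and surjective (continuous) homomorphisms $H_{r,q}\twoheadrightarrow G_{r-1-q}$ with amenable kernel such that for all $q<\tau(r)$ there is an inclusion $H_{r,q+1}\hookrightarrow H_{r,q}$ (of subgroups of $G_r$) for which the square formed by $H_{r,q+1}\hookrightarrow H_{r,q}\twoheadrightarrow G_{r-q-1}$ and $H_{r,q+1}\twoheadrightarrow G_{r-q-2}\hookrightarrow G_{r-q-1}$ commutes. An infinite measured Quillen family with parameters $(\gamma,\tau)$ is a family $(G_r,X_{r,\bullet})_{r\in\mathbb N}$, where $(G_r)$ is an ascending series of lcsc groups and each $X_{r,\bullet}$ is an admissible (measured) $G_r$-object, such that for every $r$: $X_{r,\bullet}$ is measurably $\gamma(r)$-connected; $X_{r,\bullet}$ is $\tau(r)$-transitive; and $(G_r)$ and $(X_{r,\bullet})$ are measurably $\tau$-compatible. *)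

theory Defs
  imports "HOL-Probability.Probability_Measure" "HOL-Algebra.Group_Action" "Jordan_Normal_Form.Matrix"
begin

unbundle no vec_syntax

section \<open>Locally compact second-countable groups\<close>

record 'g top_group = "'g monoid" +
  gtop :: "'g topology"

definition lcsc_group :: "'g top_group \<Rightarrow> bool" where
  "lcsc_group G \<longleftrightarrow>
     group G \<and> topspace (gtop G) = carrier G \<and>
     continuous_map (prod_topology (gtop G) (gtop G)) (gtop G) (\<lambda>(x, y). x \<otimes>\<^bsub>G\<^esub> y) \<and>
     continuous_map (gtop G) (gtop G) (\<lambda>x. inv\<^bsub>G\<^esub> x) \<and>
     Hausdorff_space (gtop G) \<and> locally_compact_space (gtop G) \<and> second_countable (gtop G)"

definition sub_top_group :: "'g top_group \<Rightarrow> 'g set \<Rightarrow> 'g top_group" where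
  "sub_top_group G H = G\<lparr>carrier := H, gtop := subtopology (gtop G) H\<rparr>"

definition bounded_continuous :: "'g top_group \<Rightarrow> ('g \<Rightarrow> real) \<Rightarrow> bool" where
  "bounded_continuous G f \<longleftrightarrow>
     continuous_map (gtop G) euclideanreal f \<and> (\<exists>C. \<forall>x\<in>carrier G. \<bar>f x\<bar> \<le> C)"

text \<open>
  Existence of a left-invariant mean on the bounded continuous functions. By positivity such a
  mean only depends on the values of a function on the carrier.
\<close>

definition amenable :: "'g top_group \<Rightarrow> bool" where
  "amenable G \<longleftrightarrow> (\<exists>m :: ('g \<Rightarrow> real) \<Rightarrow> real.
     (\<forall>f h. bounded_continuous G f \<and> bounded_continuous G h \<longrightarrow> m (\<lambda>x. f x + h x) = m f + m h) \<and>
     (\<forall>c f. bounded_continuous G f \<longrightarrow> m (\<lambda>x. c * f x) = c * m f) \<and>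
     (\<forall>f. bounded_continuous G f \<and> (\<forall>x\<in>carrier G. 0 \<le> f x) \<longrightarrow> 0 \<le> m f) \<and>
     m (\<lambda>_. 1) = 1 \<and>
     (\<forall>g f. g \<in> carrier G \<and> bounded_continuous G f \<longrightarrow> m (\<lambda>x. f (g \<otimes>\<^bsub>G\<^esub> x)) = m f))"

definition ascending_series :: "(nat \<Rightarrow> 'g top_group) \<Rightarrow> (nat \<Rightarrow> 'g \<Rightarrow> 'g) \<Rightarrow> bool" where
  "ascending_series G \<iota> \<longleftrightarrow>
     (\<forall>r. lcsc_group (G r) \<and> \<iota> r \<in> hom (G r) (G (Suc r)) \<and>
          embedding_map (gtop (G r)) (gtop (G (Suc r))) (\<iota> r))"

text \<open>
  Negative indices denote the trivial group, realised as the trivial subgroup of \<open>G 0\<close>; the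
  inclusions between such groups, and into \<open>G 0\<close>, are then constant.
\<close>

definition group_at :: "(nat \<Rightarrow> 'g top_group) \<Rightarrow> int \<Rightarrow> 'g top_group" where
  "group_at G i = (if i < 0 then sub_top_group (G 0) {\<one>\<^bsub>G 0\<^esub>} else G (nat i))"

definition incl_at ::
    "(nat \<Rightarrow> 'g top_group) \<Rightarrow> (nat \<Rightarrow> 'g \<Rightarrow> 'g) \<Rightarrow> int \<Rightarrow> 'g \<Rightarrow> 'g" where
  "incl_at G \<iota> i = (if i < 0 then (\<lambda>_. \<one>\<^bsub>G 0\<^esub>) else \<iota> (nat i))"


section \<open>Regular spaces\<close>

definition borel_of :: "'a topology \<Rightarrow> 'a measure" where
  "borel_of T = sigma (topspace T) {U. openin T U}"

definition standard_borel :: "'a measure \<Rightarrow> bool" where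
  "standard_borel M \<longleftrightarrow>
     (\<exists>T. completely_metrizable_space T \<and> second_countable T \<and>
          space M = topspace T \<and> sets M = sets (borel_of T))"

definition regular_space :: "'g top_group \<Rightarrow> 'x measure \<Rightarrow> ('g \<Rightarrow> 'x \<Rightarrow> 'x) \<Rightarrow> bool" where
  "regular_space G M \<phi> \<longleftrightarrow>
     standard_borel M \<and> prob_space M \<and>
     group_action G (space M) \<phi> \<and>
     (\<lambda>(g, x). \<phi> g x) \<in> borel_of (gtop G) \<Otimes>\<^sub>M M \<rightarrow>\<^sub>M M \<and>
     (\<forall>g\<in>carrier G. absolutely_continuous M (distr M M (\<phi> g)) \<and>
                    absolutely_continuous (distr M M (\<phi> g)) M)"


section \<open>Measured objects\<close>

text \<open>
  The dimension takes values in \<open>{-1, 0, 1, \<dots>, \<infinity>}\<close>, so that the index set \<open>[n]\<close> is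
  \<open>{k. ereal (real k) \<le> n}\<close>; dimension \<open>-1\<close> is the empty object. The map \<open>face X k i\<close> is
  \<open>\<delta>\<^sub>i : X\<^sub>k\<^sub>+\<^sub>1 \<rightarrow> X\<^sub>k\<close>. All levels have points in one type \<open>'x\<close>; once \<open>'x\<close> has at least
  the cardinality of the continuum, every standard Borel space has an isomorphic copy in it.
\<close>

record ('g, 'x) measured_obj =
  odim :: ereal
  lev :: "nat \<Rightarrow> 'x measure"
  act :: "nat \<Rightarrow> 'g \<Rightarrow> 'x \<Rightarrow> 'x"
  face :: "nat \<Rightarrow> nat \<Rightarrow> 'x \<Rightarrow> 'x"

definition idx :: "ereal \<Rightarrow> nat set" where
  "idx n = {k. ereal (real k) \<le> n}"

text \<open>
  Since \<open>X\<^sub>k\<close> is empty for \<open>k > n\<close>, any two functions on it agree almost everywhere, i.e. the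
  corresponding function spaces are zero.
\<close>

definition measured_object :: "'g top_group \<Rightarrow> ('g, 'x) measured_obj \<Rightarrow> bool" where
  "measured_object G X \<longleftrightarrow>
     (odim X = -1 \<or> odim X = \<infinity> \<or> (\<exists>n::nat. odim X = ereal (real n))) \<and>
     (\<forall>k\<in>idx (odim X). regular_space G (lev X k) (act X k)) \<and>
     (\<forall>k. k \<notin> idx (odim X) \<longrightarrow> space (lev X k) = {}) \<and>
     (\<forall>k i. i \<le> k + 1 \<longrightarrow>
        face X k i \<in> lev X (k + 1) \<rightarrow>\<^sub>M lev X k \<and>
        (\<forall>g\<in>carrier G. \<forall>x\<in>space (lev X (k + 1)).
           face X k i (act X (k + 1) g x) = act X k g (face X k i x)) \<and>
        (\<forall>N\<in>null_sets (lev X k).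
           face X k i -` N \<inter> space (lev X (k + 1)) \<in> null_sets (lev X (k + 1)))) \<and>
     (\<forall>k i j. i < j \<and> j \<le> k + 2 \<longrightarrow>
        (\<forall>x\<in>space (lev X (k + 2)).
           face X k i (face X (k + 1) j x) = face X k (j - 1) (face X (k + 1) i x)))"

text \<open>
  Elements of \<open>L\<^sup>\<infinity>\<close> and \<open>L\<^sup>1\<close> are represented by functions, equality being equality almost
  everywhere.
\<close>

definition Linf :: "'x measure \<Rightarrow> ('x \<Rightarrow> real) set" where
  "Linf M = {f \<in> borel_measurable M. \<exists>C. AE x in M. \<bar>f x\<bar> \<le> C}"

definition coboundary :: "('g, 'x) measured_obj \<Rightarrow> nat \<Rightarrow> ('x \<Rightarrow> real) \<Rightarrow> 'x \<Rightarrow> real" where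
  "coboundary X k f = (\<lambda>x. \<Sum>i\<le>k + 1. (-1) ^ i * f (face X k i x))"

text \<open>Vanishing of the cohomology of the augmented complex in the given degree.\<close>

definition cohomology_vanishes :: "('g, 'x) measured_obj \<Rightarrow> int \<Rightarrow> bool" where
  "cohomology_vanishes X d \<longleftrightarrow>
     (d = -1 \<longrightarrow> (\<forall>c::real. (AE x in lev X 0. c = 0) \<longrightarrow> c = 0)) \<and>
     (d = 0 \<longrightarrow> (\<forall>f\<in>Linf (lev X 0). (AE x in lev X 1. coboundary X 0 f x = 0) \<longrightarrow>
                   (\<exists>c::real. AE x in lev X 0. f x = c))) \<and>
     (\<forall>k::nat. d = int k + 1 \<longrightarrow>
        (\<forall>f\<in>Linf (lev X (k + 1)). (AE x in lev X (k + 2). coboundary X (k + 1) f x = 0) \<longrightarrow>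
           (\<exists>g\<in>Linf (lev X k). AE x in lev X (k + 1). f x = coboundary X k g x)))"

definition q_connected :: "('g, 'x) measured_obj \<Rightarrow> nat \<Rightarrow> bool" where
  "q_connected X q \<longleftrightarrow> q \<in> idx (odim X) \<and> (\<forall>d\<le>int q. cohomology_vanishes X d)"

text \<open>Being \<open>(-\<infinity>)\<close>-connected means not being \<open>q\<close>-connected for any \<open>q\<close>.\<close>

definition measurably_connected :: "('g, 'x) measured_obj \<Rightarrow> ereal \<Rightarrow> bool" where
  "measurably_connected X \<gamma> \<longleftrightarrow>
     (\<gamma> = -\<infinity> \<and> (\<forall>q\<in>idx (odim X). \<not> q_connected X q)) \<or>
     (\<exists>q::nat. \<gamma> = ereal (real q) \<and> q_connected X q)"

definition q_transitive :: "'g top_group \<Rightarrow> ('g, 'x) measured_obj \<Rightarrow> ereal \<Rightarrow> bool" where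
  "q_transitive G X q \<longleftrightarrow> (\<forall>k\<in>idx q. transitive_action G (space (lev X k)) (act X k))"


section \<open>Admissibility\<close>

text \<open>\<open>(g.f)(x) = d(g\<^sub>*\<mu>)/d\<mu> (x) f(g\<^sup>-\<^sup>1x)\<close>\<close>

definition L1_act ::
    "'g top_group \<Rightarrow> 'x measure \<Rightarrow> ('g \<Rightarrow> 'x \<Rightarrow> 'x) \<Rightarrow> 'g \<Rightarrow> ('x \<Rightarrow> real) \<Rightarrow> 'x \<Rightarrow> real" where
  "L1_act G M \<phi> g f =
     (\<lambda>x. enn2real (RN_deriv M (distr M M (\<phi> g)) x) * f (\<phi> (inv\<^bsub>G\<^esub> g) x))"

definition L1_operator ::
    "'x measure \<Rightarrow> 'y measure \<Rightarrow> (('x \<Rightarrow> real) \<Rightarrow> 'y \<Rightarrow> real) \<Rightarrow> bool" where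
  "L1_operator M N T \<longleftrightarrow>
     (\<forall>f. integrable M f \<longrightarrow> integrable N (T f)) \<and>
     (\<forall>f h. integrable M f \<and> integrable M h \<and> (AE x in M. f x = h x) \<longrightarrow> (AE y in N. T f y = T h y)) \<and>
     (\<forall>f h. integrable M f \<and> integrable M h \<longrightarrow>
        (AE y in N. T (\<lambda>x. f x + h x) y = T f y + T h y)) \<and>
     (\<forall>c f. integrable M f \<longrightarrow> (AE y in N. T (\<lambda>x. c * f x) y = c * T f y)) \<and>
     (\<exists>C. \<forall>f. integrable M f \<longrightarrow> (\<integral>y. \<bar>T f y\<bar> \<partial>N) \<le> C * (\<integral>x. \<bar>f x\<bar> \<partial>M))"

definition L1_functional :: "'x measure \<Rightarrow> (('x \<Rightarrow> real) \<Rightarrow> real) \<Rightarrow> bool" where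
  "L1_functional M T \<longleftrightarrow>
     (\<forall>f h. integrable M f \<and> integrable M h \<and> (AE x in M. f x = h x) \<longrightarrow> T f = T h) \<and>
     (\<forall>f h. integrable M f \<and> integrable M h \<longrightarrow> T (\<lambda>x. f x + h x) = T f + T h) \<and>
     (\<forall>c f. integrable M f \<longrightarrow> T (\<lambda>x. c * f x) = c * T f) \<and>
     (\<exists>C. \<forall>f. integrable M f \<longrightarrow> \<bar>T f\<bar> \<le> C * (\<integral>x. \<bar>f x\<bar> \<partial>M))"

definition admissible :: "'g top_group \<Rightarrow> ('g, 'x) measured_obj \<Rightarrow> bool" where
  "admissible G X \<longleftrightarrow>
     (\<forall>k. \<exists>T. L1_operator (lev X (k + 1)) (lev X k) T \<and>
        (\<forall>g h. g \<in> carrier G \<and> integrable (lev X (k + 1)) h \<longrightarrow>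
           (AE x in lev X k. T (L1_act G (lev X (k + 1)) (act X (k + 1)) g h) x =
                             L1_act G (lev X k) (act X k) g (T h) x)) \<and>
        (\<forall>h f. integrable (lev X (k + 1)) h \<and> f \<in> Linf (lev X k) \<longrightarrow>
           (\<integral>x. h x * coboundary X k f x \<partial>lev X (k + 1)) = (\<integral>x. T h x * f x \<partial>lev X k))) \<and>
     (\<exists>T. L1_functional (lev X 0) T \<and>
        (\<forall>g h. g \<in> carrier G \<and> integrable (lev X 0) h \<longrightarrow>
           T (L1_act G (lev X 0) (act X 0) g h) = T h) \<and>
        (\<forall>h c. integrable (lev X 0) h \<longrightarrow> (\<integral>x. h x * c \<partial>lev X 0) = T h * c))"


section \<open>Measured Quillen families\<close>

definition measurably_compatible ::
    "(nat \<Rightarrow> 'g top_group) \<Rightarrow> (nat \<Rightarrow> 'g \<Rightarrow> 'g) \<Rightarrow> (nat \<Rightarrow> ('g, 'x) measured_obj) \<Rightarrow>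
     (nat \<Rightarrow> ereal) \<Rightarrow> bool" where
  "measurably_compatible G \<iota> X \<tau> \<longleftrightarrow>
     (\<forall>r. \<exists>(H :: nat \<Rightarrow> 'g set) (\<pi> :: nat \<Rightarrow> 'g \<Rightarrow> 'g).
        (\<forall>q\<in>idx (\<tau> r).
           let L = sub_top_group (G r) (H q); Q = group_at G (int r - 1 - int q) in
           (\<exists>x\<in>space (lev (X r) q). H q = stabilizer (G r) (act (X r) q) x) \<and>
           \<pi> q \<in> hom L Q \<and> \<pi> q ` H q = carrier Q \<and>
           continuous_map (gtop L) (gtop Q) (\<pi> q) \<and>
           amenable (sub_top_group L (kernel L Q (\<pi> q)))) \<and>
        (\<forall>q. ereal (real q) < \<tau> r \<longrightarrow>
           H (q + 1) \<subseteq> H q \<and>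
           (\<forall>h\<in>H (q + 1). \<pi> q h = incl_at G \<iota> (int r - int q - 2) (\<pi> (q + 1) h))))"

definition measured_quillen_family ::
    "(nat \<Rightarrow> 'g top_group) \<Rightarrow> (nat \<Rightarrow> 'g \<Rightarrow> 'g) \<Rightarrow> (nat \<Rightarrow> ('g, 'x) measured_obj) \<Rightarrow>
     (nat \<Rightarrow> ereal) \<Rightarrow> (nat \<Rightarrow> ereal) \<Rightarrow> bool" where
  "measured_quillen_family G \<iota> X \<gamma> \<tau> \<longleftrightarrow>
     ascending_series G \<iota> \<and>
     (\<forall>r. measured_object (G r) (X r) \<and> admissible (G r) (X r) \<and>
          measurably_connected (X r) (\<gamma> r) \<and> q_transitive (G r) (X r) (\<tau> r)) \<and>
     measurably_compatible G \<iota> X \<tau>"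


section \<open>Symplectic groups\<close>

definition mat_topology :: "nat \<Rightarrow> nat \<Rightarrow> 'k :: topological_space mat topology" where
  "mat_topology m n =
     pullback_topology (carrier_mat m n)
       (\<lambda>A. restrict (\<lambda>p. A $$ p) ({..<m} \<times> {..<n}))
       (product_topology (\<lambda>_. euclidean) ({..<m} \<times> {..<n}))"

text \<open>
  In the ordered basis \<open>(e\<^sub>r\<^sub>-\<^sub>1, \<dots>, e\<^sub>0, f\<^sub>0, \<dots>, f\<^sub>r\<^sub>-\<^sub>1)\<close> the coordinate of \<open>e\<^sub>i\<close> has index
  \<open>r - 1 - i\<close> and that of \<open>f\<^sub>i\<close> has index \<open>r + i\<close>.
\<close>

definition symp_form :: "nat \<Rightarrow> 'k :: field vec \<Rightarrow> 'k vec \<Rightarrow> 'k" where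
  "symp_form r v w = (\<Sum>i<r. v $ (r - 1 - i) * w $ (r + i) - v $ (r + i) * w $ (r - 1 - i))"

definition Sp :: "nat \<Rightarrow> 'k :: {field, topological_space} mat top_group" where
  "Sp r =
     (let S = {A \<in> carrier_mat (2 * r) (2 * r). invertible_mat A \<and>
                 (\<forall>v\<in>carrier_vec (2 * r). \<forall>w\<in>carrier_vec (2 * r).
                    symp_form r (A *\<^sub>v v) (A *\<^sub>v w) = symp_form r v w)}
      in \<lparr>carrier = S, monoid.mult = (*), one = 1\<^sub>m (2 * r),
          gtop = subtopology (mat_topology (2 * r) (2 * r)) S\<rparr>)"

definition Sp_incl :: "nat \<Rightarrow> 'k :: {field, topological_space} mat \<Rightarrow> 'k mat" where
  "Sp_incl r A = diag_block_mat [1\<^sub>m 1, A, 1\<^sub>m 1]"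

end

theory Submission
 imports Defs "HOL-Library.Function_Algebras" "Jordan_Normal_Form.Determinant" "HOL-Probability.Infinite_Product_Measure"
begin

text \<open>
A point of degree \<open>q\<close> in the \<open>r\<close>-th object is a tuple \<open>(v0; (v1,w1), \<dots>, (vq,wq))\<close> of a nonzero vector and
mutually orthogonal hyperbolic pairs orthogonal to it; the face \<open>0\<close> forgets \<open>v0\<close> and \<open>w1\<close>, the face \<open>i > 0\<close> forgets
\<open>(vi,wi)\<close>. With plain isotropic frames the compatibility square would not commute. Here the stabilizer of the standard
tuple projects onto its middle block, the group of rank \<open>r - 1 - q\<close>, and the kernel is a Heisenberg group, amenable by
two applications of Markov-Kakutani. The symplectic Gram-Schmidt process, being equivariant, turns a random matrix
into a random group element with quasi-invariant law, and all spaces are homogeneous.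
A measurable cocycle becomes a strict one by averaging over the group. In degree \<open>j \<ge> 2\<close>, with \<open>3 j \<le> r\<close>, a strict
cocycle is filled by iterated coning over vertices that are linear corrections of standard ones, defined for generic
tuples; degree \<open>1\<close> needs a separate argument, which first shows that a cocycle does not depend on \<open>w1\<close>.
\<close>

text \<open>The form of the tuples is forced from two sides. An element that fixes only the
  isotropic vectors of a longer frame acts on the block of the shorter one through the stabilizer of
  a vector, whereas an element that fixes whole pairs is block diagonal there, as
  \<open>diag(1,A,1)\<close> demands. The first vector carries no partner because \<gamma>(2) = 0:
  with full pairs in degree 0 and \<open>r = 2\<close>, an edge would only join pairs of a plane to
  pairs of its orthogonal complement, and functions of this splitting would be nonconstant cocycles.
  The bound \<open>3 j \<le> r\<close> counts dimensions: the cycle attached to a face lives in the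
  span of \<open>6 j - 6\<close> vectors, and 6 further dimensions allow any two hyperbolic pairs
  orthogonal to it to be joined. The required range implies this bound for \<open>j \<ge> 2\<close>,
  with equality at \<open>j = 2\<close>. The obstacle throughout is that a discrete contraction
  makes choices. They are replaced by rational formulas, valid off the zero set of a polynomial.
  Null sets are moved by Fubini alone, so neither Haar measure nor a Jacobian is computed. When no
  \<open>q\<close> is in the range the claim is a negative one, and \<open>r = 1\<close> needs an
  explicit cocycle.\<close>

class efield = real_normed_field + euclidean_space

instance real :: efield ..

instance complex :: efield ..

section \<open>Coordinate vectors and the symplectic form\<close>

type_synonym 'k vect = "nat \<Rightarrow> 'k"

type_synonym 'k frame = "('k vect \<times> 'k vect) list"

text \<open>Coordinate \<open>a\<close> is paired with \<open>2*r - 1 - a\<close>, so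
  \<open>ee i\<close> is the basis vector e of index \<open>r - 1 - i\<close> and
  \<open>ee (2*r - Suc i)\<close> is its dual f. Small \<open>i\<close> are the outermost pairs, and
  fixing those leaves the middle block. Vectors are total functions of which the form sees only the
  coordinates below \<open>2*r\<close>; equality is therefore often replaced by agreement there
  (\<open>om_cong\<close>), and being nonzero by \<open>nz\<close>.\<close>

definition om :: "nat \<Rightarrow> 'k::field vect \<Rightarrow> 'k vect \<Rightarrow> 'k" where
 "om r x y = (\<Sum>i<r. x i * y (2*r - Suc i) - x (2*r - Suc i) * y i)"

definition smul :: "'k::field \<Rightarrow> 'k vect \<Rightarrow> nat \<Rightarrow> 'k" where
 "smul c x = (\<lambda>a. c * x a)"

definition ee :: "nat \<Rightarrow> nat \<Rightarrow> 'k::field" where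
 "ee i = (\<lambda>a. if a = i then 1 else 0)"

definition nz :: "nat \<Rightarrow> 'k::field vect \<Rightarrow> bool" where
 "nz r x \<longleftrightarrow> (\<exists>a<2*r. x a \<noteq> 0)"

lemma smul_apply [simp]: "smul c x a = c * x a"
 by (simp add: smul_def)

lemma smul_simps [simp]:
 "smul 0 x = 0" "smul 1 x = x" "smul c 0 = 0" "smul a (smul b x) = smul (a * b) x"
 by (auto simp: fun_eq_iff)

lemma om_add_left [simp]: "om r (x + y) z = om r x z + om r y z"
 by (simp add: om_def sum.distrib[symmetric] algebra_simps)

lemma om_add_right [simp]: "om r z (x + y) = om r z x + om r z y"
 by (simp add: om_def sum.distrib[symmetric] algebra_simps)

lemma om_smul_left [simp]: "om r (smul c x) z = c * om r x z"
 by (simp add: om_def sum_distrib_left algebra_simps)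

lemma om_smul_right [simp]: "om r z (smul c x) = c * om r z x"
 by (simp add: om_def sum_distrib_left algebra_simps)

lemma om_zero [simp]: "om r 0 x = 0" "om r x 0 = 0"
 by (simp_all add: om_def)

lemma om_minus_left [simp]: "om r (- x) z = - om r x z"
 by (simp add: om_def sum_negf[symmetric])

lemma om_minus_right [simp]: "om r z (- x) = - om r z x"
 by (simp add: om_def sum_negf[symmetric])

lemma om_diff_left [simp]: "om r (x - y) z = om r x z - om r y z"
 using om_add_left[of r x "-y" z] by simp

lemma om_diff_right [simp]: "om r z (x - y) = om r z x - om r z y"
 using om_add_right[of r z x "-y"] by simp

lemma om_self [simp]: "om r x x = 0"
 by (simp add: om_def algebra_simps)

lemma om_anti: "om r y x = - om r x y"
 by (simp add: om_def sum_negf[symmetric] algebra_simps)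

lemma om_sym0: "om r y x = 0 \<longleftrightarrow> om r x y = 0"
 by (simp add: om_anti[of r y x])

lemma om_sum_left: "om r (\<Sum>i\<in>I. f i) z = (\<Sum>i\<in>I. om r (f i) z)"
proof (induction I rule: infinite_finite_induct)
 case (insert i F)
 then show ?case unfolding sum.insert[OF insert.hyps] om_add_left om_add_right by simp
qed (simp_all only: sum.infinite sum.empty om_zero simp_thms)

lemma om_sum_right: "om r z (\<Sum>i\<in>I. f i) = (\<Sum>i\<in>I. om r z (f i))"
proof (induction I rule: infinite_finite_induct)
 case (insert i F)
 then show ?case unfolding sum.insert[OF insert.hyps] om_add_left om_add_right by simp
qed (simp_all only: sum.infinite sum.empty om_zero simp_thms)

lemma om_cong: "(\<And>a. a < 2*r ==> x a = x' a) ==> (\<And>a. a < 2*r ==> y a = y' a) ==> om r x y = om r x' y'"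
 unfolding om_def by (rule sum.cong) auto

lemma om_eeE: assumes "i < r" shows "om r (ee i) y = y (2*r - Suc i)"
proof -
 have "om r (ee i) y = (\<Sum>l<r. if l = i then y (2*r - Suc l) else 0)"
  unfolding om_def ee_def using assms by (intro sum.cong) auto
 then show ?thesis using assms by simp
qed

lemma om_eeF: assumes "i < r" shows "om r (ee (2*r - Suc i)) y = - y i"
proof -
 have "om r (ee (2*r - Suc i)) y = (\<Sum>l<r. if l = i then - y l else 0)"
  unfolding om_def ee_def using assms by (intro sum.cong) auto
 then show ?thesis using assms by simp
qed

lemma om_ee_right: assumes "i < r" shows "om r y (ee i) = - y (2*r - Suc i)" "om r y (ee (2*r - Suc i)) = y i"
 using om_eeE[OF assms, of y] om_eeF[OF assms, of y] om_anti[of r y "ee i"] om_anti[of r y "ee (2*r - Suc i)"] by auto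

lemma ee_apply: "ee i a = (if a = i then 1 else 0)"
 by (simp add: ee_def)

lemma om_ee_ee:
 assumes "i < r" "l < r"
 shows "om r (ee i) (ee l) = 0" "om r (ee (2*r - Suc i)) (ee (2*r - Suc l)) = 0"
  "om r (ee i) (ee (2*r - Suc l)) = (if i = l then 1 else 0)"
  "om r (ee (2*r - Suc l)) (ee i) = (if i = l then -1 else 0)"
 using assms by (auto simp: om_eeE om_eeF ee_apply)

lemma om_nondeg_all:
 assumes "\<And>i. i < r ==> om r (ee i) x = 0" "\<And>i. i < r ==> om r (ee (2*r - Suc i)) x = 0"
 shows "\<not> nz r x"
proof -
 have "x a = 0" if "a < 2*r" for a
 proof (cases "a < r")
  case True then show ?thesis using assms(2)[OF True] by (simp add: om_eeF)
 next
  case False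
  then have "2*r - Suc a < r" using that by auto
  moreover have "2*r - Suc (2*r - Suc a) = a" using that by auto
  ultimately show ?thesis using assms(1)[of "2*r - Suc a"] by (simp add: om_eeE)
 qed
 then show ?thesis by (auto simp: nz_def)
qed

lemma nz_partner: assumes "nz r x" obtains y where "om r x y = 1"
proof -
 obtain z where z: "om r z x \<noteq> 0" using om_nondeg_all[of r x] assms by blast
 then have "om r x (smul (- inverse (om r z x)) z) = 1"
  by (simp add: om_anti[of r x z])
 then show ?thesis using that by blast
qed

lemma om_imp_nz: "om r x y \<noteq> 0 ==> nz r x"
 unfolding nz_def om_def
proof (rule ccontr)
 assume a: "(\<Sum>i<r. x i * y (2 * r - Suc i) - x (2 * r - Suc i) * y i) \<noteq> 0" and "\<not> (\<exists>a<2*r. x a \<noteq> 0)"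
 then have *: "x a = 0" if "a < 2*r" for a using that by auto
 have "(\<Sum>i<r. x i * y (2 * r - Suc i) - x (2 * r - Suc i) * y i) = 0"
  by (rule sum.neutral) (auto simp: *)
 then show False using a by simp
qed

section \<open>Subspaces, orthogonal complements and transvections\<close>

definition subsp :: "'k::field vect set \<Rightarrow> bool" where
 "subsp W \<longleftrightarrow> 0 \<in> W \<and> (\<forall>x\<in>W. \<forall>y\<in>W. x + y \<in> W) \<and> (\<forall>c. \<forall>x\<in>W. smul c x \<in> W)"

definition perp :: "nat \<Rightarrow> 'k::field vect set \<Rightarrow> 'k vect set" where
 "perp r S = {x. \<forall>s\<in>S. om r s x = 0}"

lemma subsp_perp: "subsp (perp r S)"
 by (auto simp: subsp_def perp_def)

lemma subsp_diff: assumes "subsp W" "x \<in> W" "y \<in> W" shows "x - y \<in> W"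
proof -
 have "x - y = x + smul (-1) y" by (auto simp: fun_eq_iff)
 then show ?thesis using assms unfolding subsp_def by metis
qed

text \<open>The symplectic transvection along \<open>a\<close>. Isometries are handled as lists of
  these (\<open>tvs\<close>), because such a list depends polynomially on its parameters.\<close>

definition tv :: "nat \<Rightarrow> 'k::field vect \<Rightarrow> 'k \<Rightarrow> 'k vect \<Rightarrow> nat \<Rightarrow> 'k" where
 "tv r a c x = x + smul (c * om r x a) a"

lemma om_tv [simp]: "om r (tv r a c x) (tv r a c y) = om r x y"
 by (simp add: tv_def om_anti[of r y a] om_anti[of r x a] algebra_simps)

lemma tv_linear: "tv r a c (x + y) = tv r a c x + tv r a c y" "tv r a c (smul d x) = smul d (tv r a c x)"
 by (auto simp: tv_def fun_eq_iff algebra_simps)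

lemma tv_inverse [simp]: "tv r a (-c) (tv r a c x) = x" "tv r a c (tv r a (-c) x) = x"
 by (auto simp: tv_def fun_eq_iff algebra_simps)

lemma tv_zero [simp]: "tv r a 0 x = x"
 by (auto simp: tv_def)

lemma tv_fix: "om r x a = 0 ==> tv r a c x = x"
 by (simp add: tv_def)

lemma tv_in: "subsp W ==> a \<in> W ==> x \<in> W ==> tv r a c x \<in> W"
 by (simp add: tv_def subsp_def)

definition tvs :: "nat \<Rightarrow> ('k::field vect \<times> 'k) list \<Rightarrow> 'k vect \<Rightarrow> nat \<Rightarrow> 'k" where
 "tvs r ts x = foldr (\<lambda>p. tv r (fst p) (snd p)) ts x"

lemma tvs_simps [simp]: "tvs r [] x = x" "tvs r (p # ts) x = tv r (fst p) (snd p) (tvs r ts x)"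
 "tvs r (ts @ us) x = tvs r ts (tvs r us x)"
 by (simp_all add: tvs_def)

lemma om_tvs [simp]: "om r (tvs r ts x) (tvs r ts y) = om r x y"
 by (induction ts) auto

definition tinv :: "('k::field vect \<times> 'k) list \<Rightarrow> ('k vect \<times> 'k) list" where
 "tinv ts = rev (map (\<lambda>p. (fst p, - snd p)) ts)"

lemma tvs_tinv [simp]: "tvs r ts (tvs r (tinv ts) x) = x" "tvs r (tinv ts) (tvs r ts x) = x"
proof -
 show "tvs r ts (tvs r (tinv ts) x) = x"
  by (induction ts arbitrary: x) (auto simp: tinv_def)
 show "tvs r (tinv ts) (tvs r ts x) = x"
  by (induction ts arbitrary: x) (auto simp: tinv_def)
qed

lemma tvs_fix: "(\<And>p. p \<in> set ts ==> om r x (fst p) = 0) ==> tvs r ts x = x"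
 by (induction ts) (auto simp: tv_fix)

lemma tvs_in: "subsp W ==> fst ` set ts \<subseteq> W ==> x \<in> W ==> tvs r ts x \<in> W"
 by (induction ts) (auto simp: tv_in)

lemma tv_move: "om r x y \<noteq> 0 ==> tv r (y - x) (1 / om r x y) x = y"
 by (auto simp: tv_def fun_eq_iff)

text \<open>One transvection along \<open>y - x\<close> moves \<open>x\<close> to \<open>y\<close>
  when these are not orthogonal; going through \<open>u\<close> takes two. The last clause names the
  vectors orthogonal to both axes, which stay fixed.\<close>

lemma transvections_move_vector:
 assumes W: "subsp W" and e: "e \<in> W" and v: "v \<in> W" and u: "u \<in> W"
  and eu: "om r e u \<noteq> 0" and uv: "om r u v \<noteq> 0"
 obtains ts where "length ts = 2" "fst ` set ts \<subseteq> W" "tvs r ts e = v"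
  "\<And>x. om r x e = om r x u ==> om r x u = om r x v ==> tvs r ts x = x"
proof -
 let ?ts = "[(v - u, 1 / om r u v), (u - e, 1 / om r e u)]"
 show ?thesis
  by (rule that[of ?ts]) (use assms in \<open>auto simp: tv_move tv_fix subsp_diff\<close>)
qed

text \<open>After \<open>e\<close> has been moved to \<open>v\<close>, the image \<open>f'\<close>
  of \<open>f\<close> is moved to \<open>w\<close> without disturbing \<open>v\<close>: the axes are
  orthogonal to \<open>v\<close> because \<open>f'\<close>, \<open>w\<close> and the possible
  intermediate vector \<open>f' + v\<close> all have product 1 with \<open>v\<close>.\<close>

lemma hyperbolic_pairs_transitive:
 assumes W: "subsp W" and mem: "e \<in> W" "f \<in> W" "v \<in> W" "w \<in> W"
  and ef: "om r e f = 1" and vw: "om r v w = 1"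
 obtains ts where "length ts = 4" "fst ` set ts \<subseteq> W" "tvs r ts e = v" "tvs r ts f = w"
proof -
 \<comment> \<open>\<open>f\<close> serves unless it is orthogonal to \<open>v\<close>, and
   \<open>w\<close> unless it is orthogonal to \<open>e\<close>; if both fail, the sum
   serves.\<close>
 obtain u where u: "u \<in> W" "om r e u \<noteq> 0" "om r u v \<noteq> 0"
 proof (cases "om r f v = 0")
  case False then show ?thesis using that[of f] mem ef by simp
 next
  case fv: True
  show ?thesis
  proof (cases "om r e w = 0")
   case False then show ?thesis using that[of w] mem vw om_anti[of r w v] by simp
  next
   case True
   have "f + w \<in> W" using W mem by (simp add: subsp_def)
   then show ?thesis using that[of "f + w"] True fv ef vw om_anti[of r w v] by simp
  qed
 qed
 obtain ts where ts: "length ts = 2" "fst ` set ts \<subseteq> W" "tvs r ts e = v"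
  using transvections_move_vector[OF W mem(1) mem(3) u] by metis
 define f' where "f' = tvs r ts f"
 have f': "f' \<in> W" using tvs_in[OF W ts(2) mem(2)] by (simp add: f'_def)
 have vf': "om r v f' = 1" using om_tvs[of r ts e f] ts(3) ef by (simp add: f'_def)
 have "\<exists>us. length us = 2 \<and> fst ` set us \<subseteq> W \<and> tvs r us f' = w \<and> tvs r us v = v"
 proof (cases "om r f' w = 0")
  case False
  \<comment> \<open>The trivial transvection pads the list, so that the number of transvections
    never depends on the case.\<close>
  let ?us = "[(w - f', 1 / om r f' w), (0, 0)]"
  have "fst ` set ?us \<subseteq> W" using W mem f' by (auto simp: subsp_diff) (auto simp: subsp_def)
  moreover have "tvs r ?us f' = w" using False by (simp add: tv_move)
  moreover have "tvs r ?us v = v" using vf' vw by (simp add: tv_fix)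
  ultimately show ?thesis by (intro exI[of _ ?us]) simp
 next
  case True
  have m: "f' + v \<in> W" using W mem f' by (simp add: subsp_def)
  have "om r f' (f' + v) \<noteq> 0" using vf' om_anti[of r f' v] by simp
  moreover have "om r (f' + v) w \<noteq> 0" using True vw by simp
  ultimately obtain us where us: "length us = 2" "fst ` set us \<subseteq> W" "tvs r us f' = w"
   "\<And>x. om r x f' = om r x (f'+v) ==> om r x (f'+v) = om r x w ==> tvs r us x = x"
   using transvections_move_vector[OF W f' mem(4) m] by metis
  have "tvs r us v = v" using us(4)[of v] vf' vw by simp
  then show ?thesis using us by blast
 qed
 then obtain us where "length us = 2" "fst ` set us \<subseteq> W" "tvs r us f' = w" "tvs r us v = v" by blast
 then show ?thesis using that[of "us @ ts"] ts by (auto simp: f'_def)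
qed

section \<open>Families of orthogonal hyperbolic pairs\<close>

definition orthp :: "nat \<Rightarrow> 'k::field vect \<times> 'k vect \<Rightarrow> 'k vect \<times> 'k vect \<Rightarrow> bool" where
 "orthp r p q \<longleftrightarrow> om r (fst p) (fst q) = 0 \<and> om r (fst p) (snd q) = 0 \<and>
   om r (snd p) (fst q) = 0 \<and> om r (snd p) (snd q) = 0"

definition hfl :: "nat \<Rightarrow> 'k::field frame \<Rightarrow> bool" where
 "hfl r xs \<longleftrightarrow> (\<forall>p\<in>set xs. om r (fst p) (snd p) = 1) \<and> sorted_wrt (orthp r) xs"

lemma hfl_nth:
 "hfl r xs \<longleftrightarrow> (\<forall>i<length xs. om r (fst (xs!i)) (snd (xs!i)) = 1) \<and>
   (\<forall>i j. i < j \<and> j < length xs \<longrightarrow>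
    om r (fst (xs!i)) (fst (xs!j)) = 0 \<and> om r (fst (xs!i)) (snd (xs!j)) = 0 \<and>
    om r (snd (xs!i)) (fst (xs!j)) = 0 \<and> om r (snd (xs!i)) (snd (xs!j)) = 0)"
 by (simp add: hfl_def all_set_conv_all_nth sorted_wrt_iff_nth_less orthp_def) blast

definition pvs :: "('v \<times> 'v) list \<Rightarrow> 'v set" where
 "pvs xs = fst ` set xs \<union> snd ` set xs"

definition stdl :: "nat \<Rightarrow> nat \<Rightarrow> 'k::field frame" where
 "stdl r n = map (\<lambda>i. (ee i, ee (2*r - Suc i))) [0..<n]"

lemma pvs_nth: "x \<in> pvs xs \<longleftrightarrow> (\<exists>i<length xs. x = fst (xs!i) \<or> x = snd (xs!i))"
 unfolding pvs_def by (force simp: in_set_conv_nth)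

lemma pvs_simps [simp]: "pvs [] = {}" "pvs (p # xs) = {fst p, snd p} \<union> pvs xs" "pvs (xs @ ys) = pvs xs \<union> pvs ys"
 by (auto simp: pvs_def)

lemma hfl_snoc:
 "hfl r (xs @ [p]) \<longleftrightarrow> hfl r xs \<and> om r (fst p) (snd p) = 1 \<and> (\<forall>t\<in>pvs xs. om r t (fst p) = 0 \<and> om r t (snd p) = 0)"
 by (auto simp: hfl_def sorted_wrt_append pvs_def orthp_def)

lemma hfl_Nil [simp]: "hfl r []" by (simp add: hfl_def)

lemma stdl_Suc: "stdl r (Suc n) = stdl r n @ [(ee n, ee (2*r - Suc n))]"
 by (simp add: stdl_def)

lemma stdl_Nil [simp]: "stdl r 0 = []" "length (stdl r n) = n"
 by (simp_all add: stdl_def)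

lemma pvs_stdl: "pvs (stdl r n) = ee ` {..<n} \<union> (\<lambda>i. ee (2*r - Suc i)) ` {..<n}"
 by (auto simp: pvs_def stdl_def image_image)

lemma hfl_stdl: "n \<le> r ==> hfl r (stdl r n :: 'k::field frame)"
 by (auto simp: hfl_nth stdl_def om_ee_ee)

definition tvl where "tvl r ts = map (\<lambda>p. (tvs r ts (fst p), tvs r ts (snd p)))"

lemma pvs_tvl: "pvs (tvl r ts xs) = tvs r ts ` pvs xs"
 by (auto simp: pvs_def tvl_def image_image)

text \<open>Pulled back by the transvections found so far, the next pair lies in the complement of
  the standard pairs already treated; the four transvections that produce it can be taken there, and
  then fix those pairs.\<close>

lemma hfl_transitive:
 fixes xs :: "'k::field frame"
 assumes "hfl r xs" "length xs \<le> r"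
 shows "\<exists>ts. length ts = 4 * length xs \<and> tvl r ts (stdl r (length xs)) = xs"
 using assms
proof (induction xs rule: rev_induct)
 case Nil show ?case by (simp add: tvl_def)
next
 case (snoc p xs)
 let ?n = "length xs"
 have h: "hfl r xs" "om r (fst p) (snd p) = 1" "\<And>t. t\<in>pvs xs ==> om r t (fst p) = 0 \<and> om r t (snd p) = 0"
  using snoc.prems by (auto simp: hfl_snoc)
 obtain ts where ts: "length ts = 4 * ?n" "tvl r ts (stdl r ?n) = xs"
  using snoc.IH h(1) snoc.prems(2) by auto
 define W where "W = perp r (pvs (stdl r ?n) :: 'k vect set)"
 have std: "hfl r (stdl r (Suc ?n) :: 'k frame)" using snoc.prems(2) by (intro hfl_stdl) simp
 have m1: "ee ?n \<in> W" "ee (2*r - Suc ?n) \<in> W"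
  using std by (auto simp: stdl_Suc hfl_snoc W_def perp_def)
 let ?p = "(tvs r (tinv ts) (fst p), tvs r (tinv ts) (snd p))"
 have m2: "fst ?p \<in> W" "snd ?p \<in> W"
 proof -
  have "om r s (tvs r (tinv ts) q) = om r (tvs r ts s) q" for s q
   using om_tvs[of r ts s "tvs r (tinv ts) q"] by simp
  moreover have "tvs r ts s \<in> pvs xs" if "s \<in> pvs (stdl r ?n)" for s
   using that ts(2) pvs_tvl[of r ts "stdl r ?n"] by auto
  ultimately show "fst ?p \<in> W" "snd ?p \<in> W" using h(3) by (auto simp: W_def perp_def)
 qed
 have e: "om r (ee ?n) (ee (2*r - Suc ?n)) = (1::'k)" using snoc.prems(2) by (simp add: om_ee_ee)
 obtain us where us: "length us = 4" "fst ` set us \<subseteq> W" "tvs r us (ee ?n) = fst ?p" "tvs r us (ee (2*r - Suc ?n)) = snd ?p"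
  using hyperbolic_pairs_transitive[OF _ m1 m2 e] subsp_perp h(2) unfolding W_def
  by (metis (no_types, lifting) fst_conv om_tvs snd_conv)
 have fix1: "tvs r us s = s" if "s \<in> pvs (stdl r ?n)" for s
  by (rule tvs_fix) (use us(2) that in \<open>auto simp: W_def perp_def\<close>)
 have "tvl r (ts @ us) (stdl r ?n) = tvl r ts (stdl r ?n)"
  unfolding tvl_def by (rule map_cong[OF refl]) (use fix1 in \<open>auto simp: pvs_def\<close>)
 then have "tvl r (ts @ us) (stdl r (Suc ?n)) = xs @ [p]"
  using ts(2) us(3,4) by (simp add: stdl_Suc) (simp add: tvl_def)
 then show ?case using ts(1) us(1) by (intro exI[of _ "ts @ us"]) simp
qed

text \<open>Moved to standard position, \<open>r\<close> pairs span everything, so the first vector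
  of a further pair would be orthogonal to the whole space.\<close>

lemma hfl_length_le:
 fixes xs :: "'k::field frame"
 assumes "hfl r xs" shows "length xs \<le> r"
 using assms
proof (induction xs rule: rev_induct)
 case (snoc p xs)
 have h: "hfl r xs" "om r (fst p) (snd p) = 1" "\<And>t. t\<in>pvs xs ==> om r t (fst p) = 0 \<and> om r t (snd p) = 0"
  using snoc.prems by (auto simp: hfl_snoc)
 have le: "length xs \<le> r" using snoc h by auto
 have "length xs \<noteq> r"
 proof
  assume l: "length xs = r"
  obtain ts where ts: "tvl r ts (stdl r r) = xs" using hfl_transitive[OF h(1) le] l by auto
  have *: "om r t (tvs r (tinv ts) (fst p)) = 0" if "t \<in> pvs (stdl r r)" for t
   using om_tvs[of r ts t "tvs r (tinv ts) (fst p)"] h(3)[of "tvs r ts t"] that ts pvs_tvl[of r ts "stdl r r"] by auto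
  have "\<not> nz r (tvs r (tinv ts) (fst p))"
   by (rule om_nondeg_all) (auto intro!: * simp: pvs_stdl)
  moreover have "om r (tvs r (tinv ts) (fst p)) (tvs r (tinv ts) (snd p)) \<noteq> 0" using h(2) by simp
  ultimately show False using om_imp_nz by blast
 qed
 then show ?case using le by simp
qed simp

lemma fun_sum_apply: "(\<Sum>i\<in>I. (f i :: 'b \<Rightarrow> 'c::comm_monoid_add)) b = (\<Sum>i\<in>I. f i b)"
proof (induction I rule: infinite_finite_induct)
 case (insert i I)
 then show ?case unfolding sum.insert[OF insert.hyps] by simp
qed simp_all

lemma om_expand: "om r x y = (\<Sum>a<2*r. x a * om r (ee a) y)"
proof -
 have "om r x y = om r (\<Sum>a<2*r. smul (x a) (ee a)) y"
 proof (rule om_cong)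
  fix b assume b: "b < 2*r"
  have "(\<Sum>a<2*r. smul (x a) (ee a)) b = (\<Sum>a<2*r. if b = a then x a else 0)"
   unfolding fun_sum_apply by (rule sum.cong) (auto simp: ee_apply)
  then show "x b = (\<Sum>a<2*r. smul (x a) (ee a)) b" using b by simp
 qed simp
 then show ?thesis by (simp add: om_sum_left)
qed

lemma exists_orthogonal:
 fixes S :: "'k::field vect list"
 assumes "length S < 2*r"
 obtains x where "nz r x" "\<And>s. s \<in> set S ==> om r s x = 0"
proof -
 \<comment> \<open>The conditions are padded by zero rows to a square matrix; row number
   \<open>length S\<close> is zero, so the determinant vanishes.\<close>
 define M where "M = mat (2*r) (2*r) (\<lambda>(i,b). if i < length S then om r (S!i) (ee b) else 0)"
 have M: "M \<in> carrier_mat (2*r) (2*r)" by (simp add: M_def)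
 have "Determinant.det M = 0"
  unfolding det_def'[OF M]
 proof (rule sum.neutral, rule ballI)
  fix p assume "p \<in> {p. p permutes {0..<2*r}}"
  then have p: "p (length S) < 2*r" using assms permutes_in_image[of p "{0..<2*r}" "length S"] by auto
  have "\<exists>a\<in>{0..<2*r}. M $$ (a, p a) = 0" using assms p by (intro bexI[of _ "length S"]) (auto simp: M_def)
  then have "(\<Prod>i = 0..<2*r. M $$ (i, p i)) = 0" by (subst prod_zero_iff) auto
  then show "signof p * (\<Prod>i = 0..<2*r. M $$ (i, p i)) = 0" by simp
 qed
 then obtain v where v: "v \<in> carrier_vec (2*r)" "v \<noteq> 0\<^sub>v (2*r)" "M *\<^sub>v v = 0\<^sub>v (2*r)"
  using det_0_iff_vec_prod_zero_field[OF M] by auto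
 define x where "x = (\<lambda>b. v $ b)"
 have "nz r x"
 proof (rule ccontr)
  assume "\<not> nz r x"
  then have *: "v $ a = 0" if "a < 2*r" for a using that unfolding nz_def x_def by blast
  have "v = 0\<^sub>v (2*r)" by (rule eq_vecI) (use v(1) * in auto)
  then show False using v by simp
 qed
 moreover have "om r s x = 0" if "s \<in> set S" for s
 proof -
  have "\<exists>i<length S. S!i = s" using that by (simp add: in_set_conv_nth)
  then obtain i where i: "i < length S" "S!i = s" by (elim exE conjE)
  have "0 = (M *\<^sub>v v) $ i" unfolding v(3) using i assms by simp
  also have "\<dots> = (\<Sum>b<2*r. om r s (ee b) * x b)"
   using i assms v(1) by (auto simp: M_def scalar_prod_def x_def atLeast0LessThan intro!: sum.cong)
  also have "\<dots> = - (\<Sum>b<2*r. x b * om r (ee b) s)"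
   unfolding sum_negf[symmetric]
  proof (rule sum.cong)
   fix b show "om r s (ee b) * x b = - (x b * om r (ee b) s)"
    by (subst om_anti[of r s "ee b"]) (simp add: mult.commute)
  qed simp
  also have "\<dots> = om r s x" unfolding om_expand[of r x s, symmetric] by (rule om_anti[symmetric])
  finally show ?thesis by simp
 qed
 ultimately show ?thesis by (rule that)
qed

section \<open>Hyperbolic pairs in complements\<close>

text \<open>Nondegeneracy of the span of \<open>S\<close>, expressed as: the complement of
  \<open>S\<close> and the complement of that complement together span the space. This form avoids
  spans and bases and allows dependent vectors in \<open>S\<close>.\<close>

definition nds :: "nat \<Rightarrow> 'k::field vect set \<Rightarrow> bool" where
 "nds r S \<longleftrightarrow> (\<forall>u. \<exists>s. (\<forall>y\<in>perp r S. om r s y = 0) \<and> u - s \<in> perp r S)"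

lemma nds_insert_pair:
 assumes S: "nds r S" and ab: "a \<in> perp r S" "b \<in> perp r S" "om r a b = 1"
 shows "nds r (S \<union> {a, b})"
 unfolding nds_def
proof
 fix u
 obtain s where s: "\<forall>y\<in>perp r S. om r s y = 0" "u - s \<in> perp r S" using S by (auto simp: nds_def)
 \<comment> \<open>The component of \<open>u - s\<close> in the plane of \<open>a\<close> and
   \<open>b\<close> is moved over to \<open>s\<close>.\<close>
 define t where "t = s + smul (om r (u - s) b) a - smul (om r (u - s) a) b"
 have "\<forall>y\<in>perp r (S \<union> {a, b}). om r t y = 0"
  using s(1) by (auto simp: t_def perp_def)
 moreover have "u - t \<in> perp r (S \<union> {a, b})"
 proof -
  have "om r x (u - t) = 0" if "x \<in> S" for x
   using that ab s(2) by (auto simp: perp_def t_def)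
  moreover have "om r a (u - t) = 0" "om r b (u - t) = 0"
   using ab(3) om_anti[of r b a] om_anti[of r b "u - s"] om_anti[of r a "u - s"] by (auto simp: t_def algebra_simps)
  ultimately show ?thesis by (auto simp: perp_def)
 qed
 ultimately show "\<exists>s. (\<forall>y\<in>perp r (S \<union> {a, b}). om r s y = 0) \<and> u - s \<in> perp r (S \<union> {a, b})" by blast
qed

lemma nds_empty [simp]: "nds r {}"
 unfolding nds_def by (intro allI exI[of _ 0]) (auto simp: perp_def)

text \<open>Each vector \<open>a\<close> of \<open>A\<close> costs at most two dimensions. Modulo a
  vector \<open>s\<close> orthogonal to the complement of \<open>S\<close>, it is either orthogonal
  to that complement as well, so that \<open>a\<close> imposes no new condition, or it has a partner
  \<open>y\<close> there, and then the pair joins \<open>S\<close>, which stays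
  nondegenerate.\<close>

lemma hyperbolic_pair_in_complement:
 assumes "nds r (set S)" "length S + 2 * length A < 2*r"
 obtains v w where "v \<in> perp r (set S \<union> set A)" "w \<in> perp r (set S \<union> set A)" "om r v w = 1"
proof -
 have "\<exists>v w. v \<in> perp r (set S \<union> set A) \<and> w \<in> perp r (set S \<union> set A) \<and> om r v w = 1"
  using assms
 proof (induction A arbitrary: S)
  case Nil
  obtain x where x: "nz r x" "\<And>s. s \<in> set S ==> om r s x = 0"
   using exists_orthogonal[of S r] Nil by auto
  obtain y where y: "om r x y = 1" using nz_partner[OF x(1)] by blast
  obtain s where s: "\<forall>y\<in>perp r (set S). om r s y = 0" "y - s \<in> perp r (set S)"
   using Nil by (auto simp: nds_def)
  have xp: "x \<in> perp r (set S)" using x(2) by (auto simp: perp_def)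
  then have "om r x s = 0" using s(1) om_sym0[of r s x] by blast
  then have "om r x (y - s) = 1" using y by simp
  then show ?case using xp s(2) by (intro exI[of _ x] exI[of _ "y - s"] conjI) (simp_all only: list.set Un_empty_right)
 next
  case (Cons a A)
  obtain s where s: "\<forall>y\<in>perp r (set S). om r s y = 0" "a - s \<in> perp r (set S)"
   using Cons.prems by (auto simp: nds_def)
  show ?case
  proof (cases "\<forall>y\<in>perp r (set S). om r (a - s) y = 0")
   case True
   then have "\<forall>y\<in>perp r (set S). om r a y = 0" using s(1) by auto
   moreover obtain v w where "v \<in> perp r (set S \<union> set A)" "w \<in> perp r (set S \<union> set A)" "om r v w = 1"
    using Cons.IH[of S] Cons.prems by auto
   ultimately show ?thesis by (intro exI[of _ v] exI[of _ w]) (auto simp: perp_def)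
  next
   case False
   then obtain y0 where y0: "y0 \<in> perp r (set S)" "om r (a - s) y0 \<noteq> 0" by blast
   define y where "y = smul (inverse (om r (a - s) y0)) y0"
   have y: "y \<in> perp r (set S)" "om r (a - s) y = 1"
    using y0 by (auto simp: y_def perp_def simp del: om_diff_left)
   have "nds r (set (S @ [a - s, y]))"
    using nds_insert_pair[OF Cons.prems(1) s(2) y] by simp
   then obtain v w where vw: "v \<in> perp r (set (S @ [a - s, y]) \<union> set A)" "w \<in> perp r (set (S @ [a - s, y]) \<union> set A)" "om r v w = 1"
    using Cons.IH[of "S @ [a - s, y]"] Cons.prems by auto
   have "om r a z = 0" if "z \<in> perp r (set (S @ [a - s, y]) \<union> set A)" for z
    using that s(1) by (auto simp: perp_def)
   then show ?thesis using vw by (intro exI[of _ v] exI[of _ w]) (auto simp: perp_def)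
  qed
 qed
 then show ?thesis using that by blast
qed

text \<open>Any two pairs in the complement differ by transvections along vectors \<open>a\<close>
  of it. A pair before and after one transvection has a common neighbour: a pair orthogonal to
  \<open>y\<close>, \<open>z\<close> and \<open>a\<close> is orthogonal to the images too. It exists
  because \<open>S\<close>, the pair and \<open>a\<close> counted twice amount to less than
  \<open>2*r\<close>.\<close>

lemma hyperbolic_pairs_connected:
 assumes S: "nds r (set S)" "length S + 6 \<le> 2*r"
  and \<Phi>: "\<And>v w v' w'. \<lbrakk>v \<in> perp r (set S); w \<in> perp r (set S); om r v w = 1;
   v' \<in> perp r (set S \<union> {v, w}); w' \<in> perp r (set S \<union> {v, w}); om r v' w' = 1\<rbrakk> \<Longrightarrow> \<Phi> (v, w) = \<Phi> (v', w')"
  and 1: "v \<in> perp r (set S)" "w \<in> perp r (set S)" "om r v w = 1"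
  and 2: "v' \<in> perp r (set S)" "w' \<in> perp r (set S)" "om r v' w' = 1"
 shows "\<Phi> (v, w) = \<Phi> (v', w')"
proof -
 have step: "\<Phi> (tv r a c y, tv r a c z) = \<Phi> (y, z)"
  if a: "a \<in> perp r (set S)" and y: "y \<in> perp r (set S)" "z \<in> perp r (set S)" "om r y z = 1" for a c y z
 proof -
  have n: "nds r (set (S @ [y, z]))" using nds_insert_pair[OF S(1) y] by simp
  obtain t u where tu: "t \<in> perp r (set (S @ [y, z]) \<union> set [a])" "u \<in> perp r (set (S @ [y, z]) \<union> set [a])" "om r t u = 1"
   using hyperbolic_pair_in_complement[OF n, of "[a]"] S(2) by auto
  have "\<Phi> (y, z) = \<Phi> (t, u)"
   by (rule \<Phi>) (use tu y in \<open>auto simp: perp_def\<close>)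
  moreover have "\<Phi> (tv r a c y, tv r a c z) = \<Phi> (t, u)"
  proof (rule \<Phi>)
   show "tv r a c y \<in> perp r (set S)" "tv r a c z \<in> perp r (set S)"
    using a y tv_in[OF subsp_perp] by blast+
   show "t \<in> perp r (set S \<union> {tv r a c y, tv r a c z})" "u \<in> perp r (set S \<union> {tv r a c y, tv r a c z})"
    using tu by (auto simp: perp_def tv_def)
  qed (use tu y in auto)
  ultimately show ?thesis by simp
 qed
 obtain ts where ts: "fst ` set ts \<subseteq> perp r (set S)" "tvs r ts v = v'" "tvs r ts w = w'"
  using hyperbolic_pairs_transitive[OF subsp_perp 1(1,2) 2(1,2) 1(3) 2(3)] by metis
 have "\<Phi> (tvs r us v, tvs r us w) = \<Phi> (v, w)" if "fst ` set us \<subseteq> perp r (set S)" for us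
  using that
 proof (induction us)
  case (Cons p us)
  have "tvs r us v \<in> perp r (set S)" "tvs r us w \<in> perp r (set S)"
   using Cons.prems 1 by (auto intro!: tvs_in subsp_perp)
  then show ?case using step[of "fst p" "tvs r us v" "tvs r us w" "snd p"] Cons 1(3) by auto
 qed simp
 from this[OF ts(1)] show ?thesis using ts by simp
qed

section \<open>Faces of tuples and the coboundary\<close>

definition del :: "nat \<Rightarrow> 'a list \<Rightarrow> 'a list" where
 "del i xs = take i xs @ drop (Suc i) xs"

lemma length_del: "i < length xs ==> length (del i xs) = length xs - 1"
 by (simp add: del_def)

lemma nth_del: "i < length xs ==> k < length xs - 1 ==> del i xs ! k = (if k < i then xs ! k else xs ! Suc k)"
 by (auto simp: del_def nth_append min_def)

lemma del_del: assumes "i < l" "l < length xs" shows "del i (del l xs) = del (l - 1) (del i xs)"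
proof (rule nth_equalityI)
 show "length (del i (del l xs)) = length (del (l - 1) (del i xs))" using assms by (simp add: length_del)
 fix k assume "k < length (del i (del l xs))"
 then show "del i (del l xs) ! k = del (l - 1) (del i xs) ! k"
  using assms by (auto simp: nth_del length_del)
qed

lemma del_append_left: "i < length xs ==> del i (xs @ ys) = del i xs @ ys"
 by (simp add: del_def)

lemma del_append_last: "del (length xs) (xs @ [y]) = xs"
 by (simp add: del_def)

lemma set_del_subset: "set (del i xs) \<subseteq> set xs"
 by (auto simp: del_def dest: in_set_takeD in_set_dropD)

definition bd :: "('a list \<Rightarrow> real) \<Rightarrow> 'a list \<Rightarrow> real" where
 "bd f xs = (\<Sum>i<length xs. (-1)^i * f (del i xs))"

lemma bd_bd: "bd (bd f) xs = 0"
proof -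
 let ?n = "length xs"
 let ?F = "\<lambda>i l. (-1)^(i+l) * f (del l (del i xs))"
 define A where "A = (SIGMA i:{..<?n}. {..<?n-1})"
 define A1 where "A1 = {p\<in>A. snd p < fst p}"
 define A2 where "A2 = {p\<in>A. fst p \<le> snd p}"
 have fA: "finite A" by (auto simp: A_def)
 have "bd (bd f) xs = (\<Sum>i<?n. \<Sum>l<?n-1. ?F i l)"
  unfolding bd_def by (rule sum.cong) (auto simp: length_del sum_distrib_left power_add mult.assoc intro!: sum.cong)
 also have "\<dots> = (\<Sum>p\<in>A. ?F (fst p) (snd p))"
  by (simp add: A_def sum.Sigma split_beta)
 also have "A = A1 \<union> A2" by (auto simp: A1_def A2_def)
 also have "(\<Sum>p\<in>A1 \<union> A2. ?F (fst p) (snd p)) = (\<Sum>p\<in>A1. ?F (fst p) (snd p)) + (\<Sum>p\<in>A2. ?F (fst p) (snd p))"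
  by (rule sum.union_disjoint) (use fA in \<open>auto simp: A1_def A2_def\<close>)
 \<comment> \<open>\<open>(i, l)\<close> with \<open>l < i\<close> is matched with
   \<open>(l, i - 1)\<close>: the same two entries are deleted in the other order, with opposite
   sign.\<close>
 also have "(\<Sum>p\<in>A1. ?F (fst p) (snd p)) = (\<Sum>p\<in>A2. - ?F (fst p) (snd p))"
 proof (rule sum.reindex_bij_witness[of _ "\<lambda>p. (snd p + 1, fst p)" "\<lambda>p. (snd p, fst p - 1)"])
  fix p assume p: "p \<in> A1"
  then have p': "snd p < fst p" "fst p < ?n" "snd p < ?n - 1" by (auto simp: A1_def A_def)
  have "del (fst p - 1) (del (snd p) xs) = del (snd p) (del (fst p) xs)"
   using del_del[of "snd p" "fst p" xs] p' by simp
  moreover have "(-1::real)^(fst p + snd p) = - ((-1)^(snd p + (fst p - 1)))"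
   using p' by (cases "fst p") (auto simp: add.commute)
  ultimately show "- ?F (fst (snd p, fst p - 1)) (snd (snd p, fst p - 1)) = ?F (fst p) (snd p)" by simp
 qed (auto simp: A1_def A2_def A_def)
 finally show ?thesis by (simp add: sum_negf)
qed

section \<open>Iterated cones\<close>

text \<open>The sign is chosen so that appending \<open>y\<close> satisfies the homotopy identity
  \<open>bd_cone\<close>.\<close>

definition coned :: "'a \<Rightarrow> ('a list \<Rightarrow> real) \<Rightarrow> 'a list \<Rightarrow> real" where
 "coned y f t = (-1)^length t * f (t @ [y])"

lemma bd_cone: "coned y (bd f) t = f t - bd (coned y f) t"
proof -
 have "bd f (t @ [y]) = (\<Sum>i<length t. (-1)^i * f (del i t @ [y])) + (-1)^length t * f t"
  by (simp add: bd_def del_append_left del_append_last)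
 moreover have "bd (coned y f) t = - ((-1)^length t) * (\<Sum>i<length t. (-1)^i * f (del i t @ [y]))"
 proof -
  have *: "(-1)^i * coned y f (del i t) = - ((-1)^length t) * ((-1)^i * f (del i t @ [y]))" if i: "i < length t" for i
  proof -
   obtain n where n: "length t = Suc n" using i by (cases "length t") auto
   show ?thesis using i by (simp add: coned_def length_del n)
  qed
  have "bd (coned y f) t = (\<Sum>i<length t. - ((-1)^length t) * ((-1)^i * f (del i t @ [y])))"
   unfolding bd_def by (rule sum.cong) (use * in auto)
  then show ?thesis by (simp add: sum_distrib_left)
 qed
 ultimately show ?thesis by (simp add: coned_def algebra_simps power_mult_distrib[symmetric])
qed

text \<open>The value of \<open>f\<close> on a chain h(xs), where h is a contracting homotopy in the
  style of acyclic models: h(xs) is the cone with apex \<open>Y xs\<close> over xs minus h of the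
  boundary of xs. The apex depends on \<open>xs\<close> because none is orthogonal to all tuples.
  The number argument is meant to be \<open>length xs\<close>.\<close>

primrec cone_op :: "('a list \<Rightarrow> 'a) \<Rightarrow> nat \<Rightarrow> ('a list \<Rightarrow> real) \<Rightarrow> 'a list \<Rightarrow> real" where
 "cone_op Y 0 f xs = coned (Y xs) f xs"
| "cone_op Y (Suc n) f xs = coned (Y xs) f xs - (\<Sum>i\<le>n. (-1)^i * cone_op Y n (coned (Y xs) f) (del i xs))"

text \<open>The value of \<open>f\<close> on the cycle that h cones off: xs minus h of its
  boundary.\<close>

definition cycle_op :: "('a list \<Rightarrow> 'a) \<Rightarrow> ('a list \<Rightarrow> real) \<Rightarrow> 'a list \<Rightarrow> real" where
 "cycle_op Y f xs = f xs - (\<Sum>i<length xs. (-1)^i * cone_op Y (length xs - 1) f (del i xs))"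

lemma cone_op_diff: "cone_op Y m (\<lambda>t. f t - h t) ys = cone_op Y m f ys - cone_op Y m h ys"
proof (induction m arbitrary: f h ys)
 case 0 show ?case by (simp add: coned_def algebra_simps)
next
 case (Suc m)
 have "coned (Y ys) (\<lambda>t. f t - h t) = (\<lambda>t. coned (Y ys) f t - coned (Y ys) h t)"
  by (simp add: coned_def fun_eq_iff algebra_simps)
 then show ?case by (simp add: Suc algebra_simps sum_subtractf)
qed

text \<open>The identity \<open>d h + h d = id\<close>, \<open>d\<close> the boundary of chains,
  read on functions.\<close>

lemma cone_op_bd: "length xs = n ==> cone_op Y n (bd g) xs = cycle_op Y g xs"
proof (induction n arbitrary: xs g)
 case 0
 then show ?case by (simp add: cycle_op_def bd_cone) (simp add: bd_def)
next
 case (Suc n)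
 let ?K = "coned (Y xs)"
 have K: "?K (bd g) = (\<lambda>t. g t - bd (?K g) t)" by (simp add: bd_cone fun_eq_iff)
 have "cone_op Y (Suc n) (bd g) xs = g xs - bd (?K g) xs - (\<Sum>i\<le>n. (-1)^i * (cone_op Y n g (del i xs) - cone_op Y n (bd (?K g)) (del i xs)))"
  by (simp add: K cone_op_diff)
 also have "(\<Sum>i\<le>n. (-1)^i * (cone_op Y n g (del i xs) - cone_op Y n (bd (?K g)) (del i xs)))
   = (\<Sum>i\<le>n. (-1)^i * (cone_op Y n g (del i xs) - cycle_op Y (?K g) (del i xs)))"
  by (rule sum.cong) (auto simp: Suc.IH length_del Suc.prems)
 also have "\<dots> = (\<Sum>i\<le>n. (-1)^i * cone_op Y n g (del i xs)) - (\<Sum>i\<le>n. (-1)^i * ?K g (del i xs))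
   + (\<Sum>i\<le>n. (-1)^i * (\<Sum>l<length (del i xs). (-1)^l * cone_op Y (length (del i xs) - 1) (?K g) (del l (del i xs))))"
  unfolding cycle_op_def right_diff_distrib sum_subtractf by simp
 \<comment> \<open>The corrections of second order form a double coboundary and cancel.\<close>
 also have "(\<Sum>i\<le>n. (-1)^i * (\<Sum>l<length (del i xs). (-1)^l * cone_op Y (length (del i xs) - 1) (?K g) (del l (del i xs))))
   = bd (bd (cone_op Y (n - 1) (?K g))) xs"
  unfolding bd_def using Suc.prems by (intro sum.cong) (auto simp: length_del)
 also have "(\<Sum>i\<le>n. (-1)^i * ?K g (del i xs)) = bd (?K g) xs"
  unfolding bd_def using Suc.prems by (intro sum.cong) auto
 finally show ?case using Suc.prems by (simp add: bd_bd cycle_op_def lessThan_Suc_atMost)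
qed

text \<open>The tuples that occur in h(xs). The cocycle identity is available at valid tuples only,
  so one has to know which ones are met.\<close>

primrec cone_supp :: "('a list \<Rightarrow> 'a) \<Rightarrow> nat \<Rightarrow> 'a list \<Rightarrow> 'a list set" where
 "cone_supp Y 0 xs = {xs @ [Y xs]}"
| "cone_supp Y (Suc n) xs = (\<lambda>t. t @ [Y xs]) ` insert xs (\<Union>i\<le>n. cone_supp Y n (del i xs))"

lemma cone_op_cong: "(\<And>t. t \<in> cone_supp Y n xs ==> f t = g t) ==> cone_op Y n f xs = cone_op Y n g xs"
proof (induction n arbitrary: xs f g)
 case 0
 have "f (xs @ [Y xs]) = g (xs @ [Y xs])" by (rule 0) simp
 then show ?case unfolding cone_op.simps coned_def by simp
next
 case (Suc n)
 have *: "cone_op Y n (coned (Y xs) f) (del i xs) = cone_op Y n (coned (Y xs) g) (del i xs)" if "i \<le> n" for i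
 proof (rule Suc.IH)
  fix t assume "t \<in> cone_supp Y n (del i xs)"
  then have "t @ [Y xs] \<in> cone_supp Y (Suc n) xs" using that by auto
  then have "f (t @ [Y xs]) = g (t @ [Y xs])" by (rule Suc.prems)
  then show "coned (Y xs) f t = coned (Y xs) g t" unfolding coned_def by simp
 qed
 have "f (xs @ [Y xs]) = g (xs @ [Y xs])" by (rule Suc.prems) simp
 then have "coned (Y xs) f xs = coned (Y xs) g xs" unfolding coned_def by simp
 then show ?case by (simp add: *)
qed

lemma length_cone_supp: "length xs = n ==> t \<in> cone_supp Y n xs ==> length t = Suc n"
proof (induction n arbitrary: xs t)
 case (Suc n)
 then obtain t' where t': "t = t' @ [Y xs]" "t' = xs \<or> (\<exists>i\<le>n. t' \<in> cone_supp Y n (del i xs))" by auto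
 from t'(2) have "length t' = Suc n"
 proof
  assume "\<exists>i\<le>n. t' \<in> cone_supp Y n (del i xs)"
  then obtain i where "i \<le> n" "t' \<in> cone_supp Y n (del i xs)" by blast
  then show ?thesis using Suc.IH[of "del i xs" t'] Suc.prems(1) by (simp add: length_del)
 qed (use Suc.prems in simp)
 then show ?case using t'(1) by simp
qed simp

definition cycle_supp :: "('a list \<Rightarrow> 'a) \<Rightarrow> 'a list \<Rightarrow> 'a list set" where
 "cycle_supp Y xs = insert xs (\<Union>i<length xs. cone_supp Y (length xs - 1) (del i xs))"

lemma cycle_op_cong: "(\<And>t. t \<in> cycle_supp Y xs ==> f t = g t) ==> cycle_op Y f xs = cycle_op Y g xs"
proof -
 assume *: "\<And>t. t \<in> cycle_supp Y xs ==> f t = g t"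
 have "cone_op Y (length xs - 1) f (del i xs) = cone_op Y (length xs - 1) g (del i xs)" if "i < length xs" for i
  by (rule cone_op_cong) (use that * in \<open>auto simp: cycle_supp_def\<close>)
 then show ?thesis using * by (auto simp: cycle_op_def cycle_supp_def)
qed

lemma length_cycle_supp: "t \<in> cycle_supp Y xs ==> length t = length xs"
proof -
 assume "t \<in> cycle_supp Y xs"
 then consider "t = xs" | i where "i < length xs" "t \<in> cone_supp Y (length xs - 1) (del i xs)"
  by (auto simp: cycle_supp_def)
 then show ?thesis
 proof cases
  case 2
  then show ?thesis using length_cone_supp[of "del i xs" "length xs - 1" t Y] by (simp add: length_del)
 qed simp
qed

lemma cycle_op_bd: "xs \<noteq> [] ==> cycle_op Y (bd g) xs = 0"
proof -
 assume "xs \<noteq> []"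
 have "cycle_op Y (bd g) xs = bd g xs - (\<Sum>i<length xs. (-1)^i * cycle_op Y g (del i xs))"
  unfolding cycle_op_def[of Y "bd g"] by (simp add: cone_op_bd length_del)
 also have "(\<Sum>i<length xs. (-1)^i * cycle_op Y g (del i xs)) = bd g xs - bd (bd (cone_op Y (length xs - 2) g)) xs"
  unfolding cycle_op_def bd_def by (simp add: length_del algebra_simps sum_subtractf numeral_2_eq_2)
 finally show ?thesis by (simp add: bd_bd)
qed

lemma cycle_op_diff: "cycle_op Y (\<lambda>t. f t - h t) xs = cycle_op Y f xs - cycle_op Y h xs"
proof -
 show ?thesis by (simp add: cycle_op_def cone_op_diff algebra_simps sum_subtractf)
qed

text \<open>By the cocycle identity the cones with apexes \<open>y\<close> and \<open>y'\<close>
  differ on the cycle by the coboundary of \<open>\<lambda>t. f (t @ [y, y'])\<close>, and a cycle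
  does not see coboundaries.\<close>

lemma cycle_op_cone_indep:
 assumes ne: "xs \<noteq> []" and closed: "\<And>t. t \<in> cycle_supp Y xs ==> bd f (t @ [y, y']) = 0"
 shows "cycle_op Y (coned y f) xs = cycle_op Y (coned y' f) xs"
proof -
 define h where "h = (\<lambda>t. f (t @ [y, y']))"
 have "cycle_op Y (\<lambda>t. coned y f t - coned y' f t) xs = cycle_op Y (bd h) xs"
 proof (rule cycle_op_cong)
  fix t assume t: "t \<in> cycle_supp Y xs"
  let ?n = "length t"
  have "bd f (t @ [y, y']) = (\<Sum>i<?n. (-1)^i * f (del i (t @ [y, y']))) + (-1)^?n * f (del ?n (t @ [y, y'])) - (-1)^?n * f (del (Suc ?n) (t @ [y, y']))"
   by (simp add: bd_def)
  also have "del ?n (t @ [y, y']) = t @ [y']" by (simp add: del_def)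
  also have "del (Suc ?n) (t @ [y, y']) = t @ [y]" by (simp add: del_def)
  also have "(\<Sum>i<?n. (-1)^i * f (del i (t @ [y, y']))) = bd h t"
   by (simp add: bd_def h_def del_append_left)
  finally show "coned y f t - coned y' f t = bd h t" using closed[OF t] by (simp add: coned_def)
 qed
 then show ?thesis using cycle_op_bd[OF ne, of Y h] by (simp add: cycle_op_diff)
qed

text \<open>With a common apex the corrections of the faces cancel, and \<open>f\<close> is the
  alternating sum of its values on the coned face cycles. By \<open>cycle_op_cone_indep\<close> the
  apex in each summand can then be exchanged for one computed from the face alone, which exhibits
  \<open>f\<close> as a coboundary.\<close>

lemma cycle_op_common_cone:
 assumes "bd f (xs @ [y]) = 0"
 shows "f xs = (\<Sum>i<length xs. (-1)^i * cycle_op Y (coned y f) (del i xs))"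
proof -
 have "(\<Sum>i<length xs. (-1)^i * cycle_op Y (coned y f) (del i xs)) = bd (coned y f) xs - bd (bd (cone_op Y (length xs - 2) (coned y f))) xs"
  unfolding cycle_op_def bd_def by (simp add: length_del algebra_simps sum_subtractf numeral_2_eq_2)
 also have "\<dots> = f xs - coned y (bd f) xs" by (simp add: bd_bd bd_cone)
 also have "coned y (bd f) xs = 0" using assms by (simp add: coned_def)
 finally show ?thesis by simp
qed

lemma sorted_wrt_del: "sorted_wrt P xs ==> sorted_wrt P (del i xs)"
proof (cases "i < length xs")
 case True
 assume s: "sorted_wrt P xs"
 have "sorted_wrt P (take i xs @ xs!i # drop (Suc i) xs)" using s id_take_nth_drop[OF True] by simp
 then show ?thesis by (auto simp: sorted_wrt_append del_def)
qed (simp add: del_def)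

lemma hfl_del: "hfl r xs ==> hfl r (del i xs)"
 using set_del_subset[of i xs] by (auto simp: hfl_def sorted_wrt_del)

lemma hfl_Cons: "hfl r (p # xs) \<longleftrightarrow> om r (fst p) (snd p) = 1 \<and> (\<forall>q\<in>set xs. orthp r p q) \<and> hfl r xs"
 by (auto simp: hfl_def)

section \<open>Tuples whose first vector has no partner\<close>

text \<open>The partner in the first entry is left out: it is a dummy, carried along only so that
  tuples are lists of pairs.\<close>

fun vsl :: "('v \<times> 'v) list \<Rightarrow> 'v list" where
 "vsl [] = []"
| "vsl (p # ps) = fst p # concat (map (\<lambda>q. [fst q, snd q]) ps)"

definition vs :: "('v \<times> 'v) list \<Rightarrow> 'v set" where "vs xs = set (vsl xs)"

lemma vs_simps [simp]: "vs [] = {}" "vs (p # ps) = insert (fst p) (pvs ps)"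
 by (auto simp: vs_def pvs_def image_iff)

lemma vs_snoc: "xs \<noteq> [] ==> vs (xs @ [p]) = vs xs \<union> {fst p, snd p}"
 by (cases xs) auto

lemma length_vsl: "length (vsl xs) = 2 * length xs - 1"
proof (cases xs)
 case (Cons p ps)
 have "length (concat (map (\<lambda>q. [fst q, snd q]) ps)) = 2 * length ps" by (induction ps) auto
 then show ?thesis using Cons by simp
qed simp

definition valid :: "nat \<Rightarrow> 'k::field frame \<Rightarrow> bool" where
 "valid r xs \<longleftrightarrow> xs \<noteq> [] \<and> nz r (fst (hd xs)) \<and> hfl r (tl xs) \<and> (\<forall>t\<in>pvs (tl xs). om r (fst (hd xs)) t = 0)"

lemma valid_Cons: "valid r (p # xs) \<longleftrightarrow> nz r (fst p) \<and> hfl r xs \<and> (\<forall>t\<in>pvs xs. om r (fst p) t = 0)"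
 by (simp add: valid_def)

lemma valid_snoc:
 assumes "xs \<noteq> []"
 shows "valid r (xs @ [p]) \<longleftrightarrow> valid r xs \<and> om r (fst p) (snd p) = 1 \<and> (\<forall>t\<in>vs xs. om r t (fst p) = 0 \<and> om r t (snd p) = 0)"
 using assms by (cases xs) (auto simp: valid_Cons hfl_snoc)

lemma del_Cons: "del 0 (p # xs) = xs" "del (Suc i) (p # xs) = p # del i xs"
 by (simp_all add: del_def)

lemma pvs_del: "pvs (del i xs) \<subseteq> pvs xs"
 using set_del_subset[of i xs] by (auto simp: pvs_def)

lemma vs_del: "vs (del i xs) \<subseteq> vs xs"
proof (cases xs)
 case (Cons p ps)
 show ?thesis
 proof (cases i)
  case 0 then show ?thesis using Cons by (cases ps) (auto simp: del_Cons)
 next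
  case (Suc k) then show ?thesis using Cons pvs_del[of k ps] by (auto simp: del_Cons)
 qed
qed (simp add: del_def)

text \<open>Face 0 is the delicate one: the second vector becomes the first, and it is nonzero
  because it had a partner.\<close>

lemma valid_del:
 assumes v: "valid r xs" and l: "2 \<le> length xs" shows "valid r (del i xs)"
proof -
 obtain p q ys where xs: "xs = p # q # ys" using l by (cases xs; cases "tl xs") auto
 show ?thesis
 proof (cases i)
  case 0
  have "valid r (q # ys)" using v unfolding xs valid_Cons hfl_Cons
   by (auto simp: pvs_def orthp_def intro: om_imp_nz[of r "fst q" "snd q"])
  then show ?thesis using 0 by (simp add: xs del_Cons)
 next
  case (Suc k)
  have "hfl r (del k (q # ys))" using v by (intro hfl_del) (simp add: xs valid_Cons)
  then show ?thesis using v pvs_del[of k "q # ys"] unfolding Suc xs del_Cons valid_Cons by blast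
 qed
qed

section \<open>Linear corrections\<close>

definition gram :: "nat \<Rightarrow> 'k::field vect list \<Rightarrow> 'k vect list \<Rightarrow> 'k mat" where
 "gram r S T = mat (length S) (length S) (\<lambda>(l,i). om r (T!l) (S!i))"

lemma gram_nth: "l < length S ==> i < length S ==> gram r S T $$ (l,i) = om r (T!l) (S!i)"
 by (simp add: gram_def)

text \<open>Cramer's rule with the adjugate: these coefficients are polynomial in the data, and the
  division by the determinant is left to \<open>corr\<close>.\<close>

definition ccoef :: "nat \<Rightarrow> 'k::field vect list \<Rightarrow> 'k vect list \<Rightarrow> 'k vect \<Rightarrow> nat \<Rightarrow> 'k" where
 "ccoef r S T u i = (\<Sum>l<length S. adj_mat (gram r S T) $$ (i,l) * om r (T!l) u)"

text \<open>An oblique projection: orthogonality to \<open>T\<close> is achieved by corrections from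
  \<open>S\<close>.\<close>

definition corr :: "nat \<Rightarrow> 'k::field vect list \<Rightarrow> 'k vect list \<Rightarrow> 'k vect \<Rightarrow> nat \<Rightarrow> 'k" where
 "corr r S T u = u - (\<Sum>i<length S. smul (ccoef r S T u i / Determinant.det (gram r S T)) (S!i))"

lemma om_corr:
 assumes d: "Determinant.det (gram r S T) \<noteq> 0" and l: "l < length S"
 shows "om r (T!l) (corr r S T u) = 0"
proof -
 let ?A = "gram r S T" and ?n = "length S"
 have A: "?A \<in> carrier_mat ?n ?n" by (simp add: gram_def)
 have adj: "(\<Sum>i<?n. ?A $$ (l,i) * adj_mat ?A $$ (i,m)) = (if l = m then Determinant.det ?A else 0)" if "m < ?n" for m
 proof -
  have "(\<Sum>i<?n. ?A $$ (l,i) * adj_mat ?A $$ (i,m)) = (?A * adj_mat ?A) $$ (l,m)"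
   using A adj_mat(1)[OF A] l that by (auto simp: scalar_prod_def atLeast0LessThan intro!: sum.cong)
  then show ?thesis using adj_mat(2)[OF A] l that by simp
 qed
 have "(\<Sum>i<?n. ccoef r S T u i * om r (T!l) (S!i)) = (\<Sum>i<?n. \<Sum>m<?n. ?A $$ (l,i) * adj_mat ?A $$ (i,m) * om r (T!m) u)"
  using l by (auto simp: ccoef_def sum_distrib_left gram_nth mult_ac intro!: sum.cong)
 also have "\<dots> = (\<Sum>m<?n. (\<Sum>i<?n. ?A $$ (l,i) * adj_mat ?A $$ (i,m)) * om r (T!m) u)"
  by (subst sum.swap) (simp add: sum_distrib_right)
 also have "\<dots> = (\<Sum>m<?n. if l = m then Determinant.det ?A * om r (T!m) u else 0)"
  by (rule sum.cong) (auto simp: adj)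
 also have "\<dots> = Determinant.det ?A * om r (T!l) u" using l by simp
 finally have *: "(\<Sum>i<?n. ccoef r S T u i * om r (T!l) (S!i)) = Determinant.det ?A * om r (T!l) u" .
 have "om r (T!l) (corr r S T u) = om r (T!l) u - (\<Sum>i<?n. ccoef r S T u i * om r (T!l) (S!i)) / Determinant.det ?A"
  by (simp add: corr_def om_sum_right sum_divide_distrib)
 then show ?thesis using d by (simp add: *)
qed

lemma corr_in_perp:
 assumes d: "Determinant.det (gram r S T) \<noteq> 0" and l: "length T = length S"
 shows "corr r S T u \<in> perp r (set T)"
 unfolding perp_def using om_corr[OF d] l by (auto simp: in_set_conv_nth)

lemma nds_gram:
 assumes d: "Determinant.det (gram r S S) \<noteq> 0" shows "nds r (set S)"
 unfolding nds_def
proof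
 fix u
 let ?s = "\<Sum>i<length S. smul (ccoef r S S u i / Determinant.det (gram r S S)) (S!i)"
 have "\<forall>y\<in>perp r (set S). om r ?s y = 0"
  by (auto simp: om_sum_left perp_def intro!: sum.neutral)
 moreover have "u - ?s \<in> perp r (set S)" using corr_in_perp[OF d refl, of u] by (simp add: corr_def)
 ultimately show "\<exists>s. (\<forall>y\<in>perp r (set S). om r s y = 0) \<and> u - s \<in> perp r (set S)" by (intro exI conjI)
qed

lemma om_eq_0_support: assumes "\<And>a. a < 2*r ==> x a = 0 \<or> y (2*r - Suc a) = 0" shows "om r x y = 0"
 unfolding om_def
proof (rule sum.neutral, rule ballI)
 fix i assume "i \<in> {..<r}"
 then have i: "i < r" by simp
 then have "2*r - Suc (2*r - Suc i) = i" by simp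
 then show "x i * y (2*r - Suc i) - x (2*r - Suc i) * y i = 0"
  using assms[of i] assms[of "2*r - Suc i"] i by auto
qed

section \<open>The cone vertices\<close>

definition zl :: "nat \<Rightarrow> 'k::field vect list" where "zl n = map ee [0..<n]"

text \<open>The apex for a tuple of length \<open>m\<close>: the standard pair number
  \<open>2*j - 4 + m\<close>, made orthogonal to the \<open>2*m - 1\<close> vectors of the tuple by
  corrections among the first \<open>2*m - 1\<close> basis vectors. For \<open>1 \<le> m < j\<close>
  these numbers start at \<open>2*j - 3\<close>, beyond all corrections, and differ for different
  \<open>m\<close>; as the corrections span an isotropic space, apexes of different stages stay
  orthogonal. The empty tuple only needs a nonzero first vector.\<close>

definition yvert :: "nat \<Rightarrow> nat \<Rightarrow> 'k::field frame \<Rightarrow> 'k vect \<times> 'k vect" where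
 "yvert r j xs = (if xs = [] then (ee 0, 0) else
   (corr r (zl (2 * length xs - 1)) (vsl xs) (ee (2*j - 4 + length xs)),
   corr r (zl (2 * length xs - 1)) (vsl xs) (ee (2*r - Suc (2*j - 4 + length xs)))))"

text \<open>Spanned by the basis vectors that apexes for tuples of length at most \<open>k\<close>
  can involve. The duals of the first \<open>2*j - 3\<close> basis vectors are excluded, which makes
  \<open>low\<close> orthogonal to the corrections.\<close>

definition low :: "nat \<Rightarrow> nat \<Rightarrow> nat \<Rightarrow> 'k::field vect set" where
 "low r j k = {x. \<forall>a<2*r. x a \<noteq> 0 \<longrightarrow> a < 2*j - 3 + k \<or> (2*r - (2*j - 3) - k \<le> a \<and> a < 2*r - (2*j - 3))}"

text \<open>Its span contains every vertex of the cycle attached to a face \<open>xs\<close> of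
  length \<open>j\<close>. The length is \<open>(2*j - 3) + (2*j - 1) + 2*(j - 1) = 6*j - 6\<close>;
  under \<open>3*j \<le> r\<close> this leaves the 6 dimensions that
  \<open>hyperbolic_pairs_connected\<close> asks for.\<close>

definition slist :: "nat \<Rightarrow> nat \<Rightarrow> 'k::field frame \<Rightarrow> 'k vect list" where
 "slist r j xs = zl (2*j - 3) @ vsl xs @ map ee [2*j - 3..<3*j - 4] @ map (\<lambda>i. ee (2*r - Suc i)) [2*j - 3..<3*j - 4]"

text \<open>The denominators of the iterated cone: those of the tuple and of all its iterated
  faces.\<close>

primrec good_low :: "nat \<Rightarrow> nat \<Rightarrow> 'k::field frame \<Rightarrow> bool" where
 "good_low r 0 xs = True"
| "good_low r (Suc n) xs = (Determinant.det (gram r (zl (2 * length xs - 1)) (vsl xs)) \<noteq> 0 \<and> (\<forall>i\<le>n. good_low r n (del i xs)))"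

lemma low_perp_slist:
 assumes x: "x \<in> low r j (j - 1)" and y: "y \<in> perp r (set (slist r j xs))" and j: "2 \<le> j" "3*j \<le> r"
 shows "om r x y = 0"
proof -
 have "x a * om r (ee a) y = 0" if a: "a < 2*r" for a
 proof (cases "x a = 0")
  case False
  then have "a < 3*j - 4 \<or> (2*r - (3*j - 4) \<le> a \<and> a < 2*r - (2*j - 3))"
   using x a j by (force simp: low_def)
  then have "ee a \<in> set (slist r j xs)"
  proof
   assume "a < 3*j - 4" then show ?thesis by (cases "a < 2*j - 3") (auto simp: slist_def zl_def)
  next
   assume b: "2*r - (3*j - 4) \<le> a \<and> a < 2*r - (2*j - 3)"
   then have "2*r - Suc (2*r - Suc a) = a" "2*r - Suc a \<in> set [2*j - 3..<3*j - 4]" using a j by auto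
   then have "ee a \<in> (\<lambda>i. ee (2*r - Suc i)) ` set [2*j - 3..<3*j - 4]" by (intro image_eqI[of _ _ "2*r - Suc a"]) simp_all
   then show ?thesis unfolding slist_def set_append set_map by blast
  qed
  then show ?thesis using y by (simp add: perp_def)
 qed simp
 then show ?thesis unfolding om_expand[of r x y] by (intro sum.neutral) blast
qed

lemma corr_zl: "\<exists>z. corr r (zl n) T u = u - z \<and> (\<forall>a\<ge>n. z a = 0)"
proof -
 let ?z = "\<Sum>i<length (zl n :: (nat \<Rightarrow> 'a) list). smul (ccoef r (zl n) T u i / Determinant.det (gram r (zl n) T)) (zl n ! i)"
 have "\<forall>a\<ge>n. ?z a = 0"
  unfolding fun_sum_apply by (auto simp: zl_def ee_apply intro!: sum.neutral)
 then show ?thesis unfolding corr_def by (intro exI[of _ ?z] conjI refl)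
qed

text \<open>The corrections \<open>z\<close> and \<open>z'\<close> live in coordinates below
  \<open>2*m - 1\<close>, whereas a nonzero product needs two coordinates with sum
  \<open>2*r - 1\<close>. So they disturb neither the product of the chosen pair nor the products
  with vectors of \<open>low\<close>.\<close>

lemma yvert_props:
 fixes xs :: "'a::field frame"
 assumes j: "2 \<le> j" "3*j \<le> r" and xs: "xs \<noteq> []" "length xs \<le> j - 1"
  and d: "Determinant.det (gram r (zl (2 * length xs - 1)) (vsl xs)) \<noteq> 0"
 shows "om r (fst (yvert r j xs)) (snd (yvert r j xs)) = 1"
  and "\<And>t. t \<in> vs xs \<union> low r j (length xs - 1) ==> om r t (fst (yvert r j xs)) = 0 \<and> om r t (snd (yvert r j xs)) = 0"
  and "fst (yvert r j xs) \<in> low r j (length xs)" "snd (yvert r j xs) \<in> low r j (length xs)"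
proof -
 let ?m = "length xs" and ?i = "2*j - 4 + length xs"
 let ?n = "2 * ?m - 1"
 have m: "1 \<le> ?m" using xs by (cases xs) auto
 have i: "?i < r" "?n \<le> ?i" "?n \<le> 2*j - 3" "2*j - 3 \<le> ?i" "?i \<le> 3*j - 5" using j xs m by linarith+
 \<comment> \<open>\<open>J\<close> and \<open>M\<close> remove the truncated differences from the
   index inequalities.\<close>
 obtain J where J: "j = J + 2" using j(1) by (metis add.commute le_Suc_ex)
 obtain M where M: "?m = M + 1" using m by (metis add.commute le_Suc_ex)
 obtain z where z: "corr r (zl ?n) (vsl xs) (ee ?i) = ee ?i - z" "\<forall>a\<ge>?n. z a = 0" using corr_zl by metis
 obtain z' where z': "corr r (zl ?n) (vsl xs) (ee (2*r - Suc ?i)) = ee (2*r - Suc ?i) - z'" "\<forall>a\<ge>?n. z' a = 0" using corr_zl by metis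
 have Y: "fst (yvert r j xs) = ee ?i - z" "snd (yvert r j xs) = ee (2*r - Suc ?i) - z'"
  using xs z(1) z'(1) by (simp_all add: yvert_def)
 have 1: "om r (ee ?i) z' = 0" "om r z (ee (2*r - Suc ?i)) = 0" "om r z z' = 0"
 proof -
  have "?n \<le> 2*r - Suc ?i" using i by linarith
  then have "z' (2*r - Suc ?i) = 0" "z ?i = 0" using z(2) z'(2) i by blast+
  then show "om r (ee ?i) z' = 0" "om r z (ee (2*r - Suc ?i)) = 0" using om_eeE[OF i(1), of z'] om_ee_right(2)[OF i(1), of z] by auto
  show "om r z z' = 0"
  proof (rule om_eq_0_support)
   fix a assume "a < 2*r"
   have "?n \<le> a \<or> ?n \<le> 2*r - Suc a" using i by linarith
   then show "z a = 0 \<or> z' (2*r - Suc a) = 0" using z(2) z'(2) by blast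
  qed
 qed
 show "om r (fst (yvert r j xs)) (snd (yvert r j xs)) = 1"
  unfolding Y using 1 i(1) om_ee_ee(3)[of ?i r ?i] by simp
 have p: "corr r (zl ?n) (vsl xs) u \<in> perp r (vs xs)" for u
  unfolding vs_def by (rule corr_in_perp[OF d]) (simp add: length_vsl zl_def)
 have lo: "om r t (ee ?i - z) = 0 \<and> om r t (ee (2*r - Suc ?i) - z') = 0" if t: "t \<in> low r j (?m - 1)" for t :: "nat \<Rightarrow> 'a"
 proof -
  have t': "t a = 0" if "a < 2*r" "2*j - 3 + (?m - 1) \<le> a" "a < 2*r - (2*j - 3) - (?m - 1) \<or> 2*r - (2*j-3) \<le> a" for a
   using t that by (force simp: low_def)
  have "t (2*r - Suc ?i) = 0"
  proof (rule t')
   show "2*r - Suc ?i < 2*r" "2*j - 3 + (?m - 1) \<le> 2*r - Suc ?i"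
    using i(1) unfolding J M by simp_all
   have "2*r - Suc ?i < 2*r - (2*j - 3) - (?m - 1)" using i(1) unfolding J M by simp
   then show "2*r - Suc ?i < 2*r - (2*j - 3) - (?m - 1) \<or> 2*r - (2*j-3) \<le> 2*r - Suc ?i" ..
  qed
  moreover have "t ?i = 0"
  proof (rule t')
   show "?i < 2*r" "2*j - 3 + (?m - 1) \<le> ?i"
    using i(1) unfolding J M by simp_all
   have "?i < 2*r - (2*j - 3) - (?m - 1)" using i(1) unfolding J M by simp
   then show "?i < 2*r - (2*j - 3) - (?m - 1) \<or> 2*r - (2*j-3) \<le> ?i" ..
  qed
  ultimately have "om r t (ee ?i) = 0" "om r t (ee (2*r - Suc ?i)) = 0"
   using om_ee_right[OF i(1), of t] by simp_all
  moreover have "om r t w = 0" if w: "\<forall>a\<ge>?n. w a = 0" for w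
  proof (rule om_eq_0_support)
   fix a assume a: "a < 2*r"
   show "t a = 0 \<or> w (2*r - Suc a) = 0"
   proof (cases "2*r - (2*j - 3) \<le> a")
    case True
    have "t a = 0"
    proof (rule t'[OF a])
     have "2*j - 3 + (?m - 1) \<le> 2*r - (2*j - 3)" using i(1) unfolding J M by simp
     then show "2*j - 3 + (?m - 1) \<le> a" using True by simp
    qed (use True in blast)
    then show ?thesis ..
   next
    case False
    then have "?n \<le> 2*r - Suc a" using i a by linarith
    then show ?thesis using w by blast
   qed
  qed
  ultimately show ?thesis using z(2) z'(2) by simp
 qed
 show "om r t (fst (yvert r j xs)) = 0 \<and> om r t (snd (yvert r j xs)) = 0" if "t \<in> vs xs \<union> low r j (length xs - 1)" for t
  using that
 proof
  assume "t \<in> vs xs"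
  then show ?thesis using p[of "ee ?i"] p[of "ee (2*r - Suc ?i)"] unfolding Y z(1)[symmetric] z'(1)[symmetric] by (simp add: perp_def)
 next
  assume "t \<in> low r j (length xs - 1)"
  then show ?thesis unfolding Y by (rule lo)
 qed
 have supp: "a = i' \<or> a < ?n" if "(ee i' - x) a \<noteq> 0" "\<forall>a\<ge>?n. x a = 0" for a i' and x :: "nat \<Rightarrow> 'a"
  using that by (cases "a = i'"; cases "?n \<le> a") (simp_all add: ee_apply)
 show "fst (yvert r j xs) \<in> low r j (length xs)"
  unfolding Y low_def
 proof (intro CollectI allI impI)
  fix a assume "a < 2*r" "(ee ?i - z) a \<noteq> 0"
  then have "a = ?i \<or> a < ?n" using supp z(2) by blast
  then have "a < 2*j - 3 + ?m" using i j by linarith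
  then show "a < 2*j - 3 + ?m \<or> 2*r - (2*j-3) - ?m \<le> a \<and> a < 2*r - (2*j-3)" ..
 qed
 show "snd (yvert r j xs) \<in> low r j (length xs)"
  unfolding Y low_def
 proof (intro CollectI allI impI)
  fix a assume "a < 2*r" "(ee (2*r - Suc ?i) - z') a \<noteq> 0"
  then have "a = 2*r - Suc ?i \<or> a < ?n" using supp z'(2) by blast
  then show "a < 2*j - 3 + ?m \<or> 2*r - (2*j-3) - ?m \<le> a \<and> a < 2*r - (2*j-3)"
  proof
   assume a: "a = 2*r - Suc ?i"
   have "2*r - (2*j-3) - ?m \<le> a \<and> a < 2*r - (2*j-3)" using i(1) unfolding a J M by simp
   then show ?thesis ..
  next
   assume "a < ?n"
   then have "a < 2*j - 3 + ?m" unfolding J M using i(3) J M by simp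
   then show ?thesis ..
  qed
 qed
qed

text \<open>The invariant of the iterated cone: all vectors met come from \<open>xs\<close> or from
  the standard vectors of lower stages, and the next apex is orthogonal to both by
  \<open>yvert_props\<close>.\<close>

lemma cone_supp_valid:
 assumes j: "2 \<le> j" "3*j \<le> r"
 shows "length xs = n ==> n \<le> j - 1 ==> xs = [] \<or> valid r xs ==> good_low r n xs ==> t \<in> cone_supp (yvert r j) n xs ==>
  valid r t \<and> vs t \<subseteq> vs xs \<union> low r j n"
proof (induction n arbitrary: xs t)
 case 0
 have "nz r (ee 0 :: nat \<Rightarrow> 'a)" using j by (auto simp: nz_def ee_apply intro!: exI[of _ 0])
 moreover have "(ee 0 :: nat \<Rightarrow> 'a) \<in> low r j 0" using j by (auto simp: low_def ee_apply)
 ultimately show ?case using 0 by (auto simp: yvert_def valid_Cons)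
next
 case (Suc n)
 have xs: "xs \<noteq> []" "valid r xs" using Suc.prems by auto
 have len: "length xs \<le> j - 1" using Suc.prems by simp
 obtain t' where t: "t = t' @ [yvert r j xs]" and t': "t' = xs \<or> (\<exists>i\<le>n. t' \<in> cone_supp (yvert r j) n (del i xs))"
  using Suc.prems(5) by auto
 have "valid r t' \<and> vs t' \<subseteq> vs xs \<union> low r j n"
  using t'
 proof
  assume "\<exists>i\<le>n. t' \<in> cone_supp (yvert r j) n (del i xs)"
  then obtain i where i: "i \<le> n" "t' \<in> cone_supp (yvert r j) n (del i xs)" by blast
  have "del i xs = [] \<or> valid r (del i xs)"
  proof (cases n)
   case 0
   then have "length (del i xs) = 0" using i Suc.prems(1) by (simp add: length_del)
   then show ?thesis by simp
  next
   case (Suc k)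
   then show ?thesis using valid_del[OF xs(2), of i] Suc.prems(1) by auto
  qed
  then have "valid r t' \<and> vs t' \<subseteq> vs (del i xs) \<union> low r j n"
   using Suc.IH[of "del i xs" t'] i Suc.prems by (auto simp: length_del)
  then show ?thesis using vs_del[of i xs] by blast
 qed (use xs in auto)
 note vt = this
 have d: "Determinant.det (gram r (zl (2 * length xs - 1)) (vsl xs)) \<noteq> 0" using Suc.prems(4) by simp
 note Y = yvert_props[OF j xs(1) len d]
 have ne: "t' \<noteq> []" using vt by (auto simp: valid_def)
 have lm: "low r j n \<subseteq> (low r j (Suc n) :: (nat \<Rightarrow> 'a) set)" by (force simp: low_def)
 have "valid r t"
  unfolding t valid_snoc[OF ne] using vt Y(1) Y(2) Suc.prems(1) by auto
 moreover have "vs t \<subseteq> vs xs \<union> low r j (Suc n)"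
  unfolding t vs_snoc[OF ne] using vt lm Y(3,4) Suc.prems(1) by auto
 ultimately show ?case by blast
qed

definition good_face :: "nat \<Rightarrow> nat \<Rightarrow> 'k::field frame \<Rightarrow> bool" where
 "good_face r j xs \<longleftrightarrow> (\<forall>i<j. good_low r (j - 1) (del i xs)) \<and> Determinant.det (gram r (slist r j xs) (slist r j xs)) \<noteq> 0"

text \<open>Any hyperbolic pair orthogonal to the \<open>slist\<close> of a face can be the apex
  over the cycle of that face, and all of them give the same value since these pairs are connected.
  One pair orthogonal to all the lists serves as common apex; afterwards each face receives its own
  \<open>Yt\<close>.\<close>

lemma filling_ge2:
 fixes f :: "'k::field frame \<Rightarrow> real"
 assumes j: "2 \<le> j" "3*j \<le> r" and xs: "valid r xs" "length xs = Suc j"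
  and closed: "\<And>ys. valid r ys ==> length ys = j + 2 ==> bd f ys = 0"
  and good: "\<And>i. i \<le> j ==> good_face r j (del i xs)"
  and Yt: "\<And>i. i \<le> j ==> fst (Yt (del i xs)) \<in> perp r (set (slist r j (del i xs))) \<and>
    snd (Yt (del i xs)) \<in> perp r (set (slist r j (del i xs))) \<and> om r (fst (Yt (del i xs))) (snd (Yt (del i xs))) = 1"
 shows "f xs = (\<Sum>i<Suc j. (-1)^i * cycle_op (yvert r j) (coned (Yt (del i xs)) f) (del i xs))"
proof -
 have len_sl: "length (slist r j ys) = 6*j - 6" if "length ys = j" for ys :: "'k frame"
  using j that by (simp add: slist_def zl_def length_vsl)
 let ?W = "\<lambda>i. perp r (set (slist r j (del i xs)))"
 have ld: "length (del i xs) = j" if "i \<le> j" for i using that xs by (simp add: length_del)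
 have vd: "valid r (del i xs)" for i using valid_del[OF xs(1)] xs(2) j by simp
 have indep: "cycle_op (yvert r j) (coned (v, w) f) (del i xs) = cycle_op (yvert r j) (coned (v', w') f) (del i xs)"
  if i: "i \<le> j" and 1: "v \<in> ?W i" "w \<in> ?W i" "om r v w = 1" and 2: "v' \<in> ?W i" "w' \<in> ?W i" "om r v' w' = 1" for i v w v' w'
 proof (rule hyperbolic_pairs_connected[where \<Phi> = "\<lambda>Y. cycle_op (yvert r j) (coned Y f) (del i xs)", OF _ _ _ 1 2])
  let ?e = "del i xs"
  show "nds r (set (slist r j ?e))" using good[OF i] nds_gram by (auto simp: good_face_def)
  show "length (slist r j ?e) + 6 \<le> 2*r" using len_sl[OF ld[OF i]] j by simp
  fix v w v' w' assume vw: "v \<in> ?W i" "w \<in> ?W i" "om r v w = 1"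
   "v' \<in> perp r (set (slist r j ?e) \<union> {v, w})" "w' \<in> perp r (set (slist r j ?e) \<union> {v, w})" "om r v' w' = 1"
  show "cycle_op (yvert r j) (coned (v, w) f) ?e = cycle_op (yvert r j) (coned (v', w') f) ?e"
  proof (rule cycle_op_cone_indep)
   show "?e \<noteq> []" using ld[OF i] j by auto
   fix t assume t: "t \<in> cycle_supp (yvert r j) ?e"
   have vt: "valid r t \<and> vs t \<subseteq> vs ?e \<union> low r j (j - 1)"
   proof -
    consider "t = ?e" | l where "l < j" "t \<in> cone_supp (yvert r j) (j - 1) (del l ?e)"
     using t ld[OF i] by (auto simp: cycle_supp_def)
    then show ?thesis
    proof cases
     case 2
     have "valid r (del l ?e)" using valid_del[OF vd] ld[OF i] j by simp
     then have "valid r t \<and> vs t \<subseteq> vs (del l ?e) \<union> low r j (j - 1)"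
      using cone_supp_valid[OF j, of "del l ?e" "j - 1" t] 2 ld[OF i] good[OF i] by (auto simp: good_face_def length_del)
     then show ?thesis using vs_del[of l ?e] by blast
    qed (use vd in auto)
   qed
   have orth: "om r x y = 0" if "x \<in> vs t" "y \<in> ?W i" for x y
   proof -
    have "x \<in> vs ?e \<or> x \<in> low r j (j - 1)" using that vt by blast
    then show ?thesis
    proof
     assume "x \<in> vs ?e" then have "x \<in> set (slist r j ?e)" by (simp add: slist_def vs_def)
     then show ?thesis using that(2) by (simp add: perp_def)
    qed (rule low_perp_slist[OF _ that(2) j])
   qed
   have v'W: "v' \<in> ?W i" "w' \<in> ?W i" using vw by (auto simp: perp_def)
   have ne: "t \<noteq> []" using vt by (auto simp: valid_def)
   have v1: "valid r (t @ [(v, w)])"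
    unfolding valid_snoc[OF ne] using vt vw(1-3) orth by auto
   have ne2: "t @ [(v, w)] \<noteq> []" by simp
   have "valid r ((t @ [(v, w)]) @ [(v', w')])"
    unfolding valid_snoc[OF ne2] vs_snoc[OF ne] using v1 vw(4-6) orth v'W by (auto simp: perp_def)
   then show "bd f (t @ [(v, w), (v', w')]) = 0"
    using closed[of "t @ [(v, w), (v', w')]"] length_cycle_supp[OF t] ld[OF i] by simp
  qed
 qed
 \<comment> \<open>The list of the last face together with the last pair contains the lists of all
   faces. The count is \<open>(6*j - 6) + 4 < 2*r\<close>.\<close>
 obtain v w where vw: "v \<in> perp r (set (slist r j (del j xs)) \<union> set [fst (last xs), snd (last xs)])"
   "w \<in> perp r (set (slist r j (del j xs)) \<union> set [fst (last xs), snd (last xs)])" "om r v w = 1"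
 proof (rule hyperbolic_pair_in_complement)
  show "nds r (set (slist r j (del j xs)))" using good[of j] nds_gram by (auto simp: good_face_def)
  show "length (slist r j (del j xs)) + 2 * length [fst (last xs), snd (last xs)] < 2*r"
   using len_sl[OF ld[of j]] j by simp
 qed
 have xs_eq: "xs = del j xs @ [last xs]"
 proof -
  have "del j xs = butlast xs" using xs(2) by (simp add: del_def butlast_conv_take)
  moreover have "xs \<noteq> []" using xs(2) by auto
  ultimately show ?thesis by simp
 qed
 have vsx: "vs xs \<subseteq> set (slist r j (del j xs)) \<union> set [fst (last xs), snd (last xs)]"
 proof -
  have "del j xs \<noteq> []" using ld[of j] j by auto
  then have "vs xs = vs (del j xs) \<union> {fst (last xs), snd (last xs)}" by (subst xs_eq) (rule vs_snoc)
  then show ?thesis by (auto simp: slist_def vs_def)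
 qed
 have slx: "set (slist r j (del i xs)) \<subseteq> set (slist r j (del j xs)) \<union> set [fst (last xs), snd (last xs)]" for i
 proof -
  have "vs (del i xs) \<subseteq> set (slist r j (del j xs)) \<union> set [fst (last xs), snd (last xs)]"
   using vs_del[of i xs] vsx by blast
  then show ?thesis by (auto simp: slist_def vs_def)
 qed
 have "valid r (xs @ [(v, w)])"
 proof -
  have "xs \<noteq> []" using xs by auto
  moreover have "om r t v = 0 \<and> om r t w = 0" if "t \<in> vs xs" for t
   using vw that vsx unfolding perp_def by blast
  ultimately show ?thesis using xs(1) vw(3) by (simp add: valid_snoc)
 qed
 then have "bd f (xs @ [(v, w)]) = 0" using closed[of "xs @ [(v, w)]"] xs(2) by simp
 then have "f xs = (\<Sum>i<Suc j. (-1)^i * cycle_op (yvert r j) (coned (v, w) f) (del i xs))"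
  using cycle_op_common_cone[of f xs "(v, w)" "yvert r j"] xs(2) by simp
 also have "\<dots> = (\<Sum>i<Suc j. (-1)^i * cycle_op (yvert r j) (coned (Yt (del i xs)) f) (del i xs))"
 proof (rule sum.cong)
  fix i assume "i \<in> {..<Suc j}"
  then have i: "i \<le> j" by simp
  have W: "v \<in> ?W i" "w \<in> ?W i" using vw slx[of i] unfolding perp_def by blast+
  have "cycle_op (yvert r j) (coned (v, w) f) (del i xs) = cycle_op (yvert r j) (coned (fst (Yt (del i xs)), snd (Yt (del i xs))) f) (del i xs)"
   by (rule indep[OF i W vw(3)]) (use Yt[OF i] in auto)
  then show "(-1)^i * cycle_op (yvert r j) (coned (v, w) f) (del i xs) = (-1)^i * cycle_op (yvert r j) (coned (Yt (del i xs)) f) (del i xs)"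
   by simp
 qed simp
 finally show ?thesis .
qed

section \<open>Fillings in degrees zero and one\<close>

text \<open>Valid tuples with two entries (\<open>edge\<close>) and three (\<open>tri\<close>),
  written without the dummy partner.\<close>

definition edge :: "nat \<Rightarrow> 'k::field vect \<Rightarrow> 'k vect \<Rightarrow> 'k vect \<Rightarrow> bool" where
 "edge r v0 v1 w \<longleftrightarrow> nz r v0 \<and> om r v0 v1 = 0 \<and> om r v0 w = 0 \<and> om r v1 w = 1"

definition tri :: "nat \<Rightarrow> 'k::field vect \<Rightarrow> 'k vect \<Rightarrow> 'k vect \<Rightarrow> 'k vect \<Rightarrow> 'k vect \<Rightarrow> bool" where
 "tri r v0 v1 w1 v2 w2 \<longleftrightarrow> edge r v0 v1 w1 \<and> edge r v0 v2 w2 \<and>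
   om r v1 v2 = 0 \<and> om r v1 w2 = 0 \<and> om r w1 v2 = 0 \<and> om r w1 w2 = 0"

lemma nds_pair: "om r a b = 1 ==> nds r {a, b}"
 using nds_insert_pair[of r "{}" a b] by (simp add: perp_def)

text \<open>\<open>v\<close> and \<open>ee 0\<close> span a hyperbolic plane, and a pair in its
  complement gives edges from both to the same vertex.\<close>

lemma filling_0:
 fixes g :: "'k::field vect \<Rightarrow> real"
 assumes r: "2 \<le> r" and closed: "\<And>v0 v1 w. edge r v0 v1 w ==> g v1 = g v0"
  and v: "om r v (ee 0) \<noteq> 0"
 shows "g v = g (ee 0)"
proof -
 let ?v = "smul (inverse (om r v (ee 0))) v"
 have n: "nds r (set [?v, ee 0])" using nds_pair[of r ?v "ee 0"] v by simp
 obtain y w where yw: "y \<in> perp r (set [?v, ee 0] \<union> set [])" "w \<in> perp r (set [?v, ee 0] \<union> set [])" "om r y w = 1"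
  using hyperbolic_pair_in_complement[OF n, of "[]"] r by auto
 have "om r v y = 0" "om r v w = 0" "om r (ee 0) y = 0" "om r (ee 0) w = 0"
  using yw v by (auto simp: perp_def)
 moreover have "nz r v" "nz r (ee 0 :: 'k vect)" using om_imp_nz[OF v] v om_imp_nz[of r "ee 0" v] om_sym0[of r v "ee 0"] by auto
 ultimately have "edge r v y w" "edge r (ee 0) y w" using yw(3) by (auto simp: edge_def)
 from closed[OF this(1)] closed[OF this(2)] show ?thesis by simp
qed

text \<open>The construction for \<open>j \<ge> 2\<close> corrects by \<open>2*j - 3\<close> basis
  vectors, so \<open>j = 1\<close> needs its own argument. Once the cocycle is known not to depend
  on the partner \<open>w\<close>, the filling takes place among isotropic vectors.\<close>

locale closed_1 =
 fixes r :: nat and g :: "'k::field vect \<Rightarrow> 'k vect \<Rightarrow> 'k vect \<Rightarrow> real"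
 assumes r: "3 \<le> r"
  and closed: "\<And>v0 v1 w1 v2 w2. tri r v0 v1 w1 v2 w2 ==> g v1 v2 w2 - g v0 v2 w2 + g v0 v1 w1 = 0"
begin

text \<open>A pair orthogonal to \<open>v0\<close>, \<open>v1\<close> and \<open>w\<close> is also
  orthogonal to the shifted partner, and the two triangles ending in it share their other two
  faces.\<close>

lemma shift_in_span:
 assumes e: "edge r v0 v1 w"
 shows "g v0 v1 (w + smul a v0 + smul b v1) = g v0 v1 w"
proof -
 have n: "nds r (set [v1, w])" using nds_pair[of r v1 w] e by (simp add: edge_def)
 obtain y z where yz: "y \<in> perp r (set [v1, w] \<union> set [v0])" "z \<in> perp r (set [v1, w] \<union> set [v0])" "om r y z = 1"
  using hyperbolic_pair_in_complement[OF n, of "[v0]"] r by auto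
 have "om r v1 v0 = 0" using e om_sym0[of r v0 v1] by (simp add: edge_def)
 then have "tri r v0 v1 w y z" "tri r v0 v1 (w + smul a v0 + smul b v1) y z"
  using yz e by (auto simp: tri_def edge_def perp_def)
 from closed[OF this(1)] closed[OF this(2)] show ?thesis by simp
qed

text \<open>With \<open>u\<close> put in front as a new first vertex, the triangles over the two
  edges share the face \<open>(u, v0, w0)\<close>, and their faces at \<open>u\<close> and
  \<open>v1\<close> differ by a shift along \<open>u\<close>, which \<open>shift_in_span\<close>
  allows. The vector \<open>p\<close> shows that \<open>u\<close> is not proportional to
  \<open>v0\<close> and yields a partner \<open>w0\<close> of \<open>v0\<close> that is orthogonal
  to \<open>u\<close>.\<close>

lemma shift_transversal:
 assumes e: "edge r v0 v1 w" and u: "om r u v0 = 0" "om r u v1 = 0" "om r u w = 0"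
  and p: "om r v0 p = 0" "om r u p = 1"
 shows "g v0 v1 (w + u) = g v0 v1 w"
proof -
 note e' = e[unfolded edge_def]
 \<comment> \<open>\<open>p'\<close>, and below \<open>q1\<close>, are projections to the complement
   of the plane of \<open>v1\<close> and \<open>w\<close>.\<close>
 define p' where "p' = p - smul (om r v1 p) w + smul (om r w p) v1"
 have wv: "om r w v1 = -1" using e' om_anti[of r w v1] by simp
 have p': "om r v0 p' = 0" "om r u p' = 1" "om r v1 p' = 0" "om r w p' = 0"
  using p u e' wv by (simp_all add: p'_def)
 obtain q where q: "om r v0 q = 1" using nz_partner[of r v0] e' by auto
 define q1 where "q1 = q - smul (om r v1 q) w + smul (om r w q) v1"
 have q1: "om r v0 q1 = 1" "om r v1 q1 = 0" "om r w q1 = 0"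
  using q e' wv by (simp_all add: q1_def)
 define w0 where "w0 = q1 - smul (om r u q1) p'"
 have w0: "om r v0 w0 = 1" "om r v1 w0 = 0" "om r w w0 = 0" "om r u w0 = 0"
  using q1 p' by (simp_all add: w0_def)
 have nu: "nz r u" using om_imp_nz[of r u p] p by simp
 have uw: "om r w u = 0" "om r v1 u = 0" "om r v0 u = 0" using u om_sym0[of r] by metis+
 have s: "om r w0 v1 = 0" "om r w0 w = 0" "om r w0 u = 0" using w0 om_sym0[of r w0] by simp_all
 have t: "tri r u v0 w0 v1 w" "tri r u v0 w0 v1 (w + u)"
  using nu u w0 e' s uw by (auto simp: tri_def edge_def)
 have "edge r u v1 w" using t(1) by (simp add: tri_def)
 from shift_in_span[OF this, of 1 0] have "g u v1 (w + u) = g u v1 w" by simp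
 with closed[OF t(1)] closed[OF t(2)] show ?thesis by simp
qed

text \<open>Up to a multiple of \<open>v1\<close>, two partners differ by some \<open>u\<close>
  orthogonal to \<open>v0\<close>, \<open>v1\<close> and \<open>w\<close>. If \<open>u\<close> is
  proportional to \<open>v0\<close>, no transversal \<open>p\<close> exists; the shift is then split
  into \<open>x\<close> and \<open>u - x\<close>, both transversal, with \<open>x\<close> from a
  hyperbolic pair orthogonal to \<open>v0\<close>, \<open>v1\<close> and \<open>w\<close>.\<close>

lemma partner_indep:
 assumes e: "edge r v0 v1 w" "edge r v0 v1 w'"
 shows "g v0 v1 w = g v0 v1 w'"
proof -
 note e1 = e(1)[unfolded edge_def] and e2 = e(2)[unfolded edge_def]
 define b where "b = om r w' w"
 define u where "u = w' - w - smul b v1"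
 have a: "om r v1 v0 = 0" "om r w v0 = 0" "om r w' v0 = 0" "om r w v1 = -1" "om r w' v1 = -1"
  using e1 e2 om_anti[of r] by (metis neg_equal_0_iff_equal)+
 have u: "om r u v0 = 0" "om r u v1 = 0" "om r u w = 0"
  using e1 e2 a by (simp_all add: u_def b_def)
 have w'_eq: "w' = (w + u) + smul 0 v0 + smul b v1" by (auto simp: u_def fun_eq_iff)
 have "g v0 v1 (w + u) = g v0 v1 w"
 proof (cases "\<exists>p. om r v0 p = 0 \<and> om r u p = 1")
  case True then show ?thesis using shift_transversal[OF e(1) u] by blast
 next
  case no: False
  have n: "nds r (set [v1, w])" using nds_pair[of r v1 w] e1 by simp
  obtain x p where xp: "x \<in> perp r (set [v1, w] \<union> set [v0])" "p \<in> perp r (set [v1, w] \<union> set [v0])" "om r x p = 1"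
   using hyperbolic_pair_in_complement[OF n, of "[v0]"] r by auto
  have x: "om r v0 x = 0" "om r v1 x = 0" "om r w x = 0" and p: "om r v0 p = 0" "om r v1 p = 0" "om r w p = 0"
   using xp by (auto simp: perp_def)
  have x': "om r x v0 = 0" "om r x v1 = 0" "om r x w = 0" using x om_sym0[of r] by metis+
  have zero: "om r u q = 0" if "om r v0 q = 0" for q
  proof (rule ccontr)
   assume "om r u q \<noteq> 0"
   then have "om r v0 (smul (inverse (om r u q)) q) = 0 \<and> om r u (smul (inverse (om r u q)) q) = 1" using that by simp
   then show False using no by blast
  qed
  have ux: "om r u x = 0" "om r u p = 0" using zero x p by auto
  have s1: "g v0 v1 (w + x) = g v0 v1 w" by (rule shift_transversal[OF e(1) x' p(1) xp(3)])
  have e3: "edge r v0 v1 (w + x)" using e1 x by (simp add: edge_def)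
  have "g v0 v1 ((w + x) + (u - x)) = g v0 v1 (w + x)"
  proof (rule shift_transversal[OF e3, of "u - x" "- p"])
   show "om r (u - x) v0 = 0" "om r (u - x) v1 = 0" "om r (u - x) (w + x) = 0" using u x' ux by simp_all
   show "om r v0 (- p) = 0" "om r (u - x) (- p) = 1" using p ux xp(3) by simp_all
  qed
  moreover have "(w + x) + (u - x) = w + u" by simp
  ultimately show ?thesis using s1 by simp
 qed
 moreover have "edge r v0 v1 (w + u)" using e1 u om_sym0[of r u] by (simp add: edge_def)
 then have "g v0 v1 ((w + u) + smul 0 v0 + smul b v1) = g v0 v1 (w + u)" by (rule shift_in_span)
 ultimately show ?thesis unfolding w'_eq by simp
qed

definition gi where "gi v0 v1 = g v0 v1 (SOME w. edge r v0 v1 w)"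

lemma gi_eq: "edge r v0 v1 w ==> g v0 v1 w = gi v0 v1"
 unfolding gi_def using partner_indep[of v0 v1 w] someI[of "edge r v0 v1" w] by blast

text \<open>Dual vectors \<open>d1\<close> and \<open>d2\<close> may fail to be orthogonal to each
  other; a multiple of \<open>p1\<close> added to \<open>d2\<close> repairs this and produces a
  triangle.\<close>

lemma gi_closed:
 assumes "nz r p0" and o: "om r p0 p1 = 0" "om r p0 p2 = 0" "om r p1 p2 = 0"
  and d1: "om r p0 d1 = 0" "om r p1 d1 = 1" "om r p2 d1 = 0"
  and d2: "om r p0 d2 = 0" "om r p1 d2 = 0" "om r p2 d2 = 1"
 shows "gi p1 p2 - gi p0 p2 + gi p0 p1 = 0"
proof -
 define w2 where "w2 = d2 + smul (om r d1 d2) p1"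
 have d1p: "om r d1 p1 = -1" "om r d1 p2 = 0" using d1 om_anti[of r d1] by auto
 have pp: "om r p2 p1 = 0" using o om_sym0[of r p1 p2] by simp
 have t: "tri r p0 p1 d1 p2 w2"
  using assms d1p pp by (simp add: tri_def edge_def w2_def)
 have "nz r p1" using om_imp_nz[of r p1 d1] d1 by simp
 then have "edge r p1 p2 w2" using o d2 pp by (simp add: edge_def w2_def)
 with t closed[OF t] show ?thesis by (simp add: gi_eq tri_def)
qed

abbreviation "zz i \<equiv> (ee i :: 'k vect)"
abbreviation "zd i \<equiv> (ee (2*r - Suc i) :: 'k vect)"

text \<open>The combination of \<open>zz 0\<close> and \<open>zz 1\<close> orthogonal to
  \<open>v\<close>. The vector \<open>yw v\<close> is a partner for it orthogonal to
  \<open>v\<close> and to \<open>zz 0\<close>, so that both of these form an edge with it.\<close>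

definition yy :: "'k vect \<Rightarrow> nat \<Rightarrow> 'k" where
 "yy v = smul (om r v (zz 1)) (zz 0) - smul (om r v (zz 0)) (zz 1)"

definition yw :: "'k vect \<Rightarrow> nat \<Rightarrow> 'k" where
 "yw v = smul (- inverse (om r v (zz 0))) (zd 1) + smul (om r v (zd 1) / (om r v (zz 0))^2) (zz 0)"

lemma zz_simps: "i < 3 ==> l < 3 ==> om r (zz i) (zz l) = 0"
  "i < 3 ==> l < 3 ==> om r (zz i) (zd l) = (if i = l then 1 else 0)"
  "i < 3 ==> l < 3 ==> om r (zd l) (zz i) = (if i = l then - 1 else 0)"
 using r om_ee_ee[of i r l] by auto

lemma zz_all:
 "om r (zz 0) (zz 0) = 0" "om r (zz 0) (zz 1) = 0" "om r (zz 0) (zz 2) = 0"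
 "om r (zz 1) (zz 0) = 0" "om r (zz 1) (zz 1) = 0" "om r (zz 1) (zz 2) = 0"
 "om r (zz 2) (zz 0) = 0" "om r (zz 2) (zz 1) = 0" "om r (zz 2) (zz 2) = 0"
 "om r (zz 0) (zd 0) = 1" "om r (zz 0) (zd 1) = 0" "om r (zz 0) (zd 2) = 0"
 "om r (zz 1) (zd 0) = 0" "om r (zz 1) (zd 1) = 1" "om r (zz 1) (zd 2) = 0"
 "om r (zz 2) (zd 0) = 0" "om r (zz 2) (zd 1) = 0" "om r (zz 2) (zd 2) = 1"
 by (simp_all only: zz_simps) simp_all

lemma nz_zz0: "nz r (zz 0)"
 using om_imp_nz[of r "zz 0" "zd 0"] zz_all(10) by simp

lemma edge_yy:
 assumes "om r v (zz 0) \<noteq> 0"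
 shows "edge r v (yy v) (yw v)" "edge r (zz 0) (yy v) (yw v)"
proof -
 have "nz r v" using assms by (rule om_imp_nz)
 then show "edge r v (yy v) (yw v)" "edge r (zz 0) (yy v) (yw v)"
  using assms nz_zz0 by (simp_all only: edge_def yy_def yw_def om_diff_left om_diff_right om_add_left om_add_right om_smul_left om_smul_right zz_all)
   (auto simp: field_simps power2_eq_square)
qed

text \<open>Subtracting the two identities shows that \<open>gi v y - gi (zz 0) y\<close> does not
  depend on \<open>y\<close>.\<close>

lemma filling_aux:
 assumes a0: "om r v (zz 0) \<noteq> 0" and y: "y = smul c0 (zz 0) + smul c1 (zz 1) + smul c2 (zz 2)" and c2: "c2 \<noteq> 0"
  and vy: "om r v y = 0"
 shows "gi (yy v) y - gi v y + gi v (yy v) = 0" "gi (yy v) y - gi (zz 0) y + gi (zz 0) (yy v) = 0"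
proof -
 let ?a = "om r v (zz 0)"
 define d2 where "d2 = smul (inverse c2) (zd 2) - smul (om r v (zd 2) * inverse c2 / ?a) (zz 0)"
 define e1 where "e1 = smul (- inverse ?a) (zd 1) + smul (c1 * inverse ?a * inverse c2) (zd 2)"
 define d1 where "d1 = e1 - smul (om r v e1 / ?a) (zz 0)"
 note zs = om_diff_left om_diff_right om_add_left om_add_right om_smul_left om_smul_right zz_all
 have yz: "om r y (zz 0) = 0" "om r y (zd 2) = c2" "om r y (zd 1) = c1"
  by (simp_all only: y zs) simp_all
 have yyz: "om r (yy v) (zz 0) = 0" "om r (yy v) (zd 1) = - ?a" "om r (yy v) (zd 2) = 0"
  by (simp_all only: yy_def zs) simp_all
 have D2: "om r v d2 = 0" "om r (yy v) d2 = 0" "om r y d2 = 1" "om r (zz 0) d2 = 0"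
  using a0 c2 yz yyz zz_all by (simp_all add: d2_def)
 have E1: "om r (yy v) e1 = 1" "om r y e1 = 0" "om r (zz 0) e1 = 0"
  using a0 c2 by (simp_all only: e1_def zs yz yyz) (simp_all add: field_simps)
 have D1: "om r v d1 = 0" "om r (yy v) d1 = 1" "om r y d1 = 0" "om r (zz 0) d1 = 0"
  using a0 E1 yz yyz zz_all by (simp_all add: d1_def)
 have o: "om r (yy v) y = 0" "om r (zz 0) y = 0" "om r (zz 0) (yy v) = 0" "om r v (yy v) = 0"
  by (simp_all only: y yy_def zs) simp_all
 have "nz r v" using a0 by (rule om_imp_nz)
 then show "gi (yy v) y - gi v y + gi v (yy v) = 0"
  by (rule gi_closed) (use o vy D1 D2 in auto)
 show "gi (yy v) y - gi (zz 0) y + gi (zz 0) (yy v) = 0"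
  using nz_zz0 by (rule gi_closed) (use o D1 D2 in auto)
qed

text \<open>A common neighbour \<open>y\<close> of \<open>v0\<close> and \<open>v1\<close> gives
  \<open>gi v0 v1 = gi v0 y - gi v1 y\<close>. Comparing both terms with \<open>zz 0\<close> by
  \<open>filling_aux\<close> eliminates \<open>y\<close>.\<close>

lemma filling_1:
 assumes e: "edge r v0 v1 w"
  and g0: "om r v0 (zz 0) \<noteq> 0" "om r v1 (zz 0) \<noteq> 0"
  and D: "om r v0 (zz 0) * om r v1 (zz 1) - om r v0 (zz 1) * om r v1 (zz 0) \<noteq> 0"
 shows "g v0 v1 w = (g (zz 0) (yy v1) (yw v1) - g v1 (yy v1) (yw v1)) - (g (zz 0) (yy v0) (yw v0) - g v0 (yy v0) (yw v0))"
proof -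
 let ?a0 = "om r v0 (zz 0)" and ?a1 = "om r v0 (zz 1)" and ?a2 = "om r v0 (zz 2)"
 let ?b0 = "om r v1 (zz 0)" and ?b1 = "om r v1 (zz 1)" and ?b2 = "om r v1 (zz 2)"
 let ?D = "?a0 * ?b1 - ?a1 * ?b0"
 \<comment> \<open>The cross product of the two coefficient vectors: the combination of three
   isotropic basis vectors orthogonal to both \<open>v0\<close> and \<open>v1\<close>. Its last
   coefficient is the determinant assumed nonzero in \<open>D\<close>.\<close>
 define y where "y = smul (?a1 * ?b2 - ?a2 * ?b1) (zz 0) + smul (?a2 * ?b0 - ?a0 * ?b2) (zz 1) + smul ?D (zz 2)"
 have vy: "om r v0 y = 0" "om r v1 y = 0" by (simp_all add: y_def algebra_simps)
 note zs = om_diff_left om_diff_right om_add_left om_add_right om_smul_left om_smul_right zz_all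
 have yz: "om r y (zz 0) = 0" "om r y (zz 1) = 0" "om r y (zd 2) = ?D"
  by (simp_all only: y_def zs) simp_all
 define d0 where "d0 = smul (?b1 / ?D) (zz 0) - smul (?b0 / ?D) (zz 1)"
 define d1 where "d1 = smul (?a0 / ?D) (zz 1) - smul (?a1 / ?D) (zz 0)"
 have D0: "om r v0 d0 = 1" "om r v1 d0 = 0" "om r y d0 = 0"
  using D yz by (auto simp: d0_def diff_divide_distrib[symmetric] mult.commute)
 have D1: "om r v0 d1 = 0" "om r v1 d1 = 1" "om r y d1 = 0"
  using D yz by (auto simp: d1_def diff_divide_distrib[symmetric] mult.commute)
 define d2 where "d2 = smul (inverse ?D) (zd 2 - smul (om r v0 (zd 2)) d0 - smul (om r v1 (zd 2)) d1)"
 have D2: "om r v0 d2 = 0" "om r v1 d2 = 0" "om r y d2 = 1"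
  using D yz D0 D1 by (simp_all add: d2_def)
 have "nz r v0" using g0(1) by (rule om_imp_nz)
 then have 1: "gi v1 y - gi v0 y + gi v0 v1 = 0"
  by (rule gi_closed) (use e[unfolded edge_def] vy D1 D2 in auto)
 have 2: "gi (yy v0) y - gi v0 y + gi v0 (yy v0) = 0" "gi (yy v0) y - gi (zz 0) y + gi (zz 0) (yy v0) = 0"
  using filling_aux[OF g0(1) y_def D vy(1)] by auto
 have 3: "gi (yy v1) y - gi v1 y + gi v1 (yy v1) = 0" "gi (yy v1) y - gi (zz 0) y + gi (zz 0) (yy v1) = 0"
  using filling_aux[OF g0(2) y_def D vy(2)] by auto
 show ?thesis
  unfolding gi_eq[OF e] gi_eq[OF edge_yy(1)[OF g0(1)]] gi_eq[OF edge_yy(2)[OF g0(1)]]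
   gi_eq[OF edge_yy(1)[OF g0(2)]] gi_eq[OF edge_yy(2)[OF g0(2)]]
  using 1 2 3 by linarith
qed

end

section \<open>Spaces of matrices\<close>

lemma topspace_mat_topology [simp]: "topspace (mat_topology m n) = carrier_mat m n"
 by (auto simp: mat_topology_def topspace_pullback_topology)

lemma continuous_map_mat_entry:
 assumes "i < m" "j < n"
 shows "continuous_map (mat_topology m n) euclidean (\<lambda>A. A $$ (i, j))"
proof -
 let ?I = "{..<m} \<times> {..<n}"
 have "continuous_map (mat_topology m n) euclidean ((\<lambda>x. x (i,j)) \<circ> (\<lambda>A. restrict (\<lambda>p. A $$ p) ?I))"
  unfolding mat_topology_def
  by (rule continuous_map_pullback) (use assms in \<open>auto intro: continuous_map_product_projection\<close>)
 then show ?thesis using assms by (simp add: comp_def)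
qed

lemma continuous_map_into_mat:
 assumes "\<And>x. x \<in> topspace X ==> f x \<in> carrier_mat m n"
  and "\<And>i j. i < m ==> j < n ==> continuous_map X euclidean (\<lambda>x. f x $$ (i, j))"
 shows "continuous_map X (mat_topology m n) f"
 unfolding mat_topology_def
proof (rule continuous_map_pullback')
 show "continuous_map X (product_topology (\<lambda>_. euclidean) ({..<m} \<times> {..<n})) ((\<lambda>A. restrict (\<lambda>p. A $$ p) ({..<m} \<times> {..<n})) \<circ> f)"
  unfolding continuous_map_componentwise using assms(2) by auto
qed (use assms(1) in auto)

lemma mat_homeomorphic_product:
 "(mat_topology m n :: 'k mat topology) homeomorphic_space product_topology (\<lambda>_. euclidean :: 'k::topological_space topology) ({..<m} \<times> {..<n})"
proof -
 let ?I = "{..<m} \<times> {..<n}"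
 let ?f = "\<lambda>A :: 'k mat. restrict (\<lambda>p. A $$ p) ?I" and ?g = "\<lambda>x. mat m n x :: 'k mat"
 have 1: "continuous_map (mat_topology m n) (product_topology (\<lambda>_. euclidean) ?I) ?f"
  unfolding continuous_map_componentwise by (auto intro: continuous_map_mat_entry)
 have 2: "continuous_map (product_topology (\<lambda>_. euclidean) ?I) (mat_topology m n) ?g"
  by (rule continuous_map_into_mat) (auto intro!: continuous_map_product_projection)
 have 3: "\<forall>x\<in>topspace (mat_topology m n). ?g (?f x) = x" by (auto intro!: eq_matI)
 have 4: "\<forall>y\<in>topspace (product_topology (\<lambda>_. euclidean) ?I). ?f (?g y) = y"
  by (auto simp: PiE_def extensional_def fun_eq_iff)
 have "homeomorphic_maps (mat_topology m n) (product_topology (\<lambda>_. euclidean) ?I) ?f ?g"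
  unfolding homeomorphic_maps_def using 1 2 3 4 by simp
 then show ?thesis unfolding homeomorphic_space_def by blast
qed

text \<open>Continuing the entries by zero to all index pairs makes the type class topology on
  functions, with its countable basis and Borel sets, available for matrices.\<close>

definition mat_fun :: "nat \<Rightarrow> nat \<Rightarrow> 'k::zero mat \<Rightarrow> nat \<times> nat \<Rightarrow> 'k" where
 "mat_fun m n A = (\<lambda>(i,j). if i < m \<and> j < n then A $$ (i,j) else 0)"

lemma openin_mat_fun:
 fixes U :: "'k::{topological_space,zero} mat set"
 assumes "openin (mat_topology m n) U"
 obtains V where "open V" "U = mat_fun m n -` V \<inter> carrier_mat m n"
proof -
 let ?I = "{..<m} \<times> {..<n}"
 obtain V' where V': "openin (product_topology (\<lambda>_. euclidean) ?I) V'" "U = (\<lambda>A. restrict (\<lambda>p. A $$ p) ?I) -` V' \<inter> carrier_mat m n"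
  using assms by (auto simp: mat_topology_def openin_pullback_topology)
 define V where "V = (\<lambda>x. restrict x ?I) -` V'"
 have "continuous_map (product_topology (\<lambda>_. euclidean :: 'k topology) UNIV) (product_topology (\<lambda>_. euclidean) ?I) (\<lambda>x. restrict x ?I)"
  unfolding continuous_map_componentwise by (auto intro!: continuous_map_product_projection)
 from openin_continuous_map_preimage[OF this V'(1)] have "openin (product_topology (\<lambda>_. euclidean :: 'k topology) UNIV) V"
  by (simp add: V_def vimage_def)
 then have "open V" by (simp add: open_fun_def)
 moreover have "U = mat_fun m n -` V \<inter> carrier_mat m n"
 proof -
  have "restrict (mat_fun m n A) ?I = restrict (\<lambda>p. A $$ p) ?I" for A :: "'k mat"
   by (auto simp: mat_fun_def)
  then show ?thesis unfolding V' V_def by auto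
 qed
 ultimately show ?thesis using that by blast
qed

lemma second_countable_mat: "second_countable (mat_topology m n :: 'k::{second_countable_topology,zero} mat topology)"
proof -
 obtain B :: "(nat \<times> nat \<Rightarrow> 'k) set set" where B: "countable B" "topological_basis B"
  using ex_countable_basis by auto
 let ?C = "(\<lambda>V. mat_fun m n -` V \<inter> carrier_mat m n) ` B"
 have op: "openin (mat_topology m n) (mat_fun m n -` V \<inter> carrier_mat m n :: 'k mat set)" if "open V" for V
 proof -
  have "continuous_map (mat_topology m n) (product_topology (\<lambda>_. euclidean) UNIV) (mat_fun m n :: 'k mat \<Rightarrow> _)"
   unfolding continuous_map_componentwise_UNIV
  proof
   fix k :: "nat \<times> nat"
   obtain i j where k: "k = (i, j)" by fastforce
   show "continuous_map (mat_topology m n) euclidean (\<lambda>A :: 'k mat. mat_fun m n A k)"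
    by (cases "i < m \<and> j < n") (auto simp: k mat_fun_def intro: continuous_map_mat_entry)
  qed
  then have "continuous_map (mat_topology m n) euclidean (mat_fun m n :: 'k mat \<Rightarrow> _)"
   by (simp add: euclidean_product_topology)
  from openin_continuous_map_preimage[OF this, of V] that show ?thesis by (simp add: Int_def vimage_def conj_commute)
 qed
 show ?thesis
  unfolding second_countable_def
 proof (intro exI[of _ ?C] conjI allI ballI, goal_cases)
  case 1
  show ?case using B by simp
 next
  case (2 V)
  then show ?case using op topological_basis_open[OF B(2)] by auto
 next
  case (3 U x)
  show ?case
  proof
  assume "openin (mat_topology m n) U \<and> x \<in> U"
  then obtain V where V: "open V" "U = mat_fun m n -` V \<inter> carrier_mat m n" "x \<in> U" using openin_mat_fun by metis
  then have "mat_fun m n x \<in> V" by auto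
  then obtain W where "W \<in> B" "mat_fun m n x \<in> W" "W \<subseteq> V" using topological_basisE[OF B(2) V(1)] by metis
  then show "\<exists>Va\<in>?C. x \<in> Va \<and> Va \<subseteq> U" using V by (intro bexI[of _ "mat_fun m n -` W \<inter> carrier_mat m n"]) auto
  qed
 qed
qed

lemma Hausdorff_mat: "Hausdorff_space (mat_topology m n :: 'k::metric_space mat topology)"
 using homeomorphic_Hausdorff_space[OF mat_homeomorphic_product[of m n, where ?'k = 'k]]
 by (simp add: Hausdorff_space_product_topology)

lemma completely_metrizable_mat: "completely_metrizable_space (mat_topology m n :: 'k::complete_space mat topology)"
proof -
 have "countable {i \<in> {..<m} \<times> {..<n}. P i}" for P by (rule countable_subset[of _ "{..<m} \<times> {..<n}"]) auto
 then show ?thesis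
  using homeomorphic_completely_metrizable_space[OF mat_homeomorphic_product[of m n, where ?'k = 'k]]
  by (simp add: completely_metrizable_space_product_topology completely_metrizable_space_euclidean)
qed

lemma locally_compact_mat: "locally_compact_space (mat_topology m n :: 'k::heine_borel mat topology)"
proof -
 have "finite {i \<in> {..<m} \<times> {..<n}. P i}" for P by (rule finite_subset[of _ "{..<m} \<times> {..<n}"]) auto
 then show ?thesis
  using homeomorphic_locally_compact_space[OF mat_homeomorphic_product[of m n, where ?'k = 'k]]
  by (simp add: locally_compact_space_product_topology locally_compact_space_euclidean)
qed

abbreviation mat_sub :: "nat \<Rightarrow> nat \<Rightarrow> 'k::topological_space mat set \<Rightarrow> 'k mat topology" where
 "mat_sub m n S \<equiv> subtopology (mat_topology m n) S"

lemma continuous_map_mat_sub_entry: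
 "i < m ==> j < n ==> continuous_map (mat_sub m n S) euclidean (\<lambda>A. A $$ (i, j))"
 by (rule continuous_map_from_subtopology) (rule continuous_map_mat_entry)

lemma continuous_map_into_mat_sub:
 assumes "\<And>x. x \<in> topspace X ==> f x \<in> carrier_mat m n \<inter> S"
  and "\<And>i j. i < m ==> j < n ==> continuous_map X euclidean (\<lambda>x. f x $$ (i, j))"
 shows "continuous_map X (mat_sub m n S) f"
 unfolding continuous_map_in_subtopology using assms by (auto intro: continuous_map_into_mat)

lemma continuous_map_mult:
 fixes f :: "'a \<Rightarrow> 'b::real_normed_algebra"
 shows "continuous_map X euclidean f ==> continuous_map X euclidean g ==> continuous_map X euclidean (\<lambda>x. f x * g x)"
 by (simp add: continuous_map_atin tendsto_mult)

section \<open>Borel structure on spaces of matrices\<close>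

lemma space_borel_of [simp]: "space (borel_of T) = topspace T"
 by (simp add: borel_of_def space_measure_of_conv)

lemma sets_borel_of: "sets (borel_of T) = sigma_sets (topspace T) {U. openin T U}"
 unfolding borel_of_def by (rule sets_measure_of) (auto dest: openin_subset)

lemma measurable_borel_of_entry:
 fixes S :: "'k::{second_countable_topology,real_normed_field} mat set"
 assumes "i < m" "j < n"
 shows "(\<lambda>A. A $$ (i, j)) \<in> borel_measurable (borel_of (mat_sub m n S))"
proof (rule borel_measurableI)
 fix V :: "'k set" assume "open V"
 then have "openin (mat_sub m n S) {A \<in> topspace (mat_sub m n S). A $$ (i,j) \<in> V}"
  using openin_continuous_map_preimage[OF continuous_map_mat_sub_entry[OF assms]] by simp
 moreover have "{A \<in> topspace (mat_sub m n S). A $$ (i,j) \<in> V} = (\<lambda>A. A $$ (i, j)) -` V \<inter> space (borel_of (mat_sub m n S))"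
  by auto
 ultimately show "(\<lambda>A. A $$ (i, j)) -` V \<inter> space (borel_of (mat_sub m n S)) \<in> sets (borel_of (mat_sub m n S))"
  unfolding sets_borel_of by (auto intro: sigma_sets.Basic)
qed

text \<open>Open sets of matrices are preimages under \<open>mat_fun\<close> of open sets of
  functions, and measurability into the function space can be tested coordinatewise.\<close>

lemma measurable_into_borel_of:
 fixes f :: "'a \<Rightarrow> 'k::{second_countable_topology,real_normed_field} mat"
 assumes sp: "\<And>x. x \<in> space M ==> f x \<in> carrier_mat m n \<inter> S"
  and ent: "\<And>i j. i < m ==> j < n ==> (\<lambda>x. f x $$ (i, j)) \<in> borel_measurable M"
 shows "f \<in> M \<rightarrow>\<^sub>M borel_of (mat_sub m n S)"
 unfolding borel_of_def
proof (rule measurable_measure_of)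
 show "{U. openin (mat_sub m n S) U} \<subseteq> Pow (topspace (mat_sub m n S))" using openin_subset by blast
 show "f \<in> space M \<rightarrow> topspace (mat_sub m n S)" using sp by auto
 fix U assume "U \<in> {U. openin (mat_sub m n S) U}"
 then obtain W where W: "openin (mat_topology m n) W" "U = W \<inter> S" by (auto simp: openin_subtopology)
 obtain V where V: "open V" "W = mat_fun m n -` V \<inter> carrier_mat m n" using openin_mat_fun[OF W(1)] by metis
 have "(\<lambda>x. mat_fun m n (f x)) \<in> borel_measurable M"
 proof (rule measurable_coordinatewise_then_product)
  fix k :: "nat \<times> nat"
  obtain i j where k: "k = (i, j)" by fastforce
  show "(\<lambda>x. mat_fun m n (f x) k) \<in> borel_measurable M"
   by (cases "i < m \<and> j < n") (auto simp: k mat_fun_def intro: ent)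
 qed
 then have "(\<lambda>x. mat_fun m n (f x)) -` V \<inter> space M \<in> sets M" using V(1) by (intro measurable_sets[of _ M borel]) auto
 moreover have "(\<lambda>x. mat_fun m n (f x)) -` V \<inter> space M = f -` U \<inter> space M"
  unfolding W V using sp by auto
 ultimately show "f -` U \<inter> space M \<in> sets M" by simp
qed

section \<open>The symplectic group\<close>

definition colf :: "'k::zero mat \<Rightarrow> nat \<Rightarrow> nat \<Rightarrow> 'k" where
 "colf A c = (\<lambda>a. if a < dim_row A then A $$ (a, c) else 0)"

text \<open>A matrix acting on total functions: coordinates beyond the matrix are ignored and become
  zero, so the identity matrix truncates.\<close>

definition mv :: "'k::comm_semiring_1 mat \<Rightarrow> 'k vect \<Rightarrow> nat \<Rightarrow> 'k" where
 "mv A x = (\<lambda>a. if a < dim_row A then \<Sum>b<dim_col A. A $$ (a, b) * x b else 0)"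

lemma mv_expand: "A \<in> carrier_mat n m ==> mv A x = (\<Sum>b<m. smul (x b) (colf A b))"
 by (auto simp: mv_def fun_eq_iff fun_sum_apply colf_def mult.commute)

lemma mult_entry: "A \<in> carrier_mat n m ==> B \<in> carrier_mat m l ==> a < n ==> c < l ==>
  (A * B) $$ (a, c) = (\<Sum>b<m. A $$ (a, b) * (B $$ (b, c) :: 'k::field))"
 by (simp add: scalar_prod_def atLeast0LessThan)

lemma colf_mult: "A \<in> carrier_mat n m ==> B \<in> carrier_mat m l ==> c < l ==> colf (A * B) c = mv A (colf B c :: 'k::field vect)"
 by (rule ext) (auto simp: colf_def mv_def mult_entry simp del: index_mult_mat(1))

lemma mv_smul: "mv A (smul c x) = smul c (mv A (x :: 'k::field vect))"
 by (auto simp: mv_def fun_eq_iff sum_distrib_left mult_ac)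

lemma mv_diff: "mv A (x - y) = mv A x - mv A (y :: 'k::field vect)"
 by (auto simp: mv_def fun_eq_iff algebra_simps sum_subtractf)

lemma mv_ee: "A \<in> carrier_mat n m ==> i < m ==> mv A (ee i) = colf A i"
 by (auto simp: mv_def colf_def ee_apply fun_eq_iff if_distrib[of "\<lambda>x. _ * x"] sum.delta cong: if_cong)

lemma mv_one: "mv (1\<^sub>m n) x = (\<lambda>a. if a < n then x a else (0::'k::field))"
proof
 fix a
 have "(\<Sum>b<n. (1\<^sub>m n :: 'k mat) $$ (a, b) * x b) = (\<Sum>b<n. if b = a then x b else 0)" if "a < n"
  by (rule sum.cong) (use that in auto)
 then show "mv (1\<^sub>m n) x a = (if a < n then x a else 0)" by (auto simp: mv_def)
qed

lemma om_bilin: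
 "om r (\<Sum>b<m. smul (x b) (u b)) (\<Sum>c<m. smul (y c) (u c)) = (\<Sum>b<m. \<Sum>c<m. x b * y c * om r (u b) (u c))"
 unfolding om_sum_left om_sum_right om_smul_left om_smul_right
 by (subst sum.swap) (simp add: mult_ac sum_distrib_left)

lemma om_ee_bilin: "om r x y = (\<Sum>b<2*r. \<Sum>c<2*r. x b * y c * om r (ee b) (ee c))"
proof -
 have *: "(\<Sum>b<2*r. smul (x b) (ee b)) a = x a" if "a < 2*r" for x :: "'k::field vect" and a
 proof -
  have "(\<Sum>b<2*r. smul (x b) (ee b)) a = (\<Sum>b<2*r. if b = a then x b else 0)"
   unfolding fun_sum_apply by (rule sum.cong) (auto simp: ee_apply)
  then show ?thesis using that by simp
 qed
 have "om r x y = om r (\<Sum>b<2*r. smul (x b) (ee b)) (\<Sum>c<2*r. smul (y c) (ee c))"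
  by (rule om_cong) (simp_all only: *)
 then show ?thesis by (simp only: om_bilin)
qed

text \<open>Membership in the group as finitely many polynomial equations in the entries, from which
  closedness is read off.\<close>

definition spcond :: "nat \<Rightarrow> 'k::field mat \<Rightarrow> bool" where
 "spcond r A \<longleftrightarrow> A \<in> carrier_mat (2*r) (2*r) \<and> (\<forall>i<2*r. \<forall>j<2*r. om r (colf A i) (colf A j) = om r (ee i) (ee j))"

lemma spcond_om: "spcond r A ==> om r (mv A x) (mv A y) = om r x y"
 by (subst om_ee_bilin[of r x y]) (auto simp: spcond_def mv_expand om_bilin intro!: sum.cong)

lemma spcond_iff: "spcond r A \<longleftrightarrow> A \<in> carrier_mat (2*r) (2*r) \<and> (\<forall>x y. om r (mv A x) (mv A y) = om r x y)"
 using spcond_om[of r A] by (auto simp: spcond_def) (metis mv_ee)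

lemma om_reindex: "om r x y = (\<Sum>i<r. x (r - 1 - i) * y (r + i) - x (r + i) * y (r - 1 - i))"
proof -
 have "om r x y = (\<Sum>i<r. x (r - Suc i) * y (2*r - Suc (r - Suc i)) - x (2*r - Suc (r - Suc i)) * y (r - Suc i))"
  unfolding om_def by (rule sum.nat_diff_reindex[symmetric])
 also have "\<dots> = (\<Sum>i<r. x (r - 1 - i) * y (r + i) - x (r + i) * y (r - 1 - i))"
 proof (rule sum.cong[OF refl])
  fix i assume "i \<in> {..<r}"
  then have "2*r - Suc (r - Suc i) = r + i" by auto
  then show "x (r - Suc i) * y (2*r - Suc (r - Suc i)) - x (2*r - Suc (r - Suc i)) * y (r - Suc i)
   = x (r - 1 - i) * y (r + i) - x (r + i) * y (r - 1 - i)" by simp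
 qed
 finally show ?thesis .
qed

lemma symp_form_om: "symp_form r v w = om r (vec_index v) (vec_index w)"
 by (simp add: symp_form_def om_reindex)

lemma mult_mat_vec_mv: "A \<in> carrier_mat n m ==> v \<in> carrier_vec m ==> a < n ==> (A *\<^sub>v v) $ a = mv A (vec_index v) a"
 by (auto simp: mv_def scalar_prod_def atLeast0LessThan intro!: sum.cong)

text \<open>\<open>J^(-1) A^T J\<close> for the Gram matrix \<open>J\<close> of the form: the
  inverse of a symplectic matrix without division, whose continuity and measurability are visible
  entry by entry.\<close>

definition sinv :: "nat \<Rightarrow> 'k::field mat \<Rightarrow> 'k mat" where
 "sinv r A = mat (2*r) (2*r) (\<lambda>(a, b). (if a < r then 1 else - 1) * (if b < r then 1 else - 1) * A $$ (2*r - Suc b, 2*r - Suc a))"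

lemma sinv_carrier [simp]: "sinv r A \<in> carrier_mat (2*r) (2*r)"
 by (simp add: sinv_def)

lemma om_sign_sum: "om r x y = (\<Sum>b<2*r. (if b < r then 1 else - 1) * x b * y (2*r - Suc b))"
proof -
 let ?g = "\<lambda>b. (if b < r then 1 else - 1) * x b * y (2*r - Suc b)"
 have 1: "sum ?g {..<2*r} = sum ?g {..<r} + sum ?g {r..<2*r}"
  unfolding lessThan_atLeast0 by (rule sum.atLeastLessThan_concat[symmetric]) auto
 have 2: "sum ?g {..<r} = (\<Sum>b<r. x b * y (2*r - Suc b))"
  by (rule sum.cong) auto
 have 3: "sum ?g {r..<2*r} = (\<Sum>b\<in>{r..<2*r}. - (x b * y (2*r - Suc b)))"
  by (rule sum.cong) auto
 have "sum ?g {..<2*r} = (\<Sum>b\<in>{..<r}. x b * y (2*r - Suc b)) + (\<Sum>b\<in>{r..<2*r}. - (x b * y (2*r - Suc b)))"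
  unfolding 1 2 3 ..
 also have "(\<Sum>b\<in>{r..<2*r}. - (x b * y (2*r - Suc b))) = (\<Sum>i<r. - (x (2*r - Suc i) * y i))"
  by (rule sum.reindex_bij_witness[of _ "\<lambda>i. 2*r - Suc i" "\<lambda>b. 2*r - Suc b"]) auto
 finally show ?thesis by (simp add: om_def sum_subtractf sum_negf)
qed

lemma om_ee_all:
 assumes "i < 2*r" "j < 2*r"
 shows "om r (ee i) (ee j) = (if j = 2*r - Suc i then if i < r then 1 else - 1 else 0 :: 'k::field)"
proof -
 have "om r (ee i) (ee j :: 'k vect) = (\<Sum>b<2*r. if b = i then (if i < r then 1 else - 1) * ee j (2*r - Suc i) else 0)"
  unfolding om_sign_sum by (rule sum.cong) (auto simp: ee_apply)
 then show ?thesis using assms by (auto simp: ee_apply)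
qed

lemma sinv_mult:
 assumes A: "spcond r A"
 shows "sinv r A * A = 1\<^sub>m (2*r)" "A * sinv r A = 1\<^sub>m (2*r)"
proof -
 have Ac: "A \<in> carrier_mat (2*r) (2*r)" using A by (simp add: spcond_def)
 show 1: "sinv r A * A = 1\<^sub>m (2*r)"
 proof (rule eq_matI)
  fix a c assume "a < dim_row (1\<^sub>m (2*r) :: 'a mat)" "c < dim_col (1\<^sub>m (2*r) :: 'a mat)"
  then have ac: "a < 2*r" "c < 2*r" by auto
  have "(sinv r A * A) $$ (a, c) = (\<Sum>b<2*r. sinv r A $$ (a, b) * A $$ (b, c))"
   using ac by (intro mult_entry[OF sinv_carrier Ac])
  also have "\<dots> = (\<Sum>b<2*r. (if a < r then 1 else - 1) * ((if b < r then 1 else - 1) * colf A c b * colf A (2*r - Suc a) (2*r - Suc b)))"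
   by (rule sum.cong) (use ac Ac in \<open>auto simp: sinv_def colf_def\<close>)
  also have "\<dots> = (if a < r then 1 else - 1) * om r (colf A c) (colf A (2*r - Suc a))"
   by (simp add: om_sign_sum sum_distrib_left)
  also have "om r (colf A c) (colf A (2*r - Suc a)) = om r (ee c) (ee (2*r - Suc a))"
   using A ac by (auto simp: spcond_def)
  also have "\<dots> = (if c = a then if a < r then 1 else - 1 else 0)"
   using ac by (subst om_ee_all) auto
  finally show "(sinv r A * A) $$ (a, c) = (1\<^sub>m (2*r) :: 'a mat) $$ (a, c)" using ac by auto
 qed (use Ac in \<open>auto simp: sinv_def\<close>)
 show "A * sinv r A = 1\<^sub>m (2*r)"
  by (rule mat_mult_left_right_inverse[OF sinv_carrier Ac 1])
qed

lemma carrier_Sp: "carrier (Sp r) = {A :: 'k::{field,topological_space} mat. spcond r A}"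
proof (rule Set.set_eqI)
 fix A :: "'k mat"
 have ov: "om r (vec_index (A *\<^sub>v v)) (vec_index (A *\<^sub>v w)) = om r (mv A (vec_index v)) (mv A (vec_index w))"
  if "A \<in> carrier_mat (2*r) (2*r)" "v \<in> carrier_vec (2*r)" "w \<in> carrier_vec (2*r)" for v w
  by (rule om_cong) (use that in \<open>simp_all add: mult_mat_vec_mv del: index_mult_mat_vec\<close>)
 have inv: "invertible_mat A" if "spcond r A"
  unfolding invertible_mat_def inverts_mat_def
  using sinv_mult[OF that] carrier_matD[OF sinv_carrier[of r A]] that
  by (intro conjI exI[of _ "sinv r A"]) (auto simp: spcond_def)
 have sp: "spcond r A" if A: "A \<in> carrier_mat (2*r) (2*r)"
   and p: "\<And>v w. v\<in>carrier_vec (2*r) ==> w\<in>carrier_vec (2*r) ==> symp_form r (A *\<^sub>v v) (A *\<^sub>v w) = symp_form r v w"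
  unfolding spcond_iff
 proof (intro conjI allI A)
  fix x y :: "'k vect"
  \<comment> \<open>\<open>A\<close> reads only coordinates below \<open>2*r\<close>, so an
    arbitrary function may be truncated to a vector of the carrier.\<close>
  have e: "mv A (vec_index (vec (2*r) x)) = mv A x" for x
   using A by (auto simp: mv_def fun_eq_iff)
  have "om r (mv A x) (mv A y) = om r (vec_index (vec (2*r) x)) (vec_index (vec (2*r) y))"
   using p[of "vec (2*r) x" "vec (2*r) y"] by (simp add: symp_form_om ov A e)
  also have "\<dots> = om r x y" by (rule om_cong) auto
  finally show "om r (mv A x) (mv A y) = om r x y" .
 qed
 have car: "A \<in> carrier (Sp r) \<longleftrightarrow> A \<in> carrier_mat (2*r) (2*r) \<and> invertible_mat A \<and>
   (\<forall>v\<in>carrier_vec (2*r). \<forall>w\<in>carrier_vec (2*r). symp_form r (A *\<^sub>v v) (A *\<^sub>v w) = symp_form r v w)"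
  by (simp add: Sp_def Let_def)
 have "symp_form r (A *\<^sub>v v) (A *\<^sub>v w) = symp_form r v w"
  if "spcond r A" "v \<in> carrier_vec (2*r)" "w \<in> carrier_vec (2*r)" for v w
 proof -
  have "A \<in> carrier_mat (2*r) (2*r)" using that by (simp add: spcond_def)
  from ov[OF this that(2,3)] show ?thesis by (simp only: symp_form_om spcond_om[OF that(1)])
 qed
 then have "spcond r A ==> A \<in> carrier (Sp r)" unfolding car using inv by (auto simp only: spcond_def)
 moreover have "A \<in> carrier (Sp r) ==> spcond r A" unfolding car using sp by blast
 ultimately show "A \<in> carrier (Sp r) \<longleftrightarrow> A \<in> {A. spcond r A}" by blast
qed

lemma mult_Sp [simp]: "mult (Sp r) = (*)" and one_Sp [simp]: "one (Sp r) = 1\<^sub>m (2*r)"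
 by (simp_all add: Sp_def Let_def)

lemma gtop_Sp: "gtop (Sp r) = mat_sub (2*r) (2*r) (carrier (Sp r))"
 by (simp add: Sp_def Let_def)

lemma spcond_carrier: "spcond r A ==> A \<in> carrier_mat (2*r) (2*r)"
 by (simp add: spcond_def)

lemma mv_mult:
 assumes "A \<in> carrier_mat n m" "B \<in> carrier_mat m l"
 shows "mv (A * B) x = mv A (mv B (x :: 'k::field vect))"
proof
 fix a
 show "mv (A * B) x a = mv A (mv B x) a"
 proof (cases "a < n")
  case True
  have "(\<Sum>c<l. (A * B) $$ (a, c) * x c) = (\<Sum>c<l. \<Sum>b<m. A $$ (a, b) * B $$ (b, c) * x c)"
   by (rule sum.cong) (use assms True in \<open>auto simp: mult_entry sum_distrib_right simp del: index_mult_mat\<close>)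
  also have "\<dots> = (\<Sum>b<m. \<Sum>c<l. A $$ (a, b) * B $$ (b, c) * x c)" by (rule sum.swap)
  also have "\<dots> = (\<Sum>b<m. A $$ (a, b) * mv B x b)"
   by (rule sum.cong) (use assms in \<open>auto simp: mv_def sum_distrib_left mult.assoc\<close>)
  finally show ?thesis using assms True by (simp add: mv_def[of "A * B"] mv_def[of A])
 qed (use assms in \<open>simp add: mv_def\<close>)
qed

lemma spcond_one: "spcond r (1\<^sub>m (2*r))"
 by (auto simp: spcond_iff mv_one intro!: om_cong)

lemma spcond_mult: "spcond r A ==> spcond r B ==> spcond r (A * B)"
 by (auto simp: spcond_iff mv_mult)

lemma mv_sinv: "spcond r A ==> mv A (mv (sinv r A) x) = mv (1\<^sub>m (2*r)) x"
 using sinv_mult(2) mv_mult[OF spcond_carrier sinv_carrier] by metis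

lemma spcond_sinv: assumes "spcond r A" shows "spcond r (sinv r A)"
 unfolding spcond_iff
proof (intro conjI allI sinv_carrier)
 fix x y
 have "om r (mv (sinv r A) x) (mv (sinv r A) y) = om r (mv A (mv (sinv r A) x)) (mv A (mv (sinv r A) y))"
  using assms by (simp add: spcond_om)
 also have "\<dots> = om r (mv (1\<^sub>m (2*r)) x) (mv (1\<^sub>m (2*r)) y)" by (simp only: mv_sinv[OF assms])
 also have "\<dots> = om r x y" by (rule om_cong) (auto simp: mv_one)
 finally show "om r (mv (sinv r A) x) (mv (sinv r A) y) = om r x y" .
qed

lemma group_Sp: "group (Sp r :: 'k::{field,topological_space} mat top_group)"
proof (rule groupI)
 fix x :: "'k mat" assume "x \<in> carrier (Sp r)"
 then show "\<exists>y\<in>carrier (Sp r). y \<otimes>\<^bsub>Sp r\<^esub> x = \<one>\<^bsub>Sp r\<^esub>"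
  by (intro bexI[of _ "sinv r x"]) (auto simp: carrier_Sp sinv_mult spcond_sinv)
qed (auto simp: carrier_Sp spcond_one spcond_mult left_mult_one_mat[OF spcond_carrier]
    intro: assoc_mult_mat[OF spcond_carrier spcond_carrier spcond_carrier])

lemma inv_Sp: "A \<in> carrier (Sp r) ==> inv\<^bsub>Sp r\<^esub> A = sinv r A"
 by (rule group.inv_equality[OF group_Sp]) (auto simp: carrier_Sp sinv_mult spcond_sinv)

lemma closedin_eq_const:
 fixes f :: "'a \<Rightarrow> 'b::t1_space"
 shows "continuous_map X euclidean f ==> closedin X {x \<in> topspace X. f x = c}"
 using closedin_continuous_map_preimage[of X euclidean f "{c}"] by simp

lemma closedin_all:
 assumes "\<And>i. P i ==> closedin X {x \<in> topspace X. Q i x}"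
 shows "closedin X {x \<in> topspace X. \<forall>i. P i \<longrightarrow> Q i x}"
proof -
 have "{x \<in> topspace X. \<forall>i. P i \<longrightarrow> Q i x} = \<Inter> (insert (topspace X) ((\<lambda>i. {x \<in> topspace X. Q i x}) ` {i. P i}))" by auto
 moreover have "closedin X \<dots>" by (rule closedin_Inter) (use assms in auto)
 ultimately show ?thesis by simp
qed

lemma closedin_all':
 assumes "\<And>i. closedin X {x \<in> topspace X. Q i x}"
 shows "closedin X {x \<in> topspace X. \<forall>i. Q i x}"
 using closedin_all[of "\<lambda>_. True" X Q] assms by simp

lemma closedin_conj:
 assumes "closedin X {x \<in> topspace X. P x}" "closedin X {x \<in> topspace X. Q x}"
 shows "closedin X {x \<in> topspace X. P x \<and> Q x}"
proof -
 have "{x \<in> topspace X. P x \<and> Q x} = {x \<in> topspace X. P x} \<inter> {x \<in> topspace X. Q x}" by auto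
 then show ?thesis using assms by (simp add: closedin_Int)
qed

lemma continuous_map_om_col:
 fixes r :: nat
 assumes "c < n" "d < n"
 shows "continuous_map (mat_topology (2*r) n) euclidean (\<lambda>M :: 'k::real_normed_field mat. om r (colf M c) (colf M d))"
proof (rule continuous_map_eq)
 let ?T = "mat_topology (2*r) n :: 'k mat topology"
 show "continuous_map ?T euclidean (\<lambda>M. \<Sum>b<r. M $$ (b, c) * M $$ (2*r - Suc b, d) - M $$ (2*r - Suc b, c) * M $$ (b, d))"
  by (intro continuous_map_sum continuous_map_diff continuous_map_mult continuous_map_mat_entry) (use assms in auto)
 fix M assume "M \<in> topspace ?T"
 then show "(\<Sum>b<r. M $$ (b, c) * M $$ (2*r - Suc b, d) - M $$ (2*r - Suc b, c) * M $$ (b, d)) = om r (colf M c) (colf M d)"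
  unfolding om_def by (intro sum.cong refl) (auto simp: colf_def)
qed

lemma closedin_Sp: "closedin (mat_topology (2*r) (2*r)) (carrier (Sp r :: 'k::real_normed_field mat top_group))"
proof -
 let ?T = "mat_topology (2*r) (2*r) :: 'k mat topology"
 have "carrier (Sp r) = {A \<in> topspace ?T. \<forall>i. i < 2*r \<longrightarrow> (\<forall>j. j < 2*r \<longrightarrow> om r (colf A i) (colf A j) = om r (ee i) (ee j))}"
  by (auto simp: carrier_Sp spcond_def)
 then show ?thesis by (simp only:) (intro closedin_all closedin_eq_const continuous_map_om_col)
qed

lemma topspace_gtop_Sp: "topspace (gtop (Sp r)) = carrier (Sp r :: 'k::{field,topological_space} mat top_group)"
 by (auto simp: gtop_Sp carrier_Sp spcond_def)

lemma continuous_map_gtop_entry: "i < 2*r ==> j < 2*r ==> continuous_map (gtop (Sp r)) euclidean (\<lambda>A. A $$ (i, j))"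
 unfolding gtop_Sp by (rule continuous_map_mat_sub_entry)

lemma lcsc_Sp: "lcsc_group (Sp r :: 'k::efield mat top_group)"
 unfolding lcsc_group_def
proof (intro conjI group_Sp topspace_gtop_Sp)
 let ?T = "gtop (Sp r) :: 'k mat topology"
 have car: "A \<in> carrier_mat (2*r) (2*r)" if "A \<in> carrier (Sp r)" for A :: "'k mat"
  using that by (simp add: carrier_Sp spcond_carrier)
 show "continuous_map (prod_topology ?T ?T) ?T (\<lambda>(x, y). x \<otimes>\<^bsub>Sp r\<^esub> y)"
 proof (subst (3) gtop_Sp, rule continuous_map_into_mat_sub)
  fix p assume "p \<in> topspace (prod_topology ?T ?T)"
  then show "(case p of (x, y) \<Rightarrow> x \<otimes>\<^bsub>Sp r\<^esub> y) \<in> carrier_mat (2*r) (2*r) \<inter> carrier (Sp r)"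
   by (auto simp: topspace_gtop_Sp carrier_Sp intro: spcond_mult spcond_carrier[OF spcond_mult])
 next
  fix i j assume ij: "i < 2*r" "j < 2*r"
  have "continuous_map (prod_topology ?T ?T) euclidean (\<lambda>p. \<Sum>b<2*r. fst p $$ (i, b) * snd p $$ (b, j))"
  proof (intro continuous_map_sum continuous_map_mult)
   fix b assume "b \<in> {..<2*r}"
   then show "continuous_map (prod_topology ?T ?T) euclidean (\<lambda>p. fst p $$ (i, b))"
    "continuous_map (prod_topology ?T ?T) euclidean (\<lambda>p. snd p $$ (b, j))"
    using continuous_map_compose[OF continuous_map_fst continuous_map_gtop_entry[of i r b]]
     continuous_map_compose[OF continuous_map_snd continuous_map_gtop_entry[of b r j]] ij by (simp_all add: comp_def)
  qed simp
  then show "continuous_map (prod_topology ?T ?T) euclidean (\<lambda>p. (case p of (x, y) \<Rightarrow> x \<otimes>\<^bsub>Sp r\<^esub> y) $$ (i, j))"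
   by (rule continuous_map_eq) (use ij in \<open>auto simp: topspace_gtop_Sp mult_entry[OF car car] simp del: index_mult_mat\<close>)
 qed
 show "continuous_map ?T ?T (\<lambda>x. inv\<^bsub>Sp r\<^esub> x)"
 proof (subst (2) gtop_Sp, rule continuous_map_into_mat_sub)
  fix x assume "x \<in> topspace ?T"
  then show "inv\<^bsub>Sp r\<^esub> x \<in> carrier_mat (2*r) (2*r) \<inter> carrier (Sp r)"
   using spcond_sinv by (auto simp: topspace_gtop_Sp inv_Sp) (auto simp: carrier_Sp)
 next
  fix i j assume ij: "i < 2*r" "j < 2*r"
  have "continuous_map ?T euclidean (\<lambda>x. (if i < r then 1 else - 1) * (if j < r then 1 else - 1) * x $$ (2*r - Suc j, 2*r - Suc i))"
   by (intro continuous_map_mult continuous_map_gtop_entry) (use ij in auto)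
  then show "continuous_map ?T euclidean (\<lambda>x. (inv\<^bsub>Sp r\<^esub> x) $$ (i, j))"
   by (rule continuous_map_eq) (use ij in \<open>auto simp: topspace_gtop_Sp inv_Sp sinv_def\<close>)
 qed
 show "Hausdorff_space ?T" unfolding gtop_Sp by (rule Hausdorff_space_subtopology[OF Hausdorff_mat])
 show "locally_compact_space ?T" unfolding gtop_Sp
  by (rule locally_compact_space_closed_subset[OF _ closedin_Sp]) (simp add: locally_compact_mat)
 show "second_countable ?T" unfolding gtop_Sp by (rule second_countable_subtopology[OF second_countable_mat])
qed


section \<open>Inclusions and transvections\<close>

lemma Sp_incl_block:
 "Sp_incl r A = four_block_mat (1\<^sub>m 1) (0\<^sub>m 1 (dim_col A + 1)) (0\<^sub>m (dim_row A + 1) 1)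
   (four_block_mat A (0\<^sub>m (dim_row A) 1) (0\<^sub>m 1 (dim_col A)) (1\<^sub>m 1))"
proof -
 have "four_block_mat (1\<^sub>m 1 :: 'a mat) (0\<^sub>m 1 0) (0\<^sub>m 0 1) (0\<^sub>m 0 0) = 1\<^sub>m 1"
  by (rule eq_matI) auto
 then show ?thesis by (simp add: Sp_incl_def Let_def)
qed

lemma Sp_incl_carrier: "A \<in> carrier_mat (2*r) (2*r) ==> Sp_incl r A \<in> carrier_mat (2*Suc r) (2*Suc r)"
 by (auto simp: Sp_incl_block)

lemma Sp_incl_entry:
 assumes A: "A \<in> carrier_mat (2*r) (2*r)" and a: "a < 2*Suc r" "b < 2*Suc r"
 shows "Sp_incl r A $$ (a, b) =
    (if 1 \<le> a \<and> a \<le> 2*r \<and> 1 \<le> b \<and> b \<le> 2*r then A $$ (a - 1, b - 1) else if a = b then 1 else 0)"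
proof (cases "a = 0 \<or> b = 0")
 case True
 then show ?thesis using A a by (auto simp: Sp_incl_block)
next
 case False
 then obtain a' b' where ab: "a = Suc a'" "b = Suc b'" by (metis not0_implies_Suc)
 show ?thesis using A a unfolding ab by (auto simp: Sp_incl_block)
qed

lemma sum_split_shift:
 fixes F :: "nat \<Rightarrow> 'a::comm_monoid_add"
 shows "(\<Sum>i<n + k. F i) = (\<Sum>i<k. F i) + (\<Sum>l<n. F (l + k))"
 by (induction n) (simp_all add: add.assoc)

text \<open>Splits the \<open>k\<close> outermost pairs off from the form of rank \<open>n\<close>
  on the middle coordinates.\<close>

lemma om_split:
 "om (n + k) u v = (\<Sum>i<k. u i * v (2*(n + k) - Suc i) - u (2*(n + k) - Suc i) * v i) + om n (\<lambda>j. u (j + k)) (\<lambda>j. v (j + k))"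
proof -
 have "2*(n + k) - Suc (l + k) = (2*n - Suc l) + k" if "l < n" for l using that by simp
 then show ?thesis unfolding om_def sum_split_shift by (intro arg_cong2[where f = "(+)"] sum.cong refl) simp_all
qed

lemma sum_shift:
 fixes F :: "nat \<Rightarrow> 'a::comm_monoid_add"
 assumes "k + m \<le> N" "\<And>b. b < N ==> b < k \<or> k + m \<le> b ==> F b = 0"
 shows "(\<Sum>b<N. F b) = (\<Sum>j<m. F (j + k))"
proof -
 have "(\<Sum>b<N. F b) = (\<Sum>b\<in>(\<lambda>j. j + k) ` {..<m}. F b)"
 proof (rule sum.mono_neutral_right)
  show "\<forall>b\<in>{..<N} - (\<lambda>j. j + k) ` {..<m}. F b = 0"
  proof
   fix b assume b: "b \<in> {..<N} - (\<lambda>j. j + k) ` {..<m}"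
   have "b < k \<or> k + m \<le> b"
   proof (rule ccontr)
    assume "\<not> (b < k \<or> k + m \<le> b)"
    then have "b - k < m" "b = (b - k) + k" by linarith+
    then show False using b by blast
   qed
   then show "F b = 0" using assms(2) b by simp
  qed
 qed (use assms(1) in auto)
 also have "\<dots> = (\<Sum>j<m. F (j + k))" by (subst sum.reindex) simp_all
 finally show ?thesis .
qed

text \<open>\<open>A\<close> as middle block of an identity matrix. It will be a right inverse of
  the projection of a stabilizer to its block; for \<open>q = 0\<close> it is the inclusion of the
  series.\<close>

definition emb :: "nat \<Rightarrow> nat \<Rightarrow> 'k::zero_neq_one mat \<Rightarrow> 'k mat" where
 "emb r q A = mat (2*r) (2*r) (\<lambda>(a, b). if Suc q \<le> a \<and> a < 2*r - Suc q \<and> Suc q \<le> b \<and> b < 2*r - Suc q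
   then A $$ (a - Suc q, b - Suc q) else if a = b then 1 else 0)"

lemma spcond_emb:
 fixes A :: "'k::field mat"
 assumes q: "q < r" and A: "spcond (r - Suc q) A" shows "spcond r (emb r q A)"
proof -
 let ?n = "r - Suc q" and ?k = "Suc q" and ?g = "emb r q A"
 have r: "r = ?n + ?k" using q by simp
 have Ac: "A \<in> carrier_mat (2 * ?n) (2 * ?n)" by (rule spcond_carrier[OF A])
 have gc: "?g \<in> carrier_mat (2*r) (2*r)" by (simp add: emb_def)
 have inn: "mv ?g x (i + ?k) = mv A (\<lambda>j. x (j + ?k)) i" if i: "i < 2 * ?n" for x i
 proof -
  have lt: "i + ?k < 2*r" "i + ?k < 2*r - ?k" using i q by linarith+
  have "mv ?g x (i + ?k) = (\<Sum>b<2*r. ?g $$ (i + ?k, b) * x b)" using lt gc by (simp add: mv_def)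
  also have "\<dots> = (\<Sum>j<2 * ?n. ?g $$ (i + ?k, j + ?k) * x (j + ?k))"
  proof (rule sum_shift)
   fix b assume b: "b < 2*r" "b < ?k \<or> ?k + 2 * ?n \<le> b"
   then have "\<not> (?k \<le> b \<and> b < 2*r - ?k)" "i + ?k \<noteq> b" using q i by linarith+
   then have "?g $$ (i + ?k, b) = 0" using b(1) lt by (auto simp: emb_def)
   then show "?g $$ (i + ?k, b) * x b = 0" by simp
  qed (use q in simp)
  also have "\<dots> = (\<Sum>j<2 * ?n. A $$ (i, j) * x (j + ?k))"
  proof (rule sum.cong[OF refl])
   fix j assume "j \<in> {..<2 * ?n}"
   then have "j < 2 * ?n" by simp
   then have "j + ?k < 2*r" "j + ?k < 2*r - ?k" using q by linarith+
   then show "?g $$ (i + ?k, j + ?k) * x (j + ?k) = A $$ (i, j) * x (j + ?k)" using lt by (simp add: emb_def)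
  qed
  also have "\<dots> = mv A (\<lambda>j. x (j + ?k)) i" using i Ac by (simp add: mv_def)
  finally show ?thesis .
 qed
 have out: "mv ?g x a = x a" if a: "a < 2*r" "\<not> (?k \<le> a \<and> a < 2*r - ?k)" for x a
 proof -
  have "mv ?g x a = (\<Sum>b<2*r. ?g $$ (a, b) * x b)" using a(1) gc by (simp add: mv_def)
  also have "\<dots> = (\<Sum>b<2*r. if b = a then x a else 0)" by (rule sum.cong) (use a in \<open>auto simp: emb_def\<close>)
  finally show ?thesis using a(1) by simp
 qed
 have "om r (mv ?g x) (mv ?g y) = om r x y" for x y
 proof -
  have t: "mv ?g z i = z i" "mv ?g z (2*r - Suc i) = z (2*r - Suc i)" if "i < ?k" for z i
   using that q by (intro out; linarith)+
  have "om r (mv ?g x) (mv ?g y) = (\<Sum>i<?k. x i * y (2*r - Suc i) - x (2*r - Suc i) * y i) + om ?n (\<lambda>j. mv ?g x (j + ?k)) (\<lambda>j. mv ?g y (j + ?k))"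
   using om_split[of ?n ?k "mv ?g x" "mv ?g y"] unfolding r[symmetric] by (simp add: t)
  also have "om ?n (\<lambda>j. mv ?g x (j + ?k)) (\<lambda>j. mv ?g y (j + ?k)) = om ?n (mv A (\<lambda>j. x (j + ?k))) (mv A (\<lambda>j. y (j + ?k)))"
   by (rule om_cong) (simp_all only: inn)
  also have "\<dots> = om ?n (\<lambda>j. x (j + ?k)) (\<lambda>j. y (j + ?k))" by (rule spcond_om[OF A])
  also have "(\<Sum>i<?k. x i * y (2*r - Suc i) - x (2*r - Suc i) * y i) + \<dots> = om r x y"
   using om_split[of ?n ?k x y] unfolding r[symmetric] by simp
  finally show ?thesis .
 qed
 then show ?thesis using gc by (simp add: spcond_iff)
qed

lemma spcond_Sp_incl: assumes "spcond r A" shows "spcond (Suc r) (Sp_incl r A)"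
proof -
 have A: "A \<in> carrier_mat (2*r) (2*r)" by (rule spcond_carrier[OF assms])
 have "Sp_incl r A = emb (Suc r) 0 A"
  by (rule eq_matI) (use Sp_incl_carrier[OF A] in \<open>auto simp: emb_def Sp_incl_entry[OF A]\<close>)
 then show ?thesis using spcond_emb[of 0 "Suc r" A] assms by simp
qed

lemma Sp_incl_mult:
 assumes A: "A \<in> carrier_mat (2*r) (2*r)" and B: "B \<in> carrier_mat (2*r) (2*r)"
 shows "Sp_incl r (A * B) = Sp_incl r A * (Sp_incl r B :: 'k::{field,topological_space} mat)"
proof -
 have C: "four_block_mat A (0\<^sub>m (2*r) 1) (0\<^sub>m 1 (2*r)) (1\<^sub>m 1) * four_block_mat B (0\<^sub>m (2*r) 1) (0\<^sub>m 1 (2*r)) (1\<^sub>m 1)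
   = four_block_mat (A * B) (0\<^sub>m (2*r) 1) (0\<^sub>m 1 (2*r)) (1\<^sub>m 1 :: 'k mat)"
  by (subst mult_four_block_mat[where ?nr1.0 = "2*r" and ?nc1.0 = "2*r" and ?nr2.0 = 1 and ?nc2.0 = 1]) (use A B in auto)
 define A' B' where "A' = four_block_mat A (0\<^sub>m (2*r) 1) (0\<^sub>m 1 (2*r)) (1\<^sub>m 1)"
  and "B' = four_block_mat B (0\<^sub>m (2*r) 1) (0\<^sub>m 1 (2*r)) (1\<^sub>m 1)"
 have c: "A' \<in> carrier_mat (2*r+1) (2*r+1)" "B' \<in> carrier_mat (2*r+1) (2*r+1)"
  unfolding A'_def B'_def using A B by (auto intro!: carrier_matI)
 have "four_block_mat (1\<^sub>m 1) (0\<^sub>m 1 (2*r+1)) (0\<^sub>m (2*r+1) 1) A' * four_block_mat (1\<^sub>m 1) (0\<^sub>m 1 (2*r+1)) (0\<^sub>m (2*r+1) 1) B'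
  = four_block_mat (1\<^sub>m 1) (0\<^sub>m 1 (2*r+1)) (0\<^sub>m (2*r+1) 1) (A' * B')"
  using c by (subst mult_four_block_mat[OF one_carrier_mat zero_carrier_mat zero_carrier_mat c(1) one_carrier_mat zero_carrier_mat zero_carrier_mat c(2)]) simp
 then show ?thesis using A B C by (simp add: Sp_incl_block A'_def B'_def del: One_nat_def)
qed

lemma ascending_series_Sp: "ascending_series (Sp :: nat \<Rightarrow> 'k::efield mat top_group) Sp_incl"
 unfolding ascending_series_def
proof (intro allI conjI lcsc_Sp)
 fix r
 show "Sp_incl r \<in> hom (Sp r) (Sp (Suc r) :: 'k mat top_group)"
  by (auto simp: hom_def carrier_Sp spcond_Sp_incl Sp_incl_mult spcond_carrier)
 let ?T = "gtop (Sp r) :: 'k mat topology" and ?U = "gtop (Sp (Suc r)) :: 'k mat topology"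
 let ?V = "subtopology ?U (Sp_incl r ` topspace ?T)"
 let ?h = "\<lambda>B :: 'k mat. mat (2*r) (2*r) (\<lambda>(a, b). B $$ (Suc a, Suc b))"
 have car: "A \<in> carrier_mat (2*r) (2*r)" if "A \<in> carrier (Sp r)" for A :: "'k mat" and r
  using that by (simp add: carrier_Sp spcond_carrier)
 have inv: "?h (Sp_incl r A) = A" if "A \<in> carrier (Sp r)" for A :: "'k mat"
  using car[OF that] by (auto intro!: eq_matI simp: Sp_incl_entry)
 have "homeomorphic_maps ?T ?V (Sp_incl r) ?h"
  unfolding homeomorphic_maps_def
 proof (intro conjI ballI)
  have "continuous_map ?T ?U (Sp_incl r)"
   unfolding gtop_Sp[of "Suc r"]
  proof (rule continuous_map_into_mat_sub)
   fix A :: "'k mat" assume "A \<in> topspace ?T"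
   then show "Sp_incl r A \<in> carrier_mat (2*Suc r) (2*Suc r) \<inter> carrier (Sp (Suc r))"
    using Sp_incl_carrier[OF car] spcond_Sp_incl by (auto simp: topspace_gtop_Sp carrier_Sp simp del: mult_Suc_right)
  next
   fix i j assume ij: "i < 2*Suc r" "j < 2*Suc r"
   have "continuous_map ?T euclidean (\<lambda>A. if 1 \<le> i \<and> i \<le> 2*r \<and> 1 \<le> j \<and> j \<le> 2*r then A $$ (i - 1, j - 1) else if i = j then 1 else 0)"
    by (auto intro!: continuous_map_gtop_entry)
   then show "continuous_map ?T euclidean (\<lambda>A. Sp_incl r A $$ (i, j))"
    by (rule continuous_map_eq) (use ij in \<open>auto simp: topspace_gtop_Sp Sp_incl_entry[OF car]\<close>)
  qed
  then show "continuous_map ?T ?V (Sp_incl r)"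
   by (simp add: continuous_map_in_subtopology)
  show "continuous_map ?V ?T ?h"
   unfolding gtop_Sp[of r]
  proof (rule continuous_map_into_mat_sub)
   fix B :: "'k mat" assume "B \<in> topspace (subtopology ?U (Sp_incl r ` topspace (mat_sub (2*r) (2*r) (carrier (Sp r)))))"
   then obtain A where "A \<in> carrier (Sp r)" "B = Sp_incl r A" by auto
   then show "?h B \<in> carrier_mat (2*r) (2*r) \<inter> carrier (Sp r)"
    using inv car by auto
  next
   fix i j assume ij: "i < 2*r" "j < 2*r"
   show "continuous_map (subtopology ?U (Sp_incl r ` topspace (mat_sub (2*r) (2*r) (carrier (Sp r))))) euclidean (\<lambda>x. ?h x $$ (i, j))"
    using ij by (auto intro!: continuous_map_from_subtopology continuous_map_gtop_entry)
  qed
  show "?h (Sp_incl r A) = A" if "A \<in> topspace ?T" for A using that inv by (simp add: topspace_gtop_Sp)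
  show "Sp_incl r (?h B) = B" if "B \<in> topspace ?V" for B using that inv by (auto simp: topspace_gtop_Sp)
 qed
 then show "embedding_map ?T ?U (Sp_incl r)"
  unfolding embedding_map_def homeomorphic_map_maps by blast
qed

definition tvm :: "nat \<Rightarrow> ('k::field vect \<times> 'k) list \<Rightarrow> 'k mat" where
 "tvm r ts = mat (2*r) (2*r) (\<lambda>(a, b). tvs r ts (ee b) a)"

lemma tvs_linear: "tvs r ts (x + y) = tvs r ts x + tvs r ts y" "tvs r ts (smul c x) = smul c (tvs r ts x)"
 by (induction ts) (auto simp: tv_linear)

lemma tvs_sum: "finite I ==> tvs r ts (\<Sum>i\<in>I. smul (c i) (x i)) = (\<Sum>i\<in>I. smul (c i) (tvs r ts (x i)))"
proof (induction I rule: finite_induct)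
 case empty
 show ?case unfolding sum.empty using tvs_linear(2)[of r ts 0 0] by (simp only: smul_simps)
qed (simp only: sum.insert tvs_linear simp_thms not_False_eq_True)

lemma tvs_cong:
 assumes "\<And>a. a < 2*r ==> x a = y a" "a < 2*r"
 shows "tvs r ts x a = tvs r ts y a"
 using assms(2)
proof (induction ts arbitrary: a)
 case (Cons p ts)
 have "om r (tvs r ts x) (fst p) = om r (tvs r ts y) (fst p)" by (rule om_cong) (use Cons.IH in auto)
 then show ?case using Cons by (simp add: tv_def)
qed (use assms in simp)

lemma mv_tvm: assumes "a < 2*r" shows "mv (tvm r ts) x a = tvs r ts x a"
proof -
 have "mv (tvm r ts) x a = (\<Sum>b<2*r. smul (x b) (tvs r ts (ee b))) a"
  using assms by (simp add: mv_def tvm_def fun_sum_apply mult.commute)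
 also have "\<dots> = tvs r ts (\<Sum>b<2*r. smul (x b) (ee b)) a" by (simp add: tvs_sum)
 also have "\<dots> = tvs r ts x a"
 proof (rule tvs_cong[OF _ assms])
  fix c assume "c < 2*r"
  have "(\<Sum>b<2*r. smul (x b) (ee b)) c = (\<Sum>b<2*r. if b = c then x b else 0)"
   unfolding fun_sum_apply by (rule sum.cong) (auto simp: ee_apply)
  then show "(\<Sum>b<2*r. smul (x b) (ee b)) c = x c" using \<open>c < 2*r\<close> by simp
 qed
 finally show ?thesis .
qed

lemma spcond_tvm: "spcond r (tvm r ts)"
 unfolding spcond_iff
proof (intro conjI allI)
 fix x y
 have "om r (mv (tvm r ts) x) (mv (tvm r ts) y) = om r (tvs r ts x) (tvs r ts y)"
  by (rule om_cong) (auto simp: mv_tvm)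
 then show "om r (mv (tvm r ts) x) (mv (tvm r ts) y) = om r x y" by simp
qed (simp add: tvm_def)

section \<open>A probability measure on coordinate spaces\<close>

text \<open>A positive integrable density makes Lebesgue measure a probability measure without
  changing its null sets.\<close>

lemma ex_prob_lborel:
 "\<exists>\<nu> :: 'k::euclidean_space measure. prob_space \<nu> \<and> sets \<nu> = sets borel \<and> (\<forall>P. (AE x in \<nu>. P x) \<longleftrightarrow> (AE x in lborel. P x))"
proof -
 obtain h :: "'k \<Rightarrow> ennreal" where h: "h \<in> borel_measurable lborel" "integral\<^sup>N lborel h \<noteq> \<infinity>" "\<And>x. 0 < h x \<and> h x < \<infinity>"
  using sigma_finite_measure.Ex_finite_integrable_function[OF sigma_finite_lborel] by auto
 let ?c = "integral\<^sup>N lborel h"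
 have c0: "?c \<noteq> 0"
 proof
  assume "?c = 0"
  then have "AE x in lborel. h x = 0" using h(1) by (simp add: nn_integral_0_iff_AE)
  moreover have "h x \<noteq> 0" for x using h(3)[of x] by auto
  ultimately have "AE x in lborel :: 'k measure. False" by simp
  then have "emeasure (lborel :: 'k measure) (space lborel) = 0"
   by (simp only: eventually_False ae_filter_eq_bot_iff)
  then show False by simp
 qed
 let ?\<nu> = "density lborel (\<lambda>x. h x / ?c)"
 have m: "(\<lambda>x. h x / ?c) \<in> borel_measurable lborel" using h(1) by measurable
 have pos: "0 < h x / ?c" for x using h(3)[of x] h(2) c0 by (simp add: ennreal_zero_less_divide less_top)
 have "prob_space ?\<nu>"
 proof
  have "emeasure ?\<nu> (space ?\<nu>) = (\<integral>\<^sup>+x. h x / ?c \<partial>lborel)" using m by (simp add: emeasure_density)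
  also have "\<dots> = ?c / ?c" using h(1) by (rule nn_integral_divide)
  also have "\<dots> = 1" using c0 h(2) by (simp add: ennreal_divide_self top.not_eq_extremum)
  finally show "emeasure ?\<nu> (space ?\<nu>) = 1" .
 qed
 moreover have "(AE x in ?\<nu>. P x) \<longleftrightarrow> (AE x in lborel. P x)" for P
  using pos by (simp add: AE_density[OF m])
 ultimately show ?thesis by (intro exI[of _ ?\<nu>]) auto
qed

definition nu :: "'k::euclidean_space measure" where
 "nu = (SOME \<nu>. prob_space \<nu> \<and> sets \<nu> = sets borel \<and> (\<forall>P. (AE x in \<nu>. P x) \<longleftrightarrow> (AE x in lborel. P x)))"

lemma prob_nu: "prob_space (nu :: 'k::euclidean_space measure)" and sets_nu [simp, measurable_cong]: "sets (nu :: 'k measure) = sets borel"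
 and AE_nu: "(AE x in (nu :: 'k measure). P x) \<longleftrightarrow> (AE x in lborel. P x)"
 using someI_ex[OF ex_prob_lborel[where ?'k = 'k]] unfolding nu_def[symmetric] by auto

lemma space_nu [simp]: "space nu = (UNIV :: 'k::euclidean_space set)"
 using sets_eq_imp_space_eq[OF sets_nu] by simp

lemma AE_nu_translate: assumes "AE x in (nu :: 'k::euclidean_space measure). P x" shows "AE x in nu. P (x + y)"
proof -
 have "AE x in lborel. P x" using assms by (simp add: AE_nu)
 then have "AE x in distr lborel borel ((+) y). P x" by (simp only: lborel_distr_plus)
 from AE_distrD[OF _ this] have "AE x in lborel. P (y + x)" by simp
 then show ?thesis by (simp add: AE_nu add.commute)
qed

lemma AE_nu_finite: "finite S ==> AE x in (nu :: 'k::euclidean_space measure). x \<notin> S"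
 unfolding AE_nu by (rule AE_not_in[OF finite_imp_null_set_lborel])

definition PP :: "'i set \<Rightarrow> ('i \<Rightarrow> 'k::euclidean_space) measure" where
 "PP I = PiM I (\<lambda>_. nu)"

lemma prob_PP: "prob_space (PP I)"
 unfolding PP_def by (rule prob_space_PiM) (rule prob_nu)

lemma space_PP: "space (PP I) = extensional I"
 by (auto simp: PP_def space_PiM PiE_def)

lemma measurable_PP_component [measurable (raw)]: "i \<in> I ==> (\<lambda>x. x i) \<in> borel_measurable (PP I)"
 unfolding PP_def using measurable_component_singleton[of i I "\<lambda>_. nu"] by (simp add: measurable_cong_sets[OF refl sets_nu])

lemma measurable_PP_I:
 assumes "\<And>i. i \<in> I ==> (\<lambda>x. f x i) \<in> borel_measurable M" "\<And>x. x \<in> space M ==> f x \<in> extensional I"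
 shows "f \<in> M \<rightarrow>\<^sub>M PP I"
 unfolding PP_def
proof (rule measurable_PiM_single')
 show "f \<in> space M \<rightarrow> (\<Pi>\<^sub>E i\<in>I. space nu)" using assms(2) by (auto simp: PiE_def)
qed (use assms(1) in \<open>simp add: measurable_cong_sets[OF refl sets_nu]\<close>)

text \<open>Together with \<open>AE_pick\<close> a recurring device: if for each \<open>x\<close> a
  condition holds for a.e. \<open>y\<close>, then some single \<open>y\<close> makes it hold for
  a.e. \<open>x\<close>.\<close>

lemma fubini_pick:
 assumes "prob_space M1" "prob_space M2" "A \<in> sets (M1 \<Otimes>\<^sub>M M2)"
  and ae: "AE x in M1. AE y in M2. (x, y) \<notin> A"
 shows "AE y in M2. AE x in M1. (x, y) \<notin> A"
proof -
 interpret M1: prob_space M1 by fact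
 interpret M2: prob_space M2 by fact
 interpret pair_sigma_finite M1 M2 ..
 have "{x \<in> space (M1 \<Otimes>\<^sub>M M2). (fst x, snd x) \<notin> A} = space (M1 \<Otimes>\<^sub>M M2) - A" by auto
 then have "{x \<in> space (M1 \<Otimes>\<^sub>M M2). (fst x, snd x) \<notin> A} \<in> sets (M1 \<Otimes>\<^sub>M M2)" using assms(3) by simp
 from AE_commute[OF this] ae show ?thesis by simp
qed

lemma AE_pick: assumes "prob_space M" "AE x in M. P x" obtains x where "x \<in> space M" "P x"
proof -
 interpret prob_space M by fact
 show ?thesis
 proof (rule ccontr)
  assume n: "\<not> thesis"
  have "AE x in M. False" by (rule AE_mp[OF assms(2)], rule AE_I2) (use that n in blast)
  then show False by simp
 qed
qed

text \<open>Null sets of a finite product treated one coordinate at a time, as preparation for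
  inductions over the index set.\<close>

lemma AE_PP_insert:
 assumes I: "finite I" "i \<notin> I" and A: "A \<in> sets (PP (insert i I))"
 shows "(AE z in PP (insert i I). z \<notin> A) \<longleftrightarrow> (AE x in PP I. AE t in nu. x(i := t) \<notin> A)"
  "{x \<in> space (PP I). \<not> (AE t in nu. x(i := t) \<notin> A)} \<in> sets (PP I)"
proof -
 interpret N: prob_space "nu :: 'b measure" by (rule prob_nu)
 interpret product_sigma_finite "\<lambda>_::'a. nu :: 'b measure" ..
 have up: "(\<lambda>(x, t). x(i := t)) \<in> PP I \<Otimes>\<^sub>M nu \<rightarrow>\<^sub>M PP (insert i I)"
  unfolding PP_def using measurable_add_dim[of i I "\<lambda>_. nu"] by simp
 have ind: "(\<lambda>(x, t). indicator A (x(i := t)) :: ennreal) \<in> borel_measurable (PP I \<Otimes>\<^sub>M nu)"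
  using measurable_compose[OF up borel_measurable_indicator[OF A]] by (simp add: split_beta')
 have m: "(\<lambda>x. \<integral>\<^sup>+t. indicator A (x(i := t)) \<partial>nu :: ennreal) \<in> borel_measurable (PP I)"
  using N.borel_measurable_nn_integral_fst[OF ind] by simp
 have sec: "(\<lambda>t. indicator A (x(i := t)) :: ennreal) \<in> borel_measurable nu" if "x \<in> space (PP I)" for x
  using measurable_compose[OF measurable_Pair1' [OF that] ind] by simp
 have 1: "((\<integral>\<^sup>+t. indicator A (x(i := t)) \<partial>nu) = (0 :: ennreal)) \<longleftrightarrow> (AE t in nu. x(i := t) \<notin> A)" if "x \<in> space (PP I)" for x
  using sec[OF that] by (subst nn_integral_0_iff_AE) (auto simp: indicator_def)
 have "{x \<in> space (PP I). \<not> (AE t in nu. x(i := t) \<notin> A)} = {x \<in> space (PP I). (\<integral>\<^sup>+t. indicator A (x(i := t)) \<partial>nu) \<noteq> (0 :: ennreal)}"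
  using 1 by auto
 then show "{x \<in> space (PP I). \<not> (AE t in nu. x(i := t) \<notin> A)} \<in> sets (PP I)" using m by simp
 have "(AE z in PP (insert i I). z \<notin> A) \<longleftrightarrow> (\<integral>\<^sup>+z. indicator A z \<partial>PP (insert i I)) = (0 :: ennreal)"
  using A by (subst nn_integral_0_iff_AE) (auto simp: indicator_def)
 also have "(\<integral>\<^sup>+z. indicator A z \<partial>PP (insert i I)) = (\<integral>\<^sup>+x. \<integral>\<^sup>+t. indicator A (x(i := t)) \<partial>nu \<partial>PP I :: ennreal)"
  unfolding PP_def by (rule product_nn_integral_insert[OF I]) (use A in \<open>simp add: PP_def\<close>)
 also have "\<dots> = 0 \<longleftrightarrow> (AE x in PP I. (\<integral>\<^sup>+t. indicator A (x(i := t)) \<partial>nu) = (0 :: ennreal))"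
  using m by (rule nn_integral_0_iff_AE)
 also have "\<dots> \<longleftrightarrow> (AE x in PP I. AE t in nu. x(i := t) \<notin> A)"
  using 1 by (intro AE_cong) auto
 finally show "(AE z in PP (insert i I). z \<notin> A) \<longleftrightarrow> (AE x in PP I. AE t in nu. x(i := t) \<notin> A)" .
qed

definition padd :: "'i set \<Rightarrow> ('i \<Rightarrow> 'k::euclidean_space) \<Rightarrow> ('i \<Rightarrow> 'k) \<Rightarrow> 'i \<Rightarrow> 'k" where
 "padd I x y = restrict (\<lambda>i. x i + y i) I"

lemma PP_translate:
 assumes "finite I" "A \<in> sets (PP I)" "AE x in PP I. x \<notin> A"
 shows "AE x in PP I. padd I x y \<notin> A"
 using assms
proof (induction I arbitrary: A rule: finite_induct)
 case empty
 have "padd {} x y = x" if "x \<in> space (PP {})" for x using that by (auto simp: padd_def space_PP extensional_def)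
 then show ?case using empty(2) by (auto elim: AE_mp)
next
 case (insert i I)
 let ?B = "{x \<in> space (PP I). \<not> (AE t in nu. x(i := t) \<notin> A)}"
 have "AE x in PP I. x \<notin> ?B" using AE_PP_insert(1)[OF insert(1,2,4)] insert(5) by auto
 from insert.IH[OF AE_PP_insert(2)[OF insert(1,2,4)] this]
 have "AE x in PP I. padd I x y \<notin> ?B" .
 moreover have "padd I x y \<in> space (PP I)" for x by (simp add: padd_def space_PP)
 ultimately have ae0: "AE x in PP I. AE t in nu. (padd I x y)(i := t) \<notin> A" by simp
 have "AE x in PP I. AE t in nu. (padd I x y)(i := t + y i) \<notin> A"
  using ae0
 proof (rule eventually_mono)
  fix x assume "AE t in nu. (padd I x y)(i := t) \<notin> A"
  from AE_nu_translate[OF this, of "y i"] show "AE t in nu. (padd I x y)(i := t + y i) \<notin> A" .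
 qed
 moreover have "(padd I x y)(i := t + y i) = padd (insert i I) (x(i := t)) y" for x t
  using insert(2) by (auto simp: padd_def fun_eq_iff)
 ultimately have ae: "AE x in PP I. AE t in nu. padd (insert i I) (x(i := t)) y \<notin> A" by simp
 let ?A' = "(\<lambda>x. padd (insert i I) x y) -` A \<inter> space (PP (insert i I))"
 have "(\<lambda>x. padd (insert i I) x y) \<in> PP (insert i I) \<rightarrow>\<^sub>M PP (insert i I)"
  by (rule measurable_PP_I) (auto simp: padd_def)
 then have A': "?A' \<in> sets (PP (insert i I))" using insert.prems(1) by (rule measurable_sets)
 have "AE x in PP I. AE t in nu. x(i := t) \<notin> ?A'" using ae by (auto elim!: AE_mp)
 then have "AE x in PP (insert i I). x \<notin> ?A'" using AE_PP_insert(1)[OF insert(1,2) A'] by simp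
 then show ?case by (auto elim!: AE_mp)
qed

text \<open>Takes the place of a change of variables. For every \<open>x\<close>, the sum of
  \<open>B x\<close> and \<open>y\<close> avoids \<open>A\<close> for a.e. \<open>y\<close>; Fubini
  fixes one \<open>y\<close>, which is \<open>B z\<close> by surjectivity. So \<open>B\<close> at
  the translate of \<open>x\<close> by \<open>z\<close> avoids \<open>A\<close> for a.e.
  \<open>x\<close>, and translating back gives the claim.\<close>

lemma PP_additive:
 fixes B :: "('i \<Rightarrow> 'k::euclidean_space) \<Rightarrow> 'i \<Rightarrow> 'k"
 assumes I: "finite I" and A: "A \<in> sets (PP I)" "AE x in PP I. x \<notin> A"
  and B: "B \<in> PP I \<rightarrow>\<^sub>M PP I" and add: "\<And>x y. B (padd I x y) = padd I (B x) (B y)"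
  and surj: "\<And>y. y \<in> space (PP I) ==> \<exists>z\<in>space (PP I). B z = y"
 shows "AE x in PP I. B x \<notin> A"
proof -
 let ?A = "(\<lambda>(x, y). padd I (B x) y) -` A \<inter> space (PP I \<Otimes>\<^sub>M PP I)"
 have "(\<lambda>(x, y). padd I (B x) y) \<in> PP I \<Otimes>\<^sub>M PP I \<rightarrow>\<^sub>M PP I"
 proof (rule measurable_PP_I)
  fix i assume i: "i \<in> I"
  have "(\<lambda>p. B (fst p) i + snd p i) \<in> borel_measurable (PP I \<Otimes>\<^sub>M PP I)"
   using measurable_compose[OF measurable_compose[OF measurable_fst B] measurable_PP_component[OF i]]
    measurable_compose[OF measurable_snd measurable_PP_component[OF i]] by (rule borel_measurable_add)
  then show "(\<lambda>x. (case x of (x, y) \<Rightarrow> padd I (B x) y) i) \<in> borel_measurable (PP I \<Otimes>\<^sub>M PP I)"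
   using i by (simp add: padd_def split_beta')
 qed (auto simp: padd_def)
 then have mA: "?A \<in> sets (PP I \<Otimes>\<^sub>M PP I)" using A(1) by (rule measurable_sets)
 have comm: "padd I x y = padd I y x" for x y :: "'i \<Rightarrow> 'k" by (simp add: padd_def add.commute)
 have "AE x in PP I. AE y in PP I. (x, y) \<notin> ?A"
 proof (rule AE_I2)
  fix x :: "'i \<Rightarrow> 'k" assume "x \<in> space (PP I)"
  have "AE y in PP I. padd I y (B x) \<notin> A" by (rule PP_translate[OF I A])
  then show "AE y in PP I. (x, y) \<notin> ?A" by (auto elim!: AE_mp simp: comm)
 qed
 from fubini_pick[OF prob_PP prob_PP mA this]
 obtain y where y: "y \<in> space (PP I)" "AE x in PP I. (x, y) \<notin> ?A" by (rule AE_pick[OF prob_PP])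
 obtain z where z: "z \<in> space (PP I)" "B z = y" using surj[OF y(1)] by auto
 let ?C = "B -` A \<inter> space (PP I)"
 have C: "?C \<in> sets (PP I)" using B A(1) by (rule measurable_sets)
 have mz: "(\<lambda>x. padd I x z) \<in> PP I \<rightarrow>\<^sub>M PP I" by (rule measurable_PP_I) (auto simp: padd_def)
 let ?D = "(\<lambda>x. padd I x z) -` ?C \<inter> space (PP I)"
 have D: "?D \<in> sets (PP I)" using mz C by (rule measurable_sets)
 have "AE x in PP I. x \<notin> ?D"
 proof (rule AE_mp[OF y(2)], rule AE_I2, rule impI)
  fix x assume x: "x \<in> space (PP I)" "(x, y) \<notin> ?A"
  then have "padd I (B x) y \<notin> A" using y(1) by (auto simp: space_pair_measure)
  then show "x \<notin> ?D" by (auto simp: add z(2))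
 qed
 from PP_translate[OF I D this, of "\<lambda>i. - z i"]
 have *: "AE x in PP I. padd I x (\<lambda>i. - z i) \<notin> ?D" .
 show ?thesis
 proof (rule AE_mp[OF *], rule AE_I2, rule impI)
  fix x assume x: "x \<in> space (PP I)" "padd I x (\<lambda>i. - z i) \<notin> ?D"
  have "padd I (padd I x (\<lambda>i. - z i)) z = x" using x(1) by (auto simp: padd_def space_PP extensional_def fun_eq_iff)
  moreover have "padd I x (\<lambda>i. - z i) \<in> space (PP I)" by (simp add: padd_def space_PP)
  ultimately show "B x \<notin> A" using x by auto
 qed
qed

section \<open>Polynomial functions\<close>

definition polyfun :: "('k::field \<Rightarrow> 'k) \<Rightarrow> bool" where
 "polyfun f \<longleftrightarrow> (\<exists>p. \<forall>t. f t = poly p t)"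

lemma polyfun_const [intro, simp]: "polyfun (\<lambda>t. c)"
 unfolding polyfun_def by (rule exI[of _ "[:c:]"]) simp
lemma polyfun_id [intro, simp]: "polyfun (\<lambda>t. t)"
 unfolding polyfun_def by (rule exI[of _ "[:0,1:]"]) simp
lemma polyfun_add [intro]: "polyfun f ==> polyfun g ==> polyfun (\<lambda>t. f t + g t)"
 unfolding polyfun_def by (metis poly_add)
lemma polyfun_diff [intro]: "polyfun f ==> polyfun g ==> polyfun (\<lambda>t. f t - g t)"
 unfolding polyfun_def by (metis poly_diff)
lemma polyfun_mult [intro]: "polyfun f ==> polyfun g ==> polyfun (\<lambda>t. f t * g t)"
 unfolding polyfun_def by (metis poly_mult)
lemma polyfun_sum [intro]: "(\<And>i. i \<in> I ==> polyfun (f i)) ==> polyfun (\<lambda>t. \<Sum>i\<in>I. f i t)"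
 by (induction I rule: infinite_finite_induct) auto
lemma polyfun_finite_zeros:
 assumes "polyfun f" "f t0 \<noteq> 0" shows "finite {t. f t = 0}"
proof -
 obtain p where p: "\<And>t. f t = poly p t" using assms(1) by (auto simp: polyfun_def)
 then have "p \<noteq> 0" using assms(2) by auto
 then show ?thesis using poly_roots_finite[of p] by (simp add: p)
qed

text \<open>Induction over the coordinates: with coordinate \<open>i\<close> frozen at its value in
  \<open>x0\<close>, the function is nonzero for almost all values of the others; for each such
  choice it is a nonzero polynomial in coordinate \<open>i\<close>, with finitely many
  zeros.\<close>

lemma PP_poly_nonzero:
 fixes Q :: "('i \<Rightarrow> 'k::efield) \<Rightarrow> 'k"
 assumes "finite I" "Q \<in> borel_measurable (PP I)" "\<And>x i. polyfun (\<lambda>t. Q (x(i := t)))"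
  "x0 \<in> space (PP I)" "Q x0 \<noteq> 0"
 shows "AE x in PP I. Q x \<noteq> 0"
 using assms
proof (induction I arbitrary: Q x0 rule: finite_induct)
 case empty
 have "x = x0" if "x \<in> space (PP {})" for x using that empty(3) by (auto simp: space_PP)
 then show ?case using empty(4) by (intro AE_I2) auto
next
 case (insert i I)
 let ?Q = "\<lambda>x. Q (x(i := x0 i))" and ?x0 = "x0(i := undefined)"
 have up: "(\<lambda>x. x(i := t)) \<in> PP I \<rightarrow>\<^sub>M PP (insert i I)" for t
  by (rule measurable_PP_I) (auto simp: space_PP extensional_def)
 have "AE x in PP I. ?Q x \<noteq> 0"
 proof (rule insert.IH)
  show "?Q \<in> borel_measurable (PP I)" using measurable_compose[OF up insert.prems(1)] .
  show "polyfun (\<lambda>t. ?Q (x(j := t)))" for x j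
  proof (cases "j = i")
   case False
   then show ?thesis using insert.prems(2)[of "x(i := x0 i)" j] by (simp only: fun_upd_twist[OF False])
  qed simp
  show "?x0 \<in> space (PP I)" using insert.prems(3) insert(2) by (auto simp: space_PP extensional_def)
 qed (use insert.prems(4) in \<open>simp only: fun_upd_upd fun_upd_triv simp_thms not_False_eq_True\<close>)
 then have "AE x in PP I. AE t in nu. Q (x(i := t)) \<noteq> 0"
 proof (rule eventually_mono)
  fix x assume "?Q x \<noteq> 0"
  from AE_nu_finite[OF polyfun_finite_zeros[OF insert.prems(2), OF this]]
  show "AE t in nu. Q (x(i := t)) \<noteq> 0" by (simp only: mem_Collect_eq)
 qed
 moreover have A: "{x \<in> space (PP (insert i I)). Q x = 0} \<in> sets (PP (insert i I))" using insert.prems(1) by measurable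
 ultimately have "AE x in PP (insert i I). x \<notin> {x \<in> space (PP (insert i I)). Q x = 0}"
  unfolding AE_PP_insert(1)[OF insert(1,2) A] by (auto elim!: AE_mp)
 then show ?case by (auto elim!: AE_mp)
qed

section \<open>A quasi-invariant probability measure on the symplectic group\<close>

definition pj :: "nat \<Rightarrow> 'k::field vect \<Rightarrow> 'k vect \<Rightarrow> 'k vect \<Rightarrow> nat \<Rightarrow> 'k" where
 "pj r a b x = smul (om r a b) x - smul (om r x b) a - smul (om r a x) b"

text \<open>The projection is scaled so as to be polynomial; a pivot \<open>0\<close> spoils the result, hence \<open>piv\<close>.\<close>

primrec gs :: "nat \<Rightarrow> nat \<Rightarrow> (nat \<Rightarrow> 'k::field vect \<times> 'k vect) \<Rightarrow> 'k frame" where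
 "gs r 0 z = []"
| "gs r (Suc n) z = (fst (z 0), smul (inverse (om r (fst (z 0)) (snd (z 0)))) (snd (z 0))) #
   gs r n (\<lambda>i. map_prod (pj r (fst (z 0)) (snd (z 0))) (pj r (fst (z 0)) (snd (z 0))) (z (Suc i)))"

primrec piv :: "nat \<Rightarrow> nat \<Rightarrow> (nat \<Rightarrow> 'k::field vect \<times> 'k vect) \<Rightarrow> 'k" where
 "piv r 0 z = 1"
| "piv r (Suc n) z = om r (fst (z 0)) (snd (z 0)) *
   piv r n (\<lambda>i. map_prod (pj r (fst (z 0)) (snd (z 0))) (pj r (fst (z 0)) (snd (z 0))) (z (Suc i)))"

lemma length_gs [simp]: "length (gs r n z) = n"
 by (induction n arbitrary: z) auto

lemma om_pj [simp]: "om r a (pj r a b x) = 0" "om r b (pj r a b x) = 0"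
 by (simp_all add: pj_def om_anti[of r b x] om_anti[of r b a] algebra_simps)

lemma pj_in: "subsp W ==> a \<in> W ==> b \<in> W ==> x \<in> W ==> pj r a b x \<in> W"
 unfolding pj_def by (intro subsp_diff) (auto simp: subsp_def)

lemma pvs_gs:
 assumes "subsp W" "\<And>i. i < n ==> fst (z i) \<in> W \<and> snd (z i) \<in> W"
 shows "pvs (gs r n z) \<subseteq> W"
 using assms(2)
proof (induction n arbitrary: z)
 case (Suc n)
 have W: "fst (z i) \<in> W" "snd (z i) \<in> W" if "i < Suc n" for i using Suc.prems that by auto
 have "pvs (gs r n (\<lambda>i. map_prod (pj r (fst (z 0)) (snd (z 0))) (pj r (fst (z 0)) (snd (z 0))) (z (Suc i)))) \<subseteq> W"
  by (rule Suc.IH) (simp add: pj_in assms(1) W)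
 moreover have "smul (inverse (om r (fst (z 0)) (snd (z 0)))) (snd (z 0)) \<in> W"
  using assms(1) W[of 0] by (auto simp: subsp_def)
 ultimately show ?case using W[of 0] by simp
qed simp

lemma hfl_gs: "piv r n z \<noteq> 0 ==> hfl r (gs r n z)"
proof (induction n arbitrary: z)
 case (Suc n)
 let ?a = "fst (z 0)" and ?b = "snd (z 0)"
 let ?z = "\<lambda>i. map_prod (pj r ?a ?b) (pj r ?a ?b) (z (Suc i))"
 have ab: "om r ?a ?b \<noteq> 0" and h: "hfl r (gs r n ?z)" using Suc.prems Suc.IH[of ?z] by auto
 have "pvs (gs r n ?z) \<subseteq> perp r {?a, ?b}" by (rule pvs_gs[OF subsp_perp]) (simp add: perp_def)
 then have p: "om r ?a x = 0 \<and> om r ?b x = 0" if "x \<in> pvs (gs r n ?z)" for x using that by (auto simp: perp_def)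
 have "orthp r (?a, smul (inverse (om r ?a ?b)) ?b) q" if "q \<in> set (gs r n ?z)" for q
  using p[of "fst q"] p[of "snd q"] that by (auto simp: orthp_def pvs_def)
 then show ?case using ab h by (simp add: hfl_def)
qed simp

text \<open>Each step uses only values of the form and linear combinations with such values as
  coefficients.\<close>

lemma gs_equivariant:
 assumes T: "\<And>x y. om r (mv g x) (mv g y) = om r x y"
 shows "gs r n (\<lambda>i. map_prod (mv g) (mv g) (z i)) = map (map_prod (mv g) (mv g)) (gs r n z)"
  "piv r n (\<lambda>i. map_prod (mv g) (mv g) (z i)) = piv r n z"
proof -
 have pj: "pj r (mv g a) (mv g b) (mv g x) = mv g (pj r a b x)" for a b x
  by (simp only: pj_def T mv_diff mv_smul)
 have mp: "map_prod (pj r (mv g a) (mv g b)) (pj r (mv g a) (mv g b)) (map_prod (mv g) (mv g) p)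
  = map_prod (mv g) (mv g) (map_prod (pj r a b) (pj r a b) p)" for a b p
  by (cases p) (simp only: map_prod_simp pj)
 show "gs r n (\<lambda>i. map_prod (mv g) (mv g) (z i)) = map (map_prod (mv g) (mv g)) (gs r n z)"
 proof (induction n arbitrary: z)
  case (Suc n)
  show ?case by (simp only: gs.simps fst_map_prod snd_map_prod T mp Suc.IH list.map map_prod_simp mv_smul)
 qed simp
 show "piv r n (\<lambda>i. map_prod (mv g) (mv g) (z i)) = piv r n z"
 proof (induction n arbitrary: z)
  case (Suc n)
  show ?case by (simp only: piv.simps fst_map_prod snd_map_prod T mp Suc.IH)
 qed simp
qed

text \<open>Provides the point at which the polynomial \<open>piv\<close> does not vanish.\<close>

lemma piv_hfl:
 assumes "hfl r (map z [0..<n])" shows "piv r n z = 1"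
 using assms
proof (induction n arbitrary: z)
 case (Suc n)
 let ?a = "fst (z 0)" and ?b = "snd (z 0)"
 have e: "map z [0..<Suc n] = z 0 # map (\<lambda>i. z (Suc i)) [0..<n]"
  by (simp only: upt_conv_Cons[of 0 "Suc n"] zero_less_Suc list.map map_Suc_upt[symmetric] map_map comp_def)
 have ab: "om r ?a ?b = 1" and o: "\<And>i. i < n ==> orthp r (z 0) (z (Suc i))" and h: "hfl r (map (\<lambda>i. z (Suc i)) [0..<n])"
  using Suc.prems unfolding e hfl_def by auto
 have pj: "pj r ?a ?b x = x" if "om r ?a x = 0" "om r ?b x = 0" for x
 proof -
  have "om r x ?b = 0" using that(2) om_anti[of r x ?b] by simp
  then show ?thesis using that by (simp add: pj_def ab)
 qed
 have "map_prod (pj r ?a ?b) (pj r ?a ?b) (z (Suc i)) = z (Suc i)" if "i < n" for i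
  using o[OF that] by (cases "z (Suc i)") (simp add: orthp_def pj)
 then have *: "map (\<lambda>i. map_prod (pj r ?a ?b) (pj r ?a ?b) (z (Suc i))) [0..<n] = map (\<lambda>i. z (Suc i)) [0..<n]" by simp
 have "piv r n (\<lambda>i. map_prod (pj r ?a ?b) (pj r ?a ?b) (z (Suc i))) = 1" by (rule Suc.IH) (simp only: * h)
 then show ?case by (simp add: ab)
qed simp

text \<open>A pair occupies the columns \<open>c\<close> and \<open>2*r - 1 - c\<close>, in
  accordance with the pairing of coordinates.\<close>

definition frame_mat :: "nat \<Rightarrow> ((nat \<Rightarrow> 'k::zero) \<times> 'k vect) list \<Rightarrow> 'k mat" where
 "frame_mat r fs = mat (2*r) (2*r) (\<lambda>(a, c). if c < r then fst (fs ! c) a else snd (fs ! (2*r - Suc c)) a)"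

lemma frame_mat_carrier [simp]: "frame_mat r fs \<in> carrier_mat (2*r) (2*r)"
 by (simp add: frame_mat_def)

lemma colf_frame_mat: "a < 2*r ==> c < 2*r ==> colf (frame_mat r fs) c a = (if c < r then fst (fs ! c) a else snd (fs ! (2*r - Suc c)) a)"
 by (simp add: colf_def frame_mat_def)

lemma hfl_om:
 assumes "hfl r fs" "i < length fs" "j < length fs"
 shows "om r (fst (fs!i)) (fst (fs!j)) = 0" "om r (snd (fs!i)) (snd (fs!j)) = 0"
  "om r (fst (fs!i)) (snd (fs!j)) = (if i = j then 1 else 0)"
  "om r (snd (fs!i)) (fst (fs!j)) = (if i = j then - 1 else 0)"
proof -
 have h: "om r (fst (fs!i)) (fst (fs!j)) = 0 \<and> om r (fst (fs!i)) (snd (fs!j)) = 0 \<and>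
    om r (snd (fs!i)) (fst (fs!j)) = 0 \<and> om r (snd (fs!i)) (snd (fs!j)) = 0"
  if "i < j" "j < length fs" for i j using assms(1) that unfolding hfl_nth by blast
 have d: "om r (fst (fs!i)) (snd (fs!i)) = 1" if "i < length fs" for i using assms(1) that unfolding hfl_nth by blast
 have "om r (fst (fs!i)) (fst (fs!j)) = 0 \<and> om r (snd (fs!i)) (snd (fs!j)) = 0 \<and>
  om r (fst (fs!i)) (snd (fs!j)) = (if i = j then 1 else 0) \<and>
  om r (snd (fs!i)) (fst (fs!j)) = (if i = j then - 1 else 0)"
 proof -
  consider "i < j" | "i = j" | "j < i" by linarith
  then show ?thesis
  proof cases
   case 1
   then show ?thesis using h[of i j] assms(3) by simp
  next
   case 2
   have "om r (snd (fs!j)) (fst (fs!j)) = - om r (fst (fs!j)) (snd (fs!j))" by (rule om_anti)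
   then show ?thesis using 2 d[of j] assms(3) by simp
  next
   case 3
   have "om r (fst (fs!i)) (fst (fs!j)) = - om r (fst (fs!j)) (fst (fs!i))" "om r (snd (fs!i)) (snd (fs!j)) = - om r (snd (fs!j)) (snd (fs!i))"
    "om r (fst (fs!i)) (snd (fs!j)) = - om r (snd (fs!j)) (fst (fs!i))" "om r (snd (fs!i)) (fst (fs!j)) = - om r (fst (fs!j)) (snd (fs!i))"
    by (rule om_anti)+
   then show ?thesis using 3 h[of j i] assms(2) by simp
  qed
 qed
 then show "om r (fst (fs!i)) (fst (fs!j)) = 0" "om r (snd (fs!i)) (snd (fs!j)) = 0"
  "om r (fst (fs!i)) (snd (fs!j)) = (if i = j then 1 else 0)"
  "om r (snd (fs!i)) (fst (fs!j)) = (if i = j then - 1 else 0)" by blast+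
qed

lemma spcond_frame_mat:
 assumes "hfl r fs" "length fs = r" shows "spcond r (frame_mat r fs)"
 unfolding spcond_def
proof (intro conjI allI impI frame_mat_carrier)
 fix i j assume ij: "i < 2*r" "j < 2*r"
 have "om r (colf (frame_mat r fs) i) (colf (frame_mat r fs) j)
  = om r (if i < r then fst (fs ! i) else snd (fs ! (2*r - Suc i))) (if j < r then fst (fs ! j) else snd (fs ! (2*r - Suc j)))"
  by (rule om_cong) (use ij in \<open>auto simp: colf_frame_mat\<close>)
 also have "\<dots> = om r (ee i) (ee j)"
  using ij assms(2) by (auto simp: om_ee_all hfl_om[OF assms(1)])
 finally show "om r (colf (frame_mat r fs) i) (colf (frame_mat r fs) j) = om r (ee i) (ee j)" .
qed

lemma frame_mat_map:
 fixes g :: "'k::field mat"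
 assumes "g \<in> carrier_mat (2*r) (2*r)" "length fs = r"
 shows "frame_mat r (map (map_prod (mv g) (mv g)) fs) = g * frame_mat r fs"
proof (rule eq_matI)
 fix a c assume "a < dim_row (g * frame_mat r fs)" "c < dim_col (g * frame_mat r fs)"
 then have ac: "a < 2*r" "c < 2*r" using assms by (auto simp: frame_mat_def)
 have "(g * frame_mat r fs) $$ (a, c) = (\<Sum>b<2*r. g $$ (a, b) * frame_mat r fs $$ (b, c))"
  by (rule mult_entry[OF assms(1) frame_mat_carrier ac])
 also have "\<dots> = frame_mat r (map (map_prod (mv g) (mv g)) fs) $$ (a, c)"
  using ac assms by (auto simp: frame_mat_def mv_def intro!: sum.cong)
 finally show "frame_mat r (map (map_prod (mv g) (mv g)) fs) $$ (a, c) = (g * frame_mat r fs) $$ (a, c)" by simp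
qed (use assms in \<open>auto simp: frame_mat_def\<close>)

definition II :: "nat \<Rightarrow> (nat \<times> nat) set" where "II r = {..<2*r} \<times> {..<2*r}"

definition zv :: "nat \<Rightarrow> (nat \<times> nat \<Rightarrow> 'k::zero) \<Rightarrow> nat \<Rightarrow> nat \<Rightarrow> 'k" where
 "zv r Z c = (\<lambda>a. if a < 2*r \<and> c < 2*r then Z (a, c) else 0)"

definition zp :: "nat \<Rightarrow> (nat \<times> nat \<Rightarrow> 'k::zero) \<Rightarrow> nat \<Rightarrow> 'k vect \<times> 'k vect" where
 "zp r Z i = (zv r Z (2*i), zv r Z (Suc (2*i)))"

text \<open>The default keeps the values in the group; it is taken on a null set only
  (\<open>AE_piv\<close>).\<close>

definition gsm :: "nat \<Rightarrow> (nat \<times> nat \<Rightarrow> 'k::field) \<Rightarrow> 'k mat" where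
 "gsm r Z = (if piv r r (zp r Z) = 0 then 1\<^sub>m (2*r) else frame_mat r (gs r r (zp r Z)))"

lemma spcond_gsm: "spcond r (gsm r Z)"
 by (simp add: gsm_def spcond_one spcond_frame_mat hfl_gs)

definition lmul :: "nat \<Rightarrow> 'k::field mat \<Rightarrow> (nat \<times> nat \<Rightarrow> 'k) \<Rightarrow> nat \<times> nat \<Rightarrow> 'k" where
 "lmul r g Z = restrict (\<lambda>(a, c). \<Sum>b<2*r. g $$ (a, b) * Z (b, c)) (II r)"

lemma zv_lmul: "g \<in> carrier_mat (2*r) (2*r) ==> zv r (lmul r g Z) c = mv g (zv r Z c)"
 by (auto simp: zv_def lmul_def II_def mv_def fun_eq_iff intro!: sum.cong)

lemma gsm_lmul:
 assumes "spcond r g" "piv r r (zp r Z) \<noteq> 0"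
 shows "gsm r (lmul r g Z) = g * gsm r Z"
proof -
 have g: "g \<in> carrier_mat (2*r) (2*r)" using assms(1) by (simp add: spcond_def)
 have z: "zp r (lmul r g Z) = (\<lambda>i. map_prod (mv g) (mv g) (zp r Z i))"
  by (rule ext) (simp only: zp_def zv_lmul[OF g] map_prod_simp)
 show ?thesis using assms(2)
  by (simp add: gsm_def z gs_equivariant[OF spcond_om[OF assms(1)]] frame_mat_map[OF g])
qed

subsection \<open>Polynomial and measurable dependence\<close>

lemma polyfun_om: "(\<And>a. polyfun (\<lambda>t. x t a)) ==> (\<And>a. polyfun (\<lambda>t. y t a)) ==> polyfun (\<lambda>t. om r (x t) (y t))"
 unfolding om_def by (intro polyfun_sum polyfun_diff polyfun_mult)

lemma measurable_om:
 fixes x y :: "'z \<Rightarrow> nat \<Rightarrow> 'k::{real_normed_field,second_countable_topology}"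
 shows "(\<And>a. (\<lambda>t. x t a) \<in> borel_measurable M) ==> (\<And>a. (\<lambda>t. y t a) \<in> borel_measurable M) ==> (\<lambda>t. om r (x t) (y t)) \<in> borel_measurable M"
 unfolding om_def by (intro borel_measurable_sum borel_measurable_diff borel_measurable_times)

lemma polyfun_pj:
 assumes "\<And>a. polyfun (\<lambda>t. x t a)" "\<And>a. polyfun (\<lambda>t. y t a)" "\<And>a. polyfun (\<lambda>t. u t a)"
 shows "polyfun (\<lambda>t. pj r (x t) (y t) (u t) a)"
 unfolding pj_def minus_apply smul_apply by (intro polyfun_diff polyfun_mult polyfun_om assms)

lemma measurable_pj:
 fixes x y u :: "'z \<Rightarrow> nat \<Rightarrow> 'k::{real_normed_field,second_countable_topology}"
 assumes "\<And>a. (\<lambda>t. x t a) \<in> borel_measurable M" "\<And>a. (\<lambda>t. y t a) \<in> borel_measurable M" "\<And>a. (\<lambda>t. u t a) \<in> borel_measurable M"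
 shows "(\<lambda>t. pj r (x t) (y t) (u t) a) \<in> borel_measurable M"
 unfolding pj_def minus_apply smul_apply by (intro borel_measurable_diff borel_measurable_times measurable_om assms)

lemma polyfun_piv:
 assumes "\<And>i a. polyfun (\<lambda>t. fst (z t i) a)" "\<And>i a. polyfun (\<lambda>t. snd (z t i) a)"
 shows "polyfun (\<lambda>t. piv r n (z t))"
 using assms
proof (induction n arbitrary: z)
 case (Suc n)
 have 1: "polyfun (\<lambda>t. om r (fst (z t 0)) (snd (z t 0)))" by (intro polyfun_om Suc.prems)
 have 2: "polyfun (\<lambda>t. piv r n (\<lambda>i. map_prod (pj r (fst (z t 0)) (snd (z t 0))) (pj r (fst (z t 0)) (snd (z t 0))) (z t (Suc i))))"
  by (rule Suc.IH) (simp_all only: fst_map_prod snd_map_prod polyfun_pj Suc.prems)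
 show ?case unfolding piv.simps by (rule polyfun_mult[OF 1 2])
qed (simp only: piv.simps polyfun_const)

lemma measurable_piv:
 fixes z :: "'z \<Rightarrow> nat \<Rightarrow> (nat \<Rightarrow> 'k::{real_normed_field,second_countable_topology}) \<times> 'k vect"
 assumes "\<And>i a. (\<lambda>t. fst (z t i) a) \<in> borel_measurable M" "\<And>i a. (\<lambda>t. snd (z t i) a) \<in> borel_measurable M"
 shows "(\<lambda>t. piv r n (z t)) \<in> borel_measurable M"
 using assms
proof (induction n arbitrary: z)
 case (Suc n)
 have 1: "(\<lambda>t. om r (fst (z t 0)) (snd (z t 0))) \<in> borel_measurable M" by (intro measurable_om Suc.prems)
 have 2: "(\<lambda>t. piv r n (\<lambda>i. map_prod (pj r (fst (z t 0)) (snd (z t 0))) (pj r (fst (z t 0)) (snd (z t 0))) (z t (Suc i)))) \<in> borel_measurable M"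
  by (rule Suc.IH) (simp_all only: fst_map_prod snd_map_prod measurable_pj Suc.prems)
 show ?case unfolding piv.simps by (rule borel_measurable_times[OF 1 2])
qed simp

lemma measurable_gs:
 fixes z :: "'z \<Rightarrow> nat \<Rightarrow> (nat \<Rightarrow> 'k::{real_normed_field,second_countable_topology}) \<times> 'k vect"
 assumes "\<And>i a. (\<lambda>t. fst (z t i) a) \<in> borel_measurable M" "\<And>i a. (\<lambda>t. snd (z t i) a) \<in> borel_measurable M" "j < n"
 shows "(\<lambda>t. fst (gs r n (z t) ! j) a) \<in> borel_measurable M \<and> (\<lambda>t. snd (gs r n (z t) ! j) a) \<in> borel_measurable M"
 using assms
proof (induction n arbitrary: z j)
 case (Suc n)
 have 1: "(\<lambda>t. om r (fst (z t 0)) (snd (z t 0))) \<in> borel_measurable M" by (intro measurable_om Suc.prems)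
 show ?case
 proof (cases j)
  case 0
  then show ?thesis using 1 Suc.prems by simp
 next
  case (Suc k)
  have "k < n" using Suc Suc.prems by simp
  then have "(\<lambda>t. fst (gs r n (\<lambda>i. map_prod (pj r (fst (z t 0)) (snd (z t 0))) (pj r (fst (z t 0)) (snd (z t 0))) (z t (Suc i))) ! k) a) \<in> borel_measurable M \<and>
    (\<lambda>t. snd (gs r n (\<lambda>i. map_prod (pj r (fst (z t 0)) (snd (z t 0))) (pj r (fst (z t 0)) (snd (z t 0))) (z t (Suc i))) ! k) a) \<in> borel_measurable M"
   by (intro Suc.IH) (simp_all only: fst_map_prod snd_map_prod measurable_pj Suc.prems)
  then show ?thesis by (simp only: Suc gs.simps nth_Cons_Suc)
 qed
qed simp

abbreviation GB :: "nat \<Rightarrow> 'k::{real_normed_field,second_countable_topology} mat measure" where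
 "GB r \<equiv> borel_of (gtop (Sp r))"

declare topspace_gtop_Sp [simp]

lemma measurable_GB_entry: "a < 2*r ==> c < 2*r ==> (\<lambda>A. A $$ (a, c)) \<in> borel_measurable (GB r)"
 unfolding gtop_Sp by (rule measurable_borel_of_entry)

lemma measurable_into_GB:
 assumes "\<And>x. x \<in> space M ==> f x \<in> carrier (Sp r)"
  "\<And>i j. i < 2*r ==> j < 2*r ==> (\<lambda>x. f x $$ (i, j)) \<in> borel_measurable M"
 shows "f \<in> M \<rightarrow>\<^sub>M GB r"
 unfolding gtop_Sp by (rule measurable_into_borel_of) (use assms in \<open>auto simp: carrier_Sp spcond_def\<close>)

lemma measurable_zv: "(\<lambda>Z. zv r Z c a) \<in> borel_measurable (PP (II r))"
 unfolding zv_def by (cases "a < 2*r \<and> c < 2*r") (auto simp: II_def intro!: measurable_PP_component)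

lemma measurable_gsm: "gsm r \<in> PP (II r) \<rightarrow>\<^sub>M (GB r :: 'k::efield mat measure)"
proof (rule measurable_into_GB)
 show "gsm r x \<in> carrier (Sp r)" for x :: "nat \<times> nat \<Rightarrow> 'k" by (simp add: carrier_Sp spcond_gsm)
 fix i j assume ij: "i < 2*r" "j < 2*r"
 have z: "(\<lambda>Z :: nat \<times> nat \<Rightarrow> 'k. fst (zp r Z i) a) \<in> borel_measurable (PP (II r))"
  "(\<lambda>Z :: nat \<times> nat \<Rightarrow> 'k. snd (zp r Z i) a) \<in> borel_measurable (PP (II r))" for i a
  by (simp_all add: zp_def measurable_zv)
 have p: "(\<lambda>Z :: nat \<times> nat \<Rightarrow> 'k. piv r r (zp r Z)) \<in> borel_measurable (PP (II r))" by (rule measurable_piv) (rule z)+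
 have G: "(\<lambda>Z :: nat \<times> nat \<Rightarrow> 'k. fst (gs r r (zp r Z) ! j) i) \<in> borel_measurable (PP (II r)) \<and>
   (\<lambda>Z :: nat \<times> nat \<Rightarrow> 'k. snd (gs r r (zp r Z) ! j) i) \<in> borel_measurable (PP (II r))" if "j < r" for j
  by (rule measurable_gs) (rule z that)+
 have "(\<lambda>Z :: nat \<times> nat \<Rightarrow> 'k. if piv r r (zp r Z) = 0 then 1\<^sub>m (2*r) $$ (i, j) else (if j < r then fst (gs r r (zp r Z) ! j) i else snd (gs r r (zp r Z) ! (2*r - Suc j)) i)) \<in> borel_measurable (PP (II r))"
 proof (rule measurable_If)
  show "(\<lambda>Z :: nat \<times> nat \<Rightarrow> 'k. if j < r then fst (gs r r (zp r Z) ! j) i else snd (gs r r (zp r Z) ! (2*r - Suc j)) i) \<in> borel_measurable (PP (II r))"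
   using G[of j] G[of "2*r - Suc j"] ij
   by (cases "j < r") auto
  show "{Z \<in> space (PP (II r) :: (nat \<times> nat \<Rightarrow> 'k) measure). piv r r (zp r Z) = 0} \<in> sets (PP (II r))" using p by measurable
 qed simp
 then show "(\<lambda>Z :: nat \<times> nat \<Rightarrow> 'k. gsm r Z $$ (i, j)) \<in> borel_measurable (PP (II r))"
  by (rule measurable_cong[THEN iffD1, rotated]) (use ij in \<open>auto simp: gsm_def frame_mat_def\<close>)
qed

text \<open>Takes over the role of Haar measure as far as null sets are concerned.\<close>

definition lam :: "nat \<Rightarrow> 'k::efield mat measure" where
 "lam r = distr (PP (II r)) (GB r) (gsm r)"

lemma prob_lam: "prob_space (lam r)"
 unfolding lam_def by (rule prob_space.prob_space_distr[OF prob_PP measurable_gsm])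

lemma sets_lam [simp, measurable_cong]: "sets (lam r) = sets (GB r)" and space_lam [simp]: "space (lam r) = carrier (Sp r)"
 by (simp_all add: lam_def)

lemma AE_piv: "AE Z in PP (II r). piv r r (zp r Z) \<noteq> (0 :: 'k::efield)"
proof (rule PP_poly_nonzero)
 have z: "(\<lambda>Z :: nat \<times> nat \<Rightarrow> 'k. fst (zp r Z i) a) \<in> borel_measurable (PP (II r))"
  "(\<lambda>Z :: nat \<times> nat \<Rightarrow> 'k. snd (zp r Z i) a) \<in> borel_measurable (PP (II r))" for i a
  by (simp_all add: zp_def measurable_zv)
 show "(\<lambda>Z. piv r r (zp r Z) :: 'k) \<in> borel_measurable (PP (II r))" by (rule measurable_piv) (rule z)+
 show "polyfun (\<lambda>t. piv r r (zp r (x(i := t))))" for x :: "nat \<times> nat \<Rightarrow> 'k" and i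
 proof (rule polyfun_piv)
  have *: "polyfun (\<lambda>t. zv r (x(i := t)) c a)" for c a
   by (cases "a < 2*r \<and> c < 2*r"; cases "(a, c) = i")
     (simp_all only: zv_def simp_thms if_True if_False fun_upd_apply polyfun_const polyfun_id)
  show "polyfun (\<lambda>t. fst (zp r (x(i := t)) j) a)" "polyfun (\<lambda>t. snd (zp r (x(i := t)) j) a)" for j a
   by (simp_all only: zp_def fst_conv snd_conv *)
 qed
 \<comment> \<open>The standard pairs in consecutive columns, for which all pivots are 1.\<close>
 define Z0 :: "nat \<times> nat \<Rightarrow> 'k" where "Z0 = restrict (\<lambda>(a, c). (if even c then ee (c div 2) else ee (2*r - Suc (c div 2))) a) (II r)"
 show "Z0 \<in> space (PP (II r))" by (simp add: Z0_def space_PP)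
 have e: "zp r Z0 i = (ee i, ee (2*r - Suc i))" if "i < r" for i
  using that by (auto simp: zp_def zv_def Z0_def II_def fun_eq_iff ee_apply)
 have "map (zp r Z0) [0..<r] = stdl r r" unfolding stdl_def by (rule map_cong) (use e in auto)
 then show "piv r r (zp r Z0) \<noteq> 0" using piv_hfl[of r "zp r Z0" r] hfl_stdl[of r r, where ?'k = 'k] by simp
qed (simp add: II_def)

lemma measurable_entry_mult:
 fixes f g :: "'z \<Rightarrow> 'k::{real_normed_field,second_countable_topology} mat"
 assumes "\<And>x. x \<in> space M ==> f x \<in> carrier_mat n m" "\<And>x. x \<in> space M ==> g x \<in> carrier_mat m l" and ij: "i < n" "j < l"
  and "\<And>b. b < m ==> (\<lambda>x. f x $$ (i, b)) \<in> borel_measurable M" "\<And>b. b < m ==> (\<lambda>x. g x $$ (b, j)) \<in> borel_measurable M"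
 shows "(\<lambda>x. (f x * g x) $$ (i, j)) \<in> borel_measurable M"
proof (rule measurable_cong[THEN iffD1])
 show "(\<lambda>x. \<Sum>b<m. f x $$ (i, b) * g x $$ (b, j)) \<in> borel_measurable M"
  by (intro borel_measurable_sum borel_measurable_times assms) simp_all
qed (simp only: mult_entry[OF assms(1,2) ij])

lemma measurable_GB_mult:
 assumes "f \<in> M \<rightarrow>\<^sub>M GB r" "g \<in> M \<rightarrow>\<^sub>M GB r" shows "(\<lambda>x. f x * g x) \<in> M \<rightarrow>\<^sub>M GB r"
proof (rule measurable_into_GB)
 have sp: "spcond r (f x)" "spcond r (g x)" if "x \<in> space M" for x
  using measurable_space[OF assms(1) that] measurable_space[OF assms(2) that] by (simp_all add: carrier_Sp)
 then show "f x * g x \<in> carrier (Sp r)" if "x \<in> space M" for x using that by (simp add: carrier_Sp spcond_mult)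
 show "(\<lambda>x. (f x * g x) $$ (i, j)) \<in> borel_measurable M" if "i < 2*r" "j < 2*r" for i j
  by (rule measurable_entry_mult[OF spcond_carrier[OF sp(1)] spcond_carrier[OF sp(2)] that
    measurable_compose[OF assms(1) measurable_GB_entry] measurable_compose[OF assms(2) measurable_GB_entry]]) (use that in simp_all)
qed

lemma measurable_GB_sinv:
 assumes "f \<in> M \<rightarrow>\<^sub>M GB r" shows "(\<lambda>x. sinv r (f x)) \<in> M \<rightarrow>\<^sub>M GB r"
proof (rule measurable_into_GB)
 show "sinv r (f x) \<in> carrier (Sp r)" if "x \<in> space M" for x
  using measurable_space[OF assms that] by (auto simp: carrier_Sp spcond_sinv)
 fix i j assume ij: "i < 2*r" "j < 2*r"
 have "(\<lambda>x. (if i < r then 1 else - 1) * (if j < r then 1 else - 1) * f x $$ (2*r - Suc j, 2*r - Suc i)) \<in> borel_measurable M"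
 proof (rule borel_measurable_times[OF borel_measurable_const measurable_compose[OF assms measurable_GB_entry]])
  show "2*r - Suc j < 2*r" "2*r - Suc i < 2*r" using ij by linarith+
 qed
 then show "(\<lambda>x. sinv r (f x) $$ (i, j)) \<in> borel_measurable M"
  by (simp only: sinv_def index_mat(1)[OF ij] prod.case)
qed

text \<open>Left multiplication on all matrices is an additive bijection and so preserves null sets;
  equivariance of the Gram-Schmidt process carries it over to the group wherever the pivots are
  nonzero.\<close>

lemma lam_left:
 fixes g :: "'k::efield mat"
 assumes g: "spcond r g" and ae: "AE h in lam r. P h"
 shows "AE h in lam r. P (g * h)"
proof -
 obtain N where N: "{h \<in> space (lam r). \<not> P h} \<subseteq> N" "emeasure (lam r) N = 0" "N \<in> sets (lam r)"
  using AE_E[OF ae] by blast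
 have "AE h in lam r. h \<notin> N" using N by (intro AE_not_in) (simp add: null_sets_def)
 from AE_distrD[OF measurable_gsm this[unfolded lam_def]] have "AE Z in PP (II r). gsm r Z \<notin> N" .
 moreover define A where "A = gsm r -` N \<inter> space (PP (II r))"
 have A: "A \<in> sets (PP (II r))" unfolding A_def by (rule measurable_sets[OF measurable_gsm]) (use N(3) in simp)
 ultimately have nA: "AE Z in PP (II r). Z \<notin> A" by (auto simp: A_def elim!: AE_mp)
 have gc: "g \<in> carrier_mat (2*r) (2*r)" using g by (simp add: spcond_def)
 have sp: "lmul r h Z \<in> space (PP (II r))" for h and Z :: "nat \<times> nat \<Rightarrow> 'k" by (simp add: lmul_def space_PP)
 have lm: "lmul r h (lmul r k Z) = lmul r (h * k) Z" if "h \<in> carrier_mat (2*r) (2*r)" "k \<in> carrier_mat (2*r) (2*r)" for h k :: "'k mat" and Z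
 proof -
  have "(\<Sum>b<2*r. h $$ (a, b) * (\<Sum>d<2*r. k $$ (b, d) * Z (d, c))) = (\<Sum>d<2*r. (h * k) $$ (a, d) * Z (d, c))" if "a < 2*r" for a c
  proof -
   have "(\<Sum>b<2*r. h $$ (a, b) * (\<Sum>d<2*r. k $$ (b, d) * Z (d, c))) = (\<Sum>b<2*r. \<Sum>d<2*r. h $$ (a, b) * k $$ (b, d) * Z (d, c))"
    by (simp add: sum_distrib_left mult.assoc)
   also have "\<dots> = (\<Sum>d<2*r. \<Sum>b<2*r. h $$ (a, b) * k $$ (b, d) * Z (d, c))" by (rule sum.swap)
   also have "\<dots> = (\<Sum>d<2*r. (h * k) $$ (a, d) * Z (d, c))"
    by (rule sum.cong) (simp_all add: mult_entry[OF \<open>h \<in> _\<close> \<open>k \<in> _\<close> \<open>a < 2*r\<close>] sum_distrib_right del: index_mult_mat)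
   finally show ?thesis .
  qed
  then show ?thesis by (auto simp: lmul_def II_def fun_eq_iff simp del: index_mult_mat)
 qed
 have "AE Z in PP (II r). lmul r g Z \<notin> A"
 proof (rule PP_additive[OF _ A nA])
  show "finite (II r)" by (simp add: II_def)
  show "lmul r g \<in> PP (II r) \<rightarrow>\<^sub>M PP (II r)"
  proof (rule measurable_PP_I)
   fix p assume p: "p \<in> II r"
   obtain a c where ac: "p = (a, c)" by fastforce
   have "(\<lambda>Z. \<Sum>b<2*r. g $$ (a, b) * Z (b, c)) \<in> borel_measurable (PP (II r))"
    by (intro borel_measurable_sum borel_measurable_times borel_measurable_const measurable_PP_component) (use p ac in \<open>auto simp: II_def\<close>)
   then show "(\<lambda>Z. lmul r g Z p) \<in> borel_measurable (PP (II r))" using p by (simp add: lmul_def ac)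
  qed (simp add: lmul_def)
  show "lmul r g (padd (II r) x y) = padd (II r) (lmul r g x) (lmul r g y)" for x y
  proof (rule ext)
   fix p :: "nat \<times> nat"
   obtain a c where ac: "p = (a, c)" by fastforce
   show "lmul r g (padd (II r) x y) p = padd (II r) (lmul r g x) (lmul r g y) p"
   proof (cases "p \<in> II r")
    case True
    then have "(\<Sum>b<2*r. g $$ (a, b) * padd (II r) x y (b, c)) = (\<Sum>b<2*r. g $$ (a, b) * x (b, c) + g $$ (a, b) * y (b, c))"
     by (intro sum.cong) (auto simp: padd_def ac II_def algebra_simps)
    then show ?thesis using True by (simp add: lmul_def ac sum.distrib padd_def)
   qed (simp add: lmul_def padd_def)
  qed
  fix y :: "nat \<times> nat \<Rightarrow> 'k" assume y: "y \<in> space (PP (II r))"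
  have "lmul r (1\<^sub>m (2*r)) y = y"
  proof (rule ext)
   fix p :: "nat \<times> nat"
   obtain a c where ac: "p = (a, c)" by fastforce
   show "lmul r (1\<^sub>m (2*r)) y p = y p"
   proof (cases "p \<in> II r")
    case True
    then have "(\<Sum>b<2*r. 1\<^sub>m (2*r) $$ (a, b) * y (b, c)) = (\<Sum>b<2*r. if b = a then y (b, c) else 0)"
     by (intro sum.cong) (auto simp: ac II_def)
    then show ?thesis using True by (auto simp: lmul_def ac II_def)
   next
    case False
    then have "y p = undefined" using y unfolding space_PP extensional_def by blast
    then show ?thesis using False by (simp add: lmul_def)
   qed
  qed
  then have "lmul r g (lmul r (sinv r g) y) = y" by (simp add: lm gc sinv_mult(2)[OF g])
  then show "\<exists>z\<in>space (PP (II r)). lmul r g z = y" using sp by blast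
 qed
 then have "AE Z in PP (II r). gsm r (lmul r g Z) \<notin> N"
  by (rule eventually_mono) (use sp in \<open>simp add: A_def\<close>)
 with AE_piv have "AE Z in PP (II r). piv r r (zp r Z) \<noteq> (0::'k) \<and> gsm r (lmul r g Z) \<notin> N"
  by (rule AE_conjI)
 then have *: "AE Z in PP (II r). g * gsm r Z \<notin> N"
 proof (rule eventually_mono)
  fix Z :: "nat \<times> nat \<Rightarrow> 'k" assume Z: "piv r r (zp r Z) \<noteq> 0 \<and> gsm r (lmul r g Z) \<notin> N"
  have "gsm r (lmul r g Z) = g * gsm r Z" by (rule gsm_lmul[OF g]) (use Z in blast)
  then show "g * gsm r Z \<notin> N" using Z by (simp only:) blast
 qed
 have mg: "(\<lambda>h. g * h) \<in> GB r \<rightarrow>\<^sub>M GB r"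
  by (rule measurable_GB_mult) (use g in \<open>simp_all add: carrier_Sp\<close>)
 have "(\<lambda>h. g * h) -` N \<inter> space (GB r) \<in> sets (GB r)" by (rule measurable_sets[OF mg]) (use N(3) in simp)
 then have "space (GB r) - ((\<lambda>h. g * h) -` N \<inter> space (GB r)) \<in> sets (GB r)" by (rule sets.compl_sets)
 also have "space (GB r) - ((\<lambda>h. g * h) -` N \<inter> space (GB r)) = {h \<in> space (GB r). \<not> g * h \<in> N}" by blast
 finally have "{h \<in> space (GB r). \<not> g * h \<in> N} \<in> sets (GB r)" .
 then have "AE h in lam r. g * h \<notin> N"
  unfolding lam_def using * by (subst AE_distr_iff[OF measurable_gsm]) auto
 then show ?thesis
 proof (rule AE_mp, intro AE_I2 impI)
  fix h assume h: "h \<in> space (lam r)" "g * h \<notin> N"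
  then have "g * h \<in> space (lam r)" using g by (simp add: carrier_Sp spcond_mult)
  then show "P (g * h)" using N(1) h(2) by blast
 qed
qed

lemma sinv_times:
 fixes x y :: "'k::{field,topological_space} mat"
 assumes "spcond r x" "spcond r y" shows "sinv r (x * y) = sinv r y * sinv r x"
 using group.inv_mult_group[OF group_Sp, of x r y] assms by (simp add: inv_Sp carrier_Sp spcond_mult)

lemma sinv_sinv:
 fixes x :: "'k::{field,topological_space} mat"
 assumes "spcond r x" shows "sinv r (sinv r x) = x"
 using group.inv_inv[OF group_Sp, of x r] assms by (simp add: inv_Sp carrier_Sp spcond_sinv)

text \<open>For every \<open>x\<close> the product of the inverse of \<open>x\<close> with
  \<open>y\<close> avoids the null set for a.e. \<open>y\<close>. Fubini fixes one \<open>y\<close>;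
  replacing \<open>x\<close> by \<open>y * x\<close> turns this product into the inverse of
  \<open>x\<close>.\<close>

lemma lam_inv:
 fixes P :: "'k::efield mat \<Rightarrow> bool"
 assumes ae: "AE h in lam r. P h"
 shows "AE h in lam r. P (sinv r h)"
proof -
 obtain N where N: "{h \<in> space (lam r). \<not> P h} \<subseteq> N" "emeasure (lam r) N = 0" "N \<in> sets (lam r)"
  using AE_E[OF ae] by blast
 have nN: "AE h in lam r. h \<notin> N" using N by (intro AE_not_in) (simp add: null_sets_def)
 let ?A = "(\<lambda>(x, y). sinv r x * y) -` N \<inter> space (lam r \<Otimes>\<^sub>M lam r)"
 have mm: "(\<lambda>p. sinv r (fst p) * snd p) \<in> lam r \<Otimes>\<^sub>M lam r \<rightarrow>\<^sub>M (GB r :: 'k mat measure)"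
 proof (rule measurable_GB_mult)
  have fs: "fst \<in> lam r \<Otimes>\<^sub>M lam r \<rightarrow>\<^sub>M (GB r :: 'k mat measure)" "snd \<in> lam r \<Otimes>\<^sub>M lam r \<rightarrow>\<^sub>M (GB r :: 'k mat measure)"
   using measurable_fst[of "lam r" "lam r"] measurable_snd[of "lam r" "lam r"] by (simp_all only: measurable_cong_sets[OF refl sets_lam])
  show "(\<lambda>p. sinv r (fst p)) \<in> lam r \<Otimes>\<^sub>M lam r \<rightarrow>\<^sub>M (GB r :: 'k mat measure)" by (rule measurable_GB_sinv[OF fs(1)])
  show "snd \<in> lam r \<Otimes>\<^sub>M lam r \<rightarrow>\<^sub>M (GB r :: 'k mat measure)" by (rule fs(2))
 qed
 have "?A = (\<lambda>p. sinv r (fst p) * snd p) -` N \<inter> space (lam r \<Otimes>\<^sub>M lam r)" by (auto simp: space_pair_measure)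
 then have A: "?A \<in> sets (lam r \<Otimes>\<^sub>M lam r)" using measurable_sets[OF mm N(3)[unfolded sets_lam]] by (simp only:)
 have "AE x in lam r. AE y in lam r. (x, y) \<notin> ?A"
 proof (rule AE_I2)
  fix x :: "'k mat" assume "x \<in> space (lam r)"
  then have "spcond r (sinv r x)" by (simp add: carrier_Sp spcond_sinv)
  from lam_left[OF this nN] show "AE y in lam r. (x, y) \<notin> ?A" by (rule AE_mp) auto
 qed
 from fubini_pick[OF prob_lam prob_lam A this]
 obtain y :: "'k mat" where y: "y \<in> space (lam r)" "AE x in lam r. (x, y) \<notin> ?A" by (rule AE_pick[OF prob_lam])
 have sy: "spcond r y" using y(1) by (simp add: carrier_Sp)
 from lam_left[OF sy y(2)] have *: "AE x in lam r. (y * x, y) \<notin> ?A" .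
 show ?thesis
 proof (rule AE_mp[OF *], intro AE_I2 impI)
  fix x :: "'k mat" assume x: "x \<in> space (lam r)" "(y * x, y) \<notin> ?A"
  have sx: "spcond r x" using x(1) by (simp add: carrier_Sp)
  have "sinv r (y * x) * y = sinv r x * (sinv r y * y)"
   unfolding sinv_times[OF sy sx] by (rule assoc_mult_mat[OF sinv_carrier sinv_carrier spcond_carrier[OF sy]])
  then have "sinv r (y * x) * y = sinv r x" by (simp only: sinv_mult(1)[OF sy] right_mult_one_mat[OF sinv_carrier])
  moreover have "(y * x, y) \<in> space (lam r \<Otimes>\<^sub>M lam r)" using sx sy by (simp add: space_pair_measure carrier_Sp spcond_mult)
  ultimately have "sinv r x \<notin> N" using x(2) by auto
  moreover have "sinv r x \<in> space (lam r)" using sx by (simp add: carrier_Sp spcond_sinv)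
  ultimately show "P (sinv r x)" using N(1) by blast
 qed
qed

text \<open>Left multiplication conjugated by inversion.\<close>

lemma lam_right:
 fixes g :: "'k::efield mat"
 assumes g: "spcond r g" and ae: "AE h in lam r. P h"
 shows "AE h in lam r. P (h * g)"
proof -
 from lam_inv[OF lam_left[OF spcond_sinv[OF g] lam_inv[OF ae]]]
 have *: "AE h in lam r. P (sinv r (sinv r g * sinv r h))" .
 show ?thesis
 proof (rule AE_mp[OF *], intro AE_I2 impI)
  fix h :: "'k mat" assume h: "h \<in> space (lam r)" "P (sinv r (sinv r g * sinv r h))"
  have "spcond r h" using h(1) by (simp add: carrier_Sp)
  then have "sinv r (sinv r g * sinv r h) = h * g"
   by (simp only: sinv_times sinv_sinv spcond_sinv g)
  then show "P (h * g)" using h(2) by (simp only:)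
 qed
qed

section \<open>Spaces of frames\<close>

definition toL :: "nat \<Rightarrow> 'k::zero mat \<Rightarrow> 'k frame" where
 "toL q M = map (\<lambda>i. (colf M (2*i), colf M (Suc (2*i)))) [0..<Suc q]"

definition toM :: "nat \<Rightarrow> ((nat \<Rightarrow> 'k::zero) \<times> 'k vect) list \<Rightarrow> 'k mat" where
 "toM r xs = mat (2*r) (2 * length xs) (\<lambda>(a, c). if c = 1 then 0 else (if even c then fst (xs ! (c div 2)) a else snd (xs ! (c div 2)) a))"

text \<open>A tuple is stored as a matrix whose columns \<open>2 i\<close>, \<open>2 i + 1\<close> are \<open>vi\<close>, \<open>wi\<close>; there is no \<open>w0\<close>, so column \<open>1\<close> is zero.\<close>

definition XX :: "nat \<Rightarrow> nat \<Rightarrow> 'k::field mat set" where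
 "XX r q = {M \<in> carrier_mat (2*r) (2 * Suc q). valid r (toL q M) \<and> (\<forall>a<2*r. M $$ (a, 1) = 0)}"

text \<open>Drops the two columns of entry \<open>i\<close>. Overwriting column 1 is what forgets
  the partner of the new first vector when \<open>i = 0\<close>.\<close>

definition fc :: "nat \<Rightarrow> nat \<Rightarrow> nat \<Rightarrow> 'k::zero mat \<Rightarrow> 'k mat" where
 "fc r k i M = mat (2*r) (2 * Suc k) (\<lambda>(a, c). if c = 1 then 0 else M $$ (a, if c < 2*i then c else c + 2))"

lemma length_toL [simp]: "length (toL q M) = Suc q"
 by (simp add: toL_def)

lemma toL_nth: "i \<le> q ==> toL q M ! i = (colf M (2*i), colf M (Suc (2*i)))"
 by (simp add: toL_def nth_append)

lemma valid_nth:
 "valid r xs \<longleftrightarrow> xs \<noteq> [] \<and> nz r (fst (xs!0)) \<and>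
   (\<forall>i. Suc i < length xs \<longrightarrow> om r (fst (xs ! Suc i)) (snd (xs ! Suc i)) = 1 \<and>
    om r (fst (xs!0)) (fst (xs ! Suc i)) = 0 \<and> om r (fst (xs!0)) (snd (xs ! Suc i)) = 0) \<and>
   (\<forall>i j. i < j \<and> Suc j < length xs \<longrightarrow>
    om r (fst (xs ! Suc i)) (fst (xs ! Suc j)) = 0 \<and> om r (fst (xs ! Suc i)) (snd (xs ! Suc j)) = 0 \<and>
    om r (snd (xs ! Suc i)) (fst (xs ! Suc j)) = 0 \<and> om r (snd (xs ! Suc i)) (snd (xs ! Suc j)) = 0)"
proof (cases xs)
 case Nil
 then show ?thesis by (simp add: valid_def)
next
 case (Cons p ps)
 have "(\<forall>t\<in>pvs ps. om r (fst p) t = 0) \<longleftrightarrow> (\<forall>i<length ps. om r (fst p) (fst (ps!i)) = 0 \<and> om r (fst p) (snd (ps!i)) = 0)"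
  unfolding Ball_def pvs_nth by blast
 then show ?thesis unfolding Cons valid_Cons hfl_nth by auto
qed

lemma valid_cong:
 assumes "length xs = length ys"
  "\<And>i a. i < length xs ==> a < 2*r ==> fst (xs!i) a = fst (ys!i) a"
  "\<And>i a. 0 < i ==> i < length xs ==> a < 2*r ==> snd (xs!i) a = snd (ys!i) a"
 shows "valid r xs \<longleftrightarrow> valid r ys"
proof -
 have f: "om r (fst (xs!i)) (fst (xs!j)) = om r (fst (ys!i)) (fst (ys!j))" if "i < length xs" "j < length xs" for i j
  by (rule om_cong) (use assms that in auto)
 have fs: "om r (fst (xs!i)) (snd (xs ! Suc j)) = om r (fst (ys!i)) (snd (ys ! Suc j))" if "i < length xs" "Suc j < length xs" for i j
  by (rule om_cong) (use assms that in auto)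
 have sf: "om r (snd (xs! Suc i)) (fst (xs!j)) = om r (snd (ys! Suc i)) (fst (ys!j))" if "Suc i < length xs" "j < length xs" for i j
  by (rule om_cong) (use assms that in auto)
 have s: "om r (snd (xs! Suc i)) (snd (xs! Suc j)) = om r (snd (ys! Suc i)) (snd (ys! Suc j))" if "Suc i < length xs" "Suc j < length xs" for i j
  by (rule om_cong) (use assms that in auto)
 have n: "nz r (fst (xs!0)) \<longleftrightarrow> nz r (fst (ys!0))" if "xs \<noteq> []"
  using assms(2)[of 0] that by (auto simp: nz_def)
 have "xs \<noteq> [] \<longleftrightarrow> ys \<noteq> []" using assms(1) by auto
 then show ?thesis
  unfolding valid_nth using n f fs sf s assms(1) by (smt (verit, ccfv_SIG) Suc_lessD Suc_less_eq length_greater_0_conv less_trans_Suc)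
qed

lemma toL_toM:
 assumes "i < length xs" "a < 2*r"
 shows "fst (toL (length xs - 1) (toM r xs) ! i) a = fst (xs!i) a"
  "0 < i ==> snd (toL (length xs - 1) (toM r xs) ! i) a = snd (xs!i) a"
 using assms by (auto simp: toL_nth colf_def toM_def)

lemma toM_in_XX:
 assumes "valid r xs" "length xs = Suc q" shows "toM r xs \<in> XX r q"
proof -
 have "valid r (toL q (toM r xs)) \<longleftrightarrow> valid r xs"
  by (rule valid_cong) (use toL_toM[of _ xs _ r] assms in auto)
 then show ?thesis using assms by (auto simp: XX_def toM_def)
qed

lemma toM_toL: assumes "M \<in> XX r q" shows "toM r (toL q M) = M"
proof (rule eq_matI)
 have M: "M \<in> carrier_mat (2*r) (2 * Suc q)" "\<And>a. a < 2*r ==> M $$ (a, 1) = 0" using assms by (auto simp: XX_def)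
 fix a c assume "a < dim_row M" "c < dim_col M"
 then have ac: "a < 2*r" "c < 2 * Suc q" using M by auto
 then have c2: "c div 2 \<le> q" by auto
 show "toM r (toL q M) $$ (a, c) = M $$ (a, c)"
  using ac M c2 by (cases "c = 1"; cases "even c") (auto simp: toM_def toL_nth colf_def elim!: evenE oddE)
qed (use assms in \<open>auto simp: XX_def toM_def\<close>)

lemma fc_toM: assumes "length xs = k + 2" "i \<le> Suc k" shows "fc r k i (toM r xs) = toM r (del i xs)"
proof (rule eq_matI)
 have l: "length (del i xs) = Suc k" using assms by (simp add: length_del)
 fix a c assume "a < dim_row (toM r (del i xs))" "c < dim_col (toM r (del i xs))"
 then have ac: "a < 2*r" "c < 2 * Suc k" by (auto simp: toM_def l)
 have n: "del i xs ! (c div 2) = (if c div 2 < i then xs ! (c div 2) else xs ! Suc (c div 2))"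
  using assms ac by (subst nth_del) auto
 show "fc r k i (toM r xs) $$ (a, c) = toM r (del i xs) $$ (a, c)"
 proof (cases "c < 2*i")
  case True
  then have "c div 2 < i" by auto
  then show ?thesis using ac assms True by (auto simp: fc_def toM_def l n)
 next
  case False
  then have "\<not> c div 2 < i" by auto
  then show ?thesis using ac assms False by (auto simp: fc_def toM_def l n)
 qed
qed (use assms in \<open>auto simp: fc_def toM_def length_del\<close>)

lemma fc_XX: assumes "M \<in> XX r (Suc k)" "i \<le> Suc k"
 shows "fc r k i M = toM r (del i (toL (Suc k) M))" "fc r k i M \<in> XX r k"
proof -
 show *: "fc r k i M = toM r (del i (toL (Suc k) M))"
  using fc_toM[of "toL (Suc k) M" k i r] toM_toL[OF assms(1)] assms(2) by simp
 have "valid r (toL (Suc k) M)" using assms(1) by (simp add: XX_def)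
 then have "valid r (del i (toL (Suc k) M))" by (rule valid_del) simp
 then show "fc r k i M \<in> XX r k" unfolding * by (rule toM_in_XX) (use assms in \<open>simp add: length_del\<close>)
qed

lemma fc_fc:
 assumes "i < j" "j \<le> k + 2"
 shows "fc r k i (fc r (Suc k) j M) = fc r k (j - 1) (fc r (Suc k) i M)"
proof (rule eq_matI)
 fix a c assume "a < dim_row (fc r k (j - 1) (fc r (Suc k) i M))" "c < dim_col (fc r k (j - 1) (fc r (Suc k) i M))"
 then have ac: "a < 2*r" "c < 2 * Suc k" by (auto simp: fc_def)
 show "fc r k i (fc r (Suc k) j M) $$ (a, c) = fc r k (j - 1) (fc r (Suc k) i M) $$ (a, c)"
  using ac assms by (auto simp: fc_def)
qed (auto simp: fc_def)

lemma fc_mult: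
 fixes g :: "'k::field mat"
 assumes "g \<in> carrier_mat (2*r) (2*r)" "M \<in> carrier_mat (2*r) (2 * Suc (Suc k))"
 shows "fc r k i (g * M) = g * fc r k i M"
proof (rule eq_matI)
 have f: "fc r k i M \<in> carrier_mat (2*r) (2 * Suc k)" by (simp add: fc_def)
 fix a c assume "a < dim_row (g * fc r k i M)" "c < dim_col (g * fc r k i M)"
 then have ac: "a < 2*r" "c < 2 * Suc k" using assms by (auto simp: fc_def)
 have s: "(if c < 2*i then c else c + 2) < 2 * Suc (Suc k)" using ac by auto
 have "(g * fc r k i M) $$ (a, c) = (\<Sum>b<2*r. g $$ (a, b) * fc r k i M $$ (b, c))"
  by (rule mult_entry[OF assms(1) f ac])
 also have "\<dots> = (\<Sum>b<2*r. g $$ (a, b) * (if c = 1 then 0 else M $$ (b, if c < 2*i then c else c + 2)))"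
  by (rule sum.cong) (use ac in \<open>auto simp: fc_def\<close>)
 also have "\<dots> = (if c = 1 then 0 else (g * M) $$ (a, if c < 2*i then c else c + 2))"
  unfolding mult_entry[OF assms(1,2) ac(1) s] by simp
 also have "\<dots> = fc r k i (g * M) $$ (a, c)" using ac by (simp add: fc_def del: index_mult_mat)
 finally show "fc r k i (g * M) $$ (a, c) = (g * fc r k i M) $$ (a, c)" by simp
qed (use assms in \<open>auto simp: fc_def\<close>)

lemma toL_mult:
 fixes g :: "'k::field mat"
 assumes "g \<in> carrier_mat (2*r) (2*r)" "M \<in> carrier_mat (2*r) (2 * Suc q)"
 shows "toL q (g * M) = map (map_prod (mv g) (mv g)) (toL q M)"
 unfolding toL_def list.map_comp
 by (rule map_cong) (auto simp: colf_mult[OF assms])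

lemma toM_mult:
 fixes g :: "'k::field mat"
 assumes "g \<in> carrier_mat (2*r) (2*r)" "xs \<noteq> []"
 shows "g * toM r xs = toM r (map (map_prod (mv g) (mv g)) xs)"
proof (rule eq_matI)
 have t: "toM r xs \<in> carrier_mat (2*r) (2 * length xs)" by (simp add: toM_def)
 fix a c assume "a < dim_row (toM r (map (map_prod (mv g) (mv g)) xs))" "c < dim_col (toM r (map (map_prod (mv g) (mv g)) xs))"
 then have ac: "a < 2*r" "c < 2 * length xs" by (auto simp: toM_def)
 have "(g * toM r xs) $$ (a, c) = (\<Sum>b<2*r. g $$ (a, b) * toM r xs $$ (b, c))"
  by (rule mult_entry[OF assms(1) t ac])
 also have "\<dots> = (\<Sum>b<2*r. g $$ (a, b) * (if c = 1 then 0 else if even c then fst (xs ! (c div 2)) b else snd (xs ! (c div 2)) b))"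
  by (rule sum.cong) (use ac in \<open>auto simp: toM_def\<close>)
 also have "\<dots> = toM r (map (map_prod (mv g) (mv g)) xs) $$ (a, c)"
 proof -
  have "c div 2 < length xs" using ac by auto
  then show ?thesis using ac assms(1) by (auto simp: toM_def mv_def)
 qed
 finally show "(g * toM r xs) $$ (a, c) = toM r (map (map_prod (mv g) (mv g)) xs) $$ (a, c)" .
qed (use assms in \<open>auto simp: toM_def\<close>)

lemma valid_map:
 assumes "\<And>x y. om r (T x) (T y) = om r x y" "valid r xs"
 shows "valid r (map (map_prod T T) xs)"
proof -
 have "nz r (T x)" if "nz r x" for x
  using nz_partner[OF that] assms(1) om_imp_nz[of r "T x"] by (metis zero_neq_one)
 then show ?thesis using assms(2) unfolding valid_nth by (simp add: assms(1))
qed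

lemma mult_XX: assumes "spcond r g" "M \<in> XX r q" shows "g * M \<in> XX r q"
proof -
 have g: "g \<in> carrier_mat (2*r) (2*r)" using assms by (simp add: spcond_def)
 have "M = toM r (toL q M)" "valid r (toL q M)" using assms(2) by (simp_all add: toM_toL XX_def)
 then have "g * M = toM r (map (map_prod (mv g) (mv g)) (toL q M))" using toM_mult[OF g, of "toL q M"] by (metis length_toL list.size(3) nat.distinct(1))
 then show ?thesis using valid_map[OF spcond_om[OF assms(1)] \<open>valid r (toL q M)\<close>] toM_in_XX by (metis length_map length_toL)
qed

definition x0 :: "nat \<Rightarrow> nat \<Rightarrow> 'k::field mat" where "x0 r q = toM r (stdl r (Suc q))"

lemma hfl_valid: assumes "hfl r xs" "xs \<noteq> []" shows "valid r xs"
proof (cases xs)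
 case (Cons p ps)
 have "om r (fst p) (snd p) = 1" "\<forall>q\<in>set ps. orthp r p q" "hfl r ps" using assms unfolding Cons hfl_def by auto
 then show ?thesis unfolding Cons valid_Cons using om_imp_nz[of r "fst p" "snd p"] by (auto simp: pvs_def orthp_def)
qed (use assms in simp)

lemma x0_in: "q < r ==> x0 r q \<in> XX r q"
 unfolding x0_def by (intro toM_in_XX hfl_valid hfl_stdl) (simp_all add: stdl_Suc)

lemma nds_hfl: "hfl r xs ==> nds r (pvs xs)"
proof (induction xs rule: rev_induct)
 case Nil
 show ?case unfolding nds_def by (intro allI exI[of _ 0]) (simp add: perp_def)
next
 case (snoc p xs)
 then have "nds r (pvs xs \<union> {fst p, snd p})"
  by (intro nds_insert_pair) (auto simp: hfl_snoc perp_def)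
 then show ?case by simp
qed

text \<open>A partner for the first vector turns a valid tuple into a hyperbolic family, whose
  transitivity and length bound then apply.\<close>

lemma valid_complete:
 assumes "valid r xs" obtains w where "hfl r ((fst (hd xs), w) # tl xs)"
proof -
 obtain p ps where xs: "xs = p # ps" using assms by (cases xs) (auto simp: valid_def)
 have v: "nz r (fst p)" "hfl r ps" "\<And>t. t\<in>pvs ps ==> om r (fst p) t = 0" using assms by (auto simp: xs valid_Cons)
 obtain u where u: "om r (fst p) u = 1" using nz_partner[OF v(1)] by blast
 obtain s where s: "\<And>y. y\<in>perp r (pvs ps) ==> om r s y = 0" "u - s \<in> perp r (pvs ps)"
  using nds_hfl[OF v(2)] unfolding nds_def by blast
 have "fst p \<in> perp r (pvs ps)" using v(3) by (auto simp: perp_def om_sym0[of r _ "fst p"])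
 from s(1)[OF this] have "om r (fst p) s = 0" using om_sym0[of r s "fst p"] by blast
 then have "om r (fst p) (u - s) = 1" using u by simp
 moreover have us: "om r (u - s) t = 0" if "t \<in> pvs ps" for t
  using s(2) that om_sym0[of r "u - s" t] unfolding perp_def by blast
 have "orthp r (fst p, u - s) q" if "q \<in> set ps" for q
  using v(3) us that unfolding orthp_def pvs_def by (auto simp del: om_diff_left)
 ultimately have "hfl r ((fst p, u - s) # ps)" using v(2) by (simp add: hfl_def)
 then show ?thesis using that xs by simp
qed

lemma XX_empty: "r \<le> q ==> XX r q = {}"
proof -
 assume rq: "r \<le> q"
 have False if M: "M \<in> XX r q" for M :: "'a mat"
 proof -
  have "valid r (toL q M)" using M by (simp add: XX_def)
  then obtain w where "hfl r ((fst (hd (toL q M)), w) # tl (toL q M))" by (rule valid_complete)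
  from hfl_length_le[OF this] show False using rq by simp
 qed
 then show ?thesis by blast
qed

lemma tvm_toM: assumes "xs \<noteq> []" shows "tvm r ts * toM r xs = toM r (tvl r ts xs)"
proof -
 have "tvm r ts * toM r xs = toM r (map (map_prod (mv (tvm r ts)) (mv (tvm r ts))) xs)"
  by (rule toM_mult) (use assms in \<open>simp_all add: tvm_def\<close>)
 also have "\<dots> = toM r (tvl r ts xs)"
  by (rule eq_matI) (auto simp: toM_def tvl_def mv_tvm)
 finally show ?thesis .
qed

lemma toM_hd: "xs \<noteq> [] ==> toM r ((fst (hd xs), w) # tl xs) = toM r xs"
proof (rule eq_matI)
 assume ne: "xs \<noteq> []"
 fix a c assume "a < dim_row (toM r xs)" "c < dim_col (toM r xs)"
 then have ac: "a < 2*r" "c < 2 * length xs" by (auto simp: toM_def)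
 obtain p ps where xs: "xs = p # ps" using ne by (cases xs) auto
 show "toM r ((fst (hd xs), w) # tl xs) $$ (a, c) = toM r xs $$ (a, c)"
 proof (cases "c div 2")
  case 0
  then have "c = 0 \<or> c = 1" by presburger
  then show ?thesis using ac by (auto simp: toM_def xs)
 next
  case (Suc m)
  then show ?thesis using ac by (simp add: toM_def xs)
 qed
qed (auto simp: toM_def)

text \<open>The number of transvections is the same for all \<open>M\<close> and \<open>M'\<close>:
  they form a single family with finitely many parameters, as \<open>generic_frames\<close>
  requires.\<close>

lemma XX_transvections:
 assumes "M \<in> XX r q" "M' \<in> XX r q"
 obtains ts where "length ts = 8 * Suc q" "tvm r ts * M = M'"
proof -
 have ex: "\<exists>xs ts. length ts = 4 * Suc q \<and> xs \<noteq> [] \<and> tvl r ts (stdl r (Suc q)) = xs \<and> M = toM r xs" if "M \<in> XX r q" for M :: "'a mat"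
 proof -
  have v: "valid r (toL q M)" using that by (simp add: XX_def)
  obtain w where h: "hfl r ((fst (hd (toL q M)), w) # tl (toL q M))" using valid_complete[OF v] .
  let ?xs = "(fst (hd (toL q M)), w) # tl (toL q M)"
  have l: "length ?xs = Suc q" by simp
  obtain ts where "length ts = 4 * length ?xs" "tvl r ts (stdl r (length ?xs)) = ?xs"
   using hfl_transitive[OF h] hfl_length_le[OF h] by blast
  moreover have "toL q M \<noteq> []" using length_toL[of q M] by (metis list.size(3) nat.distinct(1))
  then have "toM r ?xs = M" using toM_hd[of "toL q M" r w] toM_toL[OF that] by simp
  ultimately show ?thesis unfolding l by (metis list.distinct(1))
 qed
 obtain xs ts where 1: "length ts = 4 * Suc q" "xs \<noteq> []" "tvl r ts (stdl r (Suc q)) = xs" "M = toM r xs" using ex[OF assms(1)] by blast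
 obtain xs' ts' where 2: "length ts' = 4 * Suc q" "xs' \<noteq> []" "tvl r ts' (stdl r (Suc q)) = xs'" "M' = toM r xs'" using ex[OF assms(2)] by blast
 have "tvl r (ts' @ tinv ts) xs = xs'"
  unfolding 1(3)[symmetric] 2(3)[symmetric] by (simp add: tvl_def comp_def)
 then have "tvm r (ts' @ tinv ts) * M = M'" using tvm_toM[OF 1(2)] 1 2 by metis
 moreover have "length (ts' @ tinv ts) = 8 * Suc q" using 1 2 by (simp add: tinv_def)
 ultimately show ?thesis using that by blast
qed

lemma XX_transitive: assumes "M \<in> XX r q" "M' \<in> XX r q" obtains g where "spcond r g" "g * M = M'"
 using XX_transvections[OF assms] spcond_tvm by metis

section \<open>Borel structure and measure class on the spaces of tuples\<close>

abbreviation MB :: "nat \<Rightarrow> nat \<Rightarrow> 'k::{real_normed_field,second_countable_topology} mat measure" where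
 "MB r q \<equiv> borel_of (mat_sub (2*r) (2 * Suc q) (XX r q))"

lemma XX_carrier: "M \<in> XX r q ==> M \<in> carrier_mat (2*r) (2 * Suc q)"
 by (simp add: XX_def)

lemma topspace_XX: "topspace (mat_sub (2*r) (2 * Suc q) (XX r q)) = XX r q"
 by (auto simp: XX_def)

lemma space_MB: "space (MB r q) = XX r q"
 unfolding space_borel_of by (rule topspace_XX)

lemma measurable_MB_entry: "a < 2*r ==> c < 2 * Suc q ==> (\<lambda>A. A $$ (a, c)) \<in> borel_measurable (MB r q)"
 by (rule measurable_borel_of_entry)

lemma measurable_into_MB:
 assumes "\<And>x. x \<in> space M ==> f x \<in> XX r q"
  "\<And>i j. i < 2*r ==> j < 2 * Suc q ==> (\<lambda>x. f x $$ (i, j)) \<in> borel_measurable M"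
 shows "f \<in> M \<rightarrow>\<^sub>M MB r q"
 by (rule measurable_into_borel_of) (use assms XX_carrier in blast)+

lemma measurable_mult_MB:
 fixes f h :: "'z \<Rightarrow> 'k::{real_normed_field,second_countable_topology} mat"
 assumes f: "f \<in> M \<rightarrow>\<^sub>M GB r" and h: "h \<in> M \<rightarrow>\<^sub>M MB r q" shows "(\<lambda>x. f x * h x) \<in> M \<rightarrow>\<^sub>M MB r q"
proof (rule measurable_into_MB)
 have sp: "spcond r (f x)" "h x \<in> XX r q" if "x \<in> space M" for x
  using measurable_space[OF f that] measurable_space[OF h that] unfolding space_MB by (simp_all add: carrier_Sp)
 then show "f x * h x \<in> XX r q" if "x \<in> space M" for x using that by (simp only: mult_XX)
 show "(\<lambda>x. (f x * h x) $$ (i, j)) \<in> borel_measurable M" if "i < 2*r" "j < 2 * Suc q" for i j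
  by (rule measurable_entry_mult[OF spcond_carrier[OF sp(1)] XX_carrier[OF sp(2)] that
    measurable_compose[OF f measurable_GB_entry] measurable_compose[OF h measurable_MB_entry]]) (use that in simp_all)
qed

text \<open>The closed conditions in the validity of a tuple, separated from the open one that the
  first vector is nonzero.\<close>

definition frame_eqs :: "nat \<Rightarrow> nat \<Rightarrow> 'k::field mat \<Rightarrow> bool" where
 "frame_eqs r q M \<longleftrightarrow>
   (\<forall>i. i < q \<longrightarrow> om r (colf M (2 * Suc i)) (colf M (Suc (2 * Suc i))) = 1 \<and>
    om r (colf M 0) (colf M (2 * Suc i)) = 0 \<and> om r (colf M 0) (colf M (Suc (2 * Suc i))) = 0) \<and>
   (\<forall>i j. i < j \<and> j < q \<longrightarrow>
    om r (colf M (2 * Suc i)) (colf M (2 * Suc j)) = 0 \<and> om r (colf M (2 * Suc i)) (colf M (Suc (2 * Suc j))) = 0 \<and>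
    om r (colf M (Suc (2 * Suc i))) (colf M (2 * Suc j)) = 0 \<and> om r (colf M (Suc (2 * Suc i))) (colf M (Suc (2 * Suc j))) = 0)"

lemma XX_iff:
 "M \<in> XX r q \<longleftrightarrow> M \<in> carrier_mat (2*r) (2 * Suc q) \<and> nz r (colf M 0) \<and> frame_eqs r q M \<and> (\<forall>a. a < 2*r \<longrightarrow> M $$ (a, 1) = 0)"
proof -
 have ne: "toL q M \<noteq> []" using length_toL[of q M] by (metis list.size(3) nat.distinct(1))
 have n0: "toL q M ! 0 = (colf M 0, colf M 1)" by (simp add: toL_nth)
 have nS: "toL q M ! Suc i = (colf M (2 * Suc i), colf M (Suc (2 * Suc i)))" if "i < q" for i using that by (subst toL_nth) auto
 have "valid r (toL q M) \<longleftrightarrow> nz r (colf M 0) \<and> frame_eqs r q M"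
  unfolding valid_nth length_toL Suc_less_eq n0 fst_conv frame_eqs_def
  by (simp only: ne simp_thms not_False_eq_True, intro conj_cong all_cong1 imp_cong refl)
    ((elim conjE)?, (frule (1) less_trans)?, simp only: nS fst_conv snd_conv)+
 then show ?thesis unfolding XX_def mem_Collect_eq by (simp only: conj_assoc)
qed

text \<open>The tuples form an open subset of a closed subset of a completely metrizable
  space.\<close>

lemma standard_borel_MB:
 assumes "sets M = sets (MB r q :: 'k::efield mat measure)"
 shows "standard_borel M"
proof -
 let ?n = "2 * Suc q"
 let ?T = "mat_topology (2*r) ?n :: 'k mat topology"
 define C where "C = {M \<in> topspace ?T. frame_eqs r q M \<and> (\<forall>a. a < 2*r \<longrightarrow> M $$ (a, 1) = 0)}"
 define U where "U = {M \<in> topspace ?T. nz r (colf M 0)}"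
 have C: "closedin ?T C"
  unfolding C_def frame_eqs_def
  by (intro closedin_conj closedin_all closedin_all' closedin_eq_const continuous_map_om_col continuous_map_mat_entry) auto
 have cf: "colf M 0 a = M $$ (a, 0)" if "M \<in> topspace ?T" "a < 2*r" for M a using that by (simp add: colf_def)
 have "U = topspace ?T - {M \<in> topspace ?T. \<forall>a. a < 2*r \<longrightarrow> M $$ (a, 0) = 0}"
  unfolding U_def nz_def using cf by (intro Set.set_eqI) (simp only: mem_Collect_eq Diff_iff, metis)
 moreover have "closedin ?T {M \<in> topspace ?T. \<forall>a. a < 2*r \<longrightarrow> M $$ (a, 0) = 0}"
  by (intro closedin_all closedin_eq_const continuous_map_mat_entry) auto
 ultimately have U: "openin ?T U" by (simp only: openin_diff[OF openin_topspace])
 have XX: "XX r q = C \<inter> U"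
  unfolding C_def U_def topspace_mat_topology by (rule Set.set_eqI) (auto simp only: XX_iff)
 have "completely_metrizable_space (subtopology (subtopology ?T C) (C \<inter> U))"
 proof (rule completely_metrizable_space_openin)
  show "completely_metrizable_space (subtopology ?T C)"
   by (rule completely_metrizable_space_closedin[OF completely_metrizable_mat C])
  show "openin (subtopology ?T C) (C \<inter> U)" using U by (auto simp: openin_subtopology)
 qed
 moreover have "subtopology (subtopology ?T C) (C \<inter> U) = mat_sub (2*r) ?n (XX r q)"
  unfolding subtopology_subtopology XX Int_left_absorb ..
 ultimately have "completely_metrizable_space (mat_sub (2*r) ?n (XX r q :: 'k mat set))" by simp
 moreover have "second_countable (mat_sub (2*r) ?n (XX r q :: 'k mat set))"
  by (rule second_countable_subtopology[OF second_countable_mat])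
 moreover have "space M = topspace (mat_sub (2*r) ?n (XX r q :: 'k mat set))"
  using sets_eq_imp_space_eq[OF assms] by simp
 ultimately show ?thesis unfolding standard_borel_def using assms by (intro exI[of _ "mat_sub (2*r) ?n (XX r q)"]) simp
qed

text \<open>The law of a random translate of the base point. For \<open>q \<ge> r\<close> the space
  is empty and the measure zero.\<close>

definition MU :: "nat \<Rightarrow> nat \<Rightarrow> 'k::efield mat measure" where
 "MU r q = distr (lam r) (MB r q) (\<lambda>g. g * x0 r q)"

lemma sets_MU: "sets (MU r q) = sets (MB r q)" and space_MU: "space (MU r q) = XX r q"
 by (simp_all only: MU_def sets_distr space_distr space_MB)

lemma measurable_lam: "measurable (lam r) N = measurable (GB r) N"
 by (rule measurable_cong_sets) simp_all

lemma measurable_orbit: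
 fixes M :: "'k::efield mat"
 assumes "M \<in> XX r q" shows "(\<lambda>g. g * M) \<in> lam r \<rightarrow>\<^sub>M MB r q"
 unfolding measurable_lam
 by (rule measurable_mult_MB) (use assms in \<open>simp_all only: measurable_ident_sets measurable_const space_MB\<close>)

lemma prob_MU: "q < r ==> prob_space (MU r q)"
 unfolding MU_def by (intro prob_space.prob_space_distr prob_lam measurable_orbit x0_in)

lemma AE_null_cover:
 assumes "AE x in M. P x"
 obtains N where "N \<in> null_sets M" "\<And>x. x \<in> space M ==> x \<notin> N ==> P x"
 using AE_E[OF assms] by (metis (mono_tags, lifting) mem_Collect_eq null_setsI subsetD)

text \<open>Passing to another base point is a right translation in the group, under which null sets
  are invariant.\<close>

lemma AE_MU_orbit:
 fixes M :: "'k::efield mat"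
 assumes "q < r" "M \<in> XX r q" "AE y in MU r q. P y" shows "AE g in lam r. P (g * M)"
proof -
 obtain h where h: "spcond r h" "h * x0 r q = M" using XX_transitive[OF x0_in[OF assms(1)] assms(2)] by blast
 have "AE g in lam r. P (g * x0 r q)"
  by (rule AE_distrD[OF measurable_orbit[OF x0_in[OF assms(1)]]]) (use assms(3) in \<open>simp only: MU_def\<close>)
 from lam_right[OF h(1) this] have *: "AE g in lam r. P (g * h * x0 r q)" .
 show ?thesis
 proof (rule AE_mp[OF *], rule AE_I2, rule impI)
  fix g :: "'k mat" assume g: "g \<in> space (lam r)" "P (g * h * x0 r q)"
  have "g * h * x0 r q = g * (h * x0 r q)"
   by (rule assoc_mult_mat[OF spcond_carrier spcond_carrier[OF h(1)] XX_carrier[OF x0_in[OF assms(1)]]]) (use g in \<open>simp add: carrier_Sp\<close>)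
  then show "P (g * M)" using g(2) h(2) by simp
 qed
qed

lemma AE_MU_I:
 assumes "q < r" "N \<in> sets (MB r q)" "AE g in lam r. g * x0 r q \<notin> N"
 shows "AE y in MU r q. y \<notin> N"
proof -
 have "{y \<in> space (MB r q). y \<notin> N} = space (MB r q) - N" by auto
 then have "{y \<in> space (MB r q). y \<notin> N} \<in> sets (MB r q)" using assms(2) by (simp only: sets.compl_sets)
 then show ?thesis unfolding MU_def
  using assms(3) by (subst AE_distr_iff[OF measurable_orbit[OF x0_in[OF assms(1)]]])
qed

lemma AE_MU_pull:
 fixes f :: "'k::efield mat \<Rightarrow> 'k mat"
 assumes q: "q < r" and f: "f \<in> MB r q \<rightarrow>\<^sub>M MB r q'"
  and orbit: "\<And>N. N \<in> null_sets (MU r q') ==> AE g in lam r. f (g * x0 r q) \<notin> N"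
  and ae: "AE y in MU r q'. P y"
 shows "AE y in MU r q. P (f y)"
proof -
 obtain N where N: "N \<in> null_sets (MU r q')" "\<And>x. x \<in> space (MU r q') ==> x \<notin> N ==> P x"
  using AE_null_cover[OF ae] by blast
 let ?A = "f -` N \<inter> space (MB r q)"
 have A: "?A \<in> sets (MB r q)" by (rule measurable_sets[OF f]) (use N(1) in \<open>simp add: null_sets_def sets_MU\<close>)
 have "AE g in lam r. g * x0 r q \<notin> ?A" using orbit[OF N(1)] by (rule eventually_mono) simp
 from AE_MU_I[OF q A this] show ?thesis
 proof (rule AE_mp, intro AE_I2 impI)
  fix y assume y: "y \<in> space (MU r q)" "y \<notin> ?A"
  then have "f y \<notin> N" by (simp only: space_MU space_MB vimage_eq Int_iff) blast
  moreover have "f y \<in> space (MU r q')" using measurable_space[OF f, of y] y(1) by (simp only: space_MU space_MB)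
  ultimately show "P (f y)" using N(2) by blast
 qed
qed

text \<open>An equivariant map turns the orbit map of \<open>x0\<close> into that of the image
  point, so it pulls null sets back to null sets. This is applied to the face maps.\<close>

lemma AE_MU_equivariant:
 fixes f :: "'k::efield mat \<Rightarrow> 'k mat"
 assumes q: "q < r" "q' < r" and f: "f \<in> MB r q \<rightarrow>\<^sub>M MB r q'"
  and eq: "\<And>g. spcond r g ==> f (g * x0 r q) = g * f (x0 r q)"
  and ae: "AE y in MU r q'. P y"
 shows "AE y in MU r q. P (f y)"
proof (rule AE_MU_pull[OF q(1) f _ ae])
 fix N :: "'k mat set" assume N: "N \<in> null_sets (MU r q')"
 have x: "f (x0 r q) \<in> XX r q'" using measurable_space[OF f, of "x0 r q"] x0_in[OF q(1)] unfolding space_MB by blast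
 show "AE g in lam r. f (g * x0 r q) \<notin> N"
  by (rule AE_mp[OF AE_MU_orbit[OF q(2) x AE_not_in[OF N]]], rule AE_I2) (simp add: eq carrier_Sp)
qed

lemma AE_MU_translate:
 fixes h :: "'k::efield mat"
 assumes q: "q < r" and h: "spcond r h" and ae: "AE y in MU r q. P y"
 shows "AE y in MU r q. P (h * y)"
proof (rule AE_MU_pull[OF q _ _ ae])
 show "(\<lambda>y. h * y) \<in> MB r q \<rightarrow>\<^sub>M MB r q"
  by (rule measurable_mult_MB) (use h in \<open>simp_all add: carrier_Sp\<close>)
 fix N :: "'k mat set" assume N: "N \<in> null_sets (MU r q)"
 have "AE g in lam r. (h * g) * x0 r q \<notin> N"
  by (rule lam_left[OF h]) (rule AE_MU_orbit[OF q x0_in[OF q] AE_not_in[OF N]])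
 then show "AE g in lam r. h * (g * x0 r q) \<notin> N"
  by (rule AE_mp, intro AE_I2 impI)
   (simp add: assoc_mult_mat[OF spcond_carrier[OF h] spcond_carrier XX_carrier[OF x0_in[OF q]]] carrier_Sp)
qed

section \<open>The measured object\<close>

definition ac :: "nat \<Rightarrow> nat \<Rightarrow> 'k::field mat \<Rightarrow> 'k mat \<Rightarrow> 'k mat" where
 "ac r q g = restrict (\<lambda>M. g * M) (XX r q)"

text \<open>By \<open>XX_empty\<close> there are no valid tuples with more than \<open>r\<close>
  entries; the dimension \<open>r - 1\<close> also covers \<open>r = 0\<close>, where it is
  \<open>-1\<close>.\<close>

definition XO :: "nat \<Rightarrow> ('k::efield mat, 'k mat) measured_obj" where
 "XO r = \<lparr>odim = ereal (real r - 1), lev = MU r, act = ac r, face = fc r\<rparr>"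

lemma XO_simps [simp]: "odim (XO r) = ereal (real r - 1)" "lev (XO r) = MU r" "act (XO r) = ac r" "face (XO r) = fc r"
 by (simp_all add: XO_def)

lemma idx_XO: "idx (ereal (real r - 1)) = {k. k < r}"
 by (auto simp: idx_def)

lemma assoc_XX: "spcond r g ==> spcond r h ==> M \<in> XX r q ==> g * h * M = g * (h * M)"
 by (rule assoc_mult_mat[OF spcond_carrier spcond_carrier XX_carrier])

lemma one_XX: "M \<in> XX r q ==> 1\<^sub>m (2*r) * M = M"
 by (rule left_mult_one_mat[OF XX_carrier])

lemma sinv_XX: "spcond r g ==> M \<in> XX r q ==> sinv r g * (g * M) = M" "spcond r g ==> M \<in> XX r q ==> g * (sinv r g * M) = M"
 using assoc_XX[of r "sinv r g" g M q] assoc_XX[of r g "sinv r g" M q] one_XX[of M r q] spcond_sinv[of r g] sinv_mult[of r g] by simp_all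

lemma group_action_XX: "group_action (Sp r :: 'k::{field,topological_space} mat top_group) (XX r q) (ac r q)"
proof (intro group_action.intro group_hom.intro group_hom_axioms.intro group_Sp group_BijGroup homI)
 have bij: "ac r q g \<in> Bij (XX r q)" if "spcond r g" for g :: "'k mat"
 proof -
  have "bij_betw (ac r q g) (XX r q) (XX r q)"
  proof (rule bij_betw_byWitness[where f' = "\<lambda>M. sinv r g * M"])
   show "\<forall>M\<in>XX r q. sinv r g * ac r q g M = M" using sinv_XX(1)[OF that] by (simp add: ac_def)
   show "\<forall>M\<in>XX r q. ac r q g (sinv r g * M) = M"
    using sinv_XX(2)[OF that] mult_XX[OF spcond_sinv[OF that]] by (simp add: ac_def)
   show "ac r q g ` XX r q \<subseteq> XX r q" using mult_XX[OF that] by (auto simp: ac_def)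
   show "(\<lambda>M. sinv r g * M) ` XX r q \<subseteq> XX r q" using mult_XX[OF spcond_sinv[OF that]] by blast
  qed
  then show ?thesis by (simp add: Bij_def ac_def)
 qed
 fix g :: "'k mat" assume g: "g \<in> carrier (Sp r)"
 then show "ac r q g \<in> carrier (BijGroup (XX r q))" using bij by (simp add: BijGroup_def carrier_Sp)
 fix h :: "'k mat" assume h: "h \<in> carrier (Sp r)"
 have "ac r q (g * h) = compose (XX r q) (ac r q g) (ac r q h)"
  using g h by (auto simp: ac_def compose_def fun_eq_iff carrier_Sp assoc_XX mult_XX)
 then show "ac r q (g \<otimes>\<^bsub>Sp r\<^esub> h) = ac r q g \<otimes>\<^bsub>BijGroup (XX r q)\<^esub> ac r q h"
  using g h bij by (simp add: BijGroup_def carrier_Sp)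
qed

lemma measurable_ac:
 fixes h :: "'k::efield mat"
 assumes "spcond r h" shows "ac r q h \<in> MU r q \<rightarrow>\<^sub>M MU r q"
proof -
 have "(\<lambda>y. h * y) \<in> MB r q \<rightarrow>\<^sub>M MB r q"
  by (rule measurable_mult_MB) (use assms in \<open>simp_all add: carrier_Sp\<close>)
 then have "ac r q h \<in> MB r q \<rightarrow>\<^sub>M MB r q"
  by (rule measurable_cong[THEN iffD1, rotated]) (simp only: ac_def space_MB restrict_apply if_True)
 then show ?thesis by (simp only: measurable_cong_sets[OF sets_MU sets_MU])
qed

lemma null_sets_ac:
 fixes h :: "'k::efield mat"
 assumes "q < r" "spcond r h" "N \<in> null_sets (MU r q)"
 shows "ac r q h -` N \<inter> space (MU r q) \<in> null_sets (MU r q)"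
proof -
 have "AE y in MU r q. h * y \<notin> N" by (rule AE_MU_translate[OF assms(1,2) AE_not_in[OF assms(3)]])
 then have "AE y in MU r q. y \<notin> ac r q h -` N \<inter> space (MU r q)"
  by (rule AE_mp) (rule AE_I2, simp add: ac_def space_MU)
 moreover have "ac r q h -` N \<inter> space (MU r q) \<in> sets (MU r q)"
  by (rule measurable_sets[OF measurable_ac[OF assms(2)]]) (use assms(3) in blast)
 ultimately show ?thesis by (simp add: AE_iff_null_sets)
qed

lemma quasi_invariant:
 fixes h :: "'k::efield mat"
 assumes "q < r" "spcond r h"
 shows "absolutely_continuous (MU r q) (distr (MU r q) (MU r q) (ac r q h))"
  "absolutely_continuous (distr (MU r q) (MU r q) (ac r q h)) (MU r q)"
proof -
 show "absolutely_continuous (MU r q) (distr (MU r q) (MU r q) (ac r q h))"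
  unfolding absolutely_continuous_def
 proof
  fix N :: "'k mat set" assume N: "N \<in> null_sets (MU r q)"
  then have s: "N \<in> sets (MU r q)" by blast
  show "N \<in> null_sets (distr (MU r q) (MU r q) (ac r q h))"
   using null_sets_ac[OF assms N] s by (simp add: null_sets_def emeasure_distr[OF measurable_ac[OF assms(2)]])
 qed
 show "absolutely_continuous (distr (MU r q) (MU r q) (ac r q h)) (MU r q)"
  unfolding absolutely_continuous_def
 proof
  fix N :: "'k mat set" assume "N \<in> null_sets (distr (MU r q) (MU r q) (ac r q h))"
  then have s: "N \<in> sets (MU r q)" and e: "emeasure (MU r q) (ac r q h -` N \<inter> space (MU r q)) = 0"
   by (auto simp: null_sets_def emeasure_distr[OF measurable_ac[OF assms(2)]])
  let ?N = "ac r q h -` N \<inter> space (MU r q)"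
  have "?N \<in> null_sets (MU r q)" using e measurable_sets[OF measurable_ac[OF assms(2)] s] by (simp add: null_sets_def)
  from null_sets_ac[OF assms(1) spcond_sinv[OF assms(2)] this]
  have "ac r q (sinv r h) -` ?N \<inter> space (MU r q) \<in> null_sets (MU r q)" .
  moreover have "ac r q (sinv r h) -` ?N \<inter> space (MU r q) = N"
  proof -
   have "N \<subseteq> XX r q" using sets.sets_into_space[OF s] by (simp only: space_MU)
   then show ?thesis using mult_XX[OF spcond_sinv[OF assms(2)]] sinv_XX(2)[OF assms(2)]
    by (auto simp: space_MU ac_def)
  qed
  ultimately show "N \<in> null_sets (MU r q)" by simp
 qed
qed

lemma measurable_fc:
 assumes "i \<le> Suc k"
 shows "fc r k i \<in> MB r (Suc k) \<rightarrow>\<^sub>M (MB r k :: 'k::efield mat measure)"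
proof (rule measurable_into_MB)
 show "fc r k i x \<in> XX r k" if "x \<in> space (MB r (Suc k))" for x :: "'k mat"
  using that fc_XX(2)[OF _ assms] unfolding space_MB by blast
 fix a c assume ac: "a < 2*r" "c < 2 * Suc k"
 have "(\<lambda>M. if c = 1 then 0 else M $$ (a, if c < 2*i then c else c + 2)) \<in> borel_measurable (MB r (Suc k) :: 'k mat measure)"
 proof (cases "c = 1")
  case False
  have "(if c < 2*i then c else c + 2) < 2 * Suc (Suc k)" using ac by auto
  from measurable_MB_entry[OF ac(1) this] False show ?thesis by simp
 qed simp
 then show "(\<lambda>x. fc r k i x $$ (a, c)) \<in> borel_measurable (MB r (Suc k) :: 'k mat measure)"
  by (simp only: fc_def index_mat(1)[OF ac] prod.case)
qed

lemma AE_MU_fc: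
 assumes "Suc k < r" "i \<le> Suc k" "AE y in (MU r k :: 'k::efield mat measure). P y"
 shows "AE y in MU r (Suc k). P (fc r k i y)"
proof (rule AE_MU_equivariant[OF assms(1) _ measurable_fc[OF assms(2)] _ assms(3)])
 show "k < r" using assms(1) by simp
 show "fc r k i (g * x0 r (Suc k)) = g * fc r k i (x0 r (Suc k))" if "spcond r g" for g :: "'k mat"
  by (rule fc_mult[OF spcond_carrier[OF that] XX_carrier[OF x0_in[OF assms(1)]]])
qed

lemma regular_space_XX:
 assumes "q < r"
 shows "regular_space (Sp r :: 'k::efield mat top_group) (MU r q) (ac r q)"
 unfolding regular_space_def
proof (intro conjI ballI)
 show "standard_borel (MU r q :: 'k mat measure)" by (rule standard_borel_MB[OF sets_MU])
 show "prob_space (MU r q :: 'k mat measure)" by (rule prob_MU[OF assms])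
 show "group_action (Sp r :: 'k mat top_group) (space (MU r q)) (ac r q)" unfolding space_MU by (rule group_action_XX)
 have "(\<lambda>p. fst p * snd p) \<in> GB r \<Otimes>\<^sub>M MU r q \<rightarrow>\<^sub>M (MB r q :: 'k mat measure)"
 proof (rule measurable_mult_MB)
  show "fst \<in> GB r \<Otimes>\<^sub>M MU r q \<rightarrow>\<^sub>M (GB r :: 'k mat measure)" by (rule measurable_fst)
  show "snd \<in> GB r \<Otimes>\<^sub>M MU r q \<rightarrow>\<^sub>M (MB r q :: 'k mat measure)"
   using measurable_snd[of "GB r" "MU r q"] by (simp only: measurable_cong_sets[OF refl sets_MU])
 qed
 then have "(\<lambda>(g, x). ac r q g x) \<in> GB r \<Otimes>\<^sub>M MU r q \<rightarrow>\<^sub>M (MB r q :: 'k mat measure)"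
  by (rule measurable_cong[THEN iffD1, rotated]) (auto simp: space_pair_measure space_MU ac_def)
 then show "(\<lambda>(g, x). ac r q g x) \<in> GB r \<Otimes>\<^sub>M MU r q \<rightarrow>\<^sub>M (MU r q :: 'k mat measure)"
  by (simp only: measurable_cong_sets[OF refl sets_MU])
 fix g :: "'k mat" assume "g \<in> carrier (Sp r)"
 then show "absolutely_continuous (MU r q) (distr (MU r q) (MU r q) (ac r q g))"
  "absolutely_continuous (distr (MU r q) (MU r q) (ac r q g)) (MU r q)"
  using quasi_invariant[OF assms] by (simp_all add: carrier_Sp)
qed

lemma measured_object_XO:
 "measured_object (Sp r :: 'k::efield mat top_group) (XO r)"
 unfolding measured_object_def XO_simps idx_XO
proof (intro conjI allI impI ballI)
 show "ereal (real r - 1) = - 1 \<or> ereal (real r - 1) = \<infinity> \<or> (\<exists>n::nat. ereal (real r - 1) = ereal (real n))"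
  by (cases r) (auto simp: one_ereal_def)
 show "regular_space (Sp r :: 'k mat top_group) (MU r k) (ac r k)" if "k \<in> {k. k < r}" for k
  by (rule regular_space_XX) (use that in simp)
 show "space (MU r k :: 'k mat measure) = {}" if "k \<notin> {k. k < r}" for k
  unfolding space_MU by (rule XX_empty) (use that in simp)
next
 fix k i :: nat assume i: "i \<le> k + 1"
 then have i': "i \<le> Suc k" by simp
 show "fc r k i \<in> MU r (k + 1) \<rightarrow>\<^sub>M (MU r k :: 'k mat measure)"
  using measurable_fc[OF i', of r, where ?'k = 'k] by (simp add: measurable_cong_sets[OF sets_MU sets_MU])
 show "fc r k i (ac r (k + 1) g x) = ac r k g (fc r k i x)"
  if "g \<in> carrier (Sp r)" "x \<in> space (MU r (k + 1))" for g x :: "'k mat"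
 proof -
  have x: "x \<in> XX r (Suc k)" and g: "spcond r g" using that by (simp_all add: space_MU carrier_Sp)
  show ?thesis using fc_mult[OF spcond_carrier[OF g] XX_carrier[OF x]] x fc_XX(2)[OF x i'] by (simp add: ac_def)
 qed
 show "fc r k i -` N \<inter> space (MU r (k + 1)) \<in> null_sets (MU r (k + 1))" if N: "N \<in> null_sets (MU r k)" for N :: "'k mat set"
 proof (cases "Suc k < r")
  case True
  have "AE y in MU r (Suc k). y \<notin> fc r k i -` N \<inter> space (MU r (Suc k))"
   using AE_MU_fc[OF True i' AE_not_in[OF N]] by (rule AE_mp) (rule AE_I2, simp)
  moreover have "fc r k i -` N \<inter> space (MU r (Suc k)) \<in> sets (MU r (Suc k))"
  proof (rule measurable_sets)
   show "fc r k i \<in> MU r (Suc k) \<rightarrow>\<^sub>M (MU r k :: 'k mat measure)"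
    using measurable_fc[OF i', of r, where ?'k = 'k] by (simp only: measurable_cong_sets[OF sets_MU sets_MU])
  qed (use N in blast)
  ultimately show ?thesis by (simp add: AE_iff_null_sets)
 next
  case False
  then have "XX r (Suc k) = ({} :: 'k mat set)" by (intro XX_empty) simp
  then show ?thesis by (simp add: space_MU)
 qed
next
 fix k i j :: nat and x :: "'k mat" assume "i < j \<and> j \<le> k + 2"
 then show "fc r k i (fc r (k + 1) j x) = fc r k (j - 1) (fc r (k + 1) i x)" using fc_fc[of i j k r x] by simp
qed

lemma q_transitive_XO: "q_transitive (Sp r :: 'k::efield mat top_group) (XO r) (ereal (real r - 1))"
 unfolding q_transitive_def XO_simps idx_XO space_MU
proof
 fix k assume "k \<in> {k. k < r}"
 show "transitive_action (Sp r :: 'k mat top_group) (XX r k) (ac r k)"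
 proof (intro transitive_action.intro transitive_action_axioms.intro group_action_XX)
  fix x y :: "'k mat" assume xy: "x \<in> XX r k" "y \<in> XX r k"
  obtain g where "spcond r g" "g * x = y" using XX_transitive[OF xy] by blast
  then show "\<exists>g\<in>carrier (Sp r). ac r k g x = y" using xy by (intro bexI[of _ g]) (simp_all add: ac_def carrier_Sp)
 qed
qed

section \<open>Admissibility\<close>

lemma density_of_distr:
 assumes N: "sigma_finite_measure N" and \<rho>: "finite_measure \<rho>" "sets \<rho> = sets N" "absolutely_continuous N \<rho>"
 obtains D :: "'a \<Rightarrow> real" where "D \<in> borel_measurable N" "AE x in N. RN_deriv N \<rho> x = ennreal (D x)" "\<And>x. 0 \<le> D x"
  "density N (\<lambda>x. ennreal (D x)) = \<rho>"
proof -
 interpret sigma_finite_measure N by fact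
 obtain D where D: "D \<in> borel_measurable N" "AE x in N. RN_deriv N \<rho> x = ennreal (D x)" "AE x in \<rho>. 0 < D x" "\<And>x. 0 \<le> D x"
  using real_RN_deriv[OF \<rho>(1,3,2)] by blast
 have "density N (\<lambda>x. ennreal (D x)) = density N (RN_deriv N \<rho>)"
 proof (rule density_cong)
  show "(\<lambda>x. ennreal (D x)) \<in> borel_measurable N" using D(1) by simp
  show "AE x in N. ennreal (D x) = RN_deriv N \<rho> x" using D(2) by (rule eventually_mono) simp
 qed simp
 also have "\<dots> = \<rho>" by (rule density_RN_deriv[OF \<rho>(3,2)])
 finally show ?thesis using that[OF D(1,2,4)] by blast
qed

text \<open>The predual of composition with \<open>\<delta>\<close>: \<open>D\<close> is the
  Radon-Nikodym density of the image under \<open>\<delta>\<close> of the measure with density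
  \<open>h\<close>, which is absolutely continuous because \<open>\<delta>\<close> pulls null sets
  back to null sets.\<close>

lemma pushforward_nonneg:
 fixes h :: "'a \<Rightarrow> real"
 assumes N: "finite_measure N" and d: "\<delta> \<in> M \<rightarrow>\<^sub>M N" "\<And>A. A \<in> null_sets N ==> \<delta> -` A \<inter> space M \<in> null_sets M"
  and h: "integrable M h" "\<And>x. 0 \<le> h x"
 obtains D where "integrable N D" "\<And>F :: 'b \<Rightarrow> real. F \<in> borel_measurable N ==> (LINT y|N. D y * F y) = (LINT x|M. h x * F (\<delta> x))"
proof -
 interpret N: finite_measure N by fact
 let ?H = "density M (\<lambda>x. ennreal (h x))"
 let ?\<rho> = "distr ?H N \<delta>"
 have hm: "h \<in> borel_measurable M" using h by simp
 have dH: "\<delta> \<in> ?H \<rightarrow>\<^sub>M N" using d(1) by (simp only: measurable_cong_sets[OF sets_density refl])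
 have fin: "emeasure ?\<rho> (space ?\<rho>) < \<infinity>"
 proof -
  have "emeasure ?\<rho> (space ?\<rho>) = emeasure ?H (\<delta> -` space N \<inter> space M)"
   using emeasure_distr[OF dH, of "space N"] by simp
  also have "\<delta> -` space N \<inter> space M = space M" using measurable_space[OF d(1)] by auto
  also have "emeasure ?H (space M) = (\<integral>\<^sup>+x. ennreal (h x) \<partial>M)"
   using hm by (subst emeasure_density) (auto intro!: nn_integral_cong)
  also have "\<dots> < \<infinity>" using h by (simp add: nn_integral_eq_integral)
  finally show ?thesis .
 qed
 then have f\<rho>: "finite_measure ?\<rho>" by (intro finite_measureI) auto
 have ac\<rho>: "absolutely_continuous N ?\<rho>"
  unfolding absolutely_continuous_def
 proof
  fix A assume A: "A \<in> null_sets N"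
  have "\<delta> -` A \<inter> space M \<in> null_sets M" by (rule d(2)[OF A])
  then have "\<delta> -` A \<inter> space M \<in> null_sets ?H"
   using hm by (subst null_sets_density_iff) (auto dest: AE_not_in)
  then have "emeasure ?H (\<delta> -` A \<inter> space M) = 0" by blast
  then show "A \<in> null_sets ?\<rho>" using A emeasure_distr[OF dH, of A] by (auto simp: null_sets_def)
 qed
 obtain D where D: "D \<in> borel_measurable N" "AE x in N. RN_deriv N ?\<rho> x = ennreal (D x)" "\<And>x. 0 \<le> D x" "density N (\<lambda>x. ennreal (D x)) = ?\<rho>"
  using density_of_distr[OF N.sigma_finite_measure_axioms f\<rho> sets_distr ac\<rho>] by blast
 have "(\<integral>\<^sup>+x. ennreal (D x) \<partial>N) = emeasure ?\<rho> (space N)"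
  unfolding D(4)[symmetric] using D(1) by (subst emeasure_density) (auto intro!: nn_integral_cong)
 then have "integrable N D" using fin D by (intro integrableI_nonneg) auto
 moreover have "(LINT y|N. D y * F y) = (LINT x|M. h x * F (\<delta> x))" if F: "F \<in> borel_measurable N" for F :: "'b \<Rightarrow> real"
 proof -
  have "(LINT y|N. D y * F y) = (LINT y|?\<rho>. F y)"
   using integral_density[OF F D(1)] D(3,4) by simp
  also have "\<dots> = (LINT x|?H. F (\<delta> x))" by (rule integral_distr[OF dH F])
  also have "\<dots> = (LINT x|M. h x * F (\<delta> x))"
   using integral_density[OF measurable_compose[OF d(1) F] hm] h(2) by simp
  finally show ?thesis .
 qed
 ultimately show ?thesis using that by blast
qed

lemma integrable_mult_Linf:
 fixes u :: "'a \<Rightarrow> real"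
 assumes "integrable N u" "F \<in> Linf N" shows "integrable N (\<lambda>x. u x * F x)"
proof -
 obtain C where C: "AE x in N. \<bar>F x\<bar> \<le> C" and Fm: "F \<in> borel_measurable N" using assms(2) by (auto simp: Linf_def)
 have "integrable N (\<lambda>x. C * u x)" using assms(1) by simp
 then show ?thesis
 proof (rule Bochner_Integration.integrable_bound)
  show "(\<lambda>x. u x * F x) \<in> borel_measurable N" using assms(1) Fm by auto
  show "AE x in N. norm (u x * F x) \<le> norm (C * u x)" using C
  proof (rule eventually_mono)
   fix x assume c: "\<bar>F x\<bar> \<le> C"
   then have "\<bar>F x\<bar> \<le> \<bar>C\<bar>" by linarith
   then show "norm (u x * F x) \<le> norm (C * u x)" using mult_right_mono[of "\<bar>F x\<bar>" "\<bar>C\<bar>" "\<bar>u x\<bar>"] by (simp add: abs_mult mult.commute)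
  qed
 qed
qed

lemma Linf_compose:
 assumes "\<delta> \<in> M \<rightarrow>\<^sub>M N" "\<And>A. A \<in> null_sets N ==> \<delta> -` A \<inter> space M \<in> null_sets M" "F \<in> Linf N"
 shows "(\<lambda>x. F (\<delta> x)) \<in> Linf M"
proof -
 obtain C where C: "AE x in N. \<bar>F x\<bar> \<le> C" and Fm: "F \<in> borel_measurable N" using assms(3) by (auto simp: Linf_def)
 obtain A where A: "A \<in> null_sets N" "\<And>x. x \<in> space N ==> x \<notin> A ==> \<bar>F x\<bar> \<le> C" using AE_null_cover[OF C] by blast
 have "AE x in M. x \<notin> \<delta> -` A \<inter> space M" by (rule AE_not_in[OF assms(2)[OF A(1)]])
 then have "AE x in M. \<bar>F (\<delta> x)\<bar> \<le> C"
 proof (rule AE_mp, intro AE_I2 impI)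
  fix x assume "x \<in> space M" "x \<notin> \<delta> -` A \<inter> space M"
  then show "\<bar>F (\<delta> x)\<bar> \<le> C" using A(2) measurable_space[OF assms(1)] by blast
 qed
 then show ?thesis using measurable_compose[OF assms(1) Fm] unfolding Linf_def by blast
qed

lemma pushforward:
 fixes h :: "'a \<Rightarrow> real"
 assumes N: "finite_measure N" and d: "\<delta> \<in> M \<rightarrow>\<^sub>M N" "\<And>A. A \<in> null_sets N ==> \<delta> -` A \<inter> space M \<in> null_sets M"
  and h: "integrable M h"
 shows "\<exists>D. integrable N D \<and> (\<forall>F\<in>Linf N. (LINT y|N. D y * F y) = (LINT x|M. h x * F (\<delta> x)))"
proof -
 let ?p = "\<lambda>x. max 0 (h x)" and ?m = "\<lambda>x. max 0 (- h x)"
 have ip: "integrable M ?p" "integrable M ?m" using h by auto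
 obtain P where P: "integrable N P" "\<And>F :: 'b \<Rightarrow> real. F \<in> borel_measurable N ==> (LINT y|N. P y * F y) = (LINT x|M. ?p x * F (\<delta> x))"
  using pushforward_nonneg[OF N d ip(1)] by auto
 obtain Q where Q: "integrable N Q" "\<And>F :: 'b \<Rightarrow> real. F \<in> borel_measurable N ==> (LINT y|N. Q y * F y) = (LINT x|M. ?m x * F (\<delta> x))"
  using pushforward_nonneg[OF N d ip(2)] by auto
 have "(LINT y|N. (P y - Q y) * F y) = (LINT x|M. h x * F (\<delta> x))" if F: "F \<in> Linf N" for F
 proof -
  have Fd: "(\<lambda>x. F (\<delta> x)) \<in> Linf M" by (rule Linf_compose[OF d F])
  have Fm: "F \<in> borel_measurable N" using F by (simp add: Linf_def)
  have "(LINT y|N. (P y - Q y) * F y) = (LINT y|N. P y * F y) - (LINT y|N. Q y * F y)"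
   by (simp only: left_diff_distrib Bochner_Integration.integral_diff[OF integrable_mult_Linf[OF P(1) F] integrable_mult_Linf[OF Q(1) F]])
  also have "\<dots> = (LINT x|M. ?p x * F (\<delta> x)) - (LINT x|M. ?m x * F (\<delta> x))"
   by (simp only: P(2)[OF Fm] Q(2)[OF Fm])
  also have "\<dots> = (LINT x|M. ?p x * F (\<delta> x) - ?m x * F (\<delta> x))"
   by (rule Bochner_Integration.integral_diff[OF integrable_mult_Linf[OF ip(1) Fd] integrable_mult_Linf[OF ip(2) Fd], symmetric])
  also have "\<dots> = (LINT x|M. h x * F (\<delta> x))" by (rule Bochner_Integration.integral_cong) (auto simp: max_def)
  finally show ?thesis .
 qed
 moreover have "integrable N (\<lambda>y. P y - Q y)" using P(1) Q(1) by simp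
 ultimately show ?thesis by blast
qed

text \<open>Existence of a predual, stated for one \<open>h\<close> at a time. Linearity,
  boundedness and equivariance of the predual are derived from uniqueness in
  \<open>admissibleI\<close>.\<close>

definition dualizable :: "'x measure \<Rightarrow> 'y measure \<Rightarrow> (('y \<Rightarrow> real) \<Rightarrow> 'x \<Rightarrow> real) \<Rightarrow> bool" where
 "dualizable M N c \<longleftrightarrow> (\<forall>F\<in>Linf N. c F \<in> Linf M) \<and>
   (\<forall>h. integrable M h \<longrightarrow> (\<exists>D. integrable N D \<and> (\<forall>F\<in>Linf N. (LINT y|N. D y * F y) = (LINT x|M. h x * c F x))))"

lemma Linf_cmult: assumes "f \<in> Linf M" shows "(\<lambda>x. c * f x) \<in> Linf M"
proof -
 obtain C where C: "AE x in M. \<bar>f x\<bar> \<le> C" and m: "f \<in> borel_measurable M" using assms by (auto simp: Linf_def)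
 have "AE x in M. \<bar>c * f x\<bar> \<le> \<bar>c\<bar> * C" using C by (rule eventually_mono) (simp add: abs_mult mult_left_mono)
 then show ?thesis using m unfolding Linf_def by auto
qed

lemma Linf_add: assumes "f \<in> Linf M" "g \<in> Linf M" shows "(\<lambda>x. f x + g x) \<in> Linf M"
proof -
 obtain C B where C: "AE x in M. \<bar>f x\<bar> \<le> C" "AE x in M. \<bar>g x\<bar> \<le> B" and m: "f \<in> borel_measurable M" "g \<in> borel_measurable M"
  using assms by (auto simp: Linf_def)
 have "AE x in M. \<bar>f x + g x\<bar> \<le> C + B" using AE_conjI[OF C] by (rule eventually_mono) linarith
 then show ?thesis using m unfolding Linf_def by auto
qed

lemma dualizable_cmult: assumes "dualizable M N c" shows "dualizable M N (\<lambda>F x. a * c F x)"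
 unfolding dualizable_def
proof (intro conjI ballI allI impI)
 show "(\<lambda>x. a * c F x) \<in> Linf M" if "F \<in> Linf N" for F using that assms by (simp add: dualizable_def Linf_cmult)
 fix h :: "'a \<Rightarrow> real" assume "integrable M h"
 then obtain D where D: "integrable N D" "\<forall>F\<in>Linf N. (LINT y|N. D y * F y) = (LINT x|M. h x * c F x)"
  using assms unfolding dualizable_def by blast
 show "\<exists>D. integrable N D \<and> (\<forall>F\<in>Linf N. (LINT y|N. D y * F y) = (LINT x|M. h x * (a * c F x)))"
  by (rule exI[of _ "\<lambda>y. a * D y"]) (use D in \<open>simp add: mult.assoc mult.left_commute[of _ a]\<close>)
qed

lemma dualizable_add: assumes "dualizable M N c" "dualizable M N c'" shows "dualizable M N (\<lambda>F x. c F x + c' F x)"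
 unfolding dualizable_def
proof (intro conjI ballI allI impI)
 show "(\<lambda>x. c F x + c' F x) \<in> Linf M" if "F \<in> Linf N" for F using that assms by (simp add: dualizable_def Linf_add)
 fix h :: "'a \<Rightarrow> real" assume h: "integrable M h"
 obtain D where D: "integrable N D" "\<forall>F\<in>Linf N. (LINT y|N. D y * F y) = (LINT x|M. h x * c F x)"
  using assms(1) h unfolding dualizable_def by blast
 obtain D' where D': "integrable N D'" "\<forall>F\<in>Linf N. (LINT y|N. D' y * F y) = (LINT x|M. h x * c' F x)"
  using assms(2) h unfolding dualizable_def by blast
 have "(LINT y|N. (D y + D' y) * F y) = (LINT x|M. h x * (c F x + c' F x))" if F: "F \<in> Linf N" for F
 proof -
  have c: "c F \<in> Linf M" "c' F \<in> Linf M" using assms F by (simp_all add: dualizable_def)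
  show ?thesis using D(2) D'(2) F
   by (simp add: distrib_left distrib_right integrable_mult_Linf[OF D(1) F] integrable_mult_Linf[OF D'(1) F]
     integrable_mult_Linf[OF h c(1)] integrable_mult_Linf[OF h c(2)])
 qed
 then show "\<exists>D. integrable N D \<and> (\<forall>F\<in>Linf N. (LINT y|N. D y * F y) = (LINT x|M. h x * (c F x + c' F x)))"
  using D(1) D'(1) by (intro exI[of _ "\<lambda>y. D y + D' y"]) simp
qed

lemma dualizable_sum: "finite I ==> (\<And>i. i \<in> I ==> dualizable M N (c i)) ==> dualizable M N (\<lambda>F x. \<Sum>i\<in>I. c i F x)"
proof (induction I rule: finite_induct)
 case empty
 show ?case unfolding dualizable_def by (auto simp: Linf_def intro!: exI[of _ 0] exI[of _ "\<lambda>_. 0"])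
qed (simp add: dualizable_add)

lemma Linf_sgn: "u \<in> borel_measurable N ==> (\<lambda>x. sgn (u x :: real)) \<in> Linf N"
 unfolding Linf_def by (auto simp: sgn_if intro!: exI[of _ 1])

text \<open>Tested on the sign of the difference.\<close>

lemma dual_unique:
 fixes u v :: "'a \<Rightarrow> real"
 assumes "integrable N u" "integrable N v" "\<And>F. F \<in> Linf N ==> (LINT x|N. u x * F x) = (LINT x|N. v x * F x)"
 shows "AE x in N. u x = v x"
proof -
 let ?w = "\<lambda>x. u x - v x"
 have w: "integrable N ?w" using assms by simp
 have F: "(\<lambda>x. sgn (?w x)) \<in> Linf N" by (rule Linf_sgn) (use w in simp)
 have "(LINT x|N. \<bar>?w x\<bar>) = (LINT x|N. u x * sgn (?w x) - v x * sgn (?w x))"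
  by (rule Bochner_Integration.integral_cong) (auto simp: sgn_if)
 also have "\<dots> = 0"
  using Bochner_Integration.integral_diff[OF integrable_mult_Linf[OF assms(1) F] integrable_mult_Linf[OF assms(2) F]] assms(3)[OF F] by simp
 finally have "AE x in N. \<bar>?w x\<bar> = 0"
  using w by (subst (asm) integral_nonneg_eq_0_iff_AE) auto
 then show ?thesis by (rule eventually_mono) simp
qed

text \<open>The action on integrable functions is the predual of composition with
  \<open>\<phi> g\<close>; the Radon-Nikodym factor of its definition turns the integral into one
  against the image measure.\<close>

lemma L1_act_dual:
 fixes h :: "'x \<Rightarrow> real"
 assumes M: "finite_measure M" and f: "\<phi> g \<in> M \<rightarrow>\<^sub>M M" "\<phi> (inv\<^bsub>G\<^esub> g) \<in> M \<rightarrow>\<^sub>M M" "absolutely_continuous M (distr M M (\<phi> g))"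
  and inv: "\<And>x. x \<in> space M ==> \<phi> (inv\<^bsub>G\<^esub> g) (\<phi> g x) = x"
  and h: "integrable M h"
 shows "integrable M (L1_act G M \<phi> g h)"
  "F \<in> borel_measurable M ==> (LINT x|M. L1_act G M \<phi> g h x * F x) = (LINT x|M. h x * F (\<phi> g x))"
proof -
 interpret finite_measure M by fact
 let ?\<rho> = "distr M M (\<phi> g)"
 have hm: "h \<in> borel_measurable M" using h by simp
 have "finite_measure ?\<rho>" by (rule finite_measure_distr[OF f(1)])
 from density_of_distr[OF sigma_finite_measure_axioms this sets_distr f(3)]
 obtain D where D: "D \<in> borel_measurable M" "AE x in M. RN_deriv M ?\<rho> x = ennreal (D x)" "\<And>x. 0 \<le> D x" "density M (\<lambda>x. ennreal (D x)) = ?\<rho>" by blast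
 have ae: "AE x in M. L1_act G M \<phi> g h x = D x * h (\<phi> (inv\<^bsub>G\<^esub> g) x)"
  using D(2) by (rule eventually_mono) (simp add: L1_act_def D(3))
 have rm: "(\<lambda>x. RN_deriv M ?\<rho> x) \<in> borel_measurable M" by simp
 have Lm: "L1_act G M \<phi> g h \<in> borel_measurable M"
  unfolding L1_act_def using measurable_compose[OF f(2) hm] rm by measurable
 have hi: "(\<lambda>x. h (\<phi> (inv\<^bsub>G\<^esub> g) x)) \<in> borel_measurable M" by (rule measurable_compose[OF f(2) hm])
 have hc: "integrable M (\<lambda>x. h (\<phi> (inv\<^bsub>G\<^esub> g) (\<phi> g x)))"
  using h inv by (subst Bochner_Integration.integrable_cong[OF refl]) auto
 have "integrable ?\<rho> (\<lambda>x. h (\<phi> (inv\<^bsub>G\<^esub> g) x))" using hc by (simp add: integrable_distr_eq[OF f(1) hi])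
 then have i1: "integrable M (\<lambda>x. D x * h (\<phi> (inv\<^bsub>G\<^esub> g) x))"
  unfolding D(4)[symmetric] using integrable_density[OF hi D(1)] D(3) by simp
 show "integrable M (L1_act G M \<phi> g h)"
  using integrable_cong_AE[OF Lm borel_measurable_times[OF D(1) hi] ae] i1 by (simp only:)
 assume F: "F \<in> borel_measurable M"
 have hF: "(\<lambda>x. h (\<phi> (inv\<^bsub>G\<^esub> g) x) * F x) \<in> borel_measurable M" using hi F by simp
 have "(LINT x|M. L1_act G M \<phi> g h x * F x) = (LINT x|M. D x * (h (\<phi> (inv\<^bsub>G\<^esub> g) x) * F x))"
 proof (rule integral_cong_AE)
  show "AE x in M. L1_act G M \<phi> g h x * F x = D x * (h (\<phi> (inv\<^bsub>G\<^esub> g) x) * F x)" using ae by (rule eventually_mono) simp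
 qed (use Lm F D(1) hF in simp_all)
 also have "\<dots> = (LINT x|?\<rho>. h (\<phi> (inv\<^bsub>G\<^esub> g) x) * F x)"
  unfolding D(4)[symmetric] using integral_density[OF hF D(1)] D(3) by simp
 also have "\<dots> = (LINT x|M. h (\<phi> (inv\<^bsub>G\<^esub> g) (\<phi> g x)) * F (\<phi> g x))"
  by (rule integral_distr[OF f(1) hF])
 also have "\<dots> = (LINT x|M. h x * F (\<phi> g x))"
  by (rule Bochner_Integration.integral_cong) (simp_all add: inv)
 finally show "(LINT x|M. L1_act G M \<phi> g h x * F x) = (LINT x|M. h x * F (\<phi> g x))" .
qed

text \<open>The predual \<open>T h\<close> is chosen separately for each \<open>h\<close>. That
  \<open>T\<close> respects equality a.e., is linear and equivariant follows each time by pairing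
  both sides with a bounded function and moving the question to the coboundary
  (\<open>dual_unique\<close>).\<close>

lemma admissibleI:
 fixes X :: "('g, 'x) measured_obj"
 assumes fin: "\<And>k. finite_measure (lev X k)"
  and fm: "\<And>k i. i \<le> k + 1 ==> face X k i \<in> lev X (k + 1) \<rightarrow>\<^sub>M lev X k"
  and fn: "\<And>k i N. i \<le> k + 1 ==> N \<in> null_sets (lev X k) ==> face X k i -` N \<inter> space (lev X (k + 1)) \<in> null_sets (lev X (k + 1))"
  and feq: "\<And>k i g x. i \<le> k + 1 ==> g \<in> carrier G ==> x \<in> space (lev X (k + 1)) ==> face X k i (act X (k + 1) g x) = act X k g (face X k i x)"
  and am: "\<And>k g. g \<in> carrier G ==> act X k g \<in> lev X k \<rightarrow>\<^sub>M lev X k"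
  and ai: "\<And>g. g \<in> carrier G ==> inv\<^bsub>G\<^esub> g \<in> carrier G"
  and aq: "\<And>k g. g \<in> carrier G ==> absolutely_continuous (lev X k) (distr (lev X k) (lev X k) (act X k g))"
  and inv: "\<And>k g x. g \<in> carrier G ==> x \<in> space (lev X k) ==> act X k (inv\<^bsub>G\<^esub> g) (act X k g x) = x"
 shows "admissible G X"
 unfolding admissible_def
proof (intro conjI allI)
 have dual: "integrable (lev X k) (L1_act G (lev X k) (act X k) g h)"
  "F \<in> borel_measurable (lev X k) ==> (LINT x|lev X k. L1_act G (lev X k) (act X k) g h x * F x) = (LINT x|lev X k. h x * F (act X k g x))"
  if g: "g \<in> carrier G" and h: "integrable (lev X k) h" for k g h F
  using L1_act_dual(1)[where \<phi> = "act X k" and G = G and g = g, OF fin am[OF g] am[OF ai[OF g]] aq[OF g] inv[OF g] h]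
   L1_act_dual(2)[where \<phi> = "act X k" and G = G and g = g and F = F, OF fin am[OF g] am[OF ai[OF g]] aq[OF g] inv[OF g] h] by simp_all
 have an: "act X k g -` N \<inter> space (lev X k) \<in> null_sets (lev X k)" if g: "g \<in> carrier G" and N: "N \<in> null_sets (lev X k)" for k g N
 proof -
  have "N \<in> null_sets (distr (lev X k) (lev X k) (act X k g))" using aq[OF g] N by (auto simp: absolutely_continuous_def)
  moreover have "N \<in> sets (lev X k)" using N by blast
  ultimately show ?thesis using measurable_sets[OF am[OF g]] by (auto simp: null_sets_def emeasure_distr[OF am[OF g]])
 qed
 fix k
 let ?M = "lev X (k + 1)" and ?N = "lev X k"
 have "dualizable ?M ?N (\<lambda>f x. f (face X k i x))" if "i \<le> k + 1" for i
  unfolding dualizable_def using Linf_compose[OF fm[OF that] fn[OF that]] pushforward[OF fin fm[OF that] fn[OF that]] by blast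
 then have dz: "dualizable ?M ?N (coboundary X k)"
  unfolding coboundary_def[abs_def] by (intro dualizable_sum dualizable_cmult) simp_all
 have cobL: "coboundary X k f \<in> Linf ?M" if "f \<in> Linf ?N" for f using dz that by (simp add: dualizable_def)
 define T where "T h = (SOME D. integrable ?N D \<and> (\<forall>F\<in>Linf ?N. (LINT y|?N. D y * F y) = (LINT x|?M. h x * coboundary X k F x)))" for h :: "'x \<Rightarrow> real"
 have T: "integrable ?N (T h)" "\<And>F. F \<in> Linf ?N ==> (LINT y|?N. T h y * F y) = (LINT x|?M. h x * coboundary X k F x)"
  if "integrable ?M h" for h
  using someI_ex[OF dz[unfolded dualizable_def, THEN conjunct2, rule_format, OF that]] unfolding T_def[symmetric] by auto
 show "\<exists>T. L1_operator ?M ?N T \<and>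
    (\<forall>g h. g \<in> carrier G \<and> integrable ?M h \<longrightarrow>
      (AE x in ?N. T (L1_act G ?M (act X (k + 1)) g h) x = L1_act G ?N (act X k) g (T h) x)) \<and>
    (\<forall>h f. integrable ?M h \<and> f \<in> Linf ?N \<longrightarrow> (LINT x|?M. h x * coboundary X k f x) = (LINT x|?N. T h x * f x))"
 proof (intro exI[of _ T] conjI allI impI; (elim conjE)?)
  show "L1_operator ?M ?N T"
   unfolding L1_operator_def
  proof (intro conjI allI impI; (elim conjE)?)
   show "integrable ?N (T f)" if "integrable ?M f" for f by (rule T(1)[OF that])
   show "AE y in ?N. T f y = T h y" if "integrable ?M f" "integrable ?M h" "AE x in ?M. f x = h x" for f h
   proof (rule dual_unique[OF T(1)[OF that(1)] T(1)[OF that(2)]])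
    fix F assume F: "F \<in> Linf ?N"
    have "(LINT x|?M. f x * coboundary X k F x) = (LINT x|?M. h x * coboundary X k F x)"
    proof (rule integral_cong_AE)
     show "AE x in ?M. f x * coboundary X k F x = h x * coboundary X k F x" using that(3) by (rule eventually_mono) simp
    qed (use integrable_mult_Linf[OF that(1) cobL[OF F]] integrable_mult_Linf[OF that(2) cobL[OF F]] in \<open>simp_all only: borel_measurable_integrable\<close>)
    then show "(LINT x|?N. T f x * F x) = (LINT x|?N. T h x * F x)" by (simp only: T(2)[OF that(1) F] T(2)[OF that(2) F])
   qed
   show "AE y in ?N. T (\<lambda>x. f x + h x) y = T f y + T h y" if "integrable ?M f" "integrable ?M h" for f h
   proof (rule dual_unique)
    have fh: "integrable ?M (\<lambda>x. f x + h x)" using that by simp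
    show "integrable ?N (T (\<lambda>x. f x + h x))" by (rule T(1)[OF fh])
    show "integrable ?N (\<lambda>y. T f y + T h y)" using T(1) that by simp
    fix F assume F: "F \<in> Linf ?N"
    show "(LINT x|?N. T (\<lambda>x. f x + h x) x * F x) = (LINT x|?N. (T f x + T h x) * F x)"
     unfolding T(2)[OF fh F] distrib_right
      Bochner_Integration.integral_add[OF integrable_mult_Linf[OF that(1) cobL[OF F]] integrable_mult_Linf[OF that(2) cobL[OF F]]]
      Bochner_Integration.integral_add[OF integrable_mult_Linf[OF T(1)[OF that(1)] F] integrable_mult_Linf[OF T(1)[OF that(2)] F]]
      T(2)[OF that(1) F] T(2)[OF that(2) F] ..
   qed
   show "AE y in ?N. T (\<lambda>x. c * f x) y = c * T f y" if "integrable ?M f" for c f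
   proof (rule dual_unique)
    have fh: "integrable ?M (\<lambda>x. c * f x)" using that by simp
    show "integrable ?N (T (\<lambda>x. c * f x))" by (rule T(1)[OF fh])
    show "integrable ?N (\<lambda>y. c * T f y)" using T(1) that by simp
    fix F assume F: "F \<in> Linf ?N"
    show "(LINT x|?N. T (\<lambda>x. c * f x) x * F x) = (LINT x|?N. (c * T f x) * F x)"
     unfolding T(2)[OF fh F] mult.assoc integral_mult_right_zero T(2)[OF that F] ..
   qed
   show "\<exists>C. \<forall>f. integrable ?M f \<longrightarrow> (LINT y|?N. \<bar>T f y\<bar>) \<le> C * (LINT x|?M. \<bar>f x\<bar>)"
   proof (intro exI allI impI)
    fix f :: "'x \<Rightarrow> real" assume f: "integrable ?M f"
    let ?F = "\<lambda>y. sgn (T f y)"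
    have F: "?F \<in> Linf ?N" by (rule Linf_sgn) (use T(1)[OF f] in simp)
    have "(LINT y|?N. \<bar>T f y\<bar>) = (LINT y|?N. T f y * ?F y)" by (rule Bochner_Integration.integral_cong) (auto simp: sgn_if)
    also have "\<dots> = (LINT x|?M. f x * coboundary X k ?F x)" by (rule T(2)[OF f F])
    \<comment> \<open>The coboundary of the sign function has \<open>k + 2\<close> terms, each of
      absolute value at most 1.\<close>
    also have "\<dots> \<le> (LINT x|?M. real (k + 2) * \<bar>f x\<bar>)"
    proof (rule integral_mono[OF integrable_mult_Linf[OF f cobL[OF F]]])
     show "integrable ?M (\<lambda>x. real (k + 2) * \<bar>f x\<bar>)" using f by simp
     fix x
     have "\<bar>coboundary X k ?F x\<bar> \<le> (\<Sum>i\<le>k+1. \<bar>(-1)^i * ?F (face X k i x)\<bar>)" unfolding coboundary_def by (rule sum_abs)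
     also have "\<dots> \<le> (\<Sum>i\<le>k+1. 1)" by (rule sum_mono) (simp add: abs_mult power_abs abs_sgn_eq)
     finally have "\<bar>coboundary X k ?F x\<bar> \<le> real (k + 2)" by simp
     then have "\<bar>f x\<bar> * \<bar>coboundary X k ?F x\<bar> \<le> \<bar>f x\<bar> * real (k + 2)" by (rule mult_left_mono) simp
     then show "f x * coboundary X k ?F x \<le> real (k + 2) * \<bar>f x\<bar>"
      using abs_ge_self[of "f x * coboundary X k ?F x"] by (simp only: abs_mult mult.commute)
    qed
    also have "\<dots> = real (k + 2) * (LINT x|?M. \<bar>f x\<bar>)" by simp
    finally show "(LINT y|?N. \<bar>T f y\<bar>) \<le> real (k + 2) * (LINT x|?M. \<bar>f x\<bar>)" .
   qed
  qed
  show "AE x in ?N. T (L1_act G ?M (act X (k + 1)) g h) x = L1_act G ?N (act X k) g (T h) x"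
   if g: "g \<in> carrier G" and h: "integrable ?M h" for g h
  proof (rule dual_unique)
   have gh: "integrable ?M (L1_act G ?M (act X (k + 1)) g h)" by (rule dual(1)[OF g h])
   show "integrable ?N (T (L1_act G ?M (act X (k + 1)) g h))" by (rule T(1)[OF gh])
   show "integrable ?N (L1_act G ?N (act X k) g (T h))" by (rule dual(1)[OF g T(1)[OF h]])
   fix F assume F: "F \<in> Linf ?N"
   have Fg: "(\<lambda>x. F (act X k g x)) \<in> Linf ?N" by (rule Linf_compose[OF am[OF g] an[OF g] F])
   have cm: "coboundary X k F \<in> borel_measurable ?M" using cobL[OF F] by (simp add: Linf_def)
   have Fm: "F \<in> borel_measurable ?N" using F by (simp add: Linf_def)
   have "(LINT x|?N. T (L1_act G ?M (act X (k + 1)) g h) x * F x) = (LINT x|?M. L1_act G ?M (act X (k + 1)) g h x * coboundary X k F x)"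
    by (rule T(2)[OF gh F])
   also have "\<dots> = (LINT x|?M. h x * coboundary X k F (act X (k + 1) g x))" by (rule dual(2)[OF g h cm])
   also have "\<dots> = (LINT x|?M. h x * coboundary X k (\<lambda>x. F (act X k g x)) x)"
   proof (rule Bochner_Integration.integral_cong[OF refl])
    fix x assume x: "x \<in> space ?M"
    have "coboundary X k F (act X (k + 1) g x) = coboundary X k (\<lambda>x. F (act X k g x)) x"
     unfolding coboundary_def by (rule sum.cong[OF refl]) (simp only: feq[OF _ g x] atMost_iff)
    then show "h x * coboundary X k F (act X (k + 1) g x) = h x * coboundary X k (\<lambda>x. F (act X k g x)) x" by (simp only:)
   qed
   also have "\<dots> = (LINT x|?N. T h x * F (act X k g x))" by (rule T(2)[OF h Fg, symmetric])
   also have "\<dots> = (LINT x|?N. L1_act G ?N (act X k) g (T h) x * F x)" by (rule dual(2)[OF g T(1)[OF h] Fm, symmetric])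
   finally show "(LINT x|?N. T (L1_act G ?M (act X (k + 1)) g h) x * F x) = (LINT x|?N. L1_act G ?N (act X k) g (T h) x * F x)" .
  qed
  show "(LINT x|?M. h x * coboundary X k f x) = (LINT x|?N. T h x * f x)" if "integrable ?M h" "f \<in> Linf ?N" for h f
   by (rule T(2)[OF that, symmetric])
 qed
next
 have dual: "integrable (lev X k) (L1_act G (lev X k) (act X k) g h)"
  "F \<in> borel_measurable (lev X k) ==> (LINT x|lev X k. L1_act G (lev X k) (act X k) g h x * F x) = (LINT x|lev X k. h x * F (act X k g x))"
  if g: "g \<in> carrier G" and h: "integrable (lev X k) h" for k g h F
  using L1_act_dual(1)[where \<phi> = "act X k" and G = G and g = g, OF fin am[OF g] am[OF ai[OF g]] aq[OF g] inv[OF g] h]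
   L1_act_dual(2)[where \<phi> = "act X k" and G = G and g = g and F = F, OF fin am[OF g] am[OF ai[OF g]] aq[OF g] inv[OF g] h] by simp_all
 show "\<exists>T. L1_functional (lev X 0) T \<and>
    (\<forall>g h. g \<in> carrier G \<and> integrable (lev X 0) h \<longrightarrow> T (L1_act G (lev X 0) (act X 0) g h) = T h) \<and>
    (\<forall>h c. integrable (lev X 0) h \<longrightarrow> (LINT x|lev X 0. h x * c) = T h * c)"
 proof (intro exI[of _ "\<lambda>h. \<integral>x. h x \<partial>lev X 0"] conjI allI impI; (elim conjE)?)
  show "L1_functional (lev X 0) (\<lambda>h. \<integral>x. h x \<partial>lev X 0)"
   unfolding L1_functional_def
  proof (intro conjI allI impI exI[of _ 1]; (elim conjE)?)
   show "(LINT x|lev X 0. f x) = (LINT x|lev X 0. h x)" if "integrable (lev X 0) f" "integrable (lev X 0) h" "AE x in lev X 0. f x = h x"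
    for f h :: "'x \<Rightarrow> real"
    by (rule integral_cong_AE) (use that in auto)
   show "\<bar>\<integral>x. f x \<partial>lev X 0\<bar> \<le> 1 * (LINT x|lev X 0. \<bar>f x\<bar>)" for f :: "'x \<Rightarrow> real"
    using integral_abs_bound[of "lev X 0" f] by simp
  qed simp_all
  show "(LINT x|lev X 0. L1_act G (lev X 0) (act X 0) g h x) = (LINT x|lev X 0. h x)" if "g \<in> carrier G" "integrable (lev X 0) h" for g and h :: "'x \<Rightarrow> real"
   using dual(2)[OF that, of "\<lambda>_. 1"] by simp
  show "(LINT x|lev X 0. h x * c) = (LINT x|lev X 0. h x) * c" for h :: "'x \<Rightarrow> real" and c by simp
 qed
qed

lemma finite_MU: "finite_measure (MU r q :: 'k::efield mat measure)"
proof (cases "q < r")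
 case True
 then interpret prob_space "MU r q :: 'k mat measure" by (rule prob_MU)
 show ?thesis by (rule finite_measure_axioms)
next
 case False
 then have "space (MU r q :: 'k mat measure) = {}" unfolding space_MU by (intro XX_empty) simp
 then show ?thesis by (intro finite_measureI) simp
qed

lemma admissible_XO: "admissible (Sp r :: 'k::efield mat top_group) (XO r)"
proof (rule admissibleI)
 have mo: "measured_object (Sp r :: 'k mat top_group) (XO r)" by (rule measured_object_XO)
 show "face (XO r) k i \<in> lev (XO r) (k + 1) \<rightarrow>\<^sub>M (lev (XO r) k :: 'k mat measure)" if "i \<le> k + 1" for k i
  using mo that unfolding measured_object_def by blast
 show "face (XO r) k i -` N \<inter> space (lev (XO r) (k + 1)) \<in> null_sets (lev (XO r) (k + 1))"
  if "i \<le> k + 1" "N \<in> null_sets (lev (XO r) k)" for k i and N :: "'k mat set"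
  using mo that unfolding measured_object_def by blast
 show "face (XO r) k i (act (XO r) (k + 1) g x) = act (XO r) k g (face (XO r) k i x)"
  if "i \<le> k + 1" "g \<in> carrier (Sp r)" "x \<in> space (lev (XO r) (k + 1))" for k i and g x :: "'k mat"
  using mo that unfolding measured_object_def by blast
 fix k and g :: "'k mat" assume g: "g \<in> carrier (Sp r)"
 then have sg: "spcond r g" by (simp add: carrier_Sp)
 show "act (XO r) k g \<in> lev (XO r) k \<rightarrow>\<^sub>M lev (XO r) k" using measurable_ac[OF sg] by simp
 show "inv\<^bsub>Sp r\<^esub> g \<in> carrier (Sp r)" by (rule group.inv_closed[OF group_Sp g])
 show "absolutely_continuous (lev (XO r) k) (distr (lev (XO r) k) (lev (XO r) k) (act (XO r) k g))"
 proof (cases "k < r")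
  case False
  then have "space (MU r k :: 'k mat measure) = {}" unfolding space_MU by (intro XX_empty) simp
  then have "N = {}" if "N \<in> null_sets (MU r k :: 'k mat measure)" for N using that sets.sets_into_space[of N "MU r k"] by auto
  then show ?thesis by (auto simp: absolutely_continuous_def)
 qed (use quasi_invariant(1)[OF _ sg] in simp)
 show "act (XO r) k (inv\<^bsub>Sp r\<^esub> g) (act (XO r) k g x) = x" if "x \<in> space (lev (XO r) k)" for x
  using that mult_XX[OF sg] sinv_XX(1)[OF sg] by (simp add: inv_Sp[OF g] ac_def space_MU)
qed (simp add: finite_MU)

section \<open>From discrete to measurable vanishing\<close>

text \<open>Formulas that evaluate the function at finitely many measurably chosen points with
  constant coefficients; they commute with averaging over the group.\<close>

definition opr :: "'z measure \<Rightarrow> nat \<Rightarrow> nat \<Rightarrow> (('k::efield mat \<Rightarrow> real) \<Rightarrow> 'z \<Rightarrow> real) \<Rightarrow> bool" where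
 "opr M r j E \<longleftrightarrow> (\<exists>L. (\<forall>p\<in>set L. snd p \<in> M \<rightarrow>\<^sub>M MB r j) \<and>
   (\<forall>\<phi>. \<forall>x\<in>space M. E \<phi> x = (\<Sum>p\<leftarrow>L. fst p * \<phi> (snd p x))))"

lemma opr_single: "\<rho> \<in> M \<rightarrow>\<^sub>M MB r j ==> opr M r j (\<lambda>\<phi> x. \<phi> (\<rho> x))"
 unfolding opr_def by (rule exI[of _ "[(1, \<rho>)]"]) simp

lemma opr_zero: "opr M r j (\<lambda>\<phi> x. 0)"
 unfolding opr_def by (rule exI[of _ "[]"]) simp

lemma opr_add: assumes "opr M r j E" "opr M r j E'" shows "opr M r j (\<lambda>\<phi> x. E \<phi> x + E' \<phi> x)"
proof -
 obtain L L' where "\<forall>p\<in>set L. snd p \<in> M \<rightarrow>\<^sub>M MB r j" "\<forall>\<phi>. \<forall>x\<in>space M. E \<phi> x = (\<Sum>p\<leftarrow>L. fst p * \<phi> (snd p x))"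
  "\<forall>p\<in>set L'. snd p \<in> M \<rightarrow>\<^sub>M MB r j" "\<forall>\<phi>. \<forall>x\<in>space M. E' \<phi> x = (\<Sum>p\<leftarrow>L'. fst p * \<phi> (snd p x))"
  using assms unfolding opr_def by blast
 then show ?thesis unfolding opr_def by (intro exI[of _ "L @ L'"]) auto
qed

lemma opr_cmult: assumes "opr M r j E" shows "opr M r j (\<lambda>\<phi> x. c * E \<phi> x)"
proof -
 obtain L where L: "\<forall>p\<in>set L. snd p \<in> M \<rightarrow>\<^sub>M MB r j" "\<forall>\<phi>. \<forall>x\<in>space M. E \<phi> x = (\<Sum>p\<leftarrow>L. fst p * \<phi> (snd p x))"
  using assms unfolding opr_def by blast
 have "(\<Sum>p\<leftarrow>map (\<lambda>p. (c * fst p, snd p)) L. fst p * \<phi> (snd p x)) = c * (\<Sum>p\<leftarrow>L. fst p * \<phi> (snd p x))" for \<phi> :: "'b mat \<Rightarrow> real" and x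
  by (induction L) (simp_all add: algebra_simps)
 then show ?thesis using L unfolding opr_def by (intro exI[of _ "map (\<lambda>p. (c * fst p, snd p)) L"]) auto
qed

lemma opr_diff: assumes "opr M r j E" "opr M r j E'" shows "opr M r j (\<lambda>\<phi> x. E \<phi> x - E' \<phi> x)"
 using opr_add[OF assms(1) opr_cmult[OF assms(2), of "-1"]] by simp

lemma opr_sum: "finite I ==> (\<And>i. i \<in> I ==> opr M r j (E i)) ==> opr M r j (\<lambda>\<phi> x. \<Sum>i\<in>I. E i \<phi> x)"
 by (induction I rule: finite_induct) (simp_all add: opr_zero opr_add)

lemma opr_compose:
 assumes "h \<in> M' \<rightarrow>\<^sub>M M" "opr M r j E" shows "opr M' r j (\<lambda>\<phi> x. E \<phi> (h x))"
proof -
 obtain L where L: "\<forall>p\<in>set L. snd p \<in> M \<rightarrow>\<^sub>M MB r j" "\<forall>\<phi>. \<forall>x\<in>space M. E \<phi> x = (\<Sum>p\<leftarrow>L. fst p * \<phi> (snd p x))"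
  using assms(2) unfolding opr_def by blast
 show ?thesis unfolding opr_def
 proof (intro exI[of _ "map (\<lambda>p. (fst p, \<lambda>x. snd p (h x))) L"] conjI allI ballI)
  show "snd p \<in> M' \<rightarrow>\<^sub>M MB r j" if "p \<in> set (map (\<lambda>p. (fst p, \<lambda>x. snd p (h x))) L)" for p
  proof -
   obtain u where u: "u \<in> set L" "p = (fst u, \<lambda>x. snd u (h x))" using \<open>p \<in> _\<close> by auto
   have "(\<lambda>x. snd u (h x)) \<in> M' \<rightarrow>\<^sub>M MB r j" by (rule measurable_compose[OF assms(1)]) (use L(1) u(1) in blast)
   then show ?thesis by (simp only: u snd_conv)
  qed
  show "E \<phi> (h x) = (\<Sum>p\<leftarrow>map (\<lambda>p. (fst p, \<lambda>x. snd p (h x))) L. fst p * \<phi> (snd p x))" if "x \<in> space M'" for \<phi> x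
   using L(2) measurable_space[OF assms(1) that] by (simp add: comp_def)
 qed
qed

lemma sum_list_nth_map: "(\<Sum>p\<leftarrow>L. F p) = (\<Sum>i<length L. F (L ! i) :: real)"
 by (simp add: sum_list_sum_nth atLeast0LessThan)

lemma opr_index:
 assumes "opr M r j E"
 shows "\<exists>(n :: nat) s \<rho>. (\<forall>i<n. \<rho> i \<in> M \<rightarrow>\<^sub>M MB r j) \<and> (\<forall>\<phi>. \<forall>x\<in>space M. E \<phi> x = (\<Sum>i<n. s i * \<phi> (\<rho> i x)))"
proof -
 obtain L where L: "\<forall>p\<in>set L. snd p \<in> M \<rightarrow>\<^sub>M MB r j" "\<forall>\<phi>. \<forall>x\<in>space M. E \<phi> x = (\<Sum>p\<leftarrow>L. fst p * \<phi> (snd p x))"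
  using assms unfolding opr_def by blast
 show ?thesis
 proof (intro exI[of _ "length L"] exI[of _ "\<lambda>i. fst (L ! i)"] exI[of _ "\<lambda>i. snd (L ! i)"] conjI allI impI ballI)
  show "snd (L ! i) \<in> M \<rightarrow>\<^sub>M MB r j" if "i < length L" for i using L(1) nth_mem[OF that] by blast
  show "E \<phi> x = (\<Sum>i<length L. fst (L ! i) * \<phi> (snd (L ! i) x))" if "x \<in> space M" for \<phi> x
   unfolding L(2)[rule_format, OF that] by (rule sum_list_nth_map)
 qed
qed

definition scoc :: "nat \<Rightarrow> nat \<Rightarrow> ('k::field mat \<Rightarrow> real) \<Rightarrow> bool" where
 "scoc r j \<phi> \<longleftrightarrow> (\<forall>\<eta>\<in>XX r (Suc j). (\<Sum>i\<le>Suc j. (-1)^i * \<phi> (fc r j i \<eta>)) = 0)"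

text \<open>Averaging a measurable cocycle against bounded functions on the group gives cocycles in the
 strict sense, to which the discrete vanishing theorem applies pointwise.\<close>

lemma transfer:
 fixes f :: "'k::efield mat \<Rightarrow> real"
 assumes j: "Suc j < r" and fm: "f \<in> borel_measurable (MB r j)" and fb: "\<And>x. \<bar>f x\<bar> \<le> C"
  and cob: "AE \<eta> in MU r (Suc j). (\<Sum>i\<le>Suc j. (-1)^i * f (fc r j i \<eta>)) = 0"
  and E: "opr (MB r j) r j E" and good: "AE \<xi> in MU r j. good \<xi>"
  and disc: "\<And>\<phi> \<xi>. scoc r j \<phi> ==> \<xi> \<in> XX r j ==> good \<xi> ==> \<phi> \<xi> = E \<phi> \<xi>"
 obtains g where "spcond r g" "AE \<xi> in MU r j. f (g * \<xi>) = E (\<lambda>x. f (g * x)) \<xi>"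
proof -
 interpret lam: prob_space "lam r :: 'k mat measure" by (rule prob_lam)
 obtain n :: nat and s \<rho> where "\<forall>i<n. \<rho> i \<in> MB r j \<rightarrow>\<^sub>M MB r j"
  and "\<forall>\<phi>. \<forall>x\<in>space (MB r j). E \<phi> x = (\<Sum>i<n. s i * \<phi> (\<rho> i x))"
  using opr_index[OF E] by blast
 then have \<rho>: "\<And>i. i < n ==> \<rho> i \<in> MB r j \<rightarrow>\<^sub>M MB r j"
  and Es: "\<And>\<phi> x. x \<in> space (MB r j) ==> E \<phi> x = (\<Sum>i<n. s i * \<phi> (\<rho> i x))" by (simp_all only:)
 have \<rho>X: "\<rho> i x \<in> XX r j" if "i < n" "x \<in> XX r j" for i x
  using measurable_space[OF \<rho>[OF that(1)], of x] that(2) unfolding space_MB by blast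
 define phi where "phi F x = (LINT g|lam r. F g * f (g * x))" for F :: "'k mat \<Rightarrow> real" and x
 have fo: "(\<lambda>g. f (g * x)) \<in> borel_measurable (lam r)" if "x \<in> XX r j" for x
  by (rule measurable_compose[OF measurable_orbit[OF that] fm])
 have int: "integrable (lam r) (\<lambda>g. F g * f (g * x))"
  if "F \<in> borel_measurable (lam r)" "\<And>g. \<bar>F g\<bar> \<le> 1" "x \<in> XX r j" for F x
 proof (rule lam.integrable_const_bound[of _ C])
  show "AE g in lam r. norm (F g * f (g * x)) \<le> C"
  proof (rule AE_I2)
   fix g
   have "\<bar>F g\<bar> * \<bar>f (g * x)\<bar> \<le> 1 * C" by (rule mult_mono) (use that(2) fb in simp_all)
   then show "norm (F g * f (g * x)) \<le> C" by (simp add: abs_mult)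
  qed
 qed (rule borel_measurable_times[OF that(1) fo[OF that(3)]])
 have strict: "scoc r j (phi F)" if F: "F \<in> borel_measurable (lam r)" "\<And>g. \<bar>F g\<bar> \<le> 1" for F
  unfolding scoc_def
 proof
  fix \<eta> :: "'k mat" assume \<eta>: "\<eta> \<in> XX r (Suc j)"
  have fX: "fc r j i \<eta> \<in> XX r j" if "i \<le> Suc j" for i by (rule fc_XX(2)[OF \<eta> that])
  have "AE g in lam r. (\<Sum>i\<le>Suc j. (-1)^i * f (fc r j i (g * \<eta>))) = 0" by (rule AE_MU_orbit[OF j \<eta> cob])
  then have ae: "AE g in lam r. (\<Sum>i\<le>Suc j. (-1)^i * (F g * f (g * fc r j i \<eta>))) = 0"
  proof (rule AE_mp, intro AE_I2 impI)
   fix g :: "'k mat" assume g: "g \<in> space (lam r)" and 0: "(\<Sum>i\<le>Suc j. (-1)^i * f (fc r j i (g * \<eta>))) = 0"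
   have gc: "g \<in> carrier_mat (2*r) (2*r)" using g by (simp add: carrier_Sp spcond_carrier)
   have "(\<Sum>i\<le>Suc j. (-1)^i * (F g * f (g * fc r j i \<eta>))) = F g * (\<Sum>i\<le>Suc j. (-1)^i * f (fc r j i (g * \<eta>)))"
    unfolding sum_distrib_left fc_mult[OF gc XX_carrier[OF \<eta>]] by (rule sum.cong[OF refl]) (rule mult.left_commute)
   then show "(\<Sum>i\<le>Suc j. (-1)^i * (F g * f (g * fc r j i \<eta>))) = 0" unfolding 0 by (simp only: mult_zero_right)
  qed
  have "(\<Sum>i\<le>Suc j. (-1)^i * phi F (fc r j i \<eta>)) = (\<Sum>i\<le>Suc j. (LINT g|lam r. (-1)^i * (F g * f (g * fc r j i \<eta>))))"
   unfolding phi_def by (simp only: integral_mult_right_zero)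
  also have "\<dots> = (LINT g|lam r. (\<Sum>i\<le>Suc j. (-1)^i * (F g * f (g * fc r j i \<eta>))))"
   by (rule Bochner_Integration.integral_sum[symmetric]) (intro integrable_mult_right int F fX, simp)
  also have "\<dots> = 0" by (rule integral_eq_zero_AE[OF ae])
  finally show "(\<Sum>i\<le>Suc j. (-1)^i * phi F (fc r j i \<eta>)) = 0" .
 qed
 define W where "W \<xi> g = f (g * \<xi>) - (\<Sum>i<n. s i * f (g * \<rho> i \<xi>))" for \<xi> g
 have W0: "AE g in lam r. W \<xi> g = 0" if \<xi>: "\<xi> \<in> XX r j" "good \<xi>" for \<xi>
 proof -
  have Wm: "W \<xi> \<in> borel_measurable (lam r)"
   unfolding W_def by (intro borel_measurable_diff borel_measurable_sum borel_measurable_times borel_measurable_const fo \<rho>X \<xi>) simp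
  \<comment> \<open>With the sign of the error \<open>W\<close> as weight, the discrete formula says
    that the integral of its absolute value is zero.\<close>
  define F where "F g = sgn (W \<xi> g)" for g
  have Fm: "F \<in> borel_measurable (lam r)" unfolding F_def using Wm by measurable
  have F1: "\<bar>F g\<bar> \<le> 1" for g by (simp add: F_def abs_sgn_eq)
  note i0 = int[OF Fm F1 \<xi>(1)]
  have i1: "integrable (lam r) (\<lambda>g. s i * (F g * f (g * \<rho> i \<xi>)))" if "i < n" for i
   by (rule integrable_mult_right) (rule int[OF Fm F1 \<rho>X[OF that \<xi>(1)]])
  have i2: "integrable (lam r) (\<lambda>g. \<Sum>i<n. s i * (F g * f (g * \<rho> i \<xi>)))"
   by (rule Bochner_Integration.integrable_sum) (use i1 in simp)
  have aW: "\<bar>W \<xi> g\<bar> = F g * f (g * \<xi>) - (\<Sum>i<n. s i * (F g * f (g * \<rho> i \<xi>)))" for g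
  proof -
   have "\<bar>W \<xi> g\<bar> = F g * W \<xi> g" by (auto simp: F_def sgn_if)
   then show ?thesis by (simp add: W_def right_diff_distrib sum_distrib_left mult.left_commute)
  qed
  have iW: "integrable (lam r) (\<lambda>g. \<bar>W \<xi> g\<bar>)" unfolding aW by (rule Bochner_Integration.integrable_diff[OF i0 i2])
  have "(LINT g|lam r. \<bar>W \<xi> g\<bar>) = phi F \<xi> - (\<Sum>i<n. s i * phi F (\<rho> i \<xi>))"
   unfolding aW Bochner_Integration.integral_diff[OF i0 i2] phi_def
   by (subst Bochner_Integration.integral_sum) (use i1 in \<open>simp_all\<close>)
  also have "\<dots> = phi F \<xi> - E (phi F) \<xi>" using Es[of \<xi> "phi F"] \<xi>(1) unfolding space_MB by simp
  also have "\<dots> = 0" using disc[OF strict[OF Fm F1] \<xi>] by simp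
  finally have "AE g in lam r. \<bar>W \<xi> g\<bar> = 0" using integral_nonneg_eq_0_iff_AE[OF iW] by simp
  then show ?thesis by simp
 qed
 have fs: "fst \<in> MU r j \<Otimes>\<^sub>M lam r \<rightarrow>\<^sub>M (MB r j :: 'k mat measure)" "snd \<in> MU r j \<Otimes>\<^sub>M lam r \<rightarrow>\<^sub>M (GB r :: 'k mat measure)"
  using measurable_fst[of "MU r j" "lam r"] measurable_snd[of "MU r j" "lam r"]
  by (simp_all only: measurable_cong_sets[OF refl sets_MU] measurable_cong_sets[OF refl sets_lam])
 have mm: "(\<lambda>p. f (snd p * h (fst p))) \<in> borel_measurable (MU r j \<Otimes>\<^sub>M lam r)" if "h \<in> MB r j \<rightarrow>\<^sub>M MB r j" for h :: "'k mat \<Rightarrow> 'k mat"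
  by (rule measurable_compose[OF measurable_mult_MB[OF fs(2) measurable_compose[OF fs(1) that]] fm])
 have Wm: "(\<lambda>p. W (fst p) (snd p)) \<in> borel_measurable (MU r j \<Otimes>\<^sub>M lam r)"
  unfolding W_def
  by (intro borel_measurable_diff borel_measurable_sum borel_measurable_times borel_measurable_const mm \<rho> mm[of "\<lambda>x. x"]) (simp_all add: measurable_ident)
 define A where "A = {p \<in> space (MU r j \<Otimes>\<^sub>M lam r). W (fst p) (snd p) \<noteq> 0}"
 have A: "A \<in> sets (MU r j \<Otimes>\<^sub>M lam r)" unfolding A_def using Wm by measurable
 have "AE \<xi> in MU r j. AE g in lam r. (\<xi>, g) \<notin> A"
 proof (rule AE_mp[OF good], rule AE_I2, rule impI)
  fix \<xi> :: "'k mat" assume "\<xi> \<in> space (MU r j)" "good \<xi>"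
  then have "AE g in lam r. W \<xi> g = 0" using W0 unfolding space_MU by blast
  then show "AE g in lam r. (\<xi>, g) \<notin> A" by (rule eventually_mono) (simp add: A_def)
 qed
 moreover have "prob_space (MU r j :: 'k mat measure)" by (rule prob_MU) (use j in simp)
 \<comment> \<open>So far the exceptional \<open>g\<close> depend on \<open>\<xi>\<close>; after the
   exchange one \<open>g\<close> serves a.e. \<open>\<xi>\<close>.\<close>
 ultimately have "AE g in lam r. AE \<xi> in MU r j. (\<xi>, g) \<notin> A" by (intro fubini_pick[OF _ prob_lam A])
 then obtain g :: "'k mat" where g: "g \<in> space (lam r)" "AE \<xi> in MU r j. (\<xi>, g) \<notin> A" by (rule AE_pick[OF prob_lam])
 have "AE \<xi> in MU r j. f (g * \<xi>) = E (\<lambda>x. f (g * x)) \<xi>"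
 proof (rule AE_mp[OF g(2)], intro AE_I2 impI)
  fix \<xi> :: "'k mat" assume \<xi>: "\<xi> \<in> space (MU r j)" "(\<xi>, g) \<notin> A"
  then have "W \<xi> g = 0" using g(1) by (simp add: A_def space_pair_measure)
  moreover have "\<xi> \<in> space (MB r j)" using \<xi>(1) by (simp only: space_MU space_MB)
  ultimately show "f (g * \<xi>) = E (\<lambda>x. f (g * x)) \<xi>" by (simp only: Es W_def right_minus_eq)
 qed
 moreover have "spcond r g" using g(1) by (simp add: carrier_Sp)
 ultimately show ?thesis using that by blast
qed

text \<open>Averaging over the group needs a representative that is bounded everywhere, since single
  orbits are integrated.\<close>

lemma Linf_bounded_version:
 assumes "f \<in> Linf M"
 obtains f' C where "f' \<in> borel_measurable M" "\<And>x. \<bar>f' x\<bar> \<le> (C :: real)" "AE x in M. f' x = f x"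
proof -
 obtain C where C: "AE x in M. \<bar>f x\<bar> \<le> C" and fm: "f \<in> borel_measurable M" using assms by (auto simp: Linf_def)
 show ?thesis
 proof (rule that[of "\<lambda>x. max (- \<bar>C\<bar>) (min \<bar>C\<bar> (f x))" "\<bar>C\<bar>"])
  show "(\<lambda>x. max (- \<bar>C\<bar>) (min \<bar>C\<bar> (f x))) \<in> borel_measurable M" using fm by measurable
  show "AE x in M. max (- \<bar>C\<bar>) (min \<bar>C\<bar> (f x)) = f x" using C by (rule eventually_mono) auto
 qed auto
qed

lemma cocycle_version:
 fixes f f' :: "'k::efield mat \<Rightarrow> real"
 assumes j: "Suc j < r" and eq: "AE x in MU r j. f' x = f x"
  and cob: "AE x in MU r (Suc j). coboundary (XO r) j f x = 0"
 shows "AE \<eta> in MU r (Suc j). (\<Sum>i\<le>Suc j. (-1)^i * f' (fc r j i \<eta>)) = 0"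
proof -
 have "AE \<eta> in MU r (Suc j). \<forall>i\<in>{..Suc j}. f' (fc r j i \<eta>) = f (fc r j i \<eta>)"
  by (rule AE_finite_allI) (use AE_MU_fc[OF j _ eq] in simp_all)
 with cob show ?thesis
 proof (rule AE_mp[OF AE_conjI], intro AE_I2 impI)
  fix \<eta> assume a: "coboundary (XO r) j f \<eta> = 0 \<and> (\<forall>i\<in>{..Suc j}. f' (fc r j i \<eta>) = f (fc r j i \<eta>))"
  then have "(\<Sum>i\<le>Suc j. (-1)^i * f' (fc r j i \<eta>)) = (\<Sum>i\<le>Suc j. (-1)^i * f (fc r j i \<eta>))" by (intro sum.cong) simp_all
  then show "(\<Sum>i\<le>Suc j. (-1)^i * f' (fc r j i \<eta>)) = 0" using a by (simp only: coboundary_def XO_simps Suc_eq_plus1)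
 qed
qed

lemma cohomology_0:
 fixes f :: "'k::efield mat \<Rightarrow> real"
 assumes r: "1 < r" and good: "AE \<xi> in MU r 0. good \<xi>" and c: "(c :: 'k mat) \<in> XX r 0"
  and disc: "\<And>\<phi> \<xi>. scoc r 0 \<phi> ==> \<xi> \<in> XX r 0 ==> good \<xi> ==> \<phi> \<xi> = \<phi> c"
  and f: "f \<in> Linf (MU r 0)" and cob: "AE x in MU r 1. coboundary (XO r) 0 f x = 0"
 shows "\<exists>c. AE x in MU r 0. f x = c"
proof -
 obtain f' C where f': "f' \<in> borel_measurable (MU r 0)" "\<And>x. \<bar>f' x\<bar> \<le> C" "AE x in MU r 0. f' x = f x"
  using Linf_bounded_version[OF f] by blast
 have r': "Suc 0 < r" using r by simp
 have fm: "f' \<in> borel_measurable (MB r 0)" using f'(1) by (simp only: measurable_cong_sets[OF sets_MU refl])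
 have cob': "AE \<eta> in MU r (Suc 0). (\<Sum>i\<le>Suc 0. (-1)^i * f' (fc r 0 i \<eta>)) = 0"
  by (rule cocycle_version[OF r' f'(3)]) (use cob in \<open>simp only: One_nat_def\<close>)
 have op: "opr (MB r 0 :: 'k mat measure) r 0 (\<lambda>\<phi> \<xi>. \<phi> c)" by (rule opr_single) (use c in \<open>simp only: measurable_const space_MB\<close>)
 obtain g where g: "spcond r g" "AE \<xi> in MU r 0. f' (g * \<xi>) = f' (g * c)"
  using transfer[OF r' fm f'(2) cob' op good disc] by blast
 have r0: "0 < r" using r by simp
 have "AE \<xi> in MU r 0. f' (g * (sinv r g * \<xi>)) = f' (g * c)" by (rule AE_MU_translate[OF r0 spcond_sinv[OF g(1)] g(2)])
 with f'(3) have "AE \<xi> in MU r 0. f \<xi> = f' (g * c)"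
 proof (rule AE_mp[OF AE_conjI], intro AE_I2 impI)
  fix \<xi> assume "\<xi> \<in> space (MU r 0)" "f' \<xi> = f \<xi> \<and> f' (g * (sinv r g * \<xi>)) = f' (g * c)"
  moreover from this have "g * (sinv r g * \<xi>) = \<xi>" by (intro sinv_XX(2)[OF g(1)]) (simp only: space_MU)
  ultimately show "f \<xi> = f' (g * c)" by simp
 qed
 then show ?thesis by blast
qed

text \<open>\<open>transfer\<close> yields a filling of the cocycle translated by some
  \<open>g\<close>. The function \<open>h\<close> is this filling translated back, so that
  equivariance of the face maps gives one of the cocycle itself.\<close>

lemma cohomology_Suc:
 fixes f :: "'k::efield mat \<Rightarrow> real" and E :: "('k mat \<Rightarrow> real) \<Rightarrow> 'k mat \<Rightarrow> real"
 assumes r: "Suc (Suc k) < r" and good: "AE \<xi> in MU r (Suc k). good \<xi>" and E: "opr (MB r k) r (Suc k) E"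
  and disc: "\<And>\<phi> \<xi>. scoc r (Suc k) \<phi> ==> \<xi> \<in> XX r (Suc k) ==> good \<xi> ==> \<phi> \<xi> = (\<Sum>i\<le>Suc k. (-1)^i * E \<phi> (fc r k i \<xi>))"
  and f: "f \<in> Linf (MU r (Suc k))" and cob: "AE x in MU r (Suc (Suc k)). coboundary (XO r) (Suc k) f x = 0"
 shows "\<exists>h\<in>Linf (MU r k). AE x in MU r (Suc k). f x = coboundary (XO r) k h x"
proof -
 obtain f' C where f': "f' \<in> borel_measurable (MU r (Suc k))" "\<And>x. \<bar>f' x\<bar> \<le> C" "AE x in MU r (Suc k). f' x = f x"
  using Linf_bounded_version[OF f] by blast
 have fm: "f' \<in> borel_measurable (MB r (Suc k))" using f'(1) by (simp only: measurable_cong_sets[OF sets_MU refl])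
 have r1: "Suc k < r" using r by simp
 define E' where "E' \<phi> \<xi> = (\<Sum>i\<le>Suc k. (-1)^i * E \<phi> (fc r k i \<xi>))" for \<phi> :: "'k mat \<Rightarrow> real" and \<xi>
 have op: "opr (MB r (Suc k)) r (Suc k) E'"
  unfolding E'_def by (intro opr_sum opr_cmult opr_compose[OF measurable_fc E]) simp_all
 obtain g where g: "spcond r g" "AE \<xi> in MU r (Suc k). f' (g * \<xi>) = E' (\<lambda>x. f' (g * x)) \<xi>"
  using transfer[OF r fm f'(2) cocycle_version[OF r f'(3) cob] op good disc[folded E'_def]] by blast
 obtain n :: nat and s \<rho> where "\<forall>i<n. \<rho> i \<in> MB r k \<rightarrow>\<^sub>M MB r (Suc k)"
  and "\<forall>\<phi>. \<forall>x\<in>space (MB r k). E \<phi> x = (\<Sum>i<n. s i * \<phi> (\<rho> i x))"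
  using opr_index[OF E] by blast
 then have \<rho>: "\<And>i. i < n ==> \<rho> i \<in> MB r k \<rightarrow>\<^sub>M MB r (Suc k)"
  and Es: "\<And>\<phi> x. x \<in> space (MB r k) ==> E \<phi> x = (\<Sum>i<n. s i * \<phi> (\<rho> i x))" by (simp_all only:)
 define h where "h y = (\<Sum>l<n. s l * f' (g * \<rho> l (sinv r g * y)))" for y
 have cg: "(\<lambda>_. g) \<in> M \<rightarrow>\<^sub>M GB r" "(\<lambda>_. sinv r g) \<in> M \<rightarrow>\<^sub>M GB r" for M
  using g(1) spcond_sinv[OF g(1)] by (simp_all add: carrier_Sp)
 have "h \<in> borel_measurable (MB r k)"
  unfolding h_def
 proof (intro borel_measurable_sum borel_measurable_times borel_measurable_const)
  fix l assume "l \<in> {..<n}"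
  then have l: "l < n" by simp
  have "(\<lambda>y. sinv r g * y) \<in> MB r k \<rightarrow>\<^sub>M MB r k" by (rule measurable_mult_MB[OF cg(2)]) simp
  from measurable_compose[OF measurable_mult_MB[OF cg(1) measurable_compose[OF this \<rho>[OF l]]] fm]
  show "(\<lambda>y. f' (g * \<rho> l (sinv r g * y))) \<in> borel_measurable (MB r k)" .
 qed
 then have hm: "h \<in> borel_measurable (MU r k)" by (simp only: measurable_cong_sets[OF sets_MU refl])
 have "\<bar>h y\<bar> \<le> (\<Sum>l<n. \<bar>s l\<bar> * C)" for y
 proof -
  have "\<bar>h y\<bar> \<le> (\<Sum>l<n. \<bar>s l * f' (g * \<rho> l (sinv r g * y))\<bar>)" unfolding h_def by (rule sum_abs)
  also have "\<dots> \<le> (\<Sum>l<n. \<bar>s l\<bar> * C)" by (rule sum_mono) (simp add: abs_mult mult_left_mono f'(2))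
  finally show ?thesis .
 qed
 then have hL: "h \<in> Linf (MU r k)" using hm unfolding Linf_def by blast
 have "AE \<xi> in MU r (Suc k). f' (g * (sinv r g * \<xi>)) = E' (\<lambda>x. f' (g * x)) (sinv r g * \<xi>)"
  by (rule AE_MU_translate[OF r1 spcond_sinv[OF g(1)] g(2)])
 with f'(3) have "AE \<xi> in MU r (Suc k). f \<xi> = coboundary (XO r) k h \<xi>"
 proof (rule AE_mp[OF AE_conjI], intro AE_I2 impI)
  fix \<xi> assume \<xi>: "\<xi> \<in> space (MU r (Suc k))" and a: "f' \<xi> = f \<xi> \<and> f' (g * (sinv r g * \<xi>)) = E' (\<lambda>x. f' (g * x)) (sinv r g * \<xi>)"
  have \<xi>X: "\<xi> \<in> XX r (Suc k)" using \<xi> by (simp only: space_MU)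
  have "E (\<lambda>x. f' (g * x)) (fc r k i (sinv r g * \<xi>)) = h (fc r k i \<xi>)" if "i \<le> Suc k" for i
  proof -
   have "fc r k i (sinv r g * \<xi>) = sinv r g * fc r k i \<xi>" by (rule fc_mult[OF sinv_carrier XX_carrier[OF \<xi>X]])
   moreover have "fc r k i (sinv r g * \<xi>) \<in> space (MB r k)"
    unfolding space_MB by (rule fc_XX(2)[OF mult_XX[OF spcond_sinv[OF g(1)] \<xi>X] that])
   ultimately show ?thesis by (simp only: Es h_def)
  qed
  then have e2: "E' (\<lambda>x. f' (g * x)) (sinv r g * \<xi>) = (\<Sum>i\<le>Suc k. (-1)^i * h (fc r k i \<xi>))"
   unfolding E'_def by (intro sum.cong refl) simp
  have e1: "g * (sinv r g * \<xi>) = \<xi>" by (rule sinv_XX(2)[OF g(1) \<xi>X])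
  have "f \<xi> = f' (g * (sinv r g * \<xi>))" using conjunct1[OF a] by (simp only: e1)
  also note conjunct2[OF a]
  also note e2
  finally show "f \<xi> = coboundary (XO r) k h \<xi>" by (simp only: coboundary_def XO_simps Suc_eq_plus1)
 qed
 then show ?thesis using hL by blast
qed

section \<open>Polynomial and measurable families of frames\<close>

text \<open>Used with two meanings of \<open>A\<close>: Borel measurable, and polynomial in each
  parameter. The same computations then show that the filling is measurable and that the conditions
  of general position are polynomial.\<close>

locale falg =
 fixes A :: "('z \<Rightarrow> 'k::field) \<Rightarrow> bool"
 assumes A_const: "A (\<lambda>_. c)" and A_add: "A f ==> A g ==> A (\<lambda>x. f x + g x)"
  and A_diff: "A f ==> A g ==> A (\<lambda>x. f x - g x)" and A_mult: "A f ==> A g ==> A (\<lambda>x. f x * g x)"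
begin

lemma A_sum: "(\<And>i. i \<in> I ==> A (f i)) ==> A (\<lambda>x. \<Sum>i\<in>I. f i x)"
 by (induction I rule: infinite_finite_induct) (simp_all add: A_const A_add)

lemma A_prod: "(\<And>i. i \<in> I ==> A (f i)) ==> A (\<lambda>x. \<Prod>i\<in>I. f i x)"
 by (induction I rule: infinite_finite_induct) (simp_all add: A_const A_mult)

definition av :: "('z \<Rightarrow> nat \<Rightarrow> 'k) \<Rightarrow> bool" where
 "av u \<longleftrightarrow> (\<forall>a. A (\<lambda>x. u x a))"

definition vl :: "nat \<Rightarrow> ('z \<Rightarrow> 'k vect list) \<Rightarrow> bool" where
 "vl n S \<longleftrightarrow> (\<forall>x. length (S x) = n) \<and> (\<forall>l<n. av (\<lambda>x. S x ! l))"

definition pl :: "nat \<Rightarrow> ('z \<Rightarrow> 'k frame) \<Rightarrow> bool" where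
 "pl n X \<longleftrightarrow> (\<forall>x. length (X x) = n) \<and> (\<forall>l<n. av (\<lambda>x. fst (X x ! l)) \<and> av (\<lambda>x. snd (X x ! l)))"

lemma av_const: "av (\<lambda>x. v)" by (simp add: av_def A_const)

lemma A_om: "av u ==> av v ==> A (\<lambda>x. om r (u x) (v x))"
 unfolding om_def av_def by (intro A_sum A_diff A_mult) simp_all

lemma vl_append: assumes "vl n S" "vl m T" shows "vl (n + m) (\<lambda>x. S x @ T x)"
proof -
 have "av (\<lambda>x. (S x @ T x) ! l)" if "l < n + m" for l
  using assms that by (cases "l < n") (auto simp: vl_def nth_append)
 then show ?thesis using assms by (simp add: vl_def)
qed

lemma vl_const: "vl (length S) (\<lambda>x. S)"
 by (simp add: vl_def av_const)

lemma pl_del: assumes "pl (Suc n) X" "i \<le> n" shows "pl n (\<lambda>x. del i (X x))"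
proof -
 have l: "length (X x) = Suc n" for x using assms by (simp add: pl_def)
 have e: "del i (X x) ! m = X x ! (if m < i then m else Suc m)" if "m < n" for m x
  using that assms l by (simp add: nth_del)
 have "av (\<lambda>x. fst (X x ! m)) \<and> av (\<lambda>x. snd (X x ! m))" if "m < Suc n" for m using assms(1) that by (simp add: pl_def)
 then show ?thesis unfolding pl_def using assms l e by (simp add: length_del)
qed

lemma pl_snoc: assumes "pl n X" "av (\<lambda>x. fst (y x))" "av (\<lambda>x. snd (y x))" shows "pl (Suc n) (\<lambda>x. X x @ [y x])"
proof -
 have l: "length (X x) = n" for x using assms(1) by (simp add: pl_def)
 have "av (\<lambda>x. fst ((X x @ [y x]) ! m)) \<and> av (\<lambda>x. snd ((X x @ [y x]) ! m))" if "m < Suc n" for m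
  using assms that l by (cases "m = n") (simp_all add: nth_append pl_def)
 then show ?thesis by (simp add: pl_def l)
qed

lemma vsl_nth: "xs \<noteq> [] ==> l < 2 * length xs - 1 ==>
  vsl xs ! l = (if l = 0 \<or> odd l then fst (xs ! ((l + 1) div 2)) else snd (xs ! (l div 2)))"
proof (induction xs arbitrary: l rule: rev_induct)
 case (snoc p xs)
 show ?case
 proof (cases "xs = []")
  case False
  have v: "vsl (xs @ [p]) = vsl xs @ [fst p, snd p]" using False by (cases xs) auto
  have lv: "length (vsl xs) = 2 * length xs - 1" by (rule length_vsl)
  define m where "m = length xs - 1"
  have m: "length xs = Suc m" using False by (cases xs) (auto simp: m_def)
  consider "l < 2 * m + 1" | "l = 2 * m + 1" | "l = 2 * m + 2" using snoc.prems m by force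
  then show ?thesis
  proof cases
   case 1
   then have "(l + 1) div 2 < length xs" "l div 2 < length xs" using m by auto
   then show ?thesis using snoc.IH[OF False, of l] 1 m lv unfolding v by (simp add: nth_append)
  next
   case 2
   then show ?thesis using m lv unfolding v by (simp add: nth_append)
  next
   case 3
   then show ?thesis using m lv unfolding v by (simp add: nth_append)
  qed
 qed (use snoc in simp)
qed simp

lemma vl_vsl: assumes "pl (Suc n) X" shows "vl (2 * n + 1) (\<lambda>x. vsl (X x))"
proof -
 have l: "length (X x) = Suc n" for x using assms by (simp add: pl_def)
 then have ne: "X x \<noteq> []" for x by (metis list.size(3) nat.distinct(1))
 have p: "av (\<lambda>x. fst (X x ! m)) \<and> av (\<lambda>x. snd (X x ! m))" if "m < Suc n" for m using assms(1) that by (simp add: pl_def)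
 have "av (\<lambda>x. vsl (X x) ! m)" if m: "m < 2 * n + 1" for m
 proof -
  have e: "vsl (X x) ! m = (if m = 0 \<or> odd m then fst (X x ! ((m + 1) div 2)) else snd (X x ! (m div 2)))" for x
   by (rule vsl_nth[OF ne]) (use l m in simp)
  have "(m + 1) div 2 < Suc n" "m div 2 < Suc n" using m by auto
  then have "av (\<lambda>x. fst (X x ! ((m + 1) div 2)))" "av (\<lambda>x. snd (X x ! (m div 2)))" using p by blast+
  then show ?thesis unfolding e by (cases "m = 0 \<or> odd m") (simp_all only: if_True if_False)
 qed
 moreover have "length (vsl (X x)) = 2 * n + 1" for x using length_vsl[of "X x"] l by simp
 ultimately show ?thesis by (simp add: vl_def)
qed

lemma A_det:
 assumes "\<And>x. B x \<in> carrier_mat n n" "\<And>i j. i < n ==> j < n ==> A (\<lambda>x. B x $$ (i, j))"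
 shows "A (\<lambda>x. Determinant.det (B x))"
proof -
 have "Determinant.det (B x) = (\<Sum>p\<in>{p. p permutes {0..<n}}. signof p * (\<Prod>i = 0..<n. B x $$ (i, p i)))" for x
  by (rule det_def'[OF assms(1)])
 moreover have "A (\<lambda>x. \<Sum>p\<in>{p. p permutes {0..<n}}. signof p * (\<Prod>i = 0..<n. B x $$ (i, p i)))"
 proof (intro A_sum A_mult A_const A_prod assms(2))
  fix p i assume "p \<in> {p. p permutes {0..<n}}" "i \<in> {0..<n}"
  then show "p i < n" "i < n" using permutes_in_image[of p "{0..<n}" i] by auto
 qed
 ultimately show ?thesis by simp
qed

lemma A_adj:
 assumes B: "\<And>x. B x \<in> carrier_mat n n" "\<And>i j. i < n ==> j < n ==> A (\<lambda>x. B x $$ (i, j))" and ij: "i < n" "j < n"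
 shows "A (\<lambda>x. adj_mat (B x) $$ (i, j))"
proof -
 have "adj_mat (B x) $$ (i, j) = (-1)^(j + i) * Determinant.det (mat_delete (B x) j i)" for x
  using B(1)[of x] ij by (simp add: adj_mat_def cofactor_def)
 moreover have "A (\<lambda>x. (-1)^(j + i) * Determinant.det (mat_delete (B x) j i))"
 proof (intro A_mult A_const A_det[where n = "n - 1"])
  show "mat_delete (B x) j i \<in> carrier_mat (n - 1) (n - 1)" for x using B(1)[of x] by (simp add: mat_delete_def)
  fix k l assume kl: "k < n - 1" "l < n - 1"
  have "mat_delete (B x) j i $$ (k, l) = B x $$ (if k < j then k else Suc k, if l < i then l else Suc l)" for x
   using B(1)[of x] kl by (simp add: mat_delete_def)
  then show "A (\<lambda>x. mat_delete (B x) j i $$ (k, l))" using B(2) kl by simp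
 qed
 ultimately show ?thesis by simp
qed

lemma gram_A:
 assumes "vl n S" "vl n T"
 shows "\<And>x. gram r (S x) (T x) \<in> carrier_mat n n" "\<And>i j. i < n ==> j < n ==> A (\<lambda>x. gram r (S x) (T x) $$ (i, j))"
proof -
 have l: "length (S x) = n" for x using assms by (simp add: vl_def)
 show "gram r (S x) (T x) \<in> carrier_mat n n" for x by (simp add: gram_def l)
 fix i j assume ij: "i < n" "j < n"
 have "A (\<lambda>x. om r (T x ! i) (S x ! j))" by (rule A_om) (use assms ij in \<open>simp_all add: vl_def\<close>)
 then show "A (\<lambda>x. gram r (S x) (T x) $$ (i, j))" using ij by (simp add: gram_nth l)
qed

lemma A_detgram: "vl n S ==> vl n T ==> A (\<lambda>x. Determinant.det (gram r (S x) (T x)))"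
 by (rule A_det) (rule gram_A; assumption)+

lemma A_ccoef:
 assumes "vl n S" "vl n T" "i < n" shows "A (\<lambda>x. ccoef r (S x) (T x) u i)"
proof -
 have l: "length (S x) = n" for x using assms by (simp add: vl_def)
 have "A (\<lambda>x. \<Sum>m<n. adj_mat (gram r (S x) (T x)) $$ (i, m) * om r (T x ! m) u)"
  by (intro A_sum A_mult A_om av_const A_adj[OF gram_A[OF assms(1,2)] assms(3)]) (use assms in \<open>simp_all add: vl_def\<close>)
 then show ?thesis by (simp add: ccoef_def l)
qed

lemma A_tvs:
 assumes "\<And>p. p \<in> set ps ==> av (fst p) \<and> A (snd p)" "av x"
 shows "av (\<lambda>z. tvs r (map (\<lambda>p. (fst p z, snd p z)) ps) (x z))"
 using assms(1)
proof (induction ps)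
 case (Cons p ps)
 let ?y = "\<lambda>z. tvs r (map (\<lambda>p. (fst p z, snd p z)) ps) (x z)"
 have y: "av ?y" and p: "av (fst p)" "A (snd p)" using Cons by auto
 have "A (\<lambda>z. ?y z a + snd p z * om r (?y z) (fst p z) * fst p z a)" for a
  by (intro A_add A_mult A_om y p) (use y p in \<open>simp_all add: av_def\<close>)
 then show ?case by (simp add: av_def tv_def)
qed (simp add: assms(2))

end

lemma falg_polyfun: "falg (polyfun :: ('k::field \<Rightarrow> 'k) \<Rightarrow> bool)"
 by unfold_locales auto

lemma falg_borel: "falg (\<lambda>f :: 'z \<Rightarrow> 'k::{real_normed_field,second_countable_topology}. f \<in> borel_measurable M)"
 by unfold_locales auto

section \<open>Generic frames\<close>

text \<open>Row \<open>m\<close> of \<open>t\<close> contains one transvection: its vector in the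
  columns below \<open>2*r\<close>, its scalar in column \<open>2*r\<close>.\<close>

definition tsl :: "nat \<Rightarrow> nat \<Rightarrow> (nat \<times> nat \<Rightarrow> 'k::zero) \<Rightarrow> ('k vect \<times> 'k) list" where
 "tsl r N t = map (\<lambda>m. (\<lambda>a. if a < 2*r then t (m, a) else 0, t (m, 2*r))) [0..<N]"

lemma tvs_trunc:
 assumes "list_all2 (\<lambda>p p'. snd p = snd p' \<and> (\<forall>a<2*r. fst p a = fst p' a)) ts ts'" "a < 2*r"
 shows "tvs r ts x a = tvs r ts' x a"
 using assms
proof (induction ts ts' arbitrary: a rule: list_all2_induct)
 case (Cons p ts p' ts')
 have "om r (tvs r ts x) (fst p) = om r (tvs r ts' x) (fst p')" by (rule om_cong) (use Cons in auto)
 then show ?case using Cons by (simp add: tv_def)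
qed simp

lemma tsl_surj:
 fixes ts :: "('k::field vect \<times> 'k) list"
 assumes "length ts = N"
 obtains t where "t \<in> extensional ({..<N} \<times> {..<Suc (2*r)})" "tvm r (tsl r N t) = tvm r ts"
proof -
 define t where "t = restrict (\<lambda>(m, a). if a < 2*r then fst (ts ! m) a else snd (ts ! m)) ({..<N} \<times> {..<Suc (2*r)})"
 have "list_all2 (\<lambda>p p'. snd p = snd p' \<and> (\<forall>a<2*r. fst p a = fst p' a)) (tsl r N t) ts"
  using assms by (auto simp: list_all2_conv_all_nth tsl_def t_def)
 from tvs_trunc[OF this] have "tvm r (tsl r N t) = tvm r ts" by (auto simp: tvm_def intro!: eq_matI)
 moreover have "t \<in> extensional ({..<N} \<times> {..<Suc (2*r)})" by (simp add: t_def)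
 ultimately show ?thesis using that by blast
qed

lemma falg_family:
 fixes f :: "'z \<Rightarrow> nat \<times> nat \<Rightarrow> 'k::field" and \<xi> :: "'z \<Rightarrow> 'k mat"
 assumes "falg A" and t: "\<And>p. p \<in> {..<N} \<times> {..<Suc (2*r)} ==> A (\<lambda>z. f z p)"
  and \<xi>: "\<And>z. \<xi> z \<in> carrier_mat (2*r) (2 * Suc q)" "\<And>a c. a < 2*r ==> c < 2 * Suc q ==> A (\<lambda>z. \<xi> z $$ (a, c))"
 shows "falg.pl A (Suc q) (\<lambda>z. toL q (tvm r (tsl r N (f z)) * \<xi> z))"
proof -
 interpret falg A by fact
 have cv: "av (\<lambda>z. colf (\<xi> z) c)" if "c < 2 * Suc q" for c
 proof -
  have "colf (\<xi> z) c a = (if a < 2*r then \<xi> z $$ (a, c) else 0)" for z a using \<xi>(1)[of z] by (simp add: colf_def)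
  moreover have "A (\<lambda>z. if a < 2*r then \<xi> z $$ (a, c) else 0)" for a
   by (cases "a < 2*r") (simp_all only: if_True if_False A_const \<xi>(2)[OF _ that])
  ultimately show ?thesis by (simp only: av_def simp_thms)
 qed
 define ps where "ps = map (\<lambda>m. (\<lambda>z a. if a < 2*r then f z (m, a) else 0, \<lambda>z. f z (m, 2*r))) [0..<N]"
 have ps: "map (\<lambda>p. (fst p z, snd p z)) ps = tsl r N (f z)" for z by (simp add: ps_def tsl_def)
 have tv: "av (\<lambda>z. tvs r (tsl r N (f z)) (colf (\<xi> z) c))" if "c < 2 * Suc q" for c
  unfolding ps[symmetric]
 proof (rule A_tvs[OF _ cv[OF that]])
  fix p assume "p \<in> set ps"
  then obtain m where m: "m < N" "p = (\<lambda>z a. if a < 2*r then f z (m, a) else 0, \<lambda>z. f z (m, 2*r))" by (auto simp: ps_def)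
  have "A (\<lambda>z. if a < 2*r then f z (m, a) else 0)" for a
   using t[of "(m, a)"] m(1) A_const by (cases "a < 2*r") simp_all
  moreover have "A (\<lambda>z. f z (m, 2*r))" by (rule t) (use m in simp)
  ultimately show "av (fst p) \<and> A (snd p)" by (simp add: m av_def)
 qed
 have mvt: "mv (tvm r ts) x = (\<lambda>a. if a < 2*r then tvs r ts x a else 0)" for ts :: "('k vect \<times> 'k) list" and x
  by (rule ext) (simp add: mv_tvm, simp add: mv_def tvm_def)
 have mva: "av (\<lambda>z. mv (tvm r (tsl r N (f z))) (colf (\<xi> z) c))" if "c < 2 * Suc q" for c
 proof -
  have "A (\<lambda>z. tvs r (tsl r N (f z)) (colf (\<xi> z) c) a)" for a using tv[OF that] by (simp only: av_def)
  then have "A (\<lambda>z. if a < 2*r then tvs r (tsl r N (f z)) (colf (\<xi> z) c) a else 0)" for a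
   by (cases "a < 2*r") (simp_all only: if_True if_False A_const)
  then show ?thesis by (simp only: mvt av_def simp_thms)
 qed
 have e: "toL q (tvm r (tsl r N (f z)) * \<xi> z) = map (map_prod (mv (tvm r (tsl r N (f z)))) (mv (tvm r (tsl r N (f z))))) (toL q (\<xi> z))" for z
  by (rule toL_mult[OF _ \<xi>(1)]) (simp add: tvm_def)
 have "av (\<lambda>z. mv (tvm r (tsl r N (f z))) (colf (\<xi> z) (2*l))) \<and> av (\<lambda>z. mv (tvm r (tsl r N (f z))) (colf (\<xi> z) (Suc (2*l))))" if "l < Suc q" for l
  by (intro conjI mva) (use that in simp_all)
 then show ?thesis unfolding pl_def e by (simp add: toL_nth)
qed

text \<open>One sample tuple \<open>\<xi>0\<close> suffices. For fixed \<open>\<xi>\<close>, the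
  value of \<open>Q\<close> at the image of \<open>\<xi>\<close> under \<open>N\<close>
  transvections is polynomial in their parameters and nonzero when they carry \<open>\<xi>\<close>
  to \<open>\<xi>0\<close>, hence for almost all parameters. Fubini fixes parameters that serve a.e.
  \<open>\<xi>\<close>, and translation by the resulting group element preserves null sets.\<close>

lemma generic_frames:
 fixes Q :: "'k::efield frame \<Rightarrow> 'k"
 assumes q: "q < r"
  and Q: "\<And>(A :: ('k mat \<times> (nat \<times> nat \<Rightarrow> 'k) \<Rightarrow> 'k) \<Rightarrow> bool) X. falg A ==> falg.pl A (Suc q) X ==> A (\<lambda>z. Q (X z))"
  and \<xi>0: "\<xi>0 \<in> XX r q" "Q (toL q \<xi>0) \<noteq> 0"
 shows "AE \<xi> in MU r q. Q (toL q \<xi>) \<noteq> 0"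
proof -
 define N where "N = 8 * Suc q"
 let ?I = "{..<N} \<times> {..<Suc (2*r)}"
 let ?P = "PP ?I :: (nat \<times> nat \<Rightarrow> 'k) measure"
 let ?S = "MU r q \<Otimes>\<^sub>M ?P :: ('k mat \<times> (nat \<times> nat \<Rightarrow> 'k)) measure"
 let ?Q = "\<lambda>\<xi> t. Q (toL q (tvm r (tsl r N t) * \<xi>))"
 \<comment> \<open>Families have to be defined at all points of the type; outside the space of
   tuples the sample is substituted, which has the right dimensions.\<close>
 define re where "re M = (if M \<in> XX r q then M else \<xi>0)" for M :: "'k mat"
 have rc: "re M \<in> carrier_mat (2*r) (2 * Suc q)" for M using XX_carrier[OF \<xi>0(1)] XX_carrier[of M r q] by (simp add: re_def)
 have fs: "fst \<in> ?S \<rightarrow>\<^sub>M (MB r q :: 'k mat measure)"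
  using measurable_fst[of "MU r q" ?P] by (simp only: measurable_cong_sets[OF refl sets_MU])
 have Qm: "(\<lambda>p. ?Q (re (fst p)) (snd p)) \<in> borel_measurable ?S"
 proof (rule Q[OF falg_borel], rule falg_family[OF falg_borel _ rc])
  show "(\<lambda>z. snd z p) \<in> borel_measurable ?S" if "p \<in> ?I" for p
   by (rule measurable_compose[OF measurable_snd measurable_PP_component[OF that]])
  fix a c assume ac: "a < 2*r" "c < 2 * Suc q"
  have "(\<lambda>z. fst z $$ (a, c)) \<in> borel_measurable ?S"
   by (rule measurable_compose[OF fs measurable_MB_entry[OF ac]])
  then show "(\<lambda>z. re (fst z) $$ (a, c)) \<in> borel_measurable ?S"
   by (rule measurable_cong[THEN iffD1, rotated]) (auto simp: space_pair_measure space_MU re_def)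
 qed
 define B where "B = {p \<in> space ?S. ?Q (re (fst p)) (snd p) = 0}"
 have B: "B \<in> sets ?S" unfolding B_def using Qm by measurable
 have "AE \<xi> in MU r q. AE t in ?P. (\<xi>, t) \<notin> B"
 proof (rule AE_I2)
  fix \<xi> :: "'k mat" assume \<xi>: "\<xi> \<in> space (MU r q)"
  then have \<xi>X: "\<xi> \<in> XX r q" by (simp only: space_MU)
  obtain ts where ts: "length ts = 8 * Suc q" "tvm r ts * \<xi> = \<xi>0" using XX_transvections[OF \<xi>X \<xi>0(1)] by blast
  obtain t0 where t0: "t0 \<in> extensional ?I" "tvm r (tsl r N t0) = tvm r ts" using tsl_surj[of ts N r] ts(1) unfolding N_def by blast
  have "AE t in ?P. ?Q \<xi> t \<noteq> 0"
  proof (rule PP_poly_nonzero)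
   show "finite ?I" by simp
   have "(\<lambda>t. ?Q (re (fst (\<xi>, t))) (snd (\<xi>, t))) \<in> borel_measurable ?P"
    by (rule measurable_compose[OF measurable_Pair1'[OF \<xi>] Qm])
   then show "(\<lambda>t. ?Q \<xi> t) \<in> borel_measurable ?P" using \<xi>X by (simp add: re_def)
   \<comment> \<open>Here \<open>A\<close> means: polynomial in each single parameter while the
     others are held fixed.\<close>
   let ?A = "\<lambda>f :: 'k mat \<times> (nat \<times> nat \<Rightarrow> 'k) \<Rightarrow> 'k. \<forall>z i. polyfun (\<lambda>s. f (fst z, (snd z)(i := s)))"
   have fA: "falg ?A" by unfold_locales auto
   have "?A (\<lambda>z. ?Q \<xi> (snd z))"
   proof (rule Q[OF fA], rule falg_family[OF fA])
    show "?A (\<lambda>z. snd z p)" for p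
    proof (intro allI)
     fix z :: "'k mat \<times> (nat \<times> nat \<Rightarrow> 'k)" and i
     show "polyfun (\<lambda>s. snd (fst z, (snd z)(i := s)) p)"
      by (cases "p = i") (simp_all only: snd_conv fun_upd_apply if_True if_False polyfun_const polyfun_id simp_thms)
    qed
   qed (rule XX_carrier[OF \<xi>X], simp)
   then show "polyfun (\<lambda>s. ?Q \<xi> (x(i := s)))" for x i
    by (rule allE[of _ "(undefined, x)"]) (simp only: fst_conv snd_conv)
   show "t0 \<in> space ?P" using t0(1) by (simp add: space_PP)
   show "?Q \<xi> t0 \<noteq> 0" using \<xi>0(2) by (simp only: t0(2) ts(2) not_False_eq_True simp_thms)
  qed
  then show "AE t in ?P. (\<xi>, t) \<notin> B" by (rule eventually_mono) (simp add: B_def re_def \<xi>X)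
 qed
 from fubini_pick[OF prob_MU[OF q] prob_PP B this]
 obtain t where t: "AE \<xi> in MU r q. (\<xi>, t) \<notin> B" "t \<in> space ?P" by (rule AE_pick[OF prob_PP]) 
 define g where "g = tvm r (tsl r N t)"
 have g: "spcond r g" unfolding g_def by (rule spcond_tvm)
 have "AE \<xi> in MU r q. Q (toL q (g * \<xi>)) \<noteq> 0"
 proof (rule AE_mp[OF t(1)], rule AE_I2, rule impI)
  fix \<xi> :: "'k mat" assume "\<xi> \<in> space (MU r q)" "(\<xi>, t) \<notin> B"
  then show "Q (toL q (g * \<xi>)) \<noteq> 0" using t(2) by (simp add: B_def g_def re_def space_pair_measure space_MU)
 qed
 from AE_MU_translate[OF q spcond_sinv[OF g] this]
 have *: "AE \<xi> in MU r q. Q (toL q (g * (sinv r g * \<xi>))) \<noteq> 0" .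
 show ?thesis
 proof (rule AE_mp[OF *], rule AE_I2, rule impI)
  fix \<xi> :: "'k mat" assume \<xi>: "\<xi> \<in> space (MU r q)" "Q (toL q (g * (sinv r g * \<xi>))) \<noteq> 0"
  have "\<xi> \<in> XX r q" using \<xi>(1) by (simp only: space_MU)
  then have "g * (sinv r g * \<xi>) = \<xi>" by (rule sinv_XX(2)[OF g])
  then show "Q (toL q \<xi>) \<noteq> 0" using \<xi>(2) by simp
 qed
qed

section \<open>Vanishing of cohomology\<close>

abbreviation bpl :: "'z measure \<Rightarrow> nat \<Rightarrow> ('z \<Rightarrow> 'k::efield frame) \<Rightarrow> bool" where
 "bpl M \<equiv> falg.pl (\<lambda>f. f \<in> borel_measurable M)"

abbreviation bav :: "'z measure \<Rightarrow> ('z \<Rightarrow> nat \<Rightarrow> 'k::efield) \<Rightarrow> bool" where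
 "bav M \<equiv> falg.av (\<lambda>f. f \<in> borel_measurable M)"

abbreviation bvl :: "'z measure \<Rightarrow> nat \<Rightarrow> ('z \<Rightarrow> 'k::efield vect list) \<Rightarrow> bool" where
 "bvl M \<equiv> falg.vl (\<lambda>f. f \<in> borel_measurable M)"

lemmas bpl_def = falg.pl_def[OF falg_borel]
lemmas bav_def = falg.av_def[OF falg_borel]
lemma bpl_toL: "bpl (MB r q) (Suc q) (toL q :: 'k::efield mat \<Rightarrow> _)"
proof -
 have c: "(\<lambda>x. colf x c a) \<in> borel_measurable (MB r q :: 'k mat measure)" if "c < 2 * Suc q" for c a
 proof (cases "a < 2*r")
  case True
  show ?thesis
  proof (rule measurable_cong[THEN iffD1, OF _ measurable_MB_entry[OF True that]])
   fix w :: "'k mat" assume "w \<in> space (MB r q)"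
   then have "w \<in> carrier_mat (2*r) (2 * Suc q)" unfolding space_MB by (rule XX_carrier)
   then show "w $$ (a, c) = colf w c a" using True by (simp add: colf_def)
  qed
 next
  case False
  show ?thesis
  proof (rule measurable_cong[THEN iffD1, OF _ borel_measurable_const[of 0]])
   fix w :: "'k mat" assume "w \<in> space (MB r q)"
   then have "w \<in> carrier_mat (2*r) (2 * Suc q)" unfolding space_MB by (rule XX_carrier)
   then show "0 = colf w c a" using False by (simp add: colf_def)
  qed
 qed
 have "bav (MB r q) (\<lambda>x :: 'k mat. colf x (2*l)) \<and> bav (MB r q) (\<lambda>x :: 'k mat. colf x (Suc (2*l)))" if "l < Suc q" for l
  unfolding bav_def by (intro conjI allI c) (use that in simp_all)
 then show ?thesis unfolding bpl_def by (simp add: toL_nth)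
qed

lemma measurable_valid:
 fixes X :: "'z \<Rightarrow> 'k::efield frame"
 assumes "bpl M n X" shows "{x \<in> space M. valid r (X x)} \<in> sets M"
proof -
 interpret falg "\<lambda>f :: 'z \<Rightarrow> 'k. f \<in> borel_measurable M" by (rule falg_borel)
 have l: "length (X x) = n" for x using assms by (simp add: pl_def)
 have p: "av (\<lambda>x. fst (X x ! m))" "av (\<lambda>x. snd (X x ! m))" if "m < n" for m using assms that by (simp_all add: pl_def)
 have eq: "{x \<in> space M. f x = c} \<in> sets M" if "f \<in> borel_measurable M" for f and c :: 'k using that by measurable
 have imp: "{x \<in> space M. P \<longrightarrow> R x} \<in> sets M" if "P ==> {x \<in> space M. R x} \<in> sets M" for P R
  using that by (cases P) simp_all
 show ?thesis
 proof (cases "n = 0")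
  case True
  then have "X x = []" for x using l[of x] by simp
  then show ?thesis by (simp add: valid_def)
 next
  case False
  then have ne: "(X x \<noteq> []) = True" for x using l[of x] by auto
  have n0: "{x \<in> space M. nz r (fst (X x ! 0))} \<in> sets M"
  proof -
   have "(\<lambda>x. fst (X x ! 0) a) \<in> borel_measurable M" for a using p(1)[of 0] False by (simp add: av_def)
   then have "{x \<in> space M. fst (X x ! 0) a = 0} \<in> sets M" for a by (rule eq)
   then have "{x \<in> space M. \<not> (fst (X x ! 0) a = 0)} \<in> sets M" for a by (rule sets.sets_Collect_neg)
   moreover have "{x \<in> space M. nz r (fst (X x ! 0))} = (\<Union>a\<in>{..<2*r}. {x \<in> space M. \<not> (fst (X x ! 0) a = 0)})" by (auto simp: nz_def)
   ultimately show ?thesis by (simp add: sets.finite_UN)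
  qed
  show ?thesis
   unfolding valid_nth l ne simp_thms
   by (intro sets.sets_Collect_conj n0 sets.sets_Collect_countable_All imp eq A_om p; (elim conjE)?) (use False in simp_all)
 qed
qed

text \<open>Turns cochains on stored tuples into functions of arbitrary lists. The default keeps the
  map measurable; the cocycle identity is invoked at valid lists only.\<close>

definition rL :: "nat \<Rightarrow> nat \<Rightarrow> 'k::field frame \<Rightarrow> 'k mat" where
 "rL r j xs = (if valid r xs then toM r xs else x0 r j)"

lemma measurable_rL:
 fixes X :: "'z \<Rightarrow> 'k::efield frame"
 assumes j: "j < r" and X: "bpl M (Suc j) X" shows "(\<lambda>x. rL r j (X x)) \<in> M \<rightarrow>\<^sub>M MB r j"
proof (rule measurable_into_MB)
 have l: "length (X x) = Suc j" for x using X by (simp add: bpl_def)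
 show "rL r j (X x) \<in> XX r j" for x
  by (simp add: rL_def toM_in_XX[OF _ l] x0_in[OF j])
 fix a c assume ac: "a < 2*r" "c < 2 * Suc j"
 then have c2: "c div 2 < Suc j" by auto
 have e: "rL r j (X x) $$ (a, c) = (if valid r (X x) then (if c = 1 then 0 else if even c then fst (X x ! (c div 2)) a else snd (X x ! (c div 2)) a) else x0 r j $$ (a, c))" for x
  using ac l[of x] by (simp add: rL_def toM_def)
 have "bav M (\<lambda>x. fst (X x ! (c div 2)))" "bav M (\<lambda>x. snd (X x ! (c div 2)))" using X c2 unfolding bpl_def by blast+
 then have "(\<lambda>x. if c = 1 then 0 else if even c then fst (X x ! (c div 2)) a else snd (X x ! (c div 2)) a) \<in> borel_measurable M"
  unfolding bav_def by (cases "c = 1"; cases "even c") simp_all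
 then show "(\<lambda>x. rL r j (X x) $$ (a, c)) \<in> borel_measurable M"
  unfolding e by (rule measurable_If[OF _ borel_measurable_const measurable_valid[OF X]])
qed

lemma opr_rL:
 fixes X :: "'z \<Rightarrow> 'k::efield frame"
 assumes "j < r" "bpl M (Suc j) X" shows "opr M r j (\<lambda>\<phi> x. \<phi> (rL r j (X x)))"
 by (rule opr_single[OF measurable_rL[OF assms]])

lemma bd_rL:
 assumes s: "scoc r j \<phi>" and v: "valid r ys" "length ys = j + 2"
 shows "bd (\<lambda>xs. \<phi> (rL r j xs)) ys = 0"
proof -
 have X: "toM r ys \<in> XX r (Suc j)" by (rule toM_in_XX[OF v(1)]) (use v(2) in simp)
 have "bd (\<lambda>xs. \<phi> (rL r j xs)) ys = (\<Sum>i<length ys. (-1)^i * \<phi> (fc r j i (toM r ys)))"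
  unfolding bd_def
 proof (rule sum.cong[OF refl])
  fix i assume "i \<in> {..<length ys}"
  then have "i \<le> Suc j" using v(2) by simp
  moreover have "valid r (del i ys)" by (rule valid_del[OF v(1)]) (use v(2) in simp)
  ultimately show "(-1)^i * \<phi> (rL r j (del i ys)) = (-1)^i * \<phi> (fc r j i (toM r ys))"
   using fc_toM[OF v(2), of i r] by (simp add: rL_def)
 qed
 also have "{..<length ys} = {..Suc j}" using v(2) by auto
 also have "(\<Sum>i\<le>Suc j. (-1)^i * \<phi> (fc r j i (toM r ys))) = 0" using s X unfolding scoc_def by blast
 finally show ?thesis .
qed

lemma rL_toL: "\<xi> \<in> XX r j ==> rL r j (toL j \<xi>) = \<xi>"
 using toM_toL[of \<xi> r j] by (simp add: rL_def XX_def)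

lemma rL_first:
 "rL r j ((v, w) # xs) = rL r j ((v, w') # xs)"
proof -
 have "toM r ((v, w) # xs) = toM r ((v, w') # xs)" using toM_hd[of "(v, w') # xs" r w] by simp
 then show ?thesis by (simp add: rL_def valid_Cons)
qed

lemma bav_om: "bav M u ==> bav M v ==> (\<lambda>x. om r (u x) (v x)) \<in> borel_measurable M"
 by (rule falg.A_om[OF falg_borel])

lemma cohomology_vanishes_0:
 assumes r: "2 \<le> r"
 shows "cohomology_vanishes (XO r :: ('k::efield mat, 'k mat) measured_obj) 0"
proof -
 let ?c = "rL r 0 [(ee 0, 0)] :: 'k mat"
 let ?F0 = "ee (2*r - Suc 0) :: nat \<Rightarrow> 'k"
 have "\<exists>c. AE x in MU r 0. f x = c" if f: "f \<in> Linf (MU r 0)" and cob: "AE x in MU r 1. coboundary (XO r) 0 f x = 0" for f :: "'k mat \<Rightarrow> real"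
 proof (rule cohomology_0[OF _ _ _ _ f cob])
  show "1 < r" using r by simp
  have v0: "valid r [(ee 0 :: nat \<Rightarrow> 'k, 0)]" "valid r [(?F0, 0)]"
   using r om_imp_nz[of r "ee 0 :: nat \<Rightarrow> 'k" ?F0] om_imp_nz[of r ?F0 "ee 0 :: nat \<Rightarrow> 'k"] by (simp_all add: valid_def om_ee_ee)
  show "?c \<in> XX r 0" unfolding rL_def using toM_in_XX[OF v0(1), of 0] v0 by simp
  let ?Q = "\<lambda>xs :: 'k frame. om r (fst (xs ! 0)) (ee 0)"
  show "AE \<xi> in MU r 0. ?Q (toL 0 \<xi>) \<noteq> 0"
  proof (rule generic_frames)
   show "0 < r" using r by simp
   show "A (\<lambda>z. ?Q (X z))" if "falg A" "falg.pl A (Suc 0) X" for A :: "('k mat \<times> (nat \<times> nat \<Rightarrow> 'k) \<Rightarrow> 'k) \<Rightarrow> bool" and X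
    by (rule falg.A_om[OF that(1) _ falg.av_const[OF that(1)]]) (use that in \<open>simp add: falg.pl_def\<close>)
   show "toM r [(?F0, 0)] \<in> XX r 0" by (rule toM_in_XX[OF v0(2)]) simp
   have "om r (fst (toL 0 (toM r [(?F0, 0)]) ! 0)) (ee 0) = om r ?F0 (ee 0)"
    by (rule om_cong) (use toL_toM(1)[of 0 "[(?F0, 0)]" _ r] in simp_all)
   then show "?Q (toL 0 (toM r [(?F0, 0)])) \<noteq> 0" using r by (simp add: om_ee_ee)
  qed
  fix \<phi> :: "'k mat \<Rightarrow> real" and \<xi> assume s: "scoc r 0 \<phi>" and \<xi>: "\<xi> \<in> XX r 0" and Q: "?Q (toL 0 \<xi>) \<noteq> 0"
  let ?g = "\<lambda>v. \<phi> (rL r 0 [(v, 0)])"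
  have "?g (colf \<xi> 0) = ?g (ee 0)"
  proof (rule filling_0[OF r])
   fix v0 v1 w :: "'k vect" assume e: "edge r v0 v1 w"
   have v: "valid r [(v0, 0), (v1, w)]" using e by (simp add: edge_def valid_Cons hfl_def)
   have "bd (\<lambda>xs. \<phi> (rL r 0 xs)) [(v0, 0), (v1, w)] = 0" by (rule bd_rL[OF s v]) simp
   then show "?g v1 = ?g v0" using rL_first[of r 0 v1 w "[]" 0] by (simp add: bd_def del_def)
  next
   show "om r (colf \<xi> 0) (ee 0) \<noteq> 0" using Q by (simp add: toL_nth)
  qed
  moreover have "toL 0 \<xi> = [(colf \<xi> 0, colf \<xi> 1)]" by (simp add: toL_def)
  then have "\<xi> = rL r 0 [(colf \<xi> 0, 0)]" using rL_toL[OF \<xi>] rL_first[of r 0 "colf \<xi> 0" "colf \<xi> 1" "[]" 0] by simp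
  ultimately show "\<phi> \<xi> = \<phi> ?c" by simp
 qed
 then show ?thesis unfolding cohomology_vanishes_def XO_simps by simp
qed

lemma cohomology_vanishes_Suc:
 assumes "\<And>f :: 'k::efield mat \<Rightarrow> real. f \<in> Linf (MU r (Suc k)) ==> AE x in MU r (Suc (Suc k)). coboundary (XO r) (Suc k) f x = 0 ==>
   \<exists>h\<in>Linf (MU r k). AE x in MU r (Suc k). f x = coboundary (XO r) k h x"
 shows "cohomology_vanishes (XO r :: ('k mat, 'k mat) measured_obj) (int (Suc k))"
 unfolding cohomology_vanishes_def
proof (intro conjI impI allI ballI)
 fix k' :: nat and f :: "'k mat \<Rightarrow> real" assume k': "int (Suc k) = int k' + 1" and f: "f \<in> Linf (lev (XO r) (k' + 1))"
  "AE x in lev (XO r) (k' + 2). coboundary (XO r) (k' + 1) f x = 0"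
 have e: "k' + 1 = Suc k" "k' + 2 = Suc (Suc k)" "k' = k" using k' by simp_all
 then show "\<exists>g\<in>Linf (lev (XO r) k'). AE x in lev (XO r) (k' + 1). f x = coboundary (XO r) k' g x"
  using assms[of f] f unfolding XO_simps e(1) e(2) unfolding e(3) by blast
qed simp_all

lemma fc_first: "M \<in> XX r 1 ==> colf (fc r 0 0 M) 0 = colf M 2" "M \<in> XX r 1 ==> colf (fc r 0 1 M) 0 = colf M 0"
 by (auto simp: colf_def fc_def fun_eq_iff XX_def numeral_2_eq_2)

lemma cohomology_vanishes_1:
 assumes r: "3 \<le> r"
 shows "cohomology_vanishes (XO r :: ('k::efield mat, 'k mat) measured_obj) 1"
proof -
 let ?z = "\<lambda>i. ee i :: nat \<Rightarrow> 'k" and ?F = "\<lambda>i. ee (2*r - Suc i) :: nat \<Rightarrow> 'k"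
 let ?yy = "closed_1.yy r :: 'k vect \<Rightarrow> nat \<Rightarrow> 'k" and ?yw = "closed_1.yw r :: 'k vect \<Rightarrow> nat \<Rightarrow> 'k"
 \<comment> \<open>The zero cochain satisfies the locale and so gives access to the formulas for
   \<open>yy\<close> and \<open>yw\<close>, which involve only \<open>r\<close>.\<close>
 have c1: "closed_1 r (\<lambda>v0 v1 w :: nat \<Rightarrow> 'k. 0)" by unfold_locales (use r in simp_all)
 have yy: "?yy v a = om r v (?z 1) * ?z 0 a - om r v (?z 0) * ?z 1 a" for v a
  by (simp add: closed_1.yy_def[OF c1])
 have yw: "?yw v a = (- inverse (om r v (?z 0))) * ?F 1 a + om r v (?F 1) / (om r v (?z 0))^2 * ?z 0 a" for v a
  by (simp add: closed_1.yw_def[OF c1])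
 define E where "E \<phi> \<eta> = \<phi> (rL r 1 [(?z 0, 0), (?yy (colf \<eta> 0), ?yw (colf \<eta> 0))]) - \<phi> (rL r 1 [(colf \<eta> 0, 0), (?yy (colf \<eta> 0), ?yw (colf \<eta> 0))])"
  for \<phi> :: "'k mat \<Rightarrow> real" and \<eta>
 have op: "opr (MB r 0) r (Suc 0) E"
 proof -
  let ?M = "MB r 0 :: 'k mat measure"
  have c: "bav ?M (\<lambda>\<eta>. colf \<eta> 0)" using bpl_toL[of r 0, where ?'k = 'k] unfolding bpl_def by (simp add: toL_nth)
  have o: "(\<lambda>\<eta>. om r (colf \<eta> 0) u) \<in> borel_measurable ?M" for u by (rule bav_om[OF c falg.av_const[OF falg_borel]])
  have y: "bav ?M (\<lambda>\<eta>. ?yy (colf \<eta> 0))" "bav ?M (\<lambda>\<eta>. ?yw (colf \<eta> 0))"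
   unfolding bav_def yy yw using o by simp_all
  have b: "bpl ?M (Suc (Suc 0)) (\<lambda>\<eta>. [(u \<eta>, 0), (?yy (colf \<eta> 0), ?yw (colf \<eta> 0))])" if "bav ?M u" for u
   using that y by (auto simp: bpl_def less_Suc_eq falg.av_const[OF falg_borel])
  show ?thesis unfolding E_def One_nat_def
   by (intro opr_diff opr_rL b falg.av_const[OF falg_borel] c) (use r in simp_all)
 qed
 let ?Q = "\<lambda>xs :: 'k frame. om r (fst (xs!0)) (?z 0) * om r (fst (xs!1)) (?z 0) *
   (om r (fst (xs!0)) (?z 0) * om r (fst (xs!1)) (?z 1) - om r (fst (xs!0)) (?z 1) * om r (fst (xs!1)) (?z 0))"
 have Qf: "A (\<lambda>t. ?Q (X t))" if "falg A" "falg.pl A (Suc 1) X" for A :: "('c \<Rightarrow> 'k) \<Rightarrow> bool" and X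
 proof -
  interpret falg A by fact
  have "av (\<lambda>x. fst (X x ! 0))" "av (\<lambda>x. fst (X x ! 1))" using that(2) by (simp_all add: pl_def)
  then show ?thesis by (intro A_mult A_diff A_om av_const)
 qed
 have om: "om r (?F i) (?z l) = (if i = l then - 1 else 0)" "om r (?F i) (?F l) = 0" if "i < 2" "l < 2" for i l
  using that r by (simp_all add: om_ee_ee)
 \<comment> \<open>The second vector is \<open>?F 0 + ?F 1\<close> because \<open>?F 1\<close> alone
   is orthogonal to \<open>?z 0\<close>, where \<open>?Q\<close> would vanish.\<close>
 let ?x = "[(?F 0, 0), (?F 0 + ?F 1, - ?z 1)]"
 have vx: "valid r ?x"
  using om_imp_nz[of r "?F 0" "?z 0"] om[of 0 0] om[of 0 1] om[of 1 1] by (simp add: valid_Cons hfl_def)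
 have gen: "AE \<xi> in MU r 1. ?Q (toL 1 \<xi>) \<noteq> 0"
 proof (rule generic_frames)
  show "1 < r" using r by simp
  show "A (\<lambda>z. ?Q (X z))" if "falg A" "falg.pl A (Suc 1) X" for A :: "('k mat \<times> (nat \<times> nat \<Rightarrow> 'k) \<Rightarrow> 'k) \<Rightarrow> bool" and X
   by (rule Qf[OF that])
  show "toM r ?x \<in> XX r 1" by (rule toM_in_XX[OF vx]) simp
  have e: "om r (fst (toL 1 (toM r ?x) ! i)) u = om r (fst (?x ! i)) u" if "i < 2" for i u
   by (rule om_cong) (use toL_toM(1)[of i ?x _ r] that in simp_all)
  have e0: "om r (fst (toL 1 (toM r ?x) ! 0)) u = om r (?F 0) u" and e1: "om r (fst (toL 1 (toM r ?x) ! 1)) u = om r (?F 0 + ?F 1) u" for u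
   using e[of 0 u] e[of 1 u] by simp_all
  show "?Q (toL 1 (toM r ?x)) \<noteq> 0"
   unfolding e0 e1 om_add_left using om[of 0 0] om[of 0 1] om[of 1 0] om[of 1 1] by simp
 qed
 then have gen': "AE \<xi> in MU r (Suc 0). ?Q (toL (Suc 0) \<xi>) \<noteq> 0" by (simp only: One_nat_def)
 have "\<exists>h\<in>Linf (MU r 0). AE x in MU r (Suc 0). f x = coboundary (XO r) 0 h x"
  if f: "f \<in> Linf (MU r (Suc 0))" and cob: "AE x in MU r (Suc (Suc 0)). coboundary (XO r) (Suc 0) f x = 0" for f :: "'k mat \<Rightarrow> real"
 proof (rule cohomology_Suc[OF _ gen' op _ f cob])
  show "Suc (Suc 0) < r" using r by simp
  fix \<phi> :: "'k mat \<Rightarrow> real" and \<xi> assume s: "scoc r (Suc 0) \<phi>" and \<xi>: "\<xi> \<in> XX r (Suc 0)" and Q: "?Q (toL (Suc 0) \<xi>) \<noteq> 0"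
  let ?g = "\<lambda>v0 v1 w. \<phi> (rL r (Suc 0) [(v0, 0), (v1, w)])"
  have cl: "closed_1 r ?g"
  proof
   show "3 \<le> r" by (rule r)
   fix v0 v1 w1 v2 w2 :: "'k vect" assume t: "tri r v0 v1 w1 v2 w2"
   have v: "valid r [(v0, 0), (v1, w1), (v2, w2)]" using t by (simp add: tri_def edge_def valid_Cons hfl_def orthp_def)
   have "bd (\<lambda>xs. \<phi> (rL r (Suc 0) xs)) [(v0, 0), (v1, w1), (v2, w2)] = 0" by (rule bd_rL[OF s v]) simp
   then show "?g v1 v2 w2 - ?g v0 v2 w2 + ?g v0 v1 w1 = 0"
    using rL_first[of r "Suc 0" v1 w1 "[(v2, w2)]" 0] by (simp add: bd_def del_def)
  qed
  have t: "toL (Suc 0) \<xi> = [(colf \<xi> 0, colf \<xi> 1), (colf \<xi> 2, colf \<xi> 3)]" by (simp add: toL_def numeral_3_eq_3 numeral_2_eq_2)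
  have "valid r (toL (Suc 0) \<xi>)" using \<xi> by (simp add: XX_def)
  then have e: "edge r (colf \<xi> 0) (colf \<xi> 2) (colf \<xi> 3)" unfolding t by (simp add: valid_Cons edge_def hfl_def)
  have Q': "om r (colf \<xi> 0) (?z 0) \<noteq> 0" "om r (colf \<xi> 2) (?z 0) \<noteq> 0"
   "om r (colf \<xi> 0) (?z 0) * om r (colf \<xi> 2) (?z 1) - om r (colf \<xi> 0) (?z 1) * om r (colf \<xi> 2) (?z 0) \<noteq> 0"
   using Q unfolding t by simp_all
  have "\<phi> \<xi> = ?g (colf \<xi> 0) (colf \<xi> 2) (colf \<xi> 3)"
   using rL_toL[OF \<xi>] rL_first[of r "Suc 0" "colf \<xi> 0" "colf \<xi> 1" "[(colf \<xi> 2, colf \<xi> 3)]" 0] unfolding t by simp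
  also have "\<dots> = (?g (?z 0) (?yy (colf \<xi> 2)) (?yw (colf \<xi> 2)) - ?g (colf \<xi> 2) (?yy (colf \<xi> 2)) (?yw (colf \<xi> 2)))
    - (?g (?z 0) (?yy (colf \<xi> 0)) (?yw (colf \<xi> 0)) - ?g (colf \<xi> 0) (?yy (colf \<xi> 0)) (?yw (colf \<xi> 0)))"
   by (rule closed_1.filling_1[OF cl e Q'])
  also have "\<dots> = E \<phi> (fc r 0 0 \<xi>) - E \<phi> (fc r 0 1 \<xi>)"
   unfolding E_def fc_first[OF \<xi>[folded One_nat_def]] by simp
  also have "\<dots> = (\<Sum>i\<le>Suc 0. (-1)^i * E \<phi> (fc r 0 i \<xi>))" by simp
  finally show "\<phi> \<xi> = (\<Sum>i\<le>Suc 0. (-1)^i * E \<phi> (fc r 0 i \<xi>))" .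
 qed
 from cohomology_vanishes_Suc[OF this] show ?thesis by simp
qed

section \<open>Vanishing in higher degrees\<close>

text \<open>In a stored face the dummy partner is zero, while \<open>del 0\<close> leaves the old
  partner in that place. The normal form \<open>z0\<close> reconciles the two, since cones, Gram
  matrices and \<open>rL\<close> all ignore the dummy.\<close>

definition z0 :: "('a \<times> 'b::zero) list \<Rightarrow> ('a \<times> 'b) list" where
 "z0 xs = (case xs of [] \<Rightarrow> [] | p # ps \<Rightarrow> (fst p, 0) # ps)"

lemma z0_simps [simp]: "z0 [] = []" "z0 (p # ps) = (fst p, 0) # ps"
 by (simp_all add: z0_def)

lemma length_z0 [simp]: "length (z0 xs) = length xs"
 by (cases xs) simp_all

lemma vsl_z0 [simp]: "vsl (z0 xs) = vsl xs"
 by (cases xs) simp_all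

lemma z0_eq_Nil [simp]: "z0 xs = [] \<longleftrightarrow> xs = []"
 by (cases xs) simp_all

lemma del_z0: "del i (z0 xs) = (if i = 0 then del i xs else z0 (del i xs))"
 by (cases xs; cases i) (simp_all add: del_def)

lemma z0_snoc: "xs \<noteq> [] ==> z0 xs @ [y] = z0 (xs @ [y])"
 by (cases xs) simp_all

lemma coned_z0: assumes "\<And>t. f (z0 t) = f t" shows "coned y f (z0 t) = coned y f t"
 by (cases "t = []") (simp_all add: coned_def z0_snoc assms)

lemma cone_op_z0:
 assumes "\<And>t. Y (z0 t) = Y t" "\<And>t. f (z0 t) = f t"
 shows "cone_op Y n f (z0 xs) = cone_op Y n f xs"
 using assms(2)
proof (induction n arbitrary: f xs)
 case 0
 show ?case by (simp add: assms(1) coned_z0 0)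
next
 case (Suc n)
 have "cone_op Y n (coned (Y xs) f) (del i (z0 xs)) = cone_op Y n (coned (Y xs) f) (del i xs)" for i
  unfolding del_z0 by (simp add: Suc.IH coned_z0 Suc.prems)
 then show ?case by (simp add: assms(1) coned_z0 Suc.prems)
qed

lemma cycle_op_z0:
 assumes "\<And>t. Y (z0 t) = Y t" "\<And>t. f (z0 t) = f t"
 shows "cycle_op Y f (z0 xs) = cycle_op Y f xs"
proof -
 have "cone_op Y (length xs - 1) f (del i (z0 xs)) = cone_op Y (length xs - 1) f (del i xs)" for i
  unfolding del_z0 by (simp add: cone_op_z0 assms)
 then show ?thesis by (simp add: cycle_op_def assms)
qed

lemma good_low_z0: "good_low r n (z0 xs) = good_low r n xs"
proof (induction n arbitrary: xs)
 case (Suc n)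
 have "good_low r n (del i (z0 xs)) = good_low r n (del i xs)" for i
  unfolding del_z0 by (simp add: Suc.IH)
 then show ?case by simp
qed simp

lemma slist_z0: "slist r j (z0 xs) = slist r j xs"
 by (simp add: slist_def)

lemma good_face_z0: "good_face r j (z0 xs) = good_face r j xs"
proof -
 have "good_low r (j - 1) (del i (z0 xs)) = good_low r (j - 1) (del i xs)" for i
  unfolding del_z0 by (simp add: good_low_z0)
 then show ?thesis by (simp add: good_face_def slist_z0)
qed

lemma yvert_z0: "yvert r j (z0 xs) = yvert r j xs"
 by (simp add: yvert_def)

lemma rL_z0: "rL r j (z0 xs) = rL r j xs"
proof (cases xs)
 case (Cons p ps)
 then show ?thesis using rL_first[of r j "fst p" 0 ps "snd p"] by simp
qed simp

lemma toL_fc: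
 assumes "\<xi> \<in> XX r (Suc k)" "i \<le> Suc k" shows "toL k (fc r k i \<xi>) = z0 (del i (toL (Suc k) \<xi>))"
proof (rule nth_equalityI)
 show l: "length (toL k (fc r k i \<xi>)) = length (z0 (del i (toL (Suc k) \<xi>)))" using assms by (simp add: length_del)
 have d: "dim_row \<xi> = 2*r" "dim_row (fc r k i \<xi>) = 2*r" using XX_carrier[OF assms(1)] by (auto simp: fc_def)
 fix m assume "m < length (toL k (fc r k i \<xi>))"
 then have m: "m \<le> k" by simp
 have c: "colf (fc r k i \<xi>) c = (\<lambda>a. if a < 2*r \<and> c \<noteq> 1 then colf \<xi> (if c < 2*i then c else c + 2) a else 0)" if "c < 2 * Suc k" for c
  using that by (auto simp: colf_def fc_def d(1) fun_eq_iff)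
 have c0: "colf \<xi> c a = 0" if "\<not> a < 2*r" for c a using that by (simp add: colf_def d)
 have cl: "2*m < 2 * Suc k" "Suc (2*m) < 2 * Suc k" using m by simp_all
 have z: "z0 ys ! m = (if m = 0 then (fst (ys ! m), 0) else ys ! m)" if "m < length ys" for ys :: "'a frame"
  using that by (cases ys; cases m) simp_all
 have dn: "del i (toL (Suc k) \<xi>) ! m = toL (Suc k) \<xi> ! (if m < i then m else Suc m)"
  using m assms(2) by (subst nth_del) auto
 have t: "toL (Suc k) \<xi> ! (if m < i then m else Suc m) = (colf \<xi> (if 2*m < 2*i then 2*m else 2*m + 2), colf \<xi> (if Suc (2*m) < 2*i then Suc (2*m) else Suc (2*m) + 2))"
  using m by (auto simp: toL_nth)
 have "toL k (fc r k i \<xi>) ! m = (colf (fc r k i \<xi>) (2*m), colf (fc r k i \<xi>) (Suc (2*m)))" by (rule toL_nth[OF m])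
 also have "colf (fc r k i \<xi>) (2*m) = colf \<xi> (if 2*m < 2*i then 2*m else 2*m + 2)"
  unfolding c[OF cl(1)] by (rule ext) (simp add: c0)
 also have "colf (fc r k i \<xi>) (Suc (2*m)) = (if m = 0 then 0 else colf \<xi> (if Suc (2*m) < 2*i then Suc (2*m) else Suc (2*m) + 2))"
 proof (cases "m = 0")
  case True
  then show ?thesis unfolding c[OF cl(2)] by (simp add: zero_fun_def)
 next
  case False
  then show ?thesis unfolding c[OF cl(2)] by (intro ext) (simp add: c0)
 qed
 finally show "toL k (fc r k i \<xi>) ! m = z0 (del i (toL (Suc k) \<xi>)) ! m"
 proof -
  assume e: "toL k (fc r k i \<xi>) ! m = (colf \<xi> (if 2*m < 2*i then 2*m else 2*m + 2), if m = 0 then 0 else colf \<xi> (if Suc (2*m) < 2*i then Suc (2*m) else Suc (2*m) + 2))"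
  have "m < length (del i (toL (Suc k) \<xi>))" using m assms(2) by (simp add: length_del)
  then have "z0 (del i (toL (Suc k) \<xi>)) ! m = (if m = 0 then (fst (toL (Suc k) \<xi> ! (if m < i then m else Suc m)), 0) else toL (Suc k) \<xi> ! (if m < i then m else Suc m))"
   by (simp only: z dn)
  then show ?thesis unfolding e t by (simp only: fst_conv split: if_split) simp
 qed
qed

subsection \<open>Measurability of the filling\<close>

text \<open>Division is a Borel function on the whole field, with value 0 at denominator 0, so
  degenerate tuples are covered too.\<close>

lemma measurable_dcorr:
 assumes "bvl M n S" "bvl M n T"
 shows "bav M (\<lambda>x. corr r (S x) (T x) u)"
proof -
 interpret falg "\<lambda>f :: 'a \<Rightarrow> 'b. f \<in> borel_measurable M" by (rule falg_borel)
 have l: "length (S x) = n" for x using assms by (simp add: vl_def)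
 have "(\<lambda>x. u a - (\<Sum>i<n. ccoef r (S x) (T x) u i / Determinant.det (gram r (S x) (T x)) * (S x ! i) a)) \<in> borel_measurable M" for a
 proof (intro borel_measurable_diff borel_measurable_const borel_measurable_sum borel_measurable_times borel_measurable_divide)
  fix i assume "i \<in> {..<n}"
  then have i: "i < n" by simp
  show "(\<lambda>x. ccoef r (S x) (T x) u i) \<in> borel_measurable M" by (rule A_ccoef[OF assms i])
  show "(\<lambda>x. Determinant.det (gram r (S x) (T x))) \<in> borel_measurable M" by (rule A_detgram[OF assms])
  show "(\<lambda>x. (S x ! i) a) \<in> borel_measurable M" using assms(1) i by (simp add: vl_def av_def)
 qed
 then show ?thesis by (simp add: av_def corr_def l fun_sum_apply)
qed

lemma length_zl [simp]: "length (zl n) = n"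
 by (simp add: zl_def)

lemma measurable_yvert:
 fixes X :: "'z \<Rightarrow> 'k::efield frame"
 assumes "bpl M n X" shows "bav M (\<lambda>x. fst (yvert r j (X x)))" "bav M (\<lambda>x. snd (yvert r j (X x)))"
proof -
 interpret falg "\<lambda>f :: 'z \<Rightarrow> 'k. f \<in> borel_measurable M" by (rule falg_borel)
 have l: "length (X x) = n" for x using assms by (simp add: pl_def)
 have "bav M (\<lambda>x. fst (yvert r j (X x))) \<and> bav M (\<lambda>x. snd (yvert r j (X x)))"
 proof (cases n)
  case 0
  then have "X x = []" for x using l[of x] by simp
  then show ?thesis by (simp add: yvert_def av_const)
 next
  case (Suc m)
  have ne: "X x \<noteq> []" for x using l[of x] Suc by auto
  have v: "vl (2*m+1) (\<lambda>x. vsl (X x))" using vl_vsl assms unfolding Suc by blast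
  have z: "vl (2*m+1) (\<lambda>x. zl (2*m+1))" using vl_const[of "zl (2*m+1)"] by simp
  have "2 * length (X x) - 1 = 2*m+1" for x using l[of x] Suc by simp
  moreover have "(X x = []) = False" for x using ne[of x] by simp
  ultimately show ?thesis unfolding yvert_def l by (simp only: if_False fst_conv snd_conv measurable_dcorr[OF z v] simp_thms)
 qed
 then show "bav M (\<lambda>x. fst (yvert r j (X x)))" "bav M (\<lambda>x. snd (yvert r j (X x)))" by blast+
qed

text \<open>The apex over a whole face, made from the innermost basis pair and normalized to product
  1. Under \<open>3*j \<le> r\<close> the standard vectors in \<open>slist\<close> do not reach this
  pair.\<close>

definition ypair :: "nat \<Rightarrow> nat \<Rightarrow> 'k::field frame \<Rightarrow> 'k vect \<times> 'k vect" where
 "ypair r j xs = (let S = slist r j xs; p = corr r S S (ee (r - 1)); q = corr r S S (ee (2*r - Suc (r - 1)))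
   in (p, smul (inverse (om r p q)) q))"

lemma vl_slist:
 assumes "falg A" "falg.pl A (Suc n) X"
 shows "falg.vl A (length (zl (2*j - 3) :: 'k::field vect list) + ((2*n + 1) + (length (map ee [2*j - 3..<3*j - 4] :: 'k vect list) + length (map (\<lambda>i. ee (2*r - Suc i)) [2*j - 3..<3*j - 4] :: 'k vect list))))
   (\<lambda>x. slist r j (X x :: 'k frame))"
proof -
 interpret falg A by fact
 show ?thesis unfolding slist_def by (rule vl_append[OF vl_const vl_append[OF vl_vsl[OF assms(2)] vl_append[OF vl_const vl_const]]])
qed

lemma measurable_ypair:
 fixes X :: "'z \<Rightarrow> 'k::efield frame"
 assumes "bpl M (Suc n) X" shows "bav M (\<lambda>x. fst (ypair r j (X x)))" "bav M (\<lambda>x. snd (ypair r j (X x)))"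
proof -
 note c = measurable_dcorr[OF vl_slist[OF falg_borel assms] vl_slist[OF falg_borel assms], of r r j]
 show "bav M (\<lambda>x. fst (ypair r j (X x)))" using c unfolding ypair_def Let_def fst_conv .
 show "bav M (\<lambda>x. snd (ypair r j (X x)))"
  unfolding ypair_def Let_def snd_conv bav_def smul_apply
 proof (intro allI borel_measurable_times borel_measurable_inverse bav_om c)
  fix a show "(\<lambda>x. corr r (slist r j (X x)) (slist r j (X x)) (ee (2*r - Suc (r - 1))) a) \<in> borel_measurable M"
   using c unfolding bav_def by blast
 qed
qed

text \<open>\<open>F\<close> is allowed to depend on \<open>x\<close>, because the recursion
  replaces it by a cone whose apex \<open>Y (X x)\<close> varies with \<open>x\<close>.\<close>

lemma opr_cone:
 fixes X :: "'z \<Rightarrow> 'k::efield frame"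
 assumes Y: "\<And>n X. bpl M n X ==> bav M (\<lambda>x. fst (Y (X x))) \<and> bav M (\<lambda>x. snd (Y (X x)))"
  and F: "\<And>X. bpl M (Suc n) X ==> opr M r j (\<lambda>\<phi> x. F \<phi> x (X x))" and X: "bpl M n X"
 shows "opr M r j (\<lambda>\<phi> x. cone_op Y n (F \<phi> x) (X x))"
 using F X
proof (induction n arbitrary: F X)
 case 0
 have l: "length (X x) = 0" for x using 0(2) unfolding bpl_def by blast
 have "bpl M (Suc 0) (\<lambda>x. X x @ [Y (X x)])" by (rule falg.pl_snoc[OF falg_borel 0(2) Y[OF 0(2), THEN conjunct1] Y[OF 0(2), THEN conjunct2]])
 from 0(1)[OF this] show ?case by (simp add: coned_def l)
next
 case (Suc n)
 have l: "length (X x) = Suc n" for x using Suc.prems(2) unfolding bpl_def by blast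
 let ?G = "\<lambda>\<phi> x. coned (Y (X x)) (F \<phi> x)"
 have G: "opr M r j (\<lambda>\<phi> x. ?G \<phi> x (X' x))" if X': "bpl M (Suc n) X'" for X'
 proof -
  have l': "length (X' x) = Suc n" for x using X' unfolding bpl_def by blast
  have "bpl M (Suc (Suc n)) (\<lambda>x. X' x @ [Y (X x)])" by (rule falg.pl_snoc[OF falg_borel X' Y[OF Suc.prems(2), THEN conjunct1] Y[OF Suc.prems(2), THEN conjunct2]])
  from opr_cmult[OF Suc.prems(1)[OF this], of "(-1)^Suc n"] show ?thesis by (simp only: coned_def l')
 qed
 have "opr M r j (\<lambda>\<phi> x. cone_op Y n (?G \<phi> x) (del i (X x)))" if "i \<le> n" for i
  by (rule Suc.IH[OF G], assumption) (rule falg.pl_del[OF falg_borel Suc.prems(2) that])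
 then show ?case unfolding cone_op.simps
  by (intro opr_diff opr_sum opr_cmult G Suc.prems(2)) simp_all
qed

subsection \<open>A frame in general position\<close>

text \<open>A kernel vector of the Gram matrix gives a combination \<open>u\<close> of
  \<open>S\<close> orthogonal to all of \<open>S\<close>. The span of \<open>S\<close> contains
  \<open>ee c\<close> and its dual for every \<open>c \<le> t\<close>, so these coordinates of
  \<open>u\<close> vanish, and then so do its coefficients, as \<open>S\<close> is
  independent.\<close>

lemma det_gram_example:
 fixes T :: "'k::field vect list"
 assumes t: "t = n0 + m" "t < r" and T: "length T = n0"
  "\<And>l. l < n0 ==> T ! l = ee (2*r - Suc l) - (if P l then ee (l - 1) else 0)" "\<And>l. P l ==> 1 \<le> l"
 defines "S \<equiv> zl n0 @ T @ [ee t, ee (2*r - Suc t)] @ map ee [n0..<t] @ map (\<lambda>i. ee (2*r - Suc i)) [n0..<t]"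
 shows "Determinant.det (gram r S S) \<noteq> 0"
proof
 assume d: "Determinant.det (gram r S S) = 0"
 let ?n = "length S"
 have n: "?n = 2*n0 + 2 + 2*m" using t by (simp add: S_def T)
 have G: "gram r S S \<in> carrier_mat ?n ?n" by (simp add: gram_def)
 from d obtain v where v: "v \<in> carrier_vec ?n" "v \<noteq> 0\<^sub>v ?n" "gram r S S *\<^sub>v v = 0\<^sub>v ?n"
  using det_0_iff_vec_prod_zero_field[OF G] by auto
 define u where "u = (\<Sum>i<?n. smul (v $ i) (S ! i))"
 have om_u: "om r s u = 0" if "s \<in> set S" for s
 proof -
  from that obtain l where l: "S ! l = s" "l < ?n" unfolding in_set_conv_nth by blast
  have "om r s u = (\<Sum>i<?n. gram r S S $$ (l, i) * v $ i)"
   unfolding u_def om_sum_right l(1)[symmetric] using l(2) by (intro sum.cong refl) (simp add: gram_nth mult.commute)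
  also have "\<dots> = (gram r S S *\<^sub>v v) $ l" using l(2) v(1) G by (auto simp: scalar_prod_def atLeast0LessThan gram_def intro!: sum.cong)
  also have "\<dots> = 0" using v(3) l(2) by simp
  finally show ?thesis .
 qed
 \<comment> \<open>Position \<open>i\<close> of \<open>S\<close> holds \<open>ee (ix i)\<close> if
   \<open>el i\<close>, and otherwise the dual of it, up to an extra summand where
   \<open>PP i\<close>.\<close>
 define el where "el i \<longleftrightarrow> i < n0 \<or> i = 2*n0 \<or> (2*n0 + 2 \<le> i \<and> i < 2*n0 + 2 + m)" for i
 define ix where "ix i = (if i < n0 then i else if i < 2*n0 then i - n0 else if i < 2*n0 + 2 then t else if i < 2*n0 + 2 + m then i - n0 - 2 else i - n0 - 2 - m)" for i
 define PP where "PP i \<longleftrightarrow> n0 \<le> i \<and> i < 2*n0 \<and> P (i - n0)" for i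
 have ixt: "ix i \<le> t" if "i < ?n" for i using that unfolding n ix_def t(1) by auto
 have inj: "i = i'" if "i < ?n" "i' < ?n" "el i = el i'" "ix i = ix i'" for i i'
  using that unfolding n ix_def el_def t(1) by (auto split: if_splits)
 have Si: "S ! i = (if el i then ee (ix i) else ee (2*r - Suc (ix i)) - (if PP i then ee (ix i - 1) else 0))" if "i < ?n" for i
 proof -
  have "i < n0 \<or> (n0 \<le> i \<and> i < 2*n0) \<or> i = 2*n0 \<or> i = 2*n0 + 1 \<or> (2*n0 + 2 \<le> i \<and> i < 2*n0 + 2 + m) \<or> (2*n0 + 2 + m \<le> i \<and> i < 2*n0 + 2 + 2*m)"
   using that unfolding n by linarith
  then consider "i < n0" | "n0 \<le> i \<and> i < 2*n0" | "i = 2*n0" | "i = 2*n0 + 1" | "2*n0 + 2 \<le> i \<and> i < 2*n0 + 2 + m" | "2*n0 + 2 + m \<le> i \<and> i < 2*n0 + 2 + 2*m"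
   by (elim disjE) 
  then show ?thesis
  proof cases
   case 1
   then show ?thesis by (simp add: S_def zl_def nth_append el_def ix_def)
  next
   case 2
   then have lt: "i - n0 < n0" by linarith
   then have "S ! i = T ! (i - n0)" using 2 by (simp add: S_def nth_append T)
   moreover have "\<not> el i" "ix i = i - n0" "PP i = P (i - n0)" using 2 by (auto simp: el_def ix_def PP_def)
   ultimately show ?thesis using T(2)[OF lt] by (simp only: if_False)
  next
   case 3
   then show ?thesis by (simp add: S_def nth_append T el_def ix_def)
  next
   case 4
   then show ?thesis by (simp add: S_def nth_append T el_def ix_def PP_def)
  next
   case 5
   then obtain k where k: "i = 2*n0 + 2 + k" "k < m" using that[of "i - (2*n0 + 2)"] by linarith
   then show ?thesis using t by (simp add: S_def nth_append T el_def ix_def)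
  next
   case 6
   then obtain k where k: "i = 2*n0 + 2 + m + k" "k < m" using that[of "i - (2*n0 + 2 + m)"] by linarith
   then show ?thesis using t by (simp add: S_def nth_append T el_def ix_def PP_def)
  qed
 qed
 have E: "ee c \<in> set S" if "c \<le> t" for c
  using that by (cases "c < n0"; cases "c = t") (auto simp: S_def zl_def)
 have uF: "u (2*r - Suc c) = 0" if "c \<le> t" for c
  using om_u[OF E[OF that]] om_eeE[of c r u] that t by simp
 have uE: "u c = 0" if c: "c \<le> t" for c
 proof (cases "c < n0")
  case True
  then have "T ! c \<in> set S" by (auto simp: S_def T(1)[symmetric])
  from om_u[OF this] have "om r (ee (2*r - Suc c) - (if P c then ee (c - 1) else 0)) u = 0" unfolding T(2)[OF True] .
  moreover have "om r (if P c then ee (c - 1) else 0) u = 0"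
   using om_u[OF E[of "c - 1"]] c by simp
  ultimately show ?thesis using om_eeF[of c r u] c t by simp
 next
  case False
  then have "ee (2*r - Suc c) \<in> set S" using c by (cases "c = t") (auto simp: S_def)
  from om_u[OF this] show ?thesis using om_eeF[of c r u] c t by simp
 qed
 have uc: "u c = (\<Sum>i<?n. v $ i * (S ! i) c)" for c by (simp add: u_def fun_sum_apply)
 \<comment> \<open>The dual coordinates come first: the extra summands of \<open>T\<close> have
   none, so each coefficient of a dual vector can be read off directly.\<close>
 have vF: "v $ i = 0" if i: "i < ?n" "\<not> el i" for i
 proof -
  have "u (2*r - Suc (ix i)) = (\<Sum>i'<?n. if i' = i then v $ i else 0)"
   unfolding uc
  proof (rule sum.cong[OF refl])
   fix i' assume "i' \<in> {..<?n}"
   then have i': "i' < ?n" by simp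
   have lt: "ix i < r" "ix i' < r" using ixt[OF i(1)] ixt[OF i'] t by simp_all
   have ne: "2*r - Suc (ix i) \<noteq> ix i'" "2*r - Suc (ix i) \<noteq> ix i' - 1" "2*r - Suc (ix i) = 2*r - Suc (ix i') \<longleftrightarrow> ix i = ix i'" using lt by linarith+
   have "(S ! i') (2*r - Suc (ix i)) = (if i' = i then 1 else 0)"
   proof (cases "el i'")
    case True
    then have "i' \<noteq> i" using i(2) by blast
    then show ?thesis using Si[OF i'] True ne(1) by (simp only: if_True ee_apply if_False)
   next
    case False
    have "ix i = ix i' \<longleftrightarrow> i' = i" using inj[OF i' i(1)] i(2) False by metis
    then show ?thesis unfolding Si[OF i'] using False ne
     by (simp only: if_False minus_apply ee_apply) (simp add: ee_apply)
   qed
   then show "v $ i' * (S ! i') (2*r - Suc (ix i)) = (if i' = i then v $ i else 0)" by simp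
  qed
  then show ?thesis using uF[OF ixt[OF i(1)]] i(1) by simp
 qed
 have vE: "v $ i = 0" if i: "i < ?n" "el i" for i
 proof -
  have "u (ix i) = (\<Sum>i'<?n. if i' = i then v $ i else 0)"
   unfolding uc
  proof (rule sum.cong[OF refl])
   fix i' assume "i' \<in> {..<?n}"
   then have i': "i' < ?n" by simp
   show "v $ i' * (S ! i') (ix i) = (if i' = i then v $ i else 0)"
   proof (cases "el i'")
    case True
    have "ix i = ix i' \<longleftrightarrow> i' = i" using inj[OF i' i(1)] i(2) True by metis
    then have "(S ! i') (ix i) = (if i' = i then 1 else 0)"
     using Si[OF i'] True by (simp only: if_True ee_apply)
    then show ?thesis by simp
   next
    case False
    then show ?thesis using vF[OF i' False] i(2) by auto
   qed
  qed
  then show ?thesis using uE[OF ixt[OF i(1)]] i(1) by simp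
 qed
 have "v = 0\<^sub>v ?n" by (rule eq_vecI) (use v(1) vF vE in auto)
 then show False using v(2) by simp
qed

text \<open>A sample in general position to \<open>zl\<close>: its vectors are the duals of
  \<open>ee 0\<close>, ..., \<open>ee (2*m)\<close> up to summands from the isotropic space of the
  \<open>ee l\<close>, so their Gram matrix with \<open>zl\<close> is minus the identity. The
  summand \<open>- ee (2*i + 1)\<close> makes two consecutive duals a hyperbolic pair.\<close>

definition exl :: "nat \<Rightarrow> nat \<Rightarrow> 'k::field frame" where
 "exl r m = (ee (2*r - Suc 0), 0) # map (\<lambda>i. (ee (2*r - Suc (2*i + 1)), ee (2*r - Suc (2*i + 2)) - ee (2*i + 1))) [0..<m]"

lemma length_exl [simp]: "length (exl r m) = Suc m"
 by (simp add: exl_def)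

lemma exl_nth: "exl r m ! 0 = (ee (2*r - Suc 0), 0)"
 "i < m ==> exl r m ! Suc i = (ee (2*r - Suc (2*i + 1)), ee (2*r - Suc (2*i + 2)) - ee (2*i + 1))"
 by (simp_all add: exl_def)

lemma valid_exl: assumes "2*m < r" shows "valid r (exl r m :: 'k::field frame)"
proof -
 let ?L = "exl r m :: 'k frame"
 have o: "om r (ee (2*r - Suc a)) (ee (2*r - Suc b)) = (0 :: 'k)" "om r (ee (2*r - Suc a)) (ee b) = (if a = b then - 1 else 0 :: 'k)"
  "om r (ee a) (ee (2*r - Suc b)) = (if a = b then 1 else 0 :: 'k)" "om r (ee a) (ee b) = (0 :: 'k)" if "a \<le> 2*m" "b \<le> 2*m" for a b
  using that assms by (auto simp: om_ee_ee)
 have nz: "nz r (ee (2*r - Suc 0) :: 'k vect)" using om_imp_nz[of r "ee (2*r - Suc 0)" "ee 0 :: nat \<Rightarrow> 'k"] o(2)[of 0 0] by simp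
 show ?thesis unfolding valid_nth length_exl
 proof (intro conjI allI impI)
  show "?L \<noteq> []" by (simp add: exl_def)
  show "nz r (fst (?L ! 0))" using nz by (simp add: exl_nth)
 next
  fix i assume "Suc i < Suc m"
  then have i: "i < m" by simp
  show "om r (fst (?L ! Suc i)) (snd (?L ! Suc i)) = 1" "om r (fst (?L ! 0)) (fst (?L ! Suc i)) = 0"
   "om r (fst (?L ! 0)) (snd (?L ! Suc i)) = 0"
   using i by (simp_all add: exl_nth o del: mult_Suc_right)
 next
  fix i j assume "i < j \<and> Suc j < Suc m"
  then have i: "i < m" "j < m" "i < j" by auto
  have ne: "2*i + 2 \<noteq> 2*j + 1" "2*i + 1 \<noteq> 2*j + 2" by presburger+
  show "om r (fst (?L ! Suc i)) (fst (?L ! Suc j)) = 0" "om r (fst (?L ! Suc i)) (snd (?L ! Suc j)) = 0"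
   "om r (snd (?L ! Suc i)) (fst (?L ! Suc j)) = 0" "om r (snd (?L ! Suc i)) (snd (?L ! Suc j)) = 0"
   using i ne by (simp_all add: exl_nth o del: mult_Suc_right)
 qed
qed

lemma vsl_exl:
 assumes "l \<le> 2*m"
 shows "vsl (exl r m) ! l = ee (2*r - Suc l) - (if even l \<and> 0 < l then ee (l - 1) else 0)"
proof -
 have v: "vsl (exl r m) ! l = (if l = 0 \<or> odd l then fst (exl r m ! ((l + 1) div 2)) else snd (exl r m ! (l div 2)))"
  by (rule falg.vsl_nth[OF falg_polyfun]) (use assms in \<open>auto simp: exl_def\<close>)
 have "l = 0 \<or> (\<exists>k. l = 2*k + 1) \<or> (\<exists>k. l = 2*k + 2)" by presburger
 then consider "l = 0" | k where "l = 2*k + 1" | k where "l = 2*k + 2" by (elim disjE exE)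
 then show ?thesis
 proof cases
  case (2 k)
  then have "k < m" using assms by simp
  then show ?thesis unfolding v by (simp add: 2 exl_nth)
 next
  case (3 k)
  then have "k < m" using assms by simp
  then show ?thesis unfolding v by (simp add: 3 exl_nth)
 next
  case 1
  then show ?thesis unfolding v by (simp add: 1 exl_nth)
 qed
qed

lemma toL_toM_eq:
 assumes "length xs = Suc k" "snd (xs ! 0) = 0" "\<And>i a. i \<le> k ==> 2*r \<le> a ==> fst (xs ! i) a = 0 \<and> snd (xs ! i) a = 0"
 shows "toL k (toM r xs) = xs"
proof (rule nth_equalityI)
 fix i assume "i < length (toL k (toM r xs))"
 then have i: "i \<le> k" by simp
 have "fst (toL k (toM r xs) ! i) a = fst (xs ! i) a" for a
  using toL_toM(1)[of i xs a r] assms(1) assms(3)[OF i, of a] i by (cases "a < 2*r") (simp_all add: toL_nth colf_def toM_def)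
 moreover have "snd (toL k (toM r xs) ! i) a = snd (xs ! i) a" for a
  using toL_toM(2)[of i xs a r] assms(1,2) assms(3)[OF i, of a] i by (cases "a < 2*r"; cases "i = 0") (simp_all add: toL_nth colf_def toM_def)
 ultimately show "toL k (toM r xs) ! i = xs ! i" by (simp add: prod_eq_iff fun_eq_iff)
qed (use assms in simp)

lemma exl_support:
 assumes "2*m < r" "i \<le> m" "2*r \<le> a"
 shows "fst (exl r m ! i :: 'k::field vect \<times> 'k vect) a = 0 \<and> snd (exl r m ! i :: 'k vect \<times> 'k vect) a = 0"
proof (cases i)
 case 0
 then show ?thesis using assms by (simp add: exl_nth ee_apply)
next
 case (Suc l)
 then have l: "l < m" using assms(2) by simp
 have "a \<noteq> 2*r - Suc (2*l + 1)" "a \<noteq> 2*r - Suc (2*l + 2)" "a \<noteq> 2*l + 1" using assms l by linarith+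
 then show ?thesis unfolding Suc exl_nth(2)[OF l] by (simp add: ee_apply)
qed

lemma det_zl_exl:
 assumes "2*m < r"
 shows "Determinant.det (gram r (zl (2*m + 1)) (vsl (exl r m))) \<noteq> (0 :: 'k::field)"
proof -
 let ?n = "2*m + 1"
 have "gram r (zl ?n) (vsl (exl r m)) = (- 1 :: 'k) \<cdot>\<^sub>m 1\<^sub>m ?n"
 proof (rule eq_matI)
  fix l i assume "l < dim_row ((- 1 :: 'k) \<cdot>\<^sub>m 1\<^sub>m ?n)" "i < dim_col ((- 1 :: 'k) \<cdot>\<^sub>m 1\<^sub>m ?n)"
  then have li: "l \<le> 2*m" "i \<le> 2*m" by simp_all
  have r: "l < r" "i < r" "l - 1 < r" using li assms by simp_all
  have z: "zl ?n ! i = (ee i :: 'k vect)" using li by (simp add: zl_def del: upt_Suc)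
  have v: "(vsl (exl r m) ! l :: 'k vect) = ee (2*r - Suc l) - (if even l \<and> 0 < l then ee (l - 1) else 0)" by (rule vsl_exl[OF li(1)])
  have "om r (if even l \<and> 0 < l then ee (l - 1) else 0) (ee i) = (0 :: 'k)"
   by (simp add: om_ee_ee(1)[OF r(3) r(2), unfolded One_nat_def])
  then have "om r (vsl (exl r m) ! l) (zl ?n ! i) = (if l = i then - 1 else 0 :: 'k)"
   unfolding z v om_diff_left om_ee_ee(4)[OF r(2) r(1)] by (simp only: diff_zero eq_commute[of i l])
  then show "gram r (zl ?n) (vsl (exl r m)) $$ (l, i) = ((- 1 :: 'k) \<cdot>\<^sub>m 1\<^sub>m ?n) $$ (l, i)"
   using li by (simp add: gram_nth)
 qed (simp_all add: gram_def)
 then show ?thesis by simp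
qed

text \<open>The determinant of the tuple itself is generically nonzero by the sample
  \<open>exl\<close>; those of its faces by induction, as face maps pull null sets back to null
  sets.\<close>

lemma AE_good_low:
 "2*m < r ==> n \<le> Suc m ==> AE \<xi> in (MU r m :: 'k::efield mat measure). good_low r n (toL m \<xi>)"
proof (induction n arbitrary: m)
 case 0
 show ?case by simp
next
 case (Suc n)
 have mr: "m < r" using Suc.prems by simp
 let ?Q = "\<lambda>xs :: 'k frame. Determinant.det (gram r (zl (2*m + 1)) (vsl xs))"
 have Qf: "A (\<lambda>t. ?Q (X t))" if "falg A" "falg.pl A (Suc m) X" for A :: "('c \<Rightarrow> 'k) \<Rightarrow> bool" and X
 proof -
  interpret falg A by fact
  have z: "vl (2*m + 1) (\<lambda>x. zl (2*m + 1))" using vl_const[of "zl (2*m+1)"] by (simp only: length_zl)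
  show ?thesis by (rule A_detgram[OF z vl_vsl[OF that(2)]])
 qed
 have "AE \<xi> in MU r m. ?Q (toL m \<xi>) \<noteq> 0"
 proof (rule generic_frames[OF mr])
  show "A (\<lambda>z. ?Q (X z))" if "falg A" "falg.pl A (Suc m) X" for A :: "('k mat \<times> (nat \<times> nat \<Rightarrow> 'k) \<Rightarrow> 'k) \<Rightarrow> bool" and X
   by (rule Qf[OF that])
  show "toM r (exl r m) \<in> XX r m" by (rule toM_in_XX[OF valid_exl[OF Suc.prems(1)]]) simp
  have "toL m (toM r (exl r m :: 'k frame)) = exl r m"
   by (rule toL_toM_eq[OF length_exl]) (simp add: exl_nth, rule exl_support[OF Suc.prems(1)])
  then show "?Q (toL m (toM r (exl r m))) \<noteq> 0" by (simp only: det_zl_exl[OF Suc.prems(1)] not_False_eq_True)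
 qed
 moreover have "AE \<xi> in (MU r m :: 'k mat measure). \<forall>i\<in>{..n}. good_low r n (del i (toL m \<xi>))"
 proof (rule AE_finite_allI)
  fix i assume i: "i \<in> {..n}"
  show "AE \<xi> in (MU r m :: 'k mat measure). good_low r n (del i (toL m \<xi>))"
  proof (cases n)
   case (Suc n')
   then obtain m' where m: "m = Suc m'" using \<open>Suc n \<le> Suc m\<close> by (cases m) simp_all
   have g: "AE \<eta> in (MU r m' :: 'k mat measure). good_low r n (toL m' \<eta>)"
    by (rule Suc.IH) (use Suc.prems m in simp_all)
   have *: "AE \<xi> in (MU r m :: 'k mat measure). good_low r n (toL m' (fc r m' i \<xi>))"
    unfolding m by (rule AE_MU_fc[OF _ _ g]) (use mr m i Suc.prems in simp_all)
   show ?thesis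
   proof (rule AE_mp[OF *], rule AE_I2, rule impI)
    fix \<xi> :: "'k mat" assume \<xi>: "\<xi> \<in> space (MU r m)" "good_low r n (toL m' (fc r m' i \<xi>))"
    then have "\<xi> \<in> XX r (Suc m')" by (simp only: space_MU m)
    from toL_fc[OF this, of i] show "good_low r n (del i (toL m \<xi>))" using \<xi>(2) i Suc.prems by (simp add: m good_low_z0)
   qed
  qed simp
 qed simp
 ultimately show ?case
 proof eventually_elim
  case (elim \<xi>)
  have "2 * length (toL m \<xi>) - 1 = 2*m + 1" by simp
  then show ?case using elim unfolding good_low.simps(2) by (simp only: simp_thms) blast
 qed
qed

text \<open>\<open>corr\<close> cleared of its denominator, hence polynomial. Then
  \<open>qpair\<close> puts both conditions for a good \<open>ypair\<close>, a nonzero determinant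
  and a nonzero product, into one polynomial.\<close>

definition dcorr :: "nat \<Rightarrow> 'k::field vect list \<Rightarrow> 'k vect \<Rightarrow> nat \<Rightarrow> 'k" where
 "dcorr r S u = smul (Determinant.det (gram r S S)) u - (\<Sum>i<length S. smul (ccoef r S S u i) (S ! i))"

lemma corr_dcorr:
 assumes "Determinant.det (gram r S S) \<noteq> 0"
 shows "dcorr r S u = smul (Determinant.det (gram r S S)) (corr r S S u)"
 by (rule ext) (use assms in \<open>simp add: dcorr_def corr_def smul_apply fun_sum_apply right_diff_distrib sum_distrib_left\<close>)

definition qpair :: "nat \<Rightarrow> 'k::field vect list \<Rightarrow> 'k" where
 "qpair r S = Determinant.det (gram r S S) * om r (dcorr r S (ee (r - 1))) (dcorr r S (ee (2*r - Suc (r - 1))))"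

lemma qpair_corr:
 assumes "qpair r S \<noteq> 0"
 shows "Determinant.det (gram r S S) \<noteq> 0" "om r (corr r S S (ee (r - 1))) (corr r S S (ee (2*r - Suc (r - 1)))) \<noteq> 0"
proof -
 show d: "Determinant.det (gram r S S) \<noteq> 0" using assms by (auto simp: qpair_def)
 show "om r (corr r S S (ee (r - 1))) (corr r S S (ee (2*r - Suc (r - 1)))) \<noteq> 0"
  using assms unfolding qpair_def corr_dcorr[OF d] by (auto simp: om_smul_left om_smul_right)
qed

lemma (in falg) A_qpair: assumes S: "vl n S" shows "A (\<lambda>x. qpair r (S x))"
proof -
 have l: "length (S x) = n" for x using S by (simp add: vl_def)
 have "av (\<lambda>x. dcorr r (S x) u)" for u
 proof -
  have "A (\<lambda>x. Determinant.det (gram r (S x) (S x)) * u a - (\<Sum>i<n. ccoef r (S x) (S x) u i * (S x ! i) a))" for a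
  proof (intro A_diff A_sum A_mult A_const A_detgram[OF S S])
   fix i assume "i \<in> {..<n}"
   then have i: "i < n" by simp
   show "A (\<lambda>x. ccoef r (S x) (S x) u i)" by (rule A_ccoef[OF S S i])
   show "A (\<lambda>x. (S x ! i) a)" using S i by (simp add: vl_def av_def)
  qed
  then show ?thesis by (simp add: av_def dcorr_def l fun_sum_apply smul_apply)
 qed
 then show ?thesis unfolding qpair_def by (intro A_mult A_om A_detgram[OF S S])
qed

lemma ypair_props:
 assumes "qpair r (slist r j xs) \<noteq> 0"
 shows "fst (ypair r j xs) \<in> perp r (set (slist r j xs))" "snd (ypair r j xs) \<in> perp r (set (slist r j xs))"
  "om r (fst (ypair r j xs)) (snd (ypair r j xs)) = 1"
proof -
 note q = qpair_corr[OF assms]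
 have p: "corr r (slist r j xs) (slist r j xs) u \<in> perp r (set (slist r j xs))" for u
  by (rule corr_in_perp[OF q(1) refl])
 show "fst (ypair r j xs) \<in> perp r (set (slist r j xs))" "snd (ypair r j xs) \<in> perp r (set (slist r j xs))"
  using p by (simp_all add: ypair_def Let_def perp_def om_smul_right)
 show "om r (fst (ypair r j xs)) (snd (ypair r j xs)) = 1"
  using q(2) by (simp add: ypair_def Let_def om_smul_right)
qed

text \<open>The sample \<open>exl\<close> is lengthened by the standard pair number
  \<open>3*j - 4\<close>, the first one that neither it nor the standard part of
  \<open>slist\<close> uses. Then \<open>det_gram_example\<close> applies with
  \<open>n0 = 2*j - 3\<close> and \<open>m = j - 1\<close>, and the innermost pair is orthogonal to
  the whole list, so that \<open>dcorr\<close> only rescales it.\<close>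

lemma qpair_example:
 assumes j: "2 \<le> j" "3*j \<le> r"
 defines "t \<equiv> 3*j - 4"
 defines "xs \<equiv> exl r (j - 2) @ [(ee t, ee (2*r - Suc t))] :: 'k::field frame"
 shows "valid r xs" "length xs = j" "toL (j - 1) (toM r xs) = xs" "qpair r (slist r j xs) \<noteq> 0"
proof -
 define J where "J = j - 2"
 have jJ: "j = J + 2" using j by (simp add: J_def)
 have tr: "t + 1 < r" "t = 2*J + 1 + (J + 1)" "2*J < r" using j by (simp_all add: t_def jJ)
 let ?E = "exl r J :: 'k frame"
 have xs: "xs = ?E @ [(ee t, ee (2*r - Suc t))]" by (simp add: xs_def jJ)
 have ne: "?E \<noteq> []" by (simp add: exl_def)
 have l1: "length (vsl ?E) = 2*J + 1" by (simp add: length_vsl)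
 show lx: "length xs = j" by (simp add: xs jJ)
 have vx: "vsl xs = vsl ?E @ [ee t, ee (2*r - Suc t)]" unfolding xs by (cases ?E) (use ne in auto)
 have vl: "vsl ?E ! l = ee (2*r - Suc l) - (if even l \<and> 0 < l then ee (l - 1) else 0)" if "l < 2*J + 1" for l
  by (rule vsl_exl) (use that in simp)
 have orth: "om r s (ee c) = 0 \<and> om r s (ee (2*r - Suc c)) = 0" if s: "s \<in> set (vsl ?E)" and c: "2*J + 1 \<le> c" "c < r" for s c
 proof -
  have "\<exists>l<length (vsl ?E). vsl ?E ! l = s" using s unfolding in_set_conv_nth .
  then obtain l where l: "l < 2*J + 1" "s = vsl ?E ! l" unfolding l1 by blast
  have lr: "l < r" "l - 1 < r" "l \<noteq> c" "l - 1 \<noteq> c" using l(1) c by linarith+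
  show ?thesis unfolding l(2) vl[OF l(1)] using lr(3,4) by (simp add: om_diff_left om_ee_ee(2)[OF lr(1) c(2)] om_ee_ee(4)[OF c(2) lr(1)] om_ee_ee(1,3)[OF lr(2) c(2), unfolded One_nat_def])
 qed
 have ct: "2*J + 1 \<le> t" "t < r" using tr by linarith+
 show "valid r xs"
  unfolding xs valid_snoc[OF ne]
 proof (intro conjI ballI)
  show "valid r ?E" by (rule valid_exl[OF tr(3)])
  show "om r (fst (ee t, ee (2*r - Suc t))) (snd (ee t, ee (2*r - Suc t))) = (1 :: 'k)" using om_ee_ee(3)[OF ct(2) ct(2)] by simp
  fix s :: "'k vect" assume "s \<in> vs ?E"
  then have s: "s \<in> set (vsl ?E)" by (simp add: vs_def)
  show "om r s (fst (ee t, ee (2*r - Suc t))) = 0" "om r s (snd (ee t, ee (2*r - Suc t))) = 0" using orth[OF s ct] by simp_all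
 qed
 show "toL (j - 1) (toM r xs) = xs"
 proof (rule toL_toM_eq)
  show "length xs = Suc (j - 1)" using lx j by simp
  show "snd (xs ! 0) = 0" by (simp add: xs nth_append exl_nth)
  fix i a :: nat assume i: "i \<le> j - 1" and a: "2*r \<le> a"
  show "fst (xs ! i) a = 0 \<and> snd (xs ! i) a = 0"
  proof (cases "i \<le> J")
   case True
   then show ?thesis using exl_support[OF tr(3) True a, where 'k = 'k] by (simp add: xs nth_append)
  next
   case False
   then have "i = Suc J" using i by (simp add: jJ)
   then have "xs ! i = (ee t, ee (2*r - Suc t))" by (simp add: xs nth_append)
   then show ?thesis using a ct by (simp add: ee_apply)
  qed
 qed
 let ?S = "slist r j xs"
 have S: "?S = zl (2*J + 1) @ vsl ?E @ [ee t, ee (2*r - Suc t)] @ map ee [2*J + 1..<t] @ map (\<lambda>i. ee (2*r - Suc i)) [2*J + 1..<t]"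
  unfolding slist_def vx by (simp add: jJ t_def)
 have d: "Determinant.det (gram r ?S ?S) \<noteq> 0"
  unfolding S by (rule det_gram_example[where P = "\<lambda>l. even l \<and> 0 < l", OF tr(2) ct(2) l1 vl]) simp_all
 have r0: "r - 1 < r" "2*J + 1 \<le> r - 1" "t < r - 1" using tr by linarith+
 have om0: "om r s (ee (r - 1)) = 0 \<and> om r s (ee (2*r - Suc (r - 1))) = 0" if s: "s \<in> set ?S" for s
 proof -
  let ?F = "\<lambda>i. ee (2*r - Suc i) :: nat \<Rightarrow> 'k"
  have "ee ` {0..<2*J + 1} \<subseteq> (ee ` {..t} :: 'k vect set)" "ee ` {2*J + 1..<t} \<subseteq> (ee ` {..t} :: 'k vect set)" "?F ` {2*J + 1..<t} \<subseteq> ?F ` {..t}"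
   "ee t \<in> (ee ` {..t} :: 'k vect set)" "?F t \<in> ?F ` {..t}" using ct(1) by (auto intro!: image_mono)
  then have "set ?S \<subseteq> set (vsl ?E) \<union> (ee ` {..t} \<union> ?F ` {..t})"
   unfolding S set_append zl_def set_map set_upt by auto
  then have "s \<in> set (vsl ?E) \<or> (\<exists>c\<le>t. s = ee c \<or> s = ee (2*r - Suc c))" using s by blast
  then show ?thesis
  proof
   assume "\<exists>c\<le>t. s = ee c \<or> s = ee (2*r - Suc c)"
   then obtain c where c: "c \<le> t" "s = ee c \<or> s = ee (2*r - Suc c)" by blast
   have cr: "c < r" "c \<noteq> r - 1" using c(1) r0 by linarith+
   show ?thesis using c(2) cr(2)
    by (elim disjE) (simp_all add: om_ee_ee[OF cr(1) r0(1), unfolded One_nat_def] om_ee_ee[OF r0(1) cr(1), unfolded One_nat_def])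
  qed (rule orth[OF _ r0(2,1)])
 qed
 have cc: "dcorr r ?S u = smul (Determinant.det (gram r ?S ?S)) u" if "\<And>s. s \<in> set ?S ==> om r s u = 0" for u
 proof -
  have "ccoef r ?S ?S u i = 0" for i unfolding ccoef_def using that by (simp add: sum.neutral)
  then show ?thesis by (rule_tac ext) (simp add: dcorr_def smul_apply fun_sum_apply)
 qed
 have "dcorr r ?S (ee (r - 1)) = smul (Determinant.det (gram r ?S ?S)) (ee (r - 1))" by (rule cc) (use om0 in blast)
 moreover have "dcorr r ?S (ee (2*r - Suc (r - 1))) = smul (Determinant.det (gram r ?S ?S)) (ee (2*r - Suc (r - 1)))" by (rule cc) (use om0 in blast)
 ultimately show "qpair r ?S \<noteq> 0" unfolding qpair_def using d
  by (simp add: om_smul_left om_smul_right om_ee_ee(3)[OF r0(1) r0(1), unfolded One_nat_def])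
qed

lemma AE_good_face:
 assumes j: "2 \<le> j" "3*j \<le> r"
 shows "AE \<eta> in (MU r (j - 1) :: 'k::efield mat measure). good_face r j (toL (j - 1) \<eta>) \<and> qpair r (slist r j (toL (j - 1) \<eta>)) \<noteq> 0"
proof -
 define k where "k = j - 2"
 have jk: "j - 1 = Suc k" "j = Suc (Suc k)" using j by (simp_all add: k_def)
 let ?x = "exl r (j - 2) @ [(ee (3*j - 4), ee (2*r - Suc (3*j - 4)))] :: 'k frame"
 have "AE \<eta> in (MU r (j - 1) :: 'k mat measure). qpair r (slist r j (toL (j - 1) \<eta>)) \<noteq> 0"
 proof (rule generic_frames)
  show "j - 1 < r" using j by simp
  show "A (\<lambda>z. qpair r (slist r j (X z)))" if "falg A" "falg.pl A (Suc (j - 1)) X" for A :: "('k mat \<times> (nat \<times> nat \<Rightarrow> 'k) \<Rightarrow> 'k) \<Rightarrow> bool" and X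
   by (rule falg.A_qpair[OF that(1) vl_slist[OF that]])
  show "toM r ?x \<in> XX r (j - 1)" by (rule toM_in_XX[OF qpair_example(1)[OF j]]) (use j in simp)
  show "qpair r (slist r j (toL (j - 1) (toM r ?x))) \<noteq> 0"
   unfolding qpair_example(3)[OF j] by (rule qpair_example(4)[OF j])
 qed
 moreover have "AE \<eta> in (MU r (j - 1) :: 'k mat measure). \<forall>i\<in>{..<j}. good_low r (j - 1) (del i (toL (j - 1) \<eta>))"
 proof (rule AE_finite_allI)
  fix i assume i: "i \<in> {..<j}"
  have g: "AE \<eta> in (MU r k :: 'k mat measure). good_low r (j - 1) (toL k \<eta>)"
   by (rule AE_good_low) (use j in \<open>simp_all add: jk\<close>)
  have *: "AE \<xi> in (MU r (Suc k) :: 'k mat measure). good_low r (j - 1) (toL k (fc r k i \<xi>))"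
   by (rule AE_MU_fc[OF _ _ g]) (use i j in \<open>simp_all add: jk\<close>)
  show "AE \<xi> in (MU r (j - 1) :: 'k mat measure). good_low r (j - 1) (del i (toL (j - 1) \<xi>))"
   unfolding jk(1)
  proof (rule AE_mp[OF *[unfolded jk(1)]], rule AE_I2, rule impI)
   fix \<xi> :: "'k mat" assume \<xi>: "\<xi> \<in> space (MU r (Suc k))" "good_low r (Suc k) (toL k (fc r k i \<xi>))"
   then have "\<xi> \<in> XX r (Suc k)" by (simp only: space_MU)
   then have "toL k (fc r k i \<xi>) = z0 (del i (toL (Suc k) \<xi>))" by (rule toL_fc) (use i jk(2) in simp)
   then show "good_low r (Suc k) (del i (toL (Suc k) \<xi>))" using \<xi>(2) by (simp only: good_low_z0)
  qed
 qed simp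
 ultimately show ?thesis
  by eventually_elim (use qpair_corr(1) in \<open>auto simp: good_face_def\<close>)
qed

lemma cohomology_vanishes_ge2:
 assumes j: "2 \<le> j" "3*j \<le> r"
 shows "cohomology_vanishes (XO r :: ('k::efield mat, 'k mat) measured_obj) (int j)"
proof -
 define k where "k = j - 1"
 have jk: "j = Suc k" "j - 1 = k" using j by (simp_all add: k_def)
 have jr: "j < r" "Suc j < r" using j by simp_all
 let ?M = "MB r k :: 'k mat measure"
 \<comment> \<open>One summand of \<open>filling_ge2\<close>, as a function of the face
   alone.\<close>
 define E where "E \<phi> \<eta> = cycle_op (yvert r j) (coned (ypair r j (toL k \<eta>)) (\<lambda>ys. \<phi> (rL r j ys))) (toL k \<eta>)" for \<phi> :: "'k mat \<Rightarrow> real" and \<eta>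
 have ym: "bav M (\<lambda>x. fst (yvert r j (X x))) \<and> bav M (\<lambda>x. snd (yvert r j (X x)))" if "bpl M n X"
  for n and M :: "'k mat measure" and X :: "'k mat \<Rightarrow> 'k frame"
  using measurable_yvert[OF that, of r j] by (intro conjI)
 have F: "opr ?M r j (\<lambda>\<phi> \<eta>. coned (ypair r j (toL k \<eta>)) (\<lambda>ys. \<phi> (rL r j ys)) (X \<eta>))" if X: "bpl ?M (Suc k) X" for X
 proof -
  have l: "length (X \<eta>) = Suc k" for \<eta> using X by (simp add: bpl_def)
  have "bpl ?M (Suc j) (\<lambda>\<eta>. X \<eta> @ [ypair r j (toL k \<eta>)])"
   unfolding jk(1) using falg.pl_snoc[OF falg_borel X measurable_ypair[OF bpl_toL] ] by (simp only: jk(1))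
  from opr_cmult[OF opr_rL[OF jr(1) this], of "(-1)^Suc k"] show ?thesis by (simp only: coned_def l)
 qed
 have op: "opr ?M r j E"
  unfolding E_def cycle_op_def length_toL diff_Suc_1
  by (intro opr_diff opr_sum opr_cmult F bpl_toL opr_cone[where Y = "yvert r j"] ym falg.pl_del[OF falg_borel bpl_toL]) simp_all
 let ?G = "\<lambda>ys :: 'k frame. good_face r j ys \<and> qpair r (slist r j ys) \<noteq> 0"
 have good: "AE \<xi> in (MU r j :: 'k mat measure). \<forall>i\<in>{..j}. ?G (toL k (fc r k i \<xi>))"
 proof (rule AE_finite_allI)
  fix i assume i: "i \<in> {..j}"
  show "AE \<xi> in (MU r j :: 'k mat measure). ?G (toL k (fc r k i \<xi>))"
   unfolding jk(1) by (rule AE_MU_fc[OF _ _ AE_good_face[OF j, unfolded jk(2), unfolded jk(1)]]) (use jr i in \<open>simp_all add: jk(1)\<close>)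
 qed simp
 have "\<exists>h\<in>Linf (MU r k). AE x in MU r (Suc k). f x = coboundary (XO r) k h x"
  if f: "f \<in> Linf (MU r (Suc k))" and cob: "AE x in MU r (Suc (Suc k)). coboundary (XO r) (Suc k) f x = 0" for f :: "'k mat \<Rightarrow> real"
 proof (rule cohomology_Suc[OF _ good[unfolded jk(1)] op[unfolded jk(1)] _ f cob])
  show "Suc (Suc k) < r" using jr by (simp add: jk(1))
  fix \<phi> :: "'k mat \<Rightarrow> real" and \<xi> :: "'k mat" assume s: "scoc r (Suc k) \<phi>" and \<xi>: "\<xi> \<in> XX r (Suc k)"
   and G: "\<forall>i\<in>{..Suc k}. good_face r (Suc k) (toL k (fc r k i \<xi>)) \<and> qpair r (slist r (Suc k) (toL k (fc r k i \<xi>))) \<noteq> 0"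
  let ?f = "\<lambda>ys. \<phi> (rL r j ys)" and ?xs = "toL j \<xi>"
  have fc: "toL k (fc r k i \<xi>) = z0 (del i ?xs)" if "i \<le> j" for i
   using toL_fc[OF \<xi>, of i] that by (simp only: jk(1))
  have G': "?G (del i ?xs)" if "i \<le> j" for i
  proof -
   have "?G (toL k (fc r k i \<xi>))" unfolding jk(1) by (rule bspec[OF G]) (use that jk in simp)
   then show ?thesis unfolding fc[OF that] good_face_z0 slist_z0 .
  qed
  have yz: "ypair r j (z0 ys) = ypair r j ys" for ys :: "'k frame" by (simp only: ypair_def slist_z0)
  have "?f ?xs = (\<Sum>i<Suc j. (-1)^i * cycle_op (yvert r j) (coned (ypair r j (del i ?xs)) ?f) (del i ?xs))"
  proof (rule filling_ge2[OF j])
   show "valid r ?xs" using \<xi> by (simp add: XX_def jk(1))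
   show "length ?xs = Suc j" by simp
   show "bd ?f ys = 0" if "valid r ys" "length ys = j + 2" for ys by (rule bd_rL[OF s[folded jk(1)] that])
   show "good_face r j (del i ?xs)" if "i \<le> j" for i using G'[OF that] by blast
   show "fst (ypair r j (del i ?xs)) \<in> perp r (set (slist r j (del i ?xs))) \<and> snd (ypair r j (del i ?xs)) \<in> perp r (set (slist r j (del i ?xs))) \<and>
     om r (fst (ypair r j (del i ?xs))) (snd (ypair r j (del i ?xs))) = 1" if "i \<le> j" for i
    using ypair_props[of r j "del i ?xs"] G'[OF that] by blast
  qed
  also have "\<dots> = (\<Sum>i<Suc j. (-1)^i * E \<phi> (fc r k i \<xi>))"
  proof (rule sum.cong[OF refl])
   fix i assume "i \<in> {..<Suc j}"
   then have i: "i \<le> j" by simp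
   have "E \<phi> (fc r k i \<xi>) = cycle_op (yvert r j) (coned (ypair r j (del i ?xs)) ?f) (del i ?xs)"
    unfolding E_def fc[OF i] yz by (rule cycle_op_z0[where Y = "yvert r j", OF yvert_z0]) (rule coned_z0[of "\<lambda>ys. \<phi> (rL r j ys)"], simp only: rL_z0)
   then show "(-1)^i * cycle_op (yvert r j) (coned (ypair r j (del i ?xs)) ?f) (del i ?xs) = (-1)^i * E \<phi> (fc r k i \<xi>)" by simp
  qed
  finally show "\<phi> \<xi> = (\<Sum>i\<le>Suc k. (-1)^i * E \<phi> (fc r k i \<xi>))"
   using rL_toL[OF \<xi>] by (simp only: jk(1) lessThan_Suc_atMost)
 qed
 from cohomology_vanishes_Suc[OF this] show ?thesis by (simp only: jk(1))
qed

section \<open>The range of connectivity\<close>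

lemma spcond_2:
 assumes "a * d - b * c = (1 :: 'k::field)"
 shows "spcond 1 (mat 2 2 (\<lambda>(i, j). if i = 0 then (if j = 0 then a else b) else (if j = 0 then c else d)))"
proof -
 let ?A = "mat 2 2 (\<lambda>(i, j). if i = 0 then (if j = 0 then a else b) else (if j = 0 then c else d)) :: 'k mat"
 have mv: "mv ?A x 0 = a * x 0 + b * x 1" "mv ?A x 1 = c * x 0 + d * x 1" for x
  by (simp_all add: mv_def lessThan_Suc numeral_2_eq_2)
 have om: "om 1 x y = x 0 * y 1 - x 1 * y 0" for x y :: "'k vect" by (simp add: om_def)
 have "om 1 (mv ?A x) (mv ?A y) = (a * d - b * c) * om 1 x y" for x y unfolding om mv by (simp add: algebra_simps)
 then show ?thesis unfolding spcond_iff assms by simp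
qed

text \<open>For \<open>r = 1\<close> there are no edges, so every bounded function on the nonzero
  vectors of the plane is a cocycle; comparing the norms of the two coordinates gives one that is
  not a.e. constant.\<close>

lemma not_cohomology_vanishes_1:
 "\<not> cohomology_vanishes (XO 1 :: ('k::efield mat, 'k mat) measured_obj) 0"
proof
 assume v: "cohomology_vanishes (XO 1 :: ('k mat, 'k mat) measured_obj) 0"
 let ?M = "MU 1 0 :: 'k mat measure"
 let ?P = "\<lambda>\<xi> :: 'k mat. norm (\<xi> $$ (1, 0)) < norm (\<xi> $$ (0, 0))"
 define f where "f \<xi> = (if ?P \<xi> then 1 else 0 :: real)" for \<xi>
 have [measurable]: "(\<lambda>\<xi>. \<xi> $$ (a, 0)) \<in> borel_measurable (MB 1 0 :: 'k mat measure)" if "a < 2" for a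
  by (rule measurable_MB_entry) (use that in simp_all)
 have "f \<in> borel_measurable (MB 1 0)" unfolding f_def by measurable
 then have "f \<in> borel_measurable ?M" by (simp only: measurable_cong_sets[OF sets_MU refl])
 then have "f \<in> Linf ?M" by (auto simp: Linf_def f_def intro!: exI[of _ 1])
 moreover have "AE x in (MU 1 1 :: 'k mat measure). coboundary (XO 1) 0 f x = 0"
  by (rule AE_I2) (simp only: space_MU XX_empty[OF order_refl] empty_iff)
 ultimately obtain c where c: "AE \<xi> in ?M. f \<xi> = c"
  using v unfolding cohomology_vanishes_def XO_simps by blast
 let ?A = "\<lambda>a b c d. mat 2 2 (\<lambda>(i, j). if i = 0 then (if j = 0 then a else b) else (if j = 0 then c else d)) :: 'k mat"
 have f_A: "f (?A a b c' d * \<xi>) = (if norm (c' * \<xi> $$ (0, 0) + d * \<xi> $$ (1, 0)) < norm (a * \<xi> $$ (0, 0) + b * \<xi> $$ (1, 0)) then 1 else 0)"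
  if "\<xi> \<in> XX 1 0" for a b c' d \<xi>
 proof -
  have "\<xi> \<in> carrier_mat 2 2" using XX_carrier[OF that] by simp
  then show ?thesis by (simp add: f_def scalar_prod_def numeral_2_eq_2)
 qed
 have tr: "AE \<xi> in ?M. (if norm (c' * \<xi> $$ (0, 0) + d * \<xi> $$ (1, 0)) < norm (a * \<xi> $$ (0, 0) + b * \<xi> $$ (1, 0)) then 1 else 0) = c"
  if "a * d - b * c' = 1" for a b c' d
 proof (rule AE_mp[OF AE_MU_translate[OF _ spcond_2[OF that] c]], simp, rule AE_I2, rule impI)
  fix \<xi> :: "'k mat" assume "\<xi> \<in> space ?M" "f (?A a b c' d * \<xi>) = c"
  then show "(if norm (c' * \<xi> $$ (0, 0) + d * \<xi> $$ (1, 0)) < norm (a * \<xi> $$ (0, 0) + b * \<xi> $$ (1, 0)) then 1 else 0) = c"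
   using f_A[of \<xi> a b c' d] by (simp only: space_MU)
 qed
 \<comment> \<open>If \<open>f\<close> were constant, the identity, a quarter turn and a shear by 3
   would make \<open>|y| < |x|\<close>, \<open>|x| < |y|\<close> and \<open>|y| < |x + 3 y|\<close>
   equivalent a.e. Then all three fail, and the triangle inequality gives
   \<open>3 |y| \<le> 2 |y|\<close>, which leaves only the zero vector.\<close>
 have "AE \<xi> in ?M. False"
 proof (rule AE_mp[OF tr[of 1 1 0 0]], simp, rule AE_mp[OF tr[of 0 0 1 "-1"]], simp, rule AE_mp[OF tr[of 1 1 3 0]], simp, rule AE_I2, intro impI)
  fix \<xi> :: "'k mat" assume \<xi>: "\<xi> \<in> space ?M"
  let ?x = "\<xi> $$ (0, 0)" and ?y = "\<xi> $$ (1, 0)"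
  assume 1: "(if norm (0 * ?x + 1 * ?y) < norm (1 * ?x + 3 * ?y) then 1 else 0) = c"
   and 2: "(if norm (- 1 * ?x + 0 * ?y) < norm (0 * ?x + 1 * ?y) then 1 else 0) = c"
   and 3: "(if norm (0 * ?x + 1 * ?y) < norm (1 * ?x + 0 * ?y) then 1 else 0) = c"
  have X: "\<xi> \<in> XX 1 0" using \<xi> by (simp only: space_MU)
  have le: "norm ?y = norm ?x" "norm (?x + 3 * ?y) \<le> norm ?y" using 1 2 3 by (auto split: if_splits)
  have "3 * norm ?y = norm (3 * ?y)" by (simp add: norm_mult)
  also have "\<dots> = norm ((?x + 3 * ?y) - ?x)" by simp
  also have "\<dots> \<le> norm (?x + 3 * ?y) + norm ?x" by (rule norm_triangle_ineq4)
  finally have "norm ?y \<le> 0" using le by linarith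
  then have "norm ?y = 0" "norm ?x = 0" using le(1) by simp_all
  then have z: "?y = 0" "?x = 0" by simp_all
  have "valid 1 (toL 0 \<xi>)" using X by (simp add: XX_def)
  then have "nz 1 (colf \<xi> 0)" by (simp add: valid_nth toL_nth)
  then show False using z XX_carrier[OF X] by (auto simp: nz_def colf_def less_2_cases_iff)
 qed
 moreover have "prob_space ?M" by (rule prob_MU) simp
 ultimately show False by (simp add: prob_space.AE_False)
qed

lemma cohomology_vanishes_low:
 assumes "d < 0" "0 < r"
 shows "cohomology_vanishes (XO r :: ('k::efield mat, 'k mat) measured_obj) d"
proof -
 interpret prob_space "MU r 0 :: 'k mat measure" by (rule prob_MU[OF assms(2)])
 show ?thesis unfolding cohomology_vanishes_def XO_simps using assms(1) by (auto simp: AE_const)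
qed

definition qset :: "nat \<Rightarrow> nat set" where
 "qset r = {q::nat. int (2 ^ q) + \<lceil>(real q + 1) / 2\<rceil> \<le> int r}"

text \<open>Links the range in the claim to the room needed by the filling. At \<open>q = 2\<close>
  both sides are 6; later the power of 2 takes over.\<close>

lemma three_le_qset: assumes "2 \<le> q" shows "3 * int q \<le> int (2 ^ q) + \<lceil>(real q + 1) / 2\<rceil>"
 using assms
proof (induction q rule: nat_induct_at_least)
 case base
 then show ?case by simp
next
 case (Suc q)
 show ?case
 proof (cases "q = 2")
  case True
  then show ?thesis by simp
 next
  case False
  then have q: "3 \<le> q" using Suc by simp
  then have p: "3 * int (Suc q) \<le> int (2 ^ Suc q) + 2"
  proof (induction q rule: nat_induct_at_least)
   case (Suc n)
   then show ?case by simp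
  qed simp
  have "(2::int) \<le> \<lceil>(real (Suc q) + 1) / 2\<rceil>" using q by (simp add: le_ceiling_iff)
  then show ?thesis using p by linarith
 qed
qed

lemma qset_bounds:
 assumes "q \<in> qset r"
 shows "2 \<le> r" "1 \<le> q ==> 3 \<le> r" "2 \<le> q ==> 3 * q \<le> r" "q < r"
proof -
 have h: "int (2 ^ q) + \<lceil>(real q + 1) / 2\<rceil> \<le> int r" using assms by (simp add: qset_def)
 have c: "(1::int) \<le> \<lceil>(real q + 1) / 2\<rceil>" by (simp add: le_ceiling_iff)
 have p: "(1::int) \<le> int (2 ^ q)" by simp
 show "2 \<le> r" using h c p by linarith
 have "int q < int (2 ^ q)" using less_exp[of q] by (simp only: of_nat_less_iff)
 then show "q < r" using h c by linarith
 show "3 \<le> r" if "1 \<le> q"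
 proof -
  have "(2::int) \<le> int (2 ^ q)" using power_increasing[OF that, of "2::int"] by simp
  then show ?thesis using h c by linarith
 qed
 show "3 * q \<le> r" if "2 \<le> q" using three_le_qset[OF that] h by linarith
qed

lemma qset_mono: assumes "q \<in> qset r" "q' \<le> q" shows "q' \<in> qset r"
proof -
 have "(2::int)^q' \<le> 2^q" by (rule power_increasing[OF assms(2)]) simp
 moreover have "\<lceil>(real q' + 1) / 2\<rceil> \<le> \<lceil>(real q + 1) / 2\<rceil>" by (rule ceiling_mono) (use assms(2) in simp)
 ultimately show ?thesis using assms(1) unfolding qset_def mem_Collect_eq of_nat_power of_nat_numeral by linarith
qed

lemma q_connected_XO:
 assumes "q \<in> qset r"
 shows "q_connected (XO r :: ('k::efield mat, 'k mat) measured_obj) q"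
 unfolding q_connected_def
proof (intro conjI allI impI)
 show "q \<in> idx (odim (XO r :: ('k mat, 'k mat) measured_obj))" unfolding XO_simps idx_XO using qset_bounds(4)[OF assms] by simp
 fix d :: int assume d: "d \<le> int q"
 show "cohomology_vanishes (XO r :: ('k mat, 'k mat) measured_obj) d"
 proof (cases "d < 0")
  case True
  then show ?thesis by (rule cohomology_vanishes_low) (use qset_bounds(1)[OF assms] in simp)
 next
  case False
  define n where "n = nat d"
  have n: "d = int n" "n \<in> qset r" using False d qset_mono[OF assms, of n] by (simp_all add: n_def)
  consider "n = 0" | "n = 1" | "2 \<le> n" by linarith
  then show ?thesis
  proof cases
   case 1
   then show ?thesis using cohomology_vanishes_0[OF qset_bounds(1)[OF n(2)], where 'k = 'k] n(1) by simp
  next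
   case 2
   then have "3 \<le> r" using qset_bounds(2)[OF n(2)] by simp
   from cohomology_vanishes_1[OF this, where 'k = 'k] show ?thesis using n(1) 2 by simp
  next
   case 3
   from cohomology_vanishes_ge2[OF this qset_bounds(3)[OF n(2) this], where 'k = 'k] show ?thesis using n(1) by simp
  qed
 qed
qed

text \<open>An empty supremum occurs for \<open>r < 2\<close>, and then connectivity has to be
  refuted: for \<open>r = 0\<close> there is no degree to consider, and \<open>r = 1\<close> is
  \<open>not_cohomology_vanishes_1\<close>.\<close>

lemma measurably_connected_XO:
 "measurably_connected (XO r :: ('k::efield mat, 'k mat) measured_obj) (SUP q\<in>qset r. ereal (real q))"
proof (cases "qset r = {}")
 case True
 have "r < 2"
 proof (rule ccontr)
  assume "\<not> r < 2"
  moreover have "\<lceil>(1::real) / 2\<rceil> \<le> 1" by (simp add: ceiling_le_iff)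
  ultimately have "1 + \<lceil>(1::real) / 2\<rceil> \<le> int r" by linarith
  then have "0 \<in> qset r" by (simp add: qset_def)
  then show False using True by simp
 qed
 have "\<not> q_connected (XO r :: ('k mat, 'k mat) measured_obj) q" if "q \<in> idx (odim (XO r :: ('k mat, 'k mat) measured_obj))" for q
 proof -
  have "q < r" using that unfolding XO_simps idx_XO by simp
  then have q: "q = 0" "r = 1" using \<open>r < 2\<close> by simp_all
  show ?thesis unfolding q_connected_def q using not_cohomology_vanishes_1[where 'k = 'k] by auto
 qed
 then show ?thesis using True by (simp add: measurably_connected_def bot_ereal_def)
next
 case False
 have fin: "finite (qset r)" by (rule finite_subset[of _ "{..<r}"]) (auto dest: qset_bounds(4))
 let ?m = "Max (qset r)"
 have m: "?m \<in> qset r" by (rule Max_in[OF fin False])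
 have "(SUP q\<in>qset r. ereal (real q)) = ereal (real ?m)"
  by (rule SUP_eqI) (use Max_ge[OF fin] m in auto)
 then show ?thesis unfolding measurably_connected_def using q_connected_XO[OF m, where 'k = 'k] by blast
qed

section \<open>Invariant means\<close>

definition bdd_on :: "'a set \<Rightarrow> ('a \<Rightarrow> real) \<Rightarrow> bool" where
 "bdd_on X f \<longleftrightarrow> (\<exists>C. \<forall>x\<in>X. \<bar>f x\<bar> \<le> C)"

definition mean_on :: "'a set \<Rightarrow> (('a \<Rightarrow> real) \<Rightarrow> real) \<Rightarrow> bool" where
 "mean_on X m \<longleftrightarrow>
   (\<forall>f h. bdd_on X f \<and> bdd_on X h \<longrightarrow> m (\<lambda>x. f x + h x) = m f + m h) \<and>
   (\<forall>c f. bdd_on X f \<longrightarrow> m (\<lambda>x. c * f x) = c * m f) \<and>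
   (\<forall>f. bdd_on X f \<and> (\<forall>x\<in>X. 0 \<le> f x) \<longrightarrow> 0 \<le> m f) \<and>
   m (\<lambda>_. 1) = 1"

lemma bdd_on_add: "bdd_on X f ==> bdd_on X h ==> bdd_on X (\<lambda>x. f x + h x)"
 unfolding bdd_on_def by (meson abs_triangle_ineq add_mono order_trans)

lemma bdd_on_cmult: assumes "bdd_on X f" shows "bdd_on X (\<lambda>x. c * f x)"
proof -
 obtain C where "\<forall>x\<in>X. \<bar>f x\<bar> \<le> C" using assms by (auto simp: bdd_on_def)
 then have "\<forall>x\<in>X. \<bar>c * f x\<bar> \<le> \<bar>c\<bar> * C" by (simp add: abs_mult mult_left_mono)
 then show ?thesis by (auto simp: bdd_on_def)
qed

lemma bdd_on_const: "bdd_on X (\<lambda>_. c)"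
 by (auto simp: bdd_on_def)

lemma mean_on_diff: assumes "mean_on X m" "bdd_on X f" "bdd_on X h" shows "m (\<lambda>x. f x - h x) = m f - m h"
proof -
 have "m (\<lambda>x. f x + (-1) * h x) = m f + m (\<lambda>x. (-1) * h x)" "m (\<lambda>x. (-1) * h x) = (-1) * m h"
  using assms bdd_on_cmult[OF assms(3)] unfolding mean_on_def by blast+
 then show ?thesis by simp
qed

lemma mean_on_mono: assumes "mean_on X m" "bdd_on X f" "bdd_on X h" "\<And>x. x \<in> X ==> f x \<le> h x" shows "m f \<le> m h"
proof -
 have "bdd_on X (\<lambda>x. h x + (-1) * f x)" by (rule bdd_on_add[OF assms(3) bdd_on_cmult[OF assms(2)]])
 then have "bdd_on X (\<lambda>x. h x - f x)" by simp
 moreover have "\<forall>x\<in>X. 0 \<le> h x - f x" using assms(4) by simp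
 ultimately have "0 \<le> m (\<lambda>x. h x - f x)" using assms(1) unfolding mean_on_def by blast
 then show ?thesis using mean_on_diff[OF assms(1,3,2)] by simp
qed

lemma mean_on_cong: assumes "mean_on X m" "bdd_on X f" "\<And>x. x \<in> X ==> f x = h x" shows "m f = m h"
proof -
 have "bdd_on X h" using assms(2,3) unfolding bdd_on_def by (metis (full_types))
 then show ?thesis using mean_on_mono[OF assms(1,2), of h] mean_on_mono[OF assms(1) _ assms(2), of h] assms(3) by force
qed

lemma mean_on_const: assumes "mean_on X m" shows "m (\<lambda>_. c) = c"
proof -
 have "m (\<lambda>x. c * 1) = c * m (\<lambda>_. 1)" using assms bdd_on_const[of X 1] unfolding mean_on_def by blast
 then show ?thesis using assms by (simp add: mean_on_def)
qed

lemma mean_on_bound: assumes "mean_on X m" "\<And>x. x \<in> X ==> \<bar>f x\<bar> \<le> C" shows "\<bar>m f\<bar> \<le> C"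
proof -
 have f: "bdd_on X f" using assms(2) by (auto simp: bdd_on_def)
 have "m f \<le> m (\<lambda>_. C)" "m (\<lambda>_. - C) \<le> m f"
  by (rule mean_on_mono[OF assms(1) f bdd_on_const], use assms(2) in force) (rule mean_on_mono[OF assms(1) bdd_on_const f], use assms(2) in force)
 then show ?thesis using mean_on_const[OF assms(1)] by (simp add: abs_le_iff)
qed

lemma bdd_on_compose: "(\<And>x. x \<in> X ==> T x \<in> X) ==> bdd_on X f ==> bdd_on X (\<lambda>x. f (T x))"
 unfolding bdd_on_def by blast

lemma funpow_in: "(\<And>x. x \<in> X ==> T x \<in> X) ==> x \<in> X ==> (T ^^ k) x \<in> X"
 by (induction k) simp_all

lemma mean_on_average:
 assumes m: "mean_on X m" and T: "\<And>x. x \<in> X ==> T x \<in> X" and N: "0 < N"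
 shows "mean_on X (\<lambda>f. (\<Sum>k<N. m (\<lambda>x. f ((T ^^ k) x))) / real N)"
 unfolding mean_on_def
proof (intro conjI allI impI)
 have b: "bdd_on X (\<lambda>x. f ((T ^^ k) x))" if "bdd_on X f" for f k
  by (rule bdd_on_compose[OF funpow_in[OF T] that])
 fix f h :: "'a \<Rightarrow> real" and c :: real
 show "(\<Sum>k<N. m (\<lambda>x. f ((T ^^ k) x) + h ((T ^^ k) x))) / real N = (\<Sum>k<N. m (\<lambda>x. f ((T ^^ k) x))) / real N + (\<Sum>k<N. m (\<lambda>x. h ((T ^^ k) x))) / real N"
  if "bdd_on X f \<and> bdd_on X h"
 proof -
  have "m (\<lambda>x. f ((T ^^ k) x) + h ((T ^^ k) x)) = m (\<lambda>x. f ((T ^^ k) x)) + m (\<lambda>x. h ((T ^^ k) x))" for k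
   using m b[of f k] b[of h k] that unfolding mean_on_def by blast
  then show ?thesis by (simp add: sum.distrib add_divide_distrib)
 qed
 show "(\<Sum>k<N. m (\<lambda>x. c * f ((T ^^ k) x))) / real N = c * ((\<Sum>k<N. m (\<lambda>x. f ((T ^^ k) x))) / real N)" if "bdd_on X f"
 proof -
  have "m (\<lambda>x. c * f ((T ^^ k) x)) = c * m (\<lambda>x. f ((T ^^ k) x))" for k
   using m b[OF that, of k] unfolding mean_on_def by blast
  then show ?thesis by (simp add: sum_distrib_left)
 qed
 show "0 \<le> (\<Sum>k<N. m (\<lambda>x. f ((T ^^ k) x))) / real N" if f: "bdd_on X f \<and> (\<forall>x\<in>X. 0 \<le> f x)"
 proof -
  have "0 \<le> m (\<lambda>x. f ((T ^^ k) x))" for k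
   using m b[of f k] f funpow_in[of X T, OF T] unfolding mean_on_def by blast
  then show ?thesis by (simp add: sum_nonneg)
 qed
 show "(\<Sum>k<N. m (\<lambda>x. 1)) / real N = 1" using mean_on_const[OF m, of 1] N by simp
qed

text \<open>One operator at a time: averaging over \<open>N\<close> iterates of \<open>T i\<close>
  makes the mean invariant under \<open>T i\<close> up to \<open>2 * C / N\<close>, by telescoping,
  and preserves the estimates for the operators already treated because these commute with
  \<open>T i\<close>.\<close>

lemma almost_invariant_mean:
 fixes T :: "'i \<Rightarrow> 'a \<Rightarrow> 'a"
 assumes X: "o0 \<in> X" and T: "\<And>i x. i \<in> I ==> x \<in> X ==> T i x \<in> X"
  and comm: "\<And>i j x. i \<in> I ==> j \<in> I ==> x \<in> X ==> T i (T j x) = T j (T i x)"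
  and J: "finite J" "J \<subseteq> I" and N: "0 < N"
 shows "\<exists>m. mean_on X m \<and> (\<forall>i\<in>J. \<forall>f C. (\<forall>x\<in>X. \<bar>f x\<bar> \<le> C) \<longrightarrow> \<bar>m (\<lambda>x. f (T i x)) - m f\<bar> \<le> 2 * C / real N)"
 using J
proof (induction J rule: finite_induct)
 case empty
 have "mean_on X (\<lambda>f. f o0)" using X by (auto simp: mean_on_def)
 then show ?case by blast
next
 case (insert i J)
 then obtain m where m: "mean_on X m"
  and J: "\<forall>j\<in>J. \<forall>f C. (\<forall>x\<in>X. \<bar>f x\<bar> \<le> C) \<longrightarrow> \<bar>m (\<lambda>x. f (T j x)) - m f\<bar> \<le> 2 * C / real N" by auto
 have i: "i \<in> I" "J \<subseteq> I" using insert by auto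
 let ?S = "\<lambda>k. T i ^^ k"
 define m' where "m' f = (\<Sum>k<N. m (\<lambda>x. f (?S k x))) / real N" for f
 have S: "?S k x \<in> X" if "x \<in> X" for k x by (rule funpow_in[OF T[OF i(1)] that])
 have bound: "\<bar>m' (\<lambda>x. f (T j x)) - m' f\<bar> \<le> 2 * C / real N" if j: "j \<in> insert i J" and f: "\<forall>x\<in>X. \<bar>f x\<bar> \<le> C" for j f C
 proof (cases "j \<in> J")
  case True
  have SC: "?S k (T j x) = T j (?S k x)" if "x \<in> X" for k x
   using that by (induction k) (use comm[OF i(1)] S i(2) True in auto)
  have "\<bar>m (\<lambda>x. f (T j (?S k x))) - m (\<lambda>x. f (?S k x))\<bar> \<le> 2 * C / real N" for k
  proof -
   have "m (\<lambda>x. f (T j (?S k x))) = m (\<lambda>x. f (?S k (T j x)))"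
   proof (rule mean_on_cong[OF m])
    show "bdd_on X (\<lambda>x. f (T j (?S k x)))" unfolding bdd_on_def using f S T i(2) True by blast
   qed (simp add: SC)
   moreover have "\<bar>m (\<lambda>x. f (?S k (T j x))) - m (\<lambda>x. f (?S k x))\<bar> \<le> 2 * C / real N"
    using J[rule_format, OF True, of "\<lambda>x. f (?S k x)" C] f S by blast
   ultimately show ?thesis by simp
  qed
  then have "\<bar>\<Sum>k<N. m (\<lambda>x. f (T j (?S k x))) - m (\<lambda>x. f (?S k x))\<bar> \<le> (\<Sum>k<N. 2 * C / real N)"
   by (intro order_trans[OF sum_abs] sum_mono)
  moreover have "m' (\<lambda>x. f (T j x)) - m' f = (\<Sum>k<N. m (\<lambda>x. f (T j (?S k x))) - m (\<lambda>x. f (?S k x))) / real N"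
   by (simp add: m'_def sum_subtractf diff_divide_distrib)
  ultimately show ?thesis using N by (simp add: abs_divide divide_le_eq)
 next
  case False
  then have ji: "j = i" using j by simp
  let ?a = "\<lambda>k. m (\<lambda>x. f (?S k x))"
  have "m' (\<lambda>x. f (T i x)) - m' f = (\<Sum>k<N. ?a (Suc k) - ?a k) / real N"
   by (simp add: m'_def sum_subtractf diff_divide_distrib)
  also have "\<dots> = (?a N - ?a 0) / real N" unfolding sum_lessThan_telescope[of ?a N] ..
  finally have e: "m' (\<lambda>x. f (T i x)) - m' f = (?a N - ?a 0) / real N" .
  have a: "\<bar>?a k\<bar> \<le> C" for k by (rule mean_on_bound[OF m]) (use f S in blast)
  then have "\<bar>?a N - ?a 0\<bar> \<le> 2 * C" using abs_triangle_ineq4[of "?a N" "?a 0"] a[of N] a[of 0] by linarith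
  then show ?thesis unfolding ji e using N by (simp add: abs_divide divide_right_mono)
 qed
 have "mean_on X m'" unfolding m'_def by (rule mean_on_average[OF m T[OF i(1)] N])
 then show ?case using bound by (intro exI[of _ m'] conjI ballI allI impI) simp_all
qed

text \<open>Markov-Kakutani for means: within a compact product of intervals, the means that are
  invariant under one operator up to a given accuracy form closed sets with the finite intersection
  property.\<close>

lemma invariant_mean:
 fixes T :: "'i \<Rightarrow> 'a \<Rightarrow> 'a"
 assumes X: "o0 \<in> X" and T: "\<And>i x. i \<in> I ==> x \<in> X ==> T i x \<in> X"
  and comm: "\<And>i j x. i \<in> I ==> j \<in> I ==> x \<in> X ==> T i (T j x) = T j (T i x)"
 shows "\<exists>m. mean_on X m \<and> (\<forall>i\<in>I. \<forall>f. bdd_on X f \<longrightarrow> m (\<lambda>x. f (T i x)) = m f)"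
proof -
 define C where "C f = (SOME C. \<forall>x\<in>X. \<bar>f x\<bar> \<le> C)" for f :: "'a \<Rightarrow> real"
 have C: "\<forall>x\<in>X. \<bar>f x\<bar> \<le> C f" if "bdd_on X f" for f using that unfolding bdd_on_def C_def by (rule someI_ex)
 define B where "B f = (if bdd_on X f then {- C f..C f} else {0})" for f
 have "compactin (product_topology (\<lambda>_ :: 'a \<Rightarrow> real. euclideanreal) UNIV) (PiE UNIV B)"
  unfolding compactin_PiE by (simp add: B_def)
 then have K: "compact (PiE UNIV B)" by (simp add: euclidean_product_topology)
 have cont: "continuous_on UNIV (\<lambda>m :: ('a \<Rightarrow> real) \<Rightarrow> real. m f)" for f by (rule continuous_on_product_coordinates)
 define P where "P = PiE UNIV B \<inter> {m. mean_on X m}"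
 have cl_imp: "closed {m. Q \<longrightarrow> R m}" if "closed {m. R m}" for Q and R :: "(('a \<Rightarrow> real) \<Rightarrow> real) \<Rightarrow> bool"
  using that by (cases Q) simp_all
 have "closed {m :: ('a \<Rightarrow> real) \<Rightarrow> real. mean_on X m}"
  unfolding mean_on_def
  by (intro closed_Collect_conj closed_Collect_all cl_imp closed_Collect_eq closed_Collect_le continuous_on_add continuous_on_mult continuous_on_const cont)
 then have P: "compact P" unfolding P_def by (rule compact_Int_closed[OF K])
 define D where "D p = {m :: ('a \<Rightarrow> real) \<Rightarrow> real. \<forall>f c. (\<forall>x\<in>X. \<bar>f x\<bar> \<le> c) \<longrightarrow> \<bar>m (\<lambda>x. f (T (fst p) x)) - m f\<bar> \<le> 2 * c / real (Suc (snd p))}" for p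
 have D: "closed (D p)" for p
  unfolding D_def by (intro closed_Collect_all cl_imp closed_Collect_le continuous_on_rabs continuous_on_diff continuous_on_const cont)
 have "P \<inter> \<Inter>(D ` (I \<times> UNIV)) \<noteq> {}"
 proof (rule compact_imp_fip[OF P])
  show "closed t" if "t \<in> D ` (I \<times> UNIV)" for t using that D by blast
  fix F' assume F': "finite F'" "F' \<subseteq> D ` (I \<times> UNIV)"
  obtain G where G: "G \<subseteq> I \<times> UNIV" "finite G" "F' = D ` G" using finite_subset_image[OF F'] by blast
  \<comment> \<open>At least as large as every accuracy \<open>Suc (snd p)\<close> in the finite
    set.\<close>
  define N where "N = Suc (\<Sum>p\<in>G. snd p)"
  have "\<exists>m. mean_on X m \<and> (\<forall>i\<in>fst ` G. \<forall>f C. (\<forall>x\<in>X. \<bar>f x\<bar> \<le> C) \<longrightarrow> \<bar>m (\<lambda>x. f (T i x)) - m f\<bar> \<le> 2 * C / real N)"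
   by (rule almost_invariant_mean[where T = T and I = I, OF X T comm]) (use G in \<open>auto simp: N_def\<close>)
  then obtain m where m: "mean_on X m" "\<forall>i\<in>fst ` G. \<forall>f C. (\<forall>x\<in>X. \<bar>f x\<bar> \<le> C) \<longrightarrow> \<bar>m (\<lambda>x. f (T i x)) - m f\<bar> \<le> 2 * C / real N" by blast
  \<comment> \<open>On unbounded functions \<open>m\<close> is uncontrolled; the value 0 puts it
    into the compact box.\<close>
  define m' where "m' f = (if bdd_on X f then m f else 0)" for f
  have m': "mean_on X m'"
   using m(1) bdd_on_add[of X] bdd_on_cmult[of X] bdd_on_const[of X 1] unfolding mean_on_def m'_def by simp
  have "m' f \<in> B f" for f
  proof (cases "bdd_on X f")
   case True
   then have "\<bar>m f\<bar> \<le> C f" using mean_on_bound[OF m(1)] C by blast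
   then show ?thesis using True by (simp add: m'_def B_def abs_le_iff)
  qed (simp add: m'_def B_def)
  then have "m' \<in> P" using m' by (simp add: P_def PiE_iff)
  moreover have "m' \<in> D p" if p: "p \<in> G" for p
   unfolding D_def
  proof (intro CollectI allI impI)
   fix f :: "'a \<Rightarrow> real" and c assume f: "\<forall>x\<in>X. \<bar>f x\<bar> \<le> c"
   have b: "bdd_on X f" using f by (auto simp: bdd_on_def)
   have pI: "fst p \<in> I" using p G(1) by auto
   have bT: "bdd_on X (\<lambda>x. f (T (fst p) x))" by (rule bdd_on_compose[OF T[OF pI] b])
   have "snd p \<le> (\<Sum>p\<in>G. snd p)" by (rule member_le_sum[OF p]) (use G(2) in simp_all)
   then have "Suc (snd p) \<le> N" by (simp add: N_def)
   then have N: "real (Suc (snd p)) \<le> real N" by (simp only: of_nat_le_iff)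
   have c: "0 \<le> c" using f X abs_ge_zero order_trans by blast
   have "\<bar>m (\<lambda>x. f (T (fst p) x)) - m f\<bar> \<le> 2 * c / real N" using m(2) p f by blast
   also have "\<dots> \<le> 2 * c / real (Suc (snd p))" by (rule divide_left_mono) (use N c in \<open>simp_all add: N_def\<close>)
   finally show "\<bar>m' (\<lambda>x. f (T (fst p) x)) - m' f\<bar> \<le> 2 * c / real (Suc (snd p))" by (simp only: m'_def b bT if_True)
  qed
  ultimately show "P \<inter> \<Inter>F' \<noteq> {}" unfolding G(3) by blast
 qed
 then obtain m where m: "m \<in> P" "\<And>i n. i \<in> I ==> m \<in> D (i, n)" by blast
 have "m (\<lambda>x. f (T i x)) = m f" if i: "i \<in> I" and f: "bdd_on X f" for i f
 proof (rule ccontr)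
  assume "m (\<lambda>x. f (T i x)) \<noteq> m f"
  then have e: "0 < \<bar>m (\<lambda>x. f (T i x)) - m f\<bar>" (is "0 < ?e") by simp
  have le: "?e \<le> 2 * C f / real (Suc n)" for n using m(2)[OF i, of n] C[OF f] unfolding D_def by simp
  obtain n where n: "2 * C f < real n * ?e" using reals_Archimedean3[OF e] by blast
  have "?e * real (Suc n) \<le> 2 * C f" using le[of n] by (simp add: le_divide_eq)
  moreover have "real n * ?e \<le> ?e * real (Suc n)" by (simp add: algebra_simps)
  ultimately show False using n by simp
 qed
 then show ?thesis using m(1) unfolding P_def by blast
qed

text \<open>The kernel of \<open>p\<close> and the image of \<open>p\<close> are abelian, and their
  invariant means are composed: \<open>F f a\<close> is the mean of \<open>f\<close> over the coset
  above \<open>a\<close>, independent of the representative \<open>s a\<close> by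
  \<open>F_p\<close>. The result is invariant on all bounded functions, in particular on the
  continuous ones.\<close>

lemma amenable_metabelian:
 fixes G :: "'g top_group" and p :: "'g \<Rightarrow> 'b::ab_group_add"
 assumes G: "group G" and K: "subgroup K G" and L: "carrier L = K" "mult L = mult G"
  and p: "\<And>x y. x \<in> K ==> y \<in> K ==> p (x \<otimes>\<^bsub>G\<^esub> y) = p x + p y"
  and comm: "\<And>x y. x \<in> K ==> y \<in> K ==> p x = 0 ==> p y = 0 ==> x \<otimes>\<^bsub>G\<^esub> y = y \<otimes>\<^bsub>G\<^esub> x"
 shows "amenable (L :: 'g top_group)"
proof -
 interpret group G by fact
 interpret K: subgroup K G by fact
 define N where "N = {x \<in> K. p x = 0}"
 have p1: "p \<one>\<^bsub>G\<^esub> = 0" using p[of "\<one>\<^bsub>G\<^esub>" "\<one>\<^bsub>G\<^esub>"] by simp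
 have pinv: "p (inv\<^bsub>G\<^esub> x) = - p x" if "x \<in> K" for x
  using p[of "inv\<^bsub>G\<^esub> x" x] that p1 by (simp add: eq_neg_iff_add_eq_0)
 have N: "\<one>\<^bsub>G\<^esub> \<in> N" by (simp add: N_def p1)
 have Nm: "x \<otimes>\<^bsub>G\<^esub> y \<in> N" if "x \<in> N" "y \<in> N" for x y using that by (simp add: N_def p)
 have "\<exists>m. mean_on N m \<and> (\<forall>n\<in>N. \<forall>f. bdd_on N f \<longrightarrow> m (\<lambda>x. f (n \<otimes>\<^bsub>G\<^esub> x)) = m f)"
 proof (rule invariant_mean[OF N])
  fix i j x assume "i \<in> N" "j \<in> N" "x \<in> N"
  then show "i \<otimes>\<^bsub>G\<^esub> (j \<otimes>\<^bsub>G\<^esub> x) = j \<otimes>\<^bsub>G\<^esub> (i \<otimes>\<^bsub>G\<^esub> x)"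
   using comm[of i j] by (simp add: N_def m_assoc[symmetric])
 qed (rule Nm)
 then obtain m1 where m1: "mean_on N m1" "\<And>n f. n \<in> N ==> bdd_on N f ==> m1 (\<lambda>x. f (n \<otimes>\<^bsub>G\<^esub> x)) = m1 f" by blast
 have "\<exists>m. mean_on (p ` K) m \<and> (\<forall>g\<in>K. \<forall>f. bdd_on (p ` K) f \<longrightarrow> m (\<lambda>x. f (p g + x)) = m f)"
 proof (rule invariant_mean[of "p \<one>\<^bsub>G\<^esub>"])
  show "p \<one>\<^bsub>G\<^esub> \<in> p ` K" by simp
  show "p i + x \<in> p ` K" if "i \<in> K" "x \<in> p ` K" for i x using that p[symmetric] by auto
 qed (simp add: add.left_commute)
 then obtain m2 where m2: "mean_on (p ` K) m2" "\<And>g f. g \<in> K ==> bdd_on (p ` K) f ==> m2 (\<lambda>x. f (p g + x)) = m2 f" by blast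
 define s where "s a = (SOME g. g \<in> K \<and> p g = a)" for a
 have s: "s a \<in> K \<and> p (s a) = a" if "a \<in> p ` K" for a
  unfolding s_def by (rule someI_ex) (use that in auto)
 define F where "F f a = m1 (\<lambda>n. f (s a \<otimes>\<^bsub>G\<^esub> n))" for f a
 define m where "m f = m2 (F f)" for f
 have NK: "n \<in> K" if "n \<in> N" for n using that by (simp add: N_def)
 have bN: "bdd_on N (\<lambda>n. f (g \<otimes>\<^bsub>G\<^esub> n))" if "bdd_on K f" "g \<in> K" for f g
  using that NK unfolding bdd_on_def by (meson K.m_closed)
 have bF: "bdd_on (p ` K) (F f)" if f: "bdd_on K f" for f
 proof -
  obtain C where "\<And>x. x \<in> K ==> \<bar>f x\<bar> \<le> C" using f by (auto simp: bdd_on_def)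
  then have "\<bar>F f a\<bar> \<le> C" if "a \<in> p ` K" for a
   unfolding F_def by (intro mean_on_bound[OF m1(1)]) (use s[OF that] NK in auto)
  then show ?thesis by (auto simp: bdd_on_def)
 qed
 have F_p: "F f (p g) = m1 (\<lambda>n. f (g \<otimes>\<^bsub>G\<^esub> n))" if f: "bdd_on K f" and g: "g \<in> K" for f g
 proof -
  let ?h = "s (p g)"
  have h: "?h \<in> K" "p ?h = p g" using s[of "p g"] g by simp_all
  define n0 where "n0 = inv\<^bsub>G\<^esub> g \<otimes>\<^bsub>G\<^esub> ?h"
  have n0: "n0 \<in> N" using g h by (simp add: n0_def N_def p pinv)
  have e: "?h \<otimes>\<^bsub>G\<^esub> n = g \<otimes>\<^bsub>G\<^esub> (n0 \<otimes>\<^bsub>G\<^esub> n)" if "n \<in> N" for n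
   using g h NK[OF that] by (simp add: n0_def m_assoc[symmetric])
  have "F f (p g) = m1 (\<lambda>n. f (g \<otimes>\<^bsub>G\<^esub> (n0 \<otimes>\<^bsub>G\<^esub> n)))"
   unfolding F_def by (rule mean_on_cong[OF m1(1) bN[OF f h(1)]]) (simp add: e)
  also have "\<dots> = m1 (\<lambda>n. f (g \<otimes>\<^bsub>G\<^esub> n))"
   by (rule m1(2)[OF n0 bN[OF f g]])
  finally show ?thesis .
 qed
 have bc: "bdd_on K f" if "bounded_continuous L f" for f
  using that L by (simp add: bounded_continuous_def bdd_on_def)
 show ?thesis
  unfolding amenable_def
 proof (intro exI[of _ m] conjI allI impI)
  fix f h :: "'g \<Rightarrow> real" and c :: real and g
  show "m (\<lambda>x. f x + h x) = m f + m h" if "bounded_continuous L f \<and> bounded_continuous L h"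
  proof -
   have b: "bdd_on K f" "bdd_on K h" using that bc by blast+
   have e: "F (\<lambda>x. f x + h x) a = F f a + F h a" if "a \<in> p ` K" for a
    using m1(1) bN[OF b(1)] bN[OF b(2)] s[OF that] unfolding F_def mean_on_def by blast
   have "m (\<lambda>x. f x + h x) = m2 (\<lambda>a. F f a + F h a)"
    unfolding m_def by (rule mean_on_cong[OF m2(1) bF[OF bdd_on_add[OF b]] e])
   also have "\<dots> = m f + m h" using m2(1) bF[OF b(1)] bF[OF b(2)] unfolding m_def mean_on_def by blast
   finally show ?thesis .
  qed
  show "m (\<lambda>x. c * f x) = c * m f" if "bounded_continuous L f"
  proof -
   have b: "bdd_on K f" using that bc by blast
   have e: "F (\<lambda>x. c * f x) a = c * F f a" if "a \<in> p ` K" for a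
    using m1(1) bN[OF b] s[OF that] unfolding F_def mean_on_def by blast
   have "m (\<lambda>x. c * f x) = m2 (\<lambda>a. c * F f a)"
    unfolding m_def by (rule mean_on_cong[OF m2(1) bF[OF bdd_on_cmult[OF b]] e])
   also have "\<dots> = c * m f" using m2(1) bF[OF b] unfolding m_def mean_on_def by blast
   finally show ?thesis .
  qed
  show "0 \<le> m f" if "bounded_continuous L f \<and> (\<forall>x\<in>carrier L. 0 \<le> f x)"
  proof -
   have b: "bdd_on K f" "\<forall>x\<in>K. 0 \<le> f x" using that bc L by auto
   have "0 \<le> F f a" if "a \<in> p ` K" for a
    using m1(1) bN[OF b(1)] s[OF that] b(2) NK unfolding F_def mean_on_def by (meson K.m_closed)
   then show ?thesis using m2(1) bF[OF b(1)] unfolding m_def mean_on_def by blast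
  qed
  show "m (\<lambda>_. 1) = 1" unfolding m_def F_def mean_on_const[OF m1(1)] by (rule mean_on_const[OF m2(1)])
  show "m (\<lambda>x. f (g \<otimes>\<^bsub>L\<^esub> x)) = m f" if "g \<in> carrier L \<and> bounded_continuous L f"
  proof -
   have g: "g \<in> K" and b: "bdd_on K f" using that bc L by auto
   have b': "bdd_on K (\<lambda>x. f (g \<otimes>\<^bsub>G\<^esub> x))" by (rule bdd_on_compose[OF K.m_closed[OF g] b])
   have e: "F (\<lambda>x. f (g \<otimes>\<^bsub>G\<^esub> x)) a = F f (p g + a)" if "a \<in> p ` K" for a
   proof -
    have sa: "s a \<in> K" "p (s a) = a" using s[OF that] by blast+
    have "F (\<lambda>x. f (g \<otimes>\<^bsub>G\<^esub> x)) a = m1 (\<lambda>n. f ((g \<otimes>\<^bsub>G\<^esub> s a) \<otimes>\<^bsub>G\<^esub> n))"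
     unfolding F_def by (rule mean_on_cong[OF m1(1) bN[OF b' sa(1)]]) (use g sa NK in \<open>simp add: m_assoc\<close>)
    also have "\<dots> = F f (p (g \<otimes>\<^bsub>G\<^esub> s a))" by (rule F_p[OF b, symmetric]) (use g sa in simp)
    finally show ?thesis by (simp add: p[OF g sa(1)] sa(2))
   qed
   have "m (\<lambda>x. f (g \<otimes>\<^bsub>L\<^esub> x)) = m2 (\<lambda>a. F f (p g + a))"
    unfolding m_def L(2) by (rule mean_on_cong[OF m2(1) bF[OF b'] e])
   also have "\<dots> = m f" unfolding m_def by (rule m2(2)[OF g bF[OF b]])
   finally show ?thesis .
  qed
 qed
qed

section \<open>Point stabilizers\<close>

text \<open>Column \<open>2*r - 1\<close> is left free since the first vector has no partner; this
  freedom produces the kernel of the projection to the block.\<close>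

definition Hs :: "nat \<Rightarrow> nat \<Rightarrow> 'k::field mat set" where
 "Hs r q = {g. spcond r g \<and> (\<forall>i\<le>q. colf g i = ee i) \<and> (\<forall>i. 1 \<le> i \<and> i \<le> q \<longrightarrow> colf g (2*r - Suc i) = ee (2*r - Suc i))}"

definition blk :: "nat \<Rightarrow> nat \<Rightarrow> 'k mat \<Rightarrow> 'k mat" where
 "blk r q g = mat (2*(r - Suc q)) (2*(r - Suc q)) (\<lambda>(i, j). g $$ (i + Suc q, j + Suc q))"

lemma Hs_stabilizer:
 assumes q: "q < r"
 shows "Hs r q = stabilizer (Sp r :: 'k::{field,topological_space} mat top_group) (ac r q) (x0 r q)"
proof -
 have "g * x0 r q = x0 r q \<longleftrightarrow> (\<forall>i\<le>q. colf g i = ee i) \<and> (\<forall>i. 1 \<le> i \<and> i \<le> q \<longrightarrow> colf g (2*r - Suc i) = ee (2*r - Suc i))"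
  (is "_ \<longleftrightarrow> ?R") if g: "spcond r g" for g :: "'k mat"
 proof -
  have gc: "g \<in> carrier_mat (2*r) (2*r)" by (rule spcond_carrier[OF g])
  let ?L = "stdl r (Suc q) :: 'k frame"
  have L: "?L ! i = (ee i, ee (2*r - Suc i))" if "i \<le> q" for i using that by (simp add: stdl_def del: upt_Suc)
  have lL: "length ?L = Suc q" by (rule stdl_Nil)
  have e: "g * x0 r q = toM r (map (map_prod (mv g) (mv g)) ?L)"
   unfolding x0_def by (rule toM_mult[OF gc]) (simp add: stdl_Suc)
  have m: "mv g (ee i) = colf g i" "mv g (ee (2*r - Suc i)) = colf g (2*r - Suc i)" if "i \<le> q" for i
   using that q by (auto intro!: mv_ee[OF gc])
  have ent: "toM r (map (map_prod (mv g) (mv g)) ?L) $$ (a, 2*i) = colf g i a" "toM r ?L $$ (a, 2*i) = ee i a"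
   "1 \<le> i ==> toM r (map (map_prod (mv g) (mv g)) ?L) $$ (a, Suc (2*i)) = colf g (2*r - Suc i) a"
   "1 \<le> i ==> toM r ?L $$ (a, Suc (2*i)) = ee (2*r - Suc i) a" if "i \<le> q" "a < 2*r" for i a
   using that L[OF that(1)] m[OF that(1)] lL by (simp_all add: toM_def)
  show ?thesis
  proof
   assume x: "g * x0 r q = x0 r q"
   then have t: "toM r (map (map_prod (mv g) (mv g)) ?L) = toM r ?L" unfolding e by (simp only: x0_def)
   have z: "colf g c a = 0" "c < 2*r ==> (ee c :: 'k vect) a = 0" if "\<not> a < 2*r" for a c
    using gc that by (auto simp: colf_def ee_apply)
   show ?R
   proof (intro conjI allI impI ext)
    fix i a assume i: "i \<le> q"
    show "colf g i a = ee i a"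
     using ent(1,2)[OF i, of a] t z[of a i] i q by (cases "a < 2*r") simp_all
   next
    fix i a assume i: "1 \<le> i \<and> i \<le> q"
    then show "colf g (2*r - Suc i) a = ee (2*r - Suc i) a"
     using ent(3,4)[of i a] t z[of a "2*r - Suc i"] q by (cases "a < 2*r") simp_all
   qed
  next
   assume R: ?R
   show "g * x0 r q = x0 r q"
    unfolding e unfolding x0_def
   proof (rule eq_matI)
    fix a c assume "a < dim_row (toM r ?L)" "c < dim_col (toM r ?L)"
    then have a: "a < 2*r" and c: "c < 2 * Suc q" by (simp_all add: toM_def lL)
    have "c = 1 \<or> (\<exists>i\<le>q. c = 2*i) \<or> (\<exists>i. 1 \<le> i \<and> i \<le> q \<and> c = Suc (2*i))" using c by presburger
    then show "toM r (map (map_prod (mv g) (mv g)) ?L) $$ (a, c) = toM r ?L $$ (a, c)"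
    proof (elim disjE exE conjE)
     assume "c = 1"
     then show ?thesis using a c lL by (simp add: toM_def)
    next
     fix i assume "i \<le> q" "c = 2*i"
     then show ?thesis using ent(1,2)[of i a] a R by simp
    next
     fix i assume "1 \<le> i" "i \<le> q" "c = Suc (2*i)"
     then show ?thesis using ent(3,4)[of i a] a R by simp
    qed
   qed (simp_all add: toM_def lL)
  qed
 qed
 moreover have "x0 r q \<in> (XX r q :: 'k mat set)" by (rule x0_in[OF q])
 ultimately show ?thesis by (auto simp: Hs_def stabilizer_def ac_def carrier_Sp)
qed

lemma Hs_spcond: "g \<in> Hs r q ==> spcond r g" by (simp add: Hs_def)

text \<open>Invariance of the form turns a fixed column into a fixed row at the dual index. Outside
  the middle block, only the first row and the last column remain free.\<close>

lemma Hs_entry: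
 fixes g :: "'k::field mat"
 assumes g: "g \<in> Hs r q" and q: "q < r" and ac: "a < 2*r" "c < 2*r"
  and h: "c \<le> q \<or> (2*r - Suc q \<le> c \<and> c < 2*r - 1) \<or> (1 \<le> a \<and> a \<le> q) \<or> 2*r - Suc q \<le> a"
 shows "g $$ (a, c) = (if a = c then 1 else 0)"
proof -
 have sp: "spcond r g" by (rule Hs_spcond[OF g])
 have gc: "g \<in> carrier_mat (2*r) (2*r)" by (rule spcond_carrier[OF sp])
 have E: "mv g (ee i) = ee i" if "i \<le> q" for i using that q g by (simp add: Hs_def mv_ee[OF gc])
 have F: "mv g (ee (2*r - Suc i)) = ee (2*r - Suc i)" if "1 \<le> i" "i \<le> q" for i
  using that q g by (simp add: Hs_def mv_ee[OF gc])
 have e: "g $$ (a, c) = mv g (ee c) a" using gc ac by (simp add: mv_ee[OF gc] colf_def)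
 have "c \<le> q \<or> (\<exists>i. 1 \<le> i \<and> i \<le> q \<and> c = 2*r - Suc i) \<or> (1 \<le> a \<and> a \<le> q) \<or> (\<exists>i\<le>q. a = 2*r - Suc i)"
 proof -
  have 1: "1 \<le> 2*r - Suc c \<and> 2*r - Suc c \<le> q \<and> c = 2*r - Suc (2*r - Suc c)" if "2*r - Suc q \<le> c" "c < 2*r - 1" using that q by linarith
  have 2: "2*r - Suc a \<le> q \<and> a = 2*r - Suc (2*r - Suc a)" if "2*r - Suc q \<le> a" using that q ac by linarith
  from h show ?thesis using 1 2 by blast
 qed
 then show ?thesis
 proof (elim disjE exE conjE)
  assume "c \<le> q"
  then show ?thesis unfolding e by (simp add: E ee_apply)
 next
  fix i assume "1 \<le> i" "i \<le> q" "c = 2*r - Suc i"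
  then show ?thesis unfolding e by (simp add: F ee_apply)
 next
  assume a: "1 \<le> a" "a \<le> q"
  have "om r (ee (2*r - Suc a)) (mv g (ee c)) = om r (ee (2*r - Suc a)) (ee c)"
   using spcond_om[OF sp, of "ee (2*r - Suc a)" "ee c"] F[OF a] by simp
  then show ?thesis unfolding e using a q om_eeF[of a r "mv g (ee c)"] om_eeF[of a r "ee c :: nat \<Rightarrow> 'k"] by (simp add: ee_apply)
 next
  fix i assume i: "i \<le> q" "a = 2*r - Suc i"
  have "om r (ee i) (mv g (ee c)) = om r (ee i) (ee c)"
   using spcond_om[OF sp, of "ee i" "ee c"] E[OF i(1)] by simp
  then show ?thesis unfolding e unfolding i(2) using i(1) q om_eeE[of i r "mv g (ee c)"] om_eeE[of i r "ee c :: nat \<Rightarrow> 'k"] by (simp add: ee_apply)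
 qed
qed

lemma Hs_antimono: "Hs r (Suc q) \<subseteq> Hs r q"
 by (auto simp: Hs_def)

lemma blk_carrier: "blk r q g \<in> carrier_mat (2*(r - Suc q)) (2*(r - Suc q))"
 by (simp add: blk_def)

text \<open>Indices \<open>b\<close> outside the middle block contribute nothing to the product: the
  low columns of \<open>g\<close> and the high rows of \<open>h\<close> are those of the
  identity.\<close>

lemma blk_mult:
 assumes q: "q < r" and g: "g \<in> Hs r q" "h \<in> Hs r q"
 shows "blk r q (g * h) = blk r q g * blk r q (h :: 'k::field mat)"
proof (rule eq_matI)
 let ?n = "r - Suc q"
 fix i j assume "i < dim_row (blk r q g * blk r q h)" "j < dim_col (blk r q g * blk r q h)"
 then have ij: "i < 2 * ?n" "j < 2 * ?n" by (simp_all add: blk_def)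
 have gc: "g \<in> carrier_mat (2*r) (2*r)" "h \<in> carrier_mat (2*r) (2*r)" using g spcond_carrier[OF Hs_spcond] by blast+
 have lt: "i + Suc q < 2*r" "j + Suc q < 2*r" "i + Suc q < 2*r - Suc q" "j + Suc q < 2*r - Suc q" using ij q by linarith+
 have "blk r q (g * h) $$ (i, j) = (\<Sum>b<2*r. g $$ (i + Suc q, b) * h $$ (b, j + Suc q))"
  using mult_entry[OF gc lt(1,2)] ij by (simp add: blk_def)
 also have "\<dots> = (\<Sum>l<2 * ?n. g $$ (i + Suc q, l + Suc q) * h $$ (l + Suc q, j + Suc q))"
 proof (rule sum_shift)
  show "Suc q + 2 * ?n \<le> 2*r" using q by simp
  fix b assume b: "b < 2*r" "b < Suc q \<or> Suc q + 2 * ?n \<le> b"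
  from b(2) show "g $$ (i + Suc q, b) * h $$ (b, j + Suc q) = 0"
  proof
   assume "b < Suc q"
   then show ?thesis using Hs_entry[OF g(1) q lt(1) b(1)] by simp
  next
   assume "Suc q + 2 * ?n \<le> b"
   then have "2*r - Suc q \<le> b" using q by linarith
   then show ?thesis using Hs_entry[OF g(2) q b(1) lt(2)] lt(4) by simp
  qed
 qed
 also have "\<dots> = (blk r q g * blk r q h) $$ (i, j)"
  unfolding mult_entry[OF blk_carrier blk_carrier ij] by (rule sum.cong) (use ij in \<open>simp_all add: blk_def\<close>)
 finally show "blk r q (g * h) $$ (i, j) = (blk r q g * blk r q h) $$ (i, j)" .
qed (simp_all add: blk_def)

lemma spcond_blk:
 fixes g :: "'k::field mat"
 assumes q: "q < r" and g: "g \<in> Hs r q" shows "spcond (r - Suc q) (blk r q g)"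
 unfolding spcond_iff
proof (intro conjI allI blk_carrier)
 let ?n = "r - Suc q" and ?k = "Suc q"
 have r: "r = ?n + ?k" using q by simp
 have gc: "g \<in> carrier_mat (2*r) (2*r)" by (rule spcond_carrier[OF Hs_spcond[OF g]])
 \<comment> \<open>A vector of the small space placed in the middle coordinates. Its image may
   acquire a coordinate 0, but the coordinate \<open>2*r - 1\<close> paired with it stays zero, so
   the form does not notice.\<close>
 define lf :: "'k vect \<Rightarrow> nat \<Rightarrow> 'k" where "lf x b = (if ?k \<le> b \<and> b < ?k + 2 * ?n then x (b - ?k) else 0)" for x b
 have mvl: "mv g (lf x) a = (\<Sum>j<2 * ?n. g $$ (a, j + ?k) * x j)" if "a < 2*r" for x a
 proof -
  have "mv g (lf x) a = (\<Sum>b<2*r. g $$ (a, b) * lf x b)" using that gc by (simp add: mv_def)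
  also have "\<dots> = (\<Sum>j<2 * ?n. g $$ (a, j + ?k) * lf x (j + ?k))"
   by (rule sum_shift) (use q in \<open>auto simp: lf_def\<close>)
  finally show ?thesis by (simp add: lf_def)
 qed
 have out: "mv g (lf x) a = 0" if a: "a < 2*r" "(1 \<le> a \<and> a \<le> q) \<or> 2*r - ?k \<le> a" for x a
 proof -
  have "g $$ (a, j + ?k) = 0" if "j < 2 * ?n" for j
  proof -
   have "j + ?k < 2*r" "a \<noteq> j + ?k" using that q a by linarith+
   then show ?thesis using Hs_entry[OF g q a(1)] a(2) by simp
  qed
  then show ?thesis unfolding mvl[OF a(1)] by simp
 qed
 have inn: "mv g (lf x) (j + ?k) = mv (blk r q g) x j" if "j < 2 * ?n" for x j
  using that q by (subst mvl) (simp_all add: mv_def blk_def)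
 fix x y
 have i0: "mv g (lf x) i * mv g (lf y) (2*r - Suc i) - mv g (lf x) (2*r - Suc i) * mv g (lf y) i = 0" if "i < ?k" for i
 proof -
  have "2*r - ?k \<le> 2*r - Suc i" "2*r - Suc i < 2*r" using that q by linarith+
  then show ?thesis by (simp add: out)
 qed
 have "om r (mv g (lf x)) (mv g (lf y)) = om ?n (\<lambda>j. mv g (lf x) (j + ?k)) (\<lambda>j. mv g (lf y) (j + ?k))"
  using om_split[of ?n ?k "mv g (lf x)" "mv g (lf y)"] i0 unfolding r[symmetric] by simp
 also have "\<dots> = om ?n (mv (blk r q g) x) (mv (blk r q g) y)" by (rule om_cong) (simp_all only: inn)
 finally have 1: "om ?n (mv (blk r q g) x) (mv (blk r q g) y) = om r (lf x) (lf y)" using spcond_om[OF Hs_spcond[OF g]] by simp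
 have "om r (lf x) (lf y) = om ?n (\<lambda>j. lf x (j + ?k)) (\<lambda>j. lf y (j + ?k))"
 proof -
  have "lf x i * lf y (2*r - Suc i) - lf x (2*r - Suc i) * lf y i = 0" if "i < ?k" for i using that by (simp add: lf_def)
  then show ?thesis using om_split[of ?n ?k "lf x" "lf y"] unfolding r[symmetric] by simp
 qed
 also have "\<dots> = om ?n x y" by (rule om_cong) (simp_all add: lf_def)
 finally show "om ?n (mv (blk r q g) x) (mv (blk r q g) y) = om ?n x y" using 1 by simp
qed

lemma emb_in_Hs:
 fixes A :: "'k::field mat"
 assumes q: "q < r" and A: "spcond (r - Suc q) A" shows "emb r q A \<in> Hs r q" "blk r q (emb r q A) = A"
proof -
 let ?g = "emb r q A"
 show "blk r q ?g = A" by (rule eq_matI) (use q spcond_carrier[OF A] in \<open>auto simp: blk_def emb_def\<close>)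
 have col: "colf ?g c = ee c" if "c < 2*r" "\<not> (Suc q \<le> c \<and> c < 2*r - Suc q)" for c
  using that by (auto simp: emb_def colf_def fun_eq_iff ee_apply emb_def)
 show "?g \<in> Hs r q" unfolding Hs_def
 proof (intro CollectI conjI allI impI spcond_emb[OF q A])
  show "colf ?g i = ee i" if "i \<le> q" for i by (rule col) (use that q in linarith)+
  show "colf ?g (2*r - Suc i) = ee (2*r - Suc i)" if "1 \<le> i \<and> i \<le> q" for i by (rule col) (use that q in linarith)+
 qed
qed

text \<open>The reason that the square commutes: \<open>h\<close> fixes both vectors of the pair
  number \<open>Suc q\<close>, so in the larger block the outer rows and columns are
  trivial.\<close>

lemma blk_Suc:
 fixes h :: "'k::{field,topological_space} mat"
 assumes q: "Suc q < r" and h: "h \<in> Hs r (Suc q)"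
 shows "blk r q h = Sp_incl (r - Suc (Suc q)) (blk r (Suc q) h)"
proof (rule eq_matI)
 let ?n = "r - Suc (Suc q)"
 have n: "r - Suc q = Suc ?n" using q by simp
 have S: "Sp_incl ?n (blk r (Suc q) h) \<in> carrier_mat (2 * Suc ?n) (2 * Suc ?n)" by (rule Sp_incl_carrier[OF blk_carrier])
 then show "dim_row (blk r q h) = dim_row (Sp_incl ?n (blk r (Suc q) h))" "dim_col (blk r q h) = dim_col (Sp_incl ?n (blk r (Suc q) h))"
  using n by (auto simp: blk_def)
 fix a b assume "a < dim_row (Sp_incl ?n (blk r (Suc q) h))" "b < dim_col (Sp_incl ?n (blk r (Suc q) h))"
 then have ab: "a < 2 * Suc ?n" "b < 2 * Suc ?n" using S by auto
 have B: "blk r q h $$ (a, b) = h $$ (a + Suc q, b + Suc q)" using ab n by (simp add: blk_def)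
 show "blk r q h $$ (a, b) = Sp_incl ?n (blk r (Suc q) h) $$ (a, b)"
 proof (cases "1 \<le> a \<and> a \<le> 2 * ?n \<and> 1 \<le> b \<and> b \<le> 2 * ?n")
  case True
  obtain a' b' where ab': "a = Suc a'" "b = Suc b'" using True by (cases a; cases b) auto
  show ?thesis using True unfolding B Sp_incl_entry[OF blk_carrier ab] unfolding ab' by (simp add: blk_def)
 next
  case False
  have lin: "x + Suc q < 2*r - 1" "x + Suc q < 2*r" if x: "x < 2 * Suc ?n" for x
  proof -
   have "r = ?n + Suc (Suc q)" using q by simp
   then obtain m where m: "r = m + Suc (Suc q)" "?n = m" by blast
   have "x < 2 * Suc m" using x unfolding m(2) .
   then show "x + Suc q < 2*r - 1" "x + Suc q < 2*r" unfolding m(1) by simp_all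
  qed
  have "b + Suc q \<le> Suc q \<or> (2*r - Suc (Suc q) \<le> b + Suc q \<and> b + Suc q < 2*r - 1) \<or>
    (1 \<le> a + Suc q \<and> a + Suc q \<le> Suc q) \<or> 2*r - Suc (Suc q) \<le> a + Suc q"
  proof -
   consider "a = 0" | "2 * ?n < a" | "b = 0" | "2 * ?n < b" using False by linarith
   then show ?thesis
   proof cases
    case 2
    then have "2*r - Suc (Suc q) \<le> a + Suc q" using q by linarith
    then show ?thesis by blast
   next
    case 4
    then have "2*r - Suc (Suc q) \<le> b + Suc q" using q by linarith
    then show ?thesis using lin(1)[OF ab(2)] by blast
   qed simp_all
  qed
  then have "h $$ (a + Suc q, b + Suc q) = (if a + Suc q = b + Suc q then 1 else 0)"
   by (rule Hs_entry[OF h q lin(2)[OF ab(1)] lin(2)[OF ab(2)]])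
  then show ?thesis unfolding B Sp_incl_entry[OF blk_carrier ab] using False by auto
 qed
qed

subsection \<open>The kernel of the projection\<close>

lemma Hs_mult: assumes "q < r" "g \<in> Hs r q" "h \<in> Hs r q" shows "g * h \<in> Hs r q"
proof -
 have c: "g \<in> carrier_mat (2*r) (2*r)" "h \<in> carrier_mat (2*r) (2*r)" using assms spcond_carrier[OF Hs_spcond] by blast+
 have "colf (g * h) i = colf g i" if "colf h i = ee i" "i < 2*r" for i
  using that mv_ee[OF c(1) that(2)] mv_mult[OF c, of "ee i"] mv_ee[OF c(2) that(2)] mv_ee[of "g * h" "2*r" "2*r" i] c by simp
 then show ?thesis using assms(2,3) assms(1) unfolding Hs_def by (auto intro: spcond_mult)
qed

lemma Hs_sinv: assumes q: "q < r" and g: "g \<in> Hs r q" shows "sinv r g \<in> Hs r q"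
proof -
 have sp: "spcond r g" by (rule Hs_spcond[OF g])
 have c: "g \<in> carrier_mat (2*r) (2*r)" "sinv r g \<in> carrier_mat (2*r) (2*r)" using spcond_carrier sp spcond_sinv by blast+
 have "colf (sinv r g) i = ee i" if "colf g i = ee i" "i < 2*r" for i
 proof -
  have "colf (sinv r g) i = mv (sinv r g) (mv g (ee i))" using mv_ee[OF c(2) that(2)] mv_ee[OF c(1) that(2)] that(1) by simp
  also have "\<dots> = mv (1\<^sub>m (2*r)) (ee i)" using mv_mult[OF c(2,1)] sinv_mult(1)[OF sp] by simp
  finally show ?thesis using that(2) by (auto simp: mv_one fun_eq_iff ee_apply)
 qed
 then show ?thesis using g q spcond_sinv[OF sp] unfolding Hs_def by auto
qed

lemma Hs_one: "q < r ==> 1\<^sub>m (2*r) \<in> Hs r q"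
 unfolding Hs_def by (auto simp: spcond_one colf_def fun_eq_iff ee_apply)

lemma blk_one: "q < r ==> blk r q (1\<^sub>m (2*r)) = 1\<^sub>m (2*(r - Suc q))"
 by (rule eq_matI) (auto simp: blk_def)

definition Ks :: "nat \<Rightarrow> nat \<Rightarrow> 'k::field mat set" where
 "Ks r q = {g \<in> Hs r q. blk r q g = 1\<^sub>m (2*(r - Suc q))}"

lemma Ks_entry:
 assumes q: "q < r" and g: "g \<in> Ks r q" and ac: "1 \<le> a" "a < 2*r" "c < 2*r - 1"
 shows "g $$ (a, c) = (if a = c then 1 else 0)"
proof (cases "c \<le> q \<or> (2*r - Suc q \<le> c \<and> c < 2*r - 1) \<or> (1 \<le> a \<and> a \<le> q) \<or> 2*r - Suc q \<le> a")
 case True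
 then show ?thesis by (intro Hs_entry) (use assms in \<open>auto simp: Ks_def\<close>)
next
 case False
 define i j where "i = a - Suc q" and "j = c - Suc q"
 have ij: "i < 2*(r - Suc q)" "j < 2*(r - Suc q)" "a = i + Suc q" "c = j + Suc q"
  using False ac q by (auto simp: i_def j_def)
 have "blk r q g $$ (i, j) = (1\<^sub>m (2*(r - Suc q))) $$ (i, j)" using g by (simp add: Ks_def)
 then show ?thesis using ij by (simp add: blk_def)
qed

lemma Ks_corner:
 assumes "q < r" "g \<in> Ks r q" shows "g $$ (0, 0) = 1" "g $$ (2*r - 1, 2*r - 1) = 1"
proof -
 have g: "g \<in> Hs r q" using assms by (simp add: Ks_def)
 show "g $$ (0, 0) = 1" using Hs_entry[OF g assms(1), of 0 0] assms(1) by simp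
 have "g $$ (2*r - 1, 2*r - 1) = (if 2*r - 1 = 2*r - 1 then 1 else 0)"
  by (rule Hs_entry[OF g assms(1)]) (use assms(1) in linarith)+
 then show "g $$ (2*r - 1, 2*r - 1) = 1" by simp
qed

text \<open>The middle of the first row is the linear coordinate of the Heisenberg group
  \<open>Ks r q\<close>; what it does not see is the corner entry, the centre.\<close>

definition kp :: "nat \<Rightarrow> 'k::zero mat \<Rightarrow> nat \<Rightarrow> 'k" where
 "kp r g = (\<lambda>c. if 1 \<le> c \<and> c < 2*r - 1 then g $$ (0, c) else 0)"

lemma Ks_carrier: "g \<in> Ks r q ==> g \<in> carrier_mat (2*r) (2*r)"
 using spcond_carrier[OF Hs_spcond] by (auto simp: Ks_def)

lemma kp_mult:
 assumes q: "q < r" and g: "g \<in> Ks r q" "h \<in> Ks r q" shows "kp r (g * h) = kp r g + kp r h"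
proof
 fix c
 show "kp r (g * h) c = (kp r g + kp r h) c"
 proof (cases "1 \<le> c \<and> c < 2*r - 1")
  case True
  then have c: "1 \<le> c" "c < 2*r - 1" "c < 2*r" "0 < 2*r" by linarith+
  have "(g * h) $$ (0, c) = (\<Sum>b<2*r. g $$ (0, b) * h $$ (b, c))" by (rule mult_entry[OF Ks_carrier[OF g(1)] Ks_carrier[OF g(2)] c(4,3)])
  also have "\<dots> = (\<Sum>b<2*r. (if b = 0 then h $$ (0, c) else 0) + (if b = c then g $$ (0, c) else 0))"
  proof (rule sum.cong[OF refl])
   fix b assume "b \<in> {..<2*r}"
   then show "g $$ (0, b) * h $$ (b, c) = (if b = 0 then h $$ (0, c) else 0) + (if b = c then g $$ (0, c) else 0)"
    using Ks_entry[OF q g(2), of b c] Ks_corner(1)[OF q g(1)] c by (cases "b = 0") auto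
  qed
  also have "\<dots> = g $$ (0, c) + h $$ (0, c)" using c by (simp add: sum.distrib)
  finally show ?thesis using True by (simp add: kp_def)
 next
  case False
  have "kp r x c = 0" for x :: "'a mat" using False by (simp only: kp_def if_False)
  then show ?thesis by simp
 qed
qed

text \<open>The form determines the last column by the first row, so when the latter is trivial only
  the corner entry is left.\<close>

lemma Ks_center_entry:
 fixes g :: "'k::field mat"
 assumes q: "q < r" and g: "g \<in> Ks r q" and p: "kp r g = 0" and ac: "a < 2*r" "c < 2*r"
 shows "g $$ (a, c) = (if a = c then 1 else if a = 0 \<and> c = 2*r - 1 then g $$ (0, 2*r - 1) else 0)"
proof -
 have row: "g $$ (0, c) = 0" if "1 \<le> c" "c < 2*r - 1" for c using fun_cong[OF p, of c] that by (simp add: kp_def)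
 have gc: "g \<in> carrier_mat (2*r) (2*r)" by (rule Ks_carrier[OF g])
 have col: "colf g c = ee c" if "1 \<le> c" "c < 2*r - 1" for c
 proof
  fix a
  show "colf g c a = ee c a"
   using row[OF that] Ks_entry[OF q g, of a c] that gc by (cases "a = 0"; cases "a < 2*r") (auto simp: colf_def ee_apply)
 qed
 have last: "g $$ (b, 2*r - 1) = 0" if b: "1 \<le> b" "b < 2*r - 1" for b
 proof -
  let ?c = "2*r - 1 - b"
  have c: "1 \<le> ?c" "?c < 2*r - 1" "?c < 2*r" "2*r - 1 < 2*r" using b by linarith+
  have sp: "spcond r g" using g by (auto simp: Ks_def intro: Hs_spcond)
  have o: "om r (ee ?c) (colf g (2*r - 1)) = om r (ee ?c) (ee (2*r - 1))"
   using sp c col[OF c(1,2)] unfolding spcond_def by metis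
  have z: "om r (ee ?c) y = 0 \<longleftrightarrow> y b = 0" for y :: "'k vect"
  proof (cases "?c < r")
   case True
   moreover have "2*r - Suc ?c = b" using b by linarith
   ultimately show ?thesis using om_eeE[of ?c r y] by simp
  next
   case False
   then have "b < r" "?c = 2*r - Suc b" using b by linarith+
   then show ?thesis using om_eeF[of b r y] by simp
  qed
  have "(ee (2*r - 1) :: 'k vect) b = 0" using b by (simp add: ee_apply)
  then have "colf g (2*r - 1) b = 0" using o z[of "ee (2*r - 1)"] z[of "colf g (2*r - 1)"] by simp
  moreover have "b < 2*r" using b by linarith
  ultimately show ?thesis using gc by (simp add: colf_def)
 qed
 consider "c < 2*r - 1" "1 \<le> a" | "c < 2*r - 1" "a = 0" "1 \<le> c" | "c = 0" "a = 0" | "c = 2*r - 1" "1 \<le> a" "a < 2*r - 1" | "c = 2*r - 1" "a = 0" | "c = 2*r - 1" "a = 2*r - 1"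
  using ac by linarith
 then show ?thesis
 proof cases
  case 1
  then show ?thesis using Ks_entry[OF q g 1(2) ac(1) 1(1)] by auto
 next
  case 2
  then show ?thesis using row[OF 2(3,1)] by auto
 next
  case 3
  then show ?thesis using Ks_corner(1)[OF q g] by simp
 next
  case 4
  then show ?thesis using last[OF 4(2,3)] by auto
 next
  case 5
  then show ?thesis using q by auto
 next
  case 6
  then show ?thesis using Ks_corner(2)[OF q g] by simp
 qed
qed

lemma Ks_center_comm:
 fixes g :: "'k::field mat"
 assumes q: "q < r" and g: "g \<in> Ks r q" "kp r g = 0" and h: "h \<in> Ks r q" "kp r h = 0"
 shows "g * h = h * g"
proof -
 have e: "(g * h) $$ (a, c) = (if a = c then 1 else if a = 0 \<and> c = 2*r - 1 then g $$ (0, 2*r - 1) + h $$ (0, 2*r - 1) else 0)"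
  if g: "g \<in> Ks r q" "kp r g = 0" and h: "h \<in> Ks r q" "kp r h = 0" and ac: "a < 2*r" "c < 2*r" for g h :: "'k mat" and a c
 proof -
  have r: "0 < 2*r - 1" using q by simp
  have "(g * h) $$ (a, c) = (\<Sum>b<2*r. g $$ (a, b) * h $$ (b, c))" by (rule mult_entry[OF Ks_carrier[OF g(1)] Ks_carrier[OF h(1)] ac])
  also have "\<dots> = (\<Sum>b<2*r. (if b = a then h $$ (a, c) else 0) + (if b = 2*r - 1 then (if a = 0 then g $$ (0, 2*r - 1) * h $$ (2*r - 1, c) else 0) else 0))"
   by (rule sum.cong[OF refl]) (use r ac in \<open>simp add: Ks_center_entry[OF q g ac(1)]\<close>)
  also have "\<dots> = h $$ (a, c) + (if a = 0 then g $$ (0, 2*r - 1) * h $$ (2*r - 1, c) else 0)" using ac r by (simp add: sum.distrib)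
  also have "\<dots> = (if a = c then 1 else if a = 0 \<and> c = 2*r - 1 then g $$ (0, 2*r - 1) + h $$ (0, 2*r - 1) else 0)"
   using r ac Ks_center_entry[OF q h ac] Ks_center_entry[OF q h _ ac(2), of "2*r - 1"] by auto
  finally show ?thesis .
 qed
 show ?thesis
 proof (rule eq_matI)
  have c: "g \<in> carrier_mat (2*r) (2*r)" "h \<in> carrier_mat (2*r) (2*r)" by (rule Ks_carrier[OF g(1)], rule Ks_carrier[OF h(1)])
  then show "dim_row (g * h) = dim_row (h * g)" "dim_col (g * h) = dim_col (h * g)" by auto
  fix a b assume "a < dim_row (h * g)" "b < dim_col (h * g)"
  then have "a < 2*r" "b < 2*r" using c by auto
  then show "(g * h) $$ (a, b) = (h * g) $$ (a, b)" using e[OF g h] e[OF h g] by (simp add: add.commute)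
 qed
qed

lemma subgroup_Ks: assumes q: "q < r" shows "subgroup (Ks r q) (Sp r :: 'k::{field,topological_space} mat top_group)"
proof (rule group.subgroupI[OF group_Sp])
 show "Ks r q \<subseteq> carrier (Sp r :: 'k mat top_group)" by (auto simp: Ks_def carrier_Sp Hs_spcond)
 show "Ks r q \<noteq> ({} :: 'k mat set)" using Hs_one[OF q] blk_one[OF q] by (auto simp: Ks_def)
 fix g :: "'k mat" assume g: "g \<in> Ks r q"
 then have gH: "g \<in> Hs r q" "spcond r g" by (auto simp: Ks_def intro: Hs_spcond)
 have iH: "sinv r g \<in> Hs r q" by (rule Hs_sinv[OF q gH(1)])
 have "blk r q (sinv r g) * blk r q g = blk r q (sinv r g * g)" by (rule blk_mult[OF q iH gH(1), symmetric])
 also have "\<dots> = 1\<^sub>m (2*(r - Suc q))" by (simp add: sinv_mult(1)[OF gH(2)] blk_one[OF q])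
 finally have "blk r q (sinv r g) = 1\<^sub>m (2*(r - Suc q))" using g right_mult_one_mat[OF blk_carrier[of r q "sinv r g"]] by (simp add: Ks_def)
 then show "inv\<^bsub>Sp r\<^esub> g \<in> Ks r q" using iH gH by (simp add: Ks_def inv_Sp carrier_Sp)
 fix h :: "'k mat" assume h: "h \<in> Ks r q"
 then show "g \<otimes>\<^bsub>Sp r\<^esub> h \<in> Ks r q" using g Hs_mult[OF q, of g h] blk_mult[OF q, of g h] by (simp add: Ks_def)
qed

section \<open>Compatibility and conclusion\<close>

lemma compatible_XO:
 "measurably_compatible (Sp :: nat \<Rightarrow> 'k::efield mat top_group) Sp_incl XO (\<lambda>r. ereal (real r - 1))"
 unfolding measurably_compatible_def
proof (intro allI exI conjI ballI impI)
 fix r q :: nat assume "q \<in> idx (ereal (real r - 1))"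
 then have q: "q < r" by (simp add: idx_XO)
 have nn: "int r - 1 - int q = int (r - Suc q)" using q by simp
 have Q: "group_at Sp (int r - 1 - int q) = (Sp (r - Suc q) :: 'k mat top_group)" unfolding nn by (simp add: group_at_def)
 let ?L = "sub_top_group (Sp r) (Hs r q) :: 'k mat top_group" and ?Q = "Sp (r - Suc q) :: 'k mat top_group"
 have Lc: "carrier ?L = Hs r q" "mult ?L = (*)" "gtop ?L = subtopology (gtop (Sp r)) (Hs r q)" by (simp_all add: sub_top_group_def)
 have K: "kernel ?L ?Q (blk r q) = Ks r q" by (auto simp: kernel_def Lc Ks_def)
 have cont: "continuous_map (gtop ?L) (gtop ?Q) (blk r q)"
  unfolding Lc(3) gtop_Sp[of "r - Suc q"]
 proof (rule continuous_map_into_mat_sub)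
  fix g :: "'k mat" assume "g \<in> topspace (subtopology (gtop (Sp r)) (Hs r q))"
  then have "g \<in> Hs r q" by simp
  then show "blk r q g \<in> carrier_mat (2*(r - Suc q)) (2*(r - Suc q)) \<inter> carrier (Sp (r - Suc q))"
   using blk_carrier spcond_blk[OF q] by (auto simp: carrier_Sp)
 next
  fix i j assume ij: "i < 2*(r - Suc q)" "j < 2*(r - Suc q)"
  have lt: "i + Suc q < 2*r" "j + Suc q < 2*r" using ij q by linarith+
  show "continuous_map (subtopology (gtop (Sp r)) (Hs r q)) euclidean (\<lambda>g :: 'k mat. blk r q g $$ (i, j))"
   using continuous_map_from_subtopology[OF continuous_map_gtop_entry[OF lt]] ij by (simp add: blk_def)
 qed
 have am: "amenable (sub_top_group ?L (Ks r q))"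
  by (rule amenable_metabelian[OF group_Sp[of r] subgroup_Ks[OF q], where p = "kp r"])
   (simp_all add: sub_top_group_def kp_mult[OF q] Ks_center_comm[OF q])
 have hom: "blk r q \<in> hom ?L ?Q"
  by (rule homI) (simp_all add: Lc carrier_Sp spcond_blk[OF q] blk_mult[OF q])
 have im: "blk r q ` Hs r q = carrier ?Q"
  using spcond_blk[OF q, where 'k = 'k] emb_in_Hs[OF q, where 'k = 'k] by (force simp: carrier_Sp)
 have st: "\<exists>x\<in>space (lev (XO r :: ('k mat, 'k mat) measured_obj) q). Hs r q = stabilizer (Sp r) (act (XO r :: ('k mat, 'k mat) measured_obj) q) x"
  unfolding XO_simps space_MU using x0_in[OF q] Hs_stabilizer[OF q] by blast
 show "let L = sub_top_group (Sp r) (Hs r q) :: 'k mat top_group; Q = group_at Sp (int r - 1 - int q)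
    in (\<exists>x\<in>space (lev (XO r :: ('k mat, 'k mat) measured_obj) q). Hs r q = stabilizer (Sp r) (act (XO r) q) x) \<and>
      blk r q \<in> hom L Q \<and> blk r q ` Hs r q = carrier Q \<and> continuous_map (gtop L) (gtop Q) (blk r q) \<and>
      amenable (sub_top_group L (kernel L Q (blk r q)))"
  unfolding Let_def Q K using st hom im cont am by blast
next
 fix r q :: nat assume "ereal (real q) < ereal (real r - 1)"
 then have q: "Suc q < r" by simp
 show "Hs r (q + 1) \<subseteq> (Hs r q :: 'k mat set)" using Hs_antimono by simp
 fix h :: "'k mat" assume h: "h \<in> Hs r (q + 1)"
 have nn: "int r - int q - 2 = int (r - Suc (Suc q))" using q by simp
 show "blk r q h = incl_at Sp Sp_incl (int r - int q - 2) (blk r (q + 1) h)"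
  unfolding nn incl_at_def using blk_Suc[OF q, of h] h by simp
qed

lemma measured_quillen_family_XO:
 "measured_quillen_family Sp Sp_incl (XO :: nat \<Rightarrow> ('k::efield mat, 'k mat) measured_obj)
   (\<lambda>r. SUP q\<in>qset r. ereal (real q)) (\<lambda>r. ereal (real r - 1))"
 unfolding measured_quillen_family_def
 by (intro conjI allI ascending_series_Sp measured_object_XO admissible_XO measurably_connected_XO q_transitive_XO compatible_XO)

theorem theorem2p14:
 shows "(\<exists>X :: nat \<Rightarrow> (real mat, real mat) measured_obj.
      odim (X 0) = -1 \<and>
      measured_quillen_family Sp Sp_incl X
       (\<lambda>r. SUP q\<in>{q::nat. int (2 ^ q) + \<lceil>(real q + 1) / 2\<rceil> \<le> int r}. ereal (real q))
       (\<lambda>r. ereal (real r - 1))) \<and>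
     (\<exists>X :: nat \<Rightarrow> (complex mat, complex mat) measured_obj.
      odim (X 0) = -1 \<and>
      measured_quillen_family Sp Sp_incl X
       (\<lambda>r. SUP q\<in>{q::nat. int (2 ^ q) + \<lceil>(real q + 1) / 2\<rceil> \<le> int r}. ereal (real q))
       (\<lambda>r. ereal (real r - 1)))"
 unfolding qset_def[symmetric]
 by (intro conjI exI[of _ XO] measured_quillen_family_XO) (simp_all add: zero_ereal_def one_ereal_def)

end
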